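(* Let $A$ be a real $n\times n$ matrix that is diagonalizable over the complex numbers and whose eigenvalues all have positive real part. Let $\Gamma$ be a separable locally compact uniform quasisimilarity group of $(\mathbb{R}^n\times\mathbb{Q}_m,d_{A,m})$. Suppose $\Gamma$ is amenable and acts cocompactly on the space of distinct pairs. Then there exist some $\lambda>0$, some integer $s\ge1$ and a biLipschitz map $$F_0:(\mathbb{R}^n\times\mathbb{Q}_m,d_{A,m})\to(\mathbb{R}^n\times\mathbb{Q}_s,d_{\lambda\bar A,s})$$ such that $m,s$ are powers of a common integer and $\Gamma':=F_0\Gamma F_0^{-1}$ acts on $(\mathbb{R}^n\times\mathbb{Q}_s,d_{\lambda\bar A,s})$ by similarities. Here $\bar A$ denotes the matrix obtained from the Jordan form of $A$ by replacing the eigenvalues with their real parts.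
   Context: Metric $d_A$ on $\mathbb{R}^n$: let $\alpha_1<\cdots<\alpha_r$ be the distinct real parts of the eigenvalues of $A$ and $\mathbb{R}^n=V_1\oplus\cdots\oplus V_r$, where $V_i$ is the real $A$-invariant subspace corresponding to all eigenvalues with real part $\alpha_i$ (for the diagonal matrix $\bar A$, with diagonal entries in increasing order, $V_i$ is the eigenspace of $\alpha_i$). Writing $x=(x_1,\dots,x_r)$ with $x_i\in V_i$ and $|\cdot|$ for the Euclidean norm, $d_A(x,x')=\max_i|x_i-x_i'|^{\alpha_1/\alpha_i}$ (up to biLipschitz equivalence, the parabolic visual metric on $\partial G_A\setminus\{\infty\}$, where $G_A=\mathbb{R}^n\rtimes_A\mathbb{R}$ with $t$ acting by $e^{tA}$). $\mathbb{Q}_m$ is the space of $m$-adics: formal sums $\sum_i a_im^i$ with digits $a_i\in\{0,\dots,m-1\}$ and $a_i=0$ for all sufficiently negative $i$, with metric $d_{\mathbb{Q}_m}(\sum a_im^i,\sum b_im^i)=m^{-(k+1)}$, where $k$ is the smallest index with $a_k\ne b_k$. On $\mathbb{R}^n\times\mathbb{Q}_m$ set $d_{A,m}=\max\{d_A,d_{\mathbb{Q}_m}\}$. A bijection $F:(X,d)\to(X,d)$ is an $(M,C)$-quasisimilarity ($M\ge1$, $C>0$) if $\frac{C}{M}d(x_1,x_2)\le d(F(x_1),F(x_2))\le MC\,d(x_1,x_2)$ for all $x_1,x_2$; it is a similarity if $M=1$. A group $\Gamma$ of quasisimilarities is uniform if there is some $M\ge1$ such that every $\gamma\in\Gamma$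 is an $(M,C_\gamma)$-quasisimilarity, where $C_\gamma$ may depend on $\gamma$. "Separable locally compact" means that $\Gamma$ carries a separable locally compact group topology for which its action is continuous; amenability is with respect to this topology. $\Gamma$ acts cocompactly on the space of distinct pairs of $X$ if there is a compact subset of $\{(x,y)\in X\times X:x\neq y\}$ whose translates under the diagonal $\Gamma$-action cover that space. *)

theory Defs
  imports "HOL-Analysis.Analysis" "HOL-Algebra.Bij"
begin

section \<open>Spectral data of a real matrix\<close>

abbreviation complex_vec :: "real^'n \<Rightarrow> complex^'n" where
  "complex_vec x \<equiv> (\<chi> i. of_real (x $ i))"

abbreviation complex_mat :: "real^'n^'n \<Rightarrow> complex^'n^'n" where
  "complex_mat A \<equiv> map_matrix of_real A"

definition eigenvalues :: "complex^'n^'n \<Rightarrow> complex set" where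
  "eigenvalues B = {z. \<exists>v. v \<noteq> 0 \<and> B *v v = z *s v}"

definition generalized_eigenspace :: "complex^'n^'n \<Rightarrow> complex \<Rightarrow> (complex^'n) set" where
  "generalized_eigenspace B z = {v. \<exists>k. ((\<lambda>w. B *v w - z *s w) ^^ k) v = 0}"

definition diagonal_mat :: "'a::zero^'n^'n \<Rightarrow> bool" where
  "diagonal_mat D \<longleftrightarrow> (\<forall>i j. i \<noteq> j \<longrightarrow> D $ i $ j = 0)"

definition diagonalization :: "complex^'n^'n \<Rightarrow> complex^'n^'n \<Rightarrow> bool" where
  "diagonalization B D \<longleftrightarrow>
     diagonal_mat D \<and> (\<exists>P. invertible P \<and> B = P ** D ** matrix_inv P)"

definition complex_diagonalizable :: "real^'n^'n \<Rightarrow> bool" where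
  "complex_diagonalizable A \<longleftrightarrow> (\<exists>D. diagonalization (complex_mat A) D)"

text \<open>For a matrix diagonalizable over the complex numbers, a Jordan form is the same thing as a
  diagonalization. Requiring the real parts on the diagonal to be in increasing order (with
  multiplicity) determines the matrix below uniquely.\<close>

definition real_part_jordan_form ::
  "real^('n::{finite,linorder})^('n::{finite,linorder}) \<Rightarrow>
   real^('n::{finite,linorder})^('n::{finite,linorder})" where
  "real_part_jordan_form A = (THE B. diagonal_mat B \<and> mono (\<lambda>i. B $ i $ i) \<and>
     (\<exists>D. diagonalization (complex_mat A) D \<and> (\<forall>i. B $ i $ i = Re (D $ i $ i))))"


section \<open>The parabolic visual metric\<close>

definition real_parts :: "real^'n^'n \<Rightarrow> real set" where
  "real_parts A = Re ` eigenvalues (complex_mat A)"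

definition real_part_space :: "real^'n^'n \<Rightarrow> real \<Rightarrow> (real^'n) set" where
  "real_part_space A \<alpha> = {x. complex_vec x \<in>
     vec.span (\<Union>z\<in>{z \<in> eigenvalues (complex_mat A). Re z = \<alpha>}.
       generalized_eigenspace (complex_mat A) z)}"

text \<open>The components of \<open>x\<close> in the direct sum of the spaces \<open>real_part_space A \<alpha>\<close>, indexed by the
  real parts \<open>\<alpha>\<close> themselves; the value at any other \<open>\<alpha>\<close> is fixed to be zero.\<close>

definition components :: "real^'n^'n \<Rightarrow> real^'n \<Rightarrow> real \<Rightarrow> real^'n" where
  "components A x = (THE c. (\<forall>\<alpha>\<in>real_parts A. c \<alpha> \<in> real_part_space A \<alpha>) \<and>
     (\<forall>\<alpha>. \<alpha> \<notin> real_parts A \<longrightarrow> c \<alpha> = 0) \<and> x = (\<Sum>\<alpha>\<in>real_parts A. c \<alpha>))"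

definition dist_mat :: "real^'n^'n \<Rightarrow> real^'n \<Rightarrow> real^'n \<Rightarrow> real" where
  "dist_mat A x y = Max ((\<lambda>\<alpha>. norm (components A x \<alpha> - components A y \<alpha>)
     powr (Min (real_parts A) / \<alpha>)) ` real_parts A)"


section \<open>The m-adics\<close>

definition madics :: "nat \<Rightarrow> (int \<Rightarrow> nat) set" where
  "madics m = {a. (\<forall>i. a i < m) \<and> (\<exists>N. \<forall>i<N. a i = 0)}"

definition dist_madic :: "nat \<Rightarrow> (int \<Rightarrow> nat) \<Rightarrow> (int \<Rightarrow> nat) \<Rightarrow> real" where
  "dist_madic m a b =
     (if a = b then 0 else real m powi (- ((LEAST k. a k \<noteq> b k) + 1)))"

type_synonym 'n point = "(real, 'n) vec \<times> (int \<Rightarrow> nat)"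

definition product_space :: "nat \<Rightarrow> ('n::finite) point set" where
  "product_space m = UNIV \<times> madics m"

definition dist_prod ::
  "real^'n^'n \<Rightarrow> nat \<Rightarrow> 'n point \<Rightarrow> 'n point \<Rightarrow> real" where
  "dist_prod A m p q = max (dist_mat A (fst p) (fst q)) (dist_madic m (snd p) (snd q))"


section \<open>Quasisimilarities and biLipschitz maps\<close>

definition quasisimilarity :: "'a set \<Rightarrow> ('a \<Rightarrow> 'a \<Rightarrow> real) \<Rightarrow> real \<Rightarrow> real \<Rightarrow> ('a \<Rightarrow> 'a) \<Rightarrow> bool" where
  "quasisimilarity X d M C f \<longleftrightarrow> M \<ge> 1 \<and> C > 0 \<and> bij_betw f X X \<and>
     (\<forall>x\<in>X. \<forall>y\<in>X. C / M * d x y \<le> d (f x) (f y) \<and> d (f x) (f y) \<le> M * C * d x y)"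

definition similarity :: "'a set \<Rightarrow> ('a \<Rightarrow> 'a \<Rightarrow> real) \<Rightarrow> ('a \<Rightarrow> 'a) \<Rightarrow> bool" where
  "similarity X d f \<longleftrightarrow> (\<exists>C. quasisimilarity X d 1 C f)"

definition uniform_quasisimilarity_group ::
  "'a set \<Rightarrow> ('a \<Rightarrow> 'a \<Rightarrow> real) \<Rightarrow> ('a \<Rightarrow> 'a) set \<Rightarrow> bool" where
  "uniform_quasisimilarity_group X d \<Gamma> \<longleftrightarrow> subgroup \<Gamma> (BijGroup X) \<and>
     (\<exists>M\<ge>1. \<forall>\<gamma>\<in>\<Gamma>. \<exists>C>0. quasisimilarity X d M C \<gamma>)"

definition bilipschitz_bij ::
  "'a set \<Rightarrow> ('a \<Rightarrow> 'a \<Rightarrow> real) \<Rightarrow> 'b set \<Rightarrow> ('b \<Rightarrow> 'b \<Rightarrow> real) \<Rightarrow> ('a \<Rightarrow> 'b) \<Rightarrow> bool" where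
  "bilipschitz_bij X d Y d' F \<longleftrightarrow> bij_betw F X Y \<and>
     (\<exists>L\<ge>1. \<forall>x\<in>X. \<forall>y\<in>X. d x y / L \<le> d' (F x) (F y) \<and> d' (F x) (F y) \<le> L * d x y)"

definition conjugate_group :: "'a set \<Rightarrow> 'b set \<Rightarrow> ('a \<Rightarrow> 'b) \<Rightarrow> ('a \<Rightarrow> 'a) set \<Rightarrow> ('b \<Rightarrow> 'b) set" where
  "conjugate_group X Y F \<Gamma> = (\<lambda>\<gamma>. \<lambda>y\<in>Y. F (\<gamma> (inv_into X F y))) ` \<Gamma>"


section \<open>Topological groups and their actions\<close>

definition topological_group :: "('g, 'r) monoid_scheme \<Rightarrow> 'g topology \<Rightarrow> bool" where
  "topological_group G T \<longleftrightarrow> group G \<and> topspace T = carrier G \<and>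
     continuous_map (prod_topology T T) T (\<lambda>(g, h). g \<otimes>\<^bsub>G\<^esub> h) \<and>
     continuous_map T T (\<lambda>g. inv\<^bsub>G\<^esub> g)"

definition separable_space :: "'g topology \<Rightarrow> bool" where
  "separable_space T \<longleftrightarrow>
     (\<exists>S. countable S \<and> S \<subseteq> topspace T \<and> T closure_of S = topspace T)"

definition bounded_continuous :: "'g topology \<Rightarrow> ('g \<Rightarrow> real) set" where
  "bounded_continuous T = {f. continuous_map T euclideanreal f \<and> bounded (f ` topspace T)}"

text \<open>Amenability of a locally compact group in the form of a left-invariant mean on the bounded
  continuous functions. Positivity and linearity make \<open>\<mu> f\<close> depend only on \<open>f\<close> restricted to the
  group.\<close>

definition amenable :: "('g, 'r) monoid_scheme \<Rightarrow> 'g topology \<Rightarrow> bool" where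
  "amenable G T \<longleftrightarrow> (\<exists>\<mu> :: ('g \<Rightarrow> real) \<Rightarrow> real.
     (\<forall>f\<in>bounded_continuous T. \<forall>h\<in>bounded_continuous T. \<mu> (\<lambda>x. f x + h x) = \<mu> f + \<mu> h) \<and>
     (\<forall>f\<in>bounded_continuous T. \<forall>a. \<mu> (\<lambda>x. a * f x) = a * \<mu> f) \<and>
     (\<forall>f\<in>bounded_continuous T. (\<forall>x\<in>carrier G. 0 \<le> f x) \<longrightarrow> 0 \<le> \<mu> f) \<and>
     \<mu> (\<lambda>x. 1) = 1 \<and>
     (\<forall>f\<in>bounded_continuous T. \<forall>g\<in>carrier G. \<mu> (\<lambda>x. f (g \<otimes>\<^bsub>G\<^esub> x)) = \<mu> f))"

abbreviation group_of_maps :: "'a set \<Rightarrow> ('a \<Rightarrow> 'a) set \<Rightarrow> ('a \<Rightarrow> 'a) monoid" where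
  "group_of_maps X \<Gamma> \<equiv> (BijGroup X)\<lparr>carrier := \<Gamma>\<rparr>"

definition separable_locally_compact_action ::
  "'a set \<Rightarrow> ('a \<Rightarrow> 'a \<Rightarrow> real) \<Rightarrow> ('a \<Rightarrow> 'a) set \<Rightarrow> ('a \<Rightarrow> 'a) topology \<Rightarrow> bool" where
  "separable_locally_compact_action X d \<Gamma> T \<longleftrightarrow>
     topological_group (group_of_maps X \<Gamma>) T \<and> separable_space T \<and> locally_compact_space T \<and>
     continuous_map (prod_topology T (Metric_space.mtopology X d)) (Metric_space.mtopology X d)
       (\<lambda>(\<gamma>, x). \<gamma> x)"

definition distinct_pairs :: "'a set \<Rightarrow> ('a \<times> 'a) set" where
  "distinct_pairs X = {(x, y). x \<in> X \<and> y \<in> X \<and> x \<noteq> y}"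

definition cocompact_on_distinct_pairs ::
  "'a set \<Rightarrow> ('a \<Rightarrow> 'a \<Rightarrow> real) \<Rightarrow> ('a \<Rightarrow> 'a) set \<Rightarrow> bool" where
  "cocompact_on_distinct_pairs X d \<Gamma> \<longleftrightarrow> (\<exists>K \<subseteq> distinct_pairs X.
     compactin (prod_topology (Metric_space.mtopology X d) (Metric_space.mtopology X d)) K \<and>
     distinct_pairs X \<subseteq> (\<Union>\<gamma>\<in>\<Gamma>. map_prod \<gamma> \<gamma> ` K))"

end

theory Submission
  imports Defs "HOL-Library.Function_Algebras"
begin

text \<open>After a linear change of coordinates, \<open>dist_mat A\<close> is the metric \<open>wdist w\<close> below, in which the
  coordinate \<open>k\<close> has weight \<open>w k \<ge> 1\<close>. A path in the coordinates of weight less than \<open>b\<close> has zero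
  \<open>b\<close>-variation, so every group element respects the m-adic component and the foliations by the
  coordinates of weight at most \<open>a\<close>. Averaging logarithms of distances with an invariant mean
  turns the constants of the quasisimilarities into a homomorphism \<open>ratio\<close>.

  For a weight \<open>a\<close>, the rescaled orbit functions \<open>g \<mapsto> (a-block of g p) / ratio g ^ a\<close> form, with the
  semi-inner product given by the mean, an equivariant embedding that is biLipschitz on the leaves
  of the foliation. Lipschitz maps into such a space are nearly affine at fine scales somewhere,
  and cocompactness transports that place and scale everywhere. Hence each leaf is embedded onto a
  flat of the dimension of the block, all these flats are parallel, and the projection to their
  common direction gives coordinates in which the group acts by similarities.

  On the m-adic factor, the supremum of the rescaled pullbacks of the metric is an ultrametric
  scaled by \<open>ratio\<close>, whose values on the group turn out to be powers of one number. Its balls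
  form a tree on which the group is transitive level by level, hence the \<open>s\<close>-adic tree for the common
  number \<open>s\<close> of children of a ball. Counting the balls inside the cells of the m-adics shows
  that \<open>s\<close> and \<open>m\<close> have a common power.\<close>

section \<open>Semi-inner product spaces\<close>

text \<open>The mean gives only a positive semidefinite form: a vector can be null without being
  zero. The space is neither completed nor divided by null vectors. Lying in a finite-dimensional
  flat is always expressed as a null distance to a finite projection, and almost affine behaviour is
  derived from integrals of real-valued squared norms instead of derivatives. Exact similarities
  arise because right translation preserves the form and the direction space of the flats is
  invariant under it. Projecting to that space turns equivariance up to null vectors into an
  equality of norms. The obstacle is that the a-block of an image point also depends on the
  coordinates of larger weight and on the m-adic component. The embedding therefore has a lower
  bound only along leaves, and the blocks have to be assembled by a descending induction over the
  weights.\<close>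

locale semi_inner =
  fixes V :: "'v::real_vector set" and ip :: "'v \<Rightarrow> 'v \<Rightarrow> real"
  assumes subsp: "subspace V"
    and ip_add: "\<lbrakk>x \<in> V; y \<in> V; z \<in> V\<rbrakk> \<Longrightarrow> ip (x + y) z = ip x z + ip y z"
    and ip_scale: "\<lbrakk>x \<in> V; z \<in> V\<rbrakk> \<Longrightarrow> ip (r *\<^sub>R x) z = r * ip x z"
    and ip_sym: "\<lbrakk>x \<in> V; z \<in> V\<rbrakk> \<Longrightarrow> ip x z = ip z x"
    and ip_nonneg: "x \<in> V \<Longrightarrow> 0 \<le> ip x x"
begin

lemmas V_add [simp, intro] = subspace_add[OF subsp]
lemmas V_diff [simp, intro] = subspace_diff[OF subsp]
lemmas V_scale [simp, intro] = subspace_scale[OF subsp]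
lemmas V_zero [simp, intro] = subspace_0[OF subsp]

lemma V_sum [simp, intro]: "(\<And>i. i \<in> I \<Longrightarrow> f i \<in> V) \<Longrightarrow> sum f I \<in> V"
  by (rule subspace_sum[OF subsp])

lemma ip_add2: "\<lbrakk>x \<in> V; y \<in> V; z \<in> V\<rbrakk> \<Longrightarrow> ip z (x + y) = ip z x + ip z y"
  by (metis V_add ip_add ip_sym)

lemma ip_scale2: "\<lbrakk>x \<in> V; z \<in> V\<rbrakk> \<Longrightarrow> ip z (r *\<^sub>R x) = r * ip z x"
  by (metis V_scale ip_scale ip_sym)

lemma ip_diff: "\<lbrakk>x \<in> V; y \<in> V; z \<in> V\<rbrakk> \<Longrightarrow> ip (x - y) z = ip x z - ip y z"
  using ip_add[of "x - y" y z] by simp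

lemma ip_diff2: "\<lbrakk>x \<in> V; y \<in> V; z \<in> V\<rbrakk> \<Longrightarrow> ip z (x - y) = ip z x - ip z y"
  using ip_add2[of "x - y" y z] by simp

lemma ip_zero [simp]: "z \<in> V \<Longrightarrow> ip 0 z = 0" "z \<in> V \<Longrightarrow> ip z 0 = 0"
  using ip_scale[of 0 z 0] ip_scale2[of 0 z 0] by auto

lemma ip_sum: "\<lbrakk>\<And>i. i \<in> I \<Longrightarrow> f i \<in> V; z \<in> V\<rbrakk> \<Longrightarrow> ip (sum f I) z = (\<Sum>i\<in>I. ip (f i) z)"
  by (induction I rule: infinite_finite_induct) (auto simp: ip_add)

definition nrm :: "'v \<Rightarrow> real" where "nrm x = sqrt (ip x x)"

lemma nrm_sq: "x \<in> V \<Longrightarrow> (nrm x)\<^sup>2 = ip x x"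
  by (simp add: nrm_def ip_nonneg)

lemma nrm_nonneg [simp]: "x \<in> V \<Longrightarrow> 0 \<le> nrm x"
  by (simp add: nrm_def ip_nonneg)

lemma nrm_zero [simp]: "nrm 0 = 0"
  using ip_zero(1)[of 0] by (simp add: nrm_def)

lemma nrm_scale: "x \<in> V \<Longrightarrow> nrm (r *\<^sub>R x) = \<bar>r\<bar> * nrm x"
  by (simp add: nrm_def ip_scale ip_scale2 real_sqrt_mult flip: mult.assoc)

lemma nrm_minus_commute: "\<lbrakk>x \<in> V; y \<in> V\<rbrakk> \<Longrightarrow> nrm (x - y) = nrm (y - x)"
  using nrm_scale[of "x - y" "-1"] by simp

lemma cauchy_schwarz:
  assumes [simp]: "x \<in> V" "y \<in> V" shows "\<bar>ip x y\<bar> \<le> nrm x * nrm y"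
proof -
  have poly: "0 \<le> ip x x + 2 * t * ip x y + t\<^sup>2 * ip y y" for t
  proof -
    have "ip (x + t *\<^sub>R y) (x + t *\<^sub>R y) = ip x x + 2 * t * ip x y + t\<^sup>2 * ip y y"
      by (simp add: ip_add ip_add2 ip_scale ip_scale2 ip_sym[of y x] power2_eq_square algebra_simps)
    then show ?thesis by (metis V_add V_scale assms ip_nonneg)
  qed
  have "(ip x y)\<^sup>2 \<le> ip x x * ip y y"
  \<comment> \<open>A null vector \<open>y\<close> need not be zero. For such \<open>y\<close> the
    polynomial is affine in \<open>t\<close> and bounded below, so its slope has to vanish; the
    \<open>t\<close> chosen below would give it the value -1.\<close>
  proof (cases "ip y y = 0")
    case True
    have "ip x y = 0"
    proof (rule ccontr)
      assume ne: "ip x y \<noteq> 0"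
      have "0 \<le> ip x x + 2 * (- (ip x x + 1) / (2 * ip x y)) * ip x y"
        using poly[of "- (ip x x + 1) / (2 * ip x y)"] True by simp
      also have "\<dots> = -1" using ne by (simp add: field_simps)
      finally show False by simp
    qed
    then show ?thesis using True by simp
  next
    case False
    then have pos: "ip y y > 0" using ip_nonneg[of y] by simp
    from poly[of "- ip x y / ip y y"] have "0 \<le> ip x x - (ip x y)\<^sup>2 / ip y y"
      using pos by (simp add: power2_eq_square field_simps)
    then show ?thesis using pos by (simp add: field_simps)
  qed
  then have "\<bar>ip x y\<bar> \<le> sqrt (ip x x * ip y y)"
    by (metis real_sqrt_abs real_sqrt_le_iff)
  then show ?thesis by (simp add: nrm_def real_sqrt_mult)
qed

lemma nrm_triangle:
  assumes [simp]: "x \<in> V" "y \<in> V" shows "nrm (x + y) \<le> nrm x + nrm y"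
proof -
  have "(nrm (x + y))\<^sup>2 = (nrm x)\<^sup>2 + 2 * ip x y + (nrm y)\<^sup>2"
    by (simp add: nrm_sq ip_add ip_add2 ip_sym[of y x])
  also have "\<dots> \<le> (nrm x + nrm y)\<^sup>2"
    using cauchy_schwarz[of x y] by (simp add: power2_sum)
  finally show ?thesis by (rule power2_le_imp_le) simp
qed

lemma nrm_triangle_diff: "\<lbrakk>x \<in> V; y \<in> V\<rbrakk> \<Longrightarrow> nrm (x - y) \<le> nrm x + nrm y"
  using nrm_triangle[of x "-1 *\<^sub>R y"] nrm_scale[of y "-1"] V_scale[of y "-1"] by simp

lemma nrm_triangle3: "\<lbrakk>x \<in> V; y \<in> V; z \<in> V\<rbrakk> \<Longrightarrow> nrm (x - z) \<le> nrm (x - y) + nrm (y - z)"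
  using nrm_triangle[of "x - y" "y - z"] by simp

lemma nrm_sum_le: "(\<And>i. i \<in> I \<Longrightarrow> f i \<in> V) \<Longrightarrow> nrm (sum f I) \<le> (\<Sum>i\<in>I. nrm (f i))"
  by (induction I rule: infinite_finite_induct)
     (auto intro!: order_trans[OF nrm_triangle] simp: V_sum)

lemma nrm_null_ip: "\<lbrakk>x \<in> V; y \<in> V; nrm x = 0\<rbrakk> \<Longrightarrow> ip x y = 0"
  using cauchy_schwarz[of x y] by simp

lemma nrm_null_eq: "\<lbrakk>x \<in> V; y \<in> V; nrm (x - y) = 0\<rbrakk> \<Longrightarrow> nrm x = nrm y"
  using nrm_triangle[of "x - y" y] nrm_triangle[of "y - x" x] nrm_minus_commute[of x y] by simp

lemma ip_null_cong: "\<lbrakk>x \<in> V; y \<in> V; z \<in> V; nrm (x - y) = 0\<rbrakk> \<Longrightarrow> ip x z = ip y z"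
  using nrm_null_ip[of "x - y" z] by (simp add: ip_diff)

definition orthonormal :: "('i \<Rightarrow> 'v) \<Rightarrow> 'i set \<Rightarrow> bool" where
  "orthonormal w J \<longleftrightarrow> finite J \<and> (\<forall>i\<in>J. w i \<in> V) \<and>
     (\<forall>i\<in>J. \<forall>j\<in>J. ip (w i) (w j) = (if i = j then 1 else 0))"

definition proj :: "('i \<Rightarrow> 'v) \<Rightarrow> 'i set \<Rightarrow> 'v \<Rightarrow> 'v" where
  "proj w J v = (\<Sum>j\<in>J. ip v (w j) *\<^sub>R w j)"

lemma proj_V: "orthonormal w J \<Longrightarrow> proj w J v \<in> V"
  by (auto simp: proj_def orthonormal_def)

lemma ip_proj: assumes "orthonormal w J" "v \<in> V" "z \<in> V"
  shows "ip (proj w J v) z = (\<Sum>j\<in>J. ip v (w j) * ip z (w j))"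
proof -
  have "ip (proj w J v) z = (\<Sum>j\<in>J. ip (ip v (w j) *\<^sub>R w j) z)"
    using assms unfolding proj_def by (intro ip_sum) (auto simp: orthonormal_def)
  also have "\<dots> = (\<Sum>j\<in>J. ip v (w j) * ip z (w j))"
    using assms by (intro sum.cong) (auto simp: orthonormal_def ip_scale ip_sym[of z])
  finally show ?thesis .
qed

lemma ip_proj_basis: assumes "orthonormal w J" "v \<in> V" "j \<in> J"
  shows "ip (proj w J v) (w j) = ip v (w j)"
proof -
  have "ip (proj w J v) (w j) = (\<Sum>i\<in>J. ip v (w i) * ip (w j) (w i))"
    using assms by (intro ip_proj) (auto simp: orthonormal_def)
  also have "\<dots> = (\<Sum>i\<in>J. if i = j then ip v (w i) else 0)"
    using assms by (intro sum.cong) (auto simp: orthonormal_def)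
  finally show ?thesis using assms by (simp add: orthonormal_def)
qed

lemma nrm_proj: assumes "orthonormal w J" "v \<in> V"
  shows "(nrm (proj w J v))\<^sup>2 = (\<Sum>j\<in>J. (ip v (w j))\<^sup>2)"
proof -
  have "(nrm (proj w J v))\<^sup>2 = (\<Sum>j\<in>J. ip v (w j) * ip (proj w J v) (w j))"
    using assms by (simp add: nrm_sq proj_V ip_proj)
  also have "\<dots> = (\<Sum>j\<in>J. (ip v (w j))\<^sup>2)"
    using assms by (intro sum.cong) (auto simp: ip_proj_basis power2_eq_square)
  finally show ?thesis .
qed

text \<open>The last hypothesis says that \<open>z\<close> lies in the span of the frame modulo null
  vectors. It allows \<open>z\<close> to be replaced by its projection, on which both terms have the
  same coefficients.\<close>

lemma proj_orthogonal: assumes "orthonormal w J" "v \<in> V" "z \<in> V" "nrm (z - proj w J z) = 0"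
  shows "ip (v - proj w J v) z = 0"
proof -
  have "ip (v - proj w J v) z = ip (v - proj w J v) (proj w J z)"
    using assms by (metis V_diff ip_null_cong ip_sym proj_V)
  also have "\<dots> = ip v (proj w J z) - ip (proj w J v) (proj w J z)"
    using assms by (simp add: ip_diff proj_V)
  also have "ip v (proj w J z) = (\<Sum>j\<in>J. ip z (w j) * ip v (w j))"
    using assms by (simp add: ip_sym[of v] ip_proj proj_V)
  also have "ip (proj w J v) (proj w J z) = (\<Sum>j\<in>J. ip v (w j) * ip (proj w J z) (w j))"
    using assms by (simp add: ip_proj proj_V)
  also have "\<dots> = (\<Sum>j\<in>J. ip z (w j) * ip v (w j))"
    using assms by (intro sum.cong) (auto simp: ip_proj_basis)
  finally show ?thesis by simp
qed

lemma nrm_proj_le: assumes "orthonormal w J" "v \<in> V" shows "nrm (proj w J v) \<le> nrm v"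
proof -
  have "(nrm (proj w J v))\<^sup>2 = ip (proj w J v) v"
    using nrm_proj[OF assms] ip_proj[OF assms assms(2)] by (simp add: power2_eq_square)
  also have "\<dots> \<le> nrm (proj w J v) * nrm v"
    using cauchy_schwarz[OF proj_V[OF assms(1), of v] assms(2)] by linarith
  finally show ?thesis
    using assms proj_V[OF assms(1), of v] nrm_nonneg[of v] nrm_nonneg[of "proj w J v"]
    by (metis le_less_linear mult_le_cancel_left_pos order_trans power2_eq_square)
qed

lemma proj_diff: assumes "orthonormal w J" "v \<in> V" "z \<in> V"
  shows "proj w J (v - z) = proj w J v - proj w J z"
  using assms unfolding proj_def sum_subtractf[symmetric]
  by (intro sum.cong) (auto simp: orthonormal_def ip_diff scaleR_left_diff_distrib)

lemma proj_scale: assumes "orthonormal w J" "v \<in> V"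
  shows "proj w J (r *\<^sub>R v) = r *\<^sub>R proj w J v"
  using assms unfolding proj_def scaleR_sum_right
  by (intro sum.cong) (auto simp: orthonormal_def ip_scale)

text \<open>The projection is linear on \<open>V\<close>, so the vectors with null residual form a
  subspace.\<close>

lemma span_fixed:
  assumes w: "orthonormal w J" and Z: "Z \<subseteq> V" "\<And>z. z \<in> Z \<Longrightarrow> nrm (z - proj w J z) = 0"
    and v: "v \<in> span Z"
  shows "nrm (v - proj w J v) = 0"
proof -
  define S where "S = {v \<in> V. nrm (v - proj w J v) = 0}"
  have "subspace S"
  proof (rule subspaceI)
    show "0 \<in> S" using w by (simp add: S_def proj_def orthonormal_def)
  next
    fix x y assume "x \<in> S" "y \<in> S"
    then have xy: "x \<in> V" "y \<in> V" "nrm (x - proj w J x) = 0" "nrm (y - proj w J y) = 0"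
      by (auto simp: S_def)
    have "proj w J (x + y) = proj w J x + proj w J y"
      using proj_diff[OF w, of "x + y" y] xy by simp
    then have "nrm (x + y - proj w J (x + y)) \<le> 0"
      using nrm_triangle[of "x - proj w J x" "y - proj w J y"] xy proj_V[OF w]
      by (simp add: algebra_simps)
    then show "x + y \<in> S"
      using xy nrm_nonneg[OF V_diff[OF V_add[OF xy(1,2)] proj_V[OF w, of "x + y"]]] by (auto simp: S_def)
  next
    fix c x assume "x \<in> S"
    then show "c *\<^sub>R x \<in> S"
      using proj_V[OF w] by (auto simp: S_def proj_scale[OF w] nrm_scale simp flip: scaleR_right_diff_distrib)
  qed
  moreover have "Z \<subseteq> S" using Z by (auto simp: S_def)
  ultimately have "span Z \<subseteq> S" by (rule span_minimal[rotated])
  then show ?thesis using v by (auto simp: S_def)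
qed

text \<open>Gram-Schmidt modulo null vectors. The hypothesis makes any \<open>card I + 1\<close>
  members of \<open>Z\<close> dependent up to a null vector. Indexing the frame by a subset of
  \<open>I\<close>, rather than by numbers, later allows its coordinates to be placed in a
  coordinate block.\<close>

lemma exists_orthonormal:
  fixes I :: "'i set"
  assumes "finite I" "Z \<subseteq> V"
    and "\<And>z. (\<And>k::nat. z k \<in> Z) \<Longrightarrow>
      \<exists>l. (\<exists>k\<le>card I. l k \<noteq> (0::real)) \<and> nrm (\<Sum>k\<le>card I. l k *\<^sub>R z k) = 0"
  shows "\<exists>w J. J \<subseteq> I \<and> orthonormal w J \<and> (\<forall>j\<in>J. w j \<in> span Z) \<and>
    (\<forall>z\<in>Z. nrm (z - proj w J z) = 0)"
  using assms
proof (induction I arbitrary: Z)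
  case empty
  have "nrm z = 0" if "z \<in> Z" for z
  proof -
    obtain l where "l (0::nat) \<noteq> 0" "nrm (l 0 *\<^sub>R z) = 0"
      using empty(2)[of "\<lambda>_. z"] \<open>z \<in> Z\<close> by auto
    then show ?thesis using that empty(1) by (auto simp: nrm_scale)
  qed
  then show ?case
    by (intro exI[of _ "\<lambda>_. 0"] exI[of _ "{}"]) (auto simp: proj_def orthonormal_def)
next
  case (insert a I)
  show ?case
  proof (cases "\<forall>z\<in>Z. nrm z = 0")
    case True
    then show ?thesis
      by (intro exI[of _ "\<lambda>_. 0"] exI[of _ "{}"]) (auto simp: proj_def orthonormal_def)
  next
    case False
    then obtain z0 where z0: "z0 \<in> Z" "nrm z0 \<noteq> 0" by auto
    \<comment> \<open>\<open>u\<close> is the new frame vector; the induction hypothesis is applied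
      to the components of \<open>Z\<close> orthogonal to it.\<close>
    define u where "u = (1 / nrm z0) *\<^sub>R z0"
    define Q where "Q z = z - ip z u *\<^sub>R u" for z
    define Z' where "Z' = Q ` Z"
    have z0V: "z0 \<in> V" using z0 insert by auto
    have uV: "u \<in> V" using z0V by (simp add: u_def)
    have uu: "ip u u = 1"
      using z0 z0V nrm_sq[of z0] by (auto simp: u_def ip_scale ip_scale2 power2_eq_square)
    have u1: "nrm u = 1" by (simp add: nrm_def uu)
    have QV: "Q z \<in> V" if "z \<in> V" for z using that uV by (simp add: Q_def)
    have Qu: "ip (Q z) u = 0" if "z \<in> V" for z
      using that uV uu by (simp add: Q_def ip_diff ip_scale)
    have uspan: "u \<in> span Z" using z0 by (simp add: u_def span_base span_scale)
    have Z'V: "Z' \<subseteq> V" using insert QV by (auto simp: Z'_def)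
    have dep: "\<exists>l. (\<exists>k\<le>card I. l k \<noteq> 0) \<and> nrm (\<Sum>k\<le>card I. l k *\<^sub>R z' k) = 0"
      if z': "\<And>k::nat. z' k \<in> Z'" for z'
    proof -
      have "\<exists>z\<in>Z. z' k = Q z" for k using z'[of k] by (auto simp: Z'_def)
      then obtain z where z: "\<And>k. z k \<in> Z" "\<And>k. z' k = Q (z k)" by metis
      \<comment> \<open>With \<open>z0\<close> put in front of the family, a relation among
        \<open>z0\<close> and the \<open>z k\<close> projects to a relation among the residuals. It
        is still nontrivial: if only the coefficient of \<open>z0\<close> survived,
        \<open>z0\<close> would be null.\<close>
      obtain l where l: "\<exists>k\<le>card (insert a I). l k \<noteq> 0"
        "nrm (\<Sum>k\<le>card (insert a I). l k *\<^sub>R case_nat z0 z k) = 0"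
        using insert(5)[of "case_nat z0 z"] z(1) z0(1) by (metis nat.case_eq_if)
      have c: "card (insert a I) = Suc (card I)" using insert by simp
      define s where "s = (\<Sum>k\<le>card I. l (Suc k) *\<^sub>R z k)"
      have zV: "z k \<in> V" for k using z insert by auto
      have sV: "s \<in> V" unfolding s_def using zV by auto
      have n0: "nrm (l 0 *\<^sub>R z0 + s) = 0"
        using l(2) unfolding c by (simp add: s_def sum.atMost_Suc_shift del: sum.atMost_Suc)
      have l1: "\<exists>k\<le>card I. l (Suc k) \<noteq> 0"
      proof (rule ccontr)
        assume *: "\<not> ?thesis"
        then have "s = 0" by (auto simp: s_def)
        with n0 z0 z0V have "l 0 = 0" by (simp add: nrm_scale)
        with * l(1) show False unfolding c by (metis Suc_le_mono not0_implies_Suc)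
      qed
      have "(\<Sum>k\<le>card I. l (Suc k) *\<^sub>R z' k) = s - ip s u *\<^sub>R u"
        using zV uV by (simp add: z Q_def s_def ip_sum ip_scale scaleR_sum_left sum_subtractf
            scaleR_right_diff_distrib)
      also have "nrm (s - ip s u *\<^sub>R u) = 0"
      proof -
        define n where "n = l 0 *\<^sub>R z0 + s"
        have nV: "n \<in> V" using z0V sV by (simp add: n_def)
        have z0u: "z0 = nrm z0 *\<^sub>R u" using z0 by (simp add: u_def)
        have "ip z0 u *\<^sub>R u = z0"
          by (subst z0u, subst ip_scale[OF uV uV], subst z0u) (simp add: uu flip: z0u)
        then have "s - ip s u *\<^sub>R u = n - ip n u *\<^sub>R u"
          using z0V sV uV by (simp add: n_def ip_add ip_scale scaleR_left_distrib flip: scaleR_scaleR)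
        moreover have "ip n u = 0" using n0 nV uV by (simp add: n_def nrm_null_ip)
        ultimately have "s - ip s u *\<^sub>R u = n" by simp
        then show ?thesis using n0 by (simp only: n_def)
      qed
      finally show ?thesis using l1 by (intro exI[of _ "\<lambda>k. l (Suc k)"]) auto
    qed
    from insert.IH[OF Z'V dep] obtain w J where
      w: "J \<subseteq> I" "orthonormal w J" "\<forall>j\<in>J. w j \<in> span Z'" "\<forall>z\<in>Z'. nrm (z - proj w J z) = 0"
      by auto
    have aJ: "a \<notin> J" using w insert by auto
    have perp: "ip v u = 0" if "v \<in> span Z'" for v
    proof -
      have "subspace {v \<in> V. ip v u = 0}"
        by (rule subspaceI) (auto simp: ip_add ip_scale uV)
      moreover have "Z' \<subseteq> {v \<in> V. ip v u = 0}"
        using insert QV Qu by (auto simp: Z'_def)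
      ultimately show ?thesis using that span_minimal by blast
    qed
    have sub: "span Z' \<subseteq> span Z"
    proof (rule span_minimal[OF _ subspace_span], unfold Z'_def Q_def, rule image_subsetI)
      fix z assume "z \<in> Z"
      then show "z - ip z u *\<^sub>R u \<in> span Z"
        by (rule span_diff[OF span_base span_scale[OF uspan]])
    qed
    define w' where "w' = w(a := u)"
    have w'J: "w' j = w j" if "j \<in> J" for j using that aJ by (auto simp: w'_def)
    have on: "orthonormal w' (insert a J)"
    proof -
      have wJ: "w j \<in> V" "ip (w j) u = 0" "ip u (w j) = 0" if "j \<in> J" for j
        using w that perp uV ip_sym[of u "w j"] by (auto simp: orthonormal_def)
      then show ?thesis using w uV uu aJ by (auto simp: orthonormal_def w'_def)
    qed
    have "nrm (z - proj w' (insert a J) z) = 0" if "z \<in> Z" for z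
    proof -
      have zV: "z \<in> V" using that insert by auto
      have fin: "finite J" using w by (simp add: orthonormal_def)
      have "proj w' (insert a J) z = ip z u *\<^sub>R u + proj w J z"
        using fin aJ by (simp add: proj_def w'_def)
          (intro sum.cong, auto)
      also have "proj w J z = proj w J (Q z)"
      proof -
        have "proj w J (ip z u *\<^sub>R u) = 0"
          unfolding proj_def using w perp uV
          by (intro sum.neutral) (simp add: ip_scale orthonormal_def, metis ip_sym mult_zero_right)
        then show ?thesis using proj_diff[OF w(2) zV, of "ip z u *\<^sub>R u"] uV by (simp add: Q_def)
      qed
      finally have "z - proj w' (insert a J) z = Q z - proj w J (Q z)" by (simp add: Q_def)
      then show ?thesis using w that by (auto simp: Z'_def)
    qed
    moreover have "\<forall>j\<in>insert a J. w' j \<in> span Z"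
      using w sub uspan by (auto simp: w'_def)
    ultimately show ?thesis using on w by (intro exI[of _ w'] exI[of _ "insert a J"]) auto
  qed
qed

end

section \<open>Small second differences\<close>

context semi_inner
begin

lemma parallelogram:
  assumes [simp]: "x \<in> V" "y \<in> V"
  shows "ip (x - y) (x - y) = 2 * ip x x + 2 * ip y y - ip (x + y) (x + y)"
  by (simp add: ip_add ip_add2 ip_diff ip_diff2 ip_sym[of y x])

text \<open>\<open>V\<close> carries no topology, so only real functions are integrated; this
  supplies their continuity.\<close>

lemma continuous_ip_lipschitz:
  fixes g :: "real^'n \<Rightarrow> 'v"
  assumes V: "\<And>x. g x \<in> V" and L: "\<And>x y. nrm (g x - g y) \<le> L * norm (x - y)"
  shows "continuous_on S (\<lambda>x. ip (g x) (g x))"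
proof -
  have L0: "0 \<le> L"
    using L[of "axis undefined 1" 0] nrm_nonneg[OF V_diff[OF V V], of "axis undefined 1" 0]
    by (simp add: norm_axis_1)
  have "\<bar>nrm (g x) - nrm (g y)\<bar> \<le> L * norm (x - y)" for x y
    using L[of x y] nrm_triangle[of "g x - g y" "g y"] nrm_triangle[of "g y - g x" "g x"]
      nrm_minus_commute[of "g x" "g y"] V by simp
  then have "L-lipschitz_on S (\<lambda>x. nrm (g x))"
    using L0 by (auto intro!: lipschitz_onI simp: dist_norm)
  then have "continuous_on S (\<lambda>x. (nrm (g x))\<^sup>2)"
    by (intro continuous_intros lipschitz_on_continuous_on)
  then show ?thesis using V by (simp add: nrm_sq)
qed

text \<open>The dyadic energies over slightly growing cubes increase, by the parallelogram law, by at
  least the integral of the second differences; as they are bounded, second differences become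
  small at fine scales.\<close>

lemma small_second_differences:
  fixes f :: "real^'n \<Rightarrow> 'v" and D :: "(real^'n) set"
  assumes V: "\<And>x. f x \<in> V" and L: "\<And>x y. nrm (f x - f y) \<le> L * norm (x - y)"
    and D: "finite D" "\<And>v i. v \<in> D \<Longrightarrow> \<bar>v $ i\<bar> \<le> 1"
    and e: "0 < e"
  shows "\<exists>j::nat. N \<le> j \<and> integral (cbox (- 1) 1) (\<lambda>x. \<Sum>v\<in>D.
     (nrm (f x - 2 *\<^sub>R f (x + (1/2^j) *\<^sub>R v) + f (x + (2/2^j) *\<^sub>R v)))\<^sup>2 / (1/2^j)\<^sup>2) \<le> e"
proof (rule ccontr)
  assume neg: "\<not> ?thesis"
  define h :: "nat \<Rightarrow> real" where "h j = 1 / 2^j" for j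
  \<comment> \<open>The half-sides grow by exactly one step,
    \<open>r (Suc j) = r j + h (Suc j)\<close>. Hence a shift by \<open>h (Suc j)\<close> in a
    direction of \<open>D\<close> maps each cube into the next, while all cubes stay between
    half-side 1 and 2.\<close>
  define r :: "nat \<Rightarrow> real" where "r j = 2 - h j" for j
  define C :: "nat \<Rightarrow> (real^'n) set" where "C j = cbox (\<chi> i. - r j) (\<chi> i. r j)" for j
  define F where "F j v x = ip (f (x + h j *\<^sub>R v) - f x) (f (x + h j *\<^sub>R v) - f x)" for j v x
  define dd where "dd j x = (\<Sum>v\<in>D. (nrm (f x - 2 *\<^sub>R f (x + h j *\<^sub>R v) + f (x + (2 * h j) *\<^sub>R v)))\<^sup>2 / (h j)\<^sup>2)" for j x
  define E where "E j = (\<Sum>v\<in>D. integral (C j) (F j v)) / (h j)\<^sup>2" for j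
  have hpos: "h j > 0" for j by (simp add: h_def)
  have h2: "h j = 2 * h (Suc j)" for j by (simp add: h_def)
  have h1: "h j \<le> 1" for j by (simp add: h_def)
  have rS: "r (Suc j) = r j + h (Suc j)" for j using h2[of j] by (simp add: r_def)
  have r1: "1 \<le> r j" "r j \<le> 2" for j using h1[of j] hpos[of j] by (auto simp: r_def)
  have contF: "continuous_on S (F j v)" for S j v
  proof -
    have "nrm ((f (x + h j *\<^sub>R v) - f x) - (f (y + h j *\<^sub>R v) - f y)) \<le> 2 * L * norm (x - y)" for x y
    proof -
      have "(f (x + h j *\<^sub>R v) - f x) - (f (y + h j *\<^sub>R v) - f y) = (f (x + h j *\<^sub>R v) - f (y + h j *\<^sub>R v)) - (f x - f y)"
        by simp
      also have "nrm \<dots> \<le> nrm (f (x + h j *\<^sub>R v) - f (y + h j *\<^sub>R v)) + nrm (f x - f y)"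
        using V by (intro nrm_triangle_diff) auto
      also have "\<dots> \<le> L * norm (x - y) + L * norm (x - y)"
        using L[of "x + h j *\<^sub>R v" "y + h j *\<^sub>R v"] L[of x y] by (intro add_mono) auto
      finally show ?thesis by simp
    qed
    then show ?thesis unfolding F_def
      by (intro continuous_ip_lipschitz[where L = "2 * L"]) (use V in auto)
  qed
  have contF2: "continuous_on S (\<lambda>x. F j v (x + w))" for S j v w
    by (rule continuous_on_compose2[OF contF[of UNIV]]) (auto intro!: continuous_intros)
  have Fnn: "0 \<le> F j v x" for j v x unfolding F_def using V by (intro ip_nonneg) auto
  have intF: "F j v integrable_on cbox a b" for j v a b
    by (rule integrable_continuous) (rule contF)
  \<comment> \<open>A second difference is the difference of two consecutive increments, and their
    sum is the increment of the doubled step. The parallelogram law relates the three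
    squares.\<close>
  have dd_eq: "dd (Suc j) x = (2 * (\<Sum>v\<in>D. F (Suc j) v x) + 2 * (\<Sum>v\<in>D. F (Suc j) v (x + h (Suc j) *\<^sub>R v))
     - (\<Sum>v\<in>D. F j v x)) / (h (Suc j))\<^sup>2" for j x
  proof -
    have "(nrm (f x - 2 *\<^sub>R f (x + h (Suc j) *\<^sub>R v) + f (x + (2 * h (Suc j)) *\<^sub>R v)))\<^sup>2 =
      2 * F (Suc j) v x + 2 * F (Suc j) v (x + h (Suc j) *\<^sub>R v) - F j v x" for v
    proof -
      define a where "a = f (x + h (Suc j) *\<^sub>R v + h (Suc j) *\<^sub>R v) - f (x + h (Suc j) *\<^sub>R v)"
      define b where "b = f (x + h (Suc j) *\<^sub>R v) - f x"
      have ab: "a \<in> V" "b \<in> V" using V by (auto simp: a_def b_def)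
      have 1: "x + h (Suc j) *\<^sub>R v + h (Suc j) *\<^sub>R v = x + (2 * h (Suc j)) *\<^sub>R v"
        by (simp add: scaleR_2 scaleR_left_distrib flip: mult_2 scaleR_scaleR)
      have "f x - 2 *\<^sub>R f (x + h (Suc j) *\<^sub>R v) + f (x + (2 * h (Suc j)) *\<^sub>R v) = a - b"
        by (simp add: a_def b_def 1 scaleR_2)
      moreover have "F j v x = ip (a + b) (a + b)"
        unfolding F_def a_def b_def 1 h2[of j] by simp
      ultimately show ?thesis
        using parallelogram[OF ab] nrm_sq[of "a - b"] ab unfolding F_def a_def[symmetric] b_def[symmetric]
        by (simp add: a_def[symmetric] b_def[symmetric])
    qed
    then show ?thesis
      by (simp add: dd_def sum.distrib sum_subtractf sum_distrib_left flip: sum_divide_distrib)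
  qed
  have contdd: "continuous_on S (dd (Suc j))" for S j
    unfolding dd_eq by (intro continuous_intros contF contF2) (use hpos[of "Suc j"] in auto)
  have Csub: "C j \<subseteq> C (Suc j)" for j
    using rS[of j] hpos[of "Suc j"] unfolding C_def mem_box_cart subset_iff by simp (smt (verit))
  have Cbase: "cbox (- 1) 1 \<subseteq> C j" for j
    using r1[of j] unfolding C_def mem_box_cart subset_iff by simp (smt (verit))
  \<comment> \<open>The factor 4 is the square of \<open>h j / h (Suc j)\<close>: it appears when
    the energy at the coarse step is normalised by the fine one.\<close>
  have step: "integral (cbox (- 1) 1) (dd (Suc j)) \<le> 4 * (E (Suc j) - E j)" for j
  proof -
    let ?h = "h (Suc j)"
    have shift: "integral (C j) (\<lambda>x. F (Suc j) v (x + ?h *\<^sub>R v)) \<le> integral (C (Suc j)) (F (Suc j) v)"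
      if "v \<in> D" for v
    proof -
      have "integral (C j) (\<lambda>x. F (Suc j) v (x + ?h *\<^sub>R v)) = integral ((+) (?h *\<^sub>R v) ` C j) (F (Suc j) v)"
        using integral_shift_cbox[of "?h *\<^sub>R v + (\<chi> i. - r j)" "?h *\<^sub>R v" "?h *\<^sub>R v + (\<chi> i. r j)" "F (Suc j) v"]
        unfolding C_def cbox_translation by simp
      also have "\<dots> \<le> integral (C (Suc j)) (F (Suc j) v)"
      proof (rule integral_subset_le)
        show "(+) (?h *\<^sub>R v) ` C j \<subseteq> C (Suc j)"
        proof
          fix y assume "y \<in> (+) (?h *\<^sub>R v) ` C j"
          then obtain x where x: "x \<in> C j" "y = ?h *\<^sub>R v + x" by auto
          have "\<bar>?h * v $ i\<bar> \<le> ?h" for i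
            using D(2)[OF that, of i] hpos[of "Suc j"] by (simp add: abs_mult)
          then show "y \<in> C (Suc j)"
            using x unfolding C_def rS mem_box_cart by simp (smt (verit))
        qed
        show "F (Suc j) v integrable_on (+) (?h *\<^sub>R v) ` C j"
          unfolding C_def cbox_translation[symmetric] by (rule intF)
        show "F (Suc j) v integrable_on C (Suc j)" unfolding C_def by (rule intF)
      qed (use Fnn in auto)
      finally show ?thesis .
    qed
    have "integral (cbox (- 1) 1) (dd (Suc j)) \<le> integral (C j) (dd (Suc j))"
      using contdd Cbase unfolding C_def
      by (intro integral_subset_le integrable_continuous) (auto simp: dd_def sum_nonneg)
    also have "\<dots> = (2 * (\<Sum>v\<in>D. integral (C j) (F (Suc j) v)) +
       2 * (\<Sum>v\<in>D. integral (C j) (\<lambda>x. F (Suc j) v (x + ?h *\<^sub>R v))) - (\<Sum>v\<in>D. integral (C j) (F j v))) / ?h\<^sup>2"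
    proof -
      have i1: "F (Suc j) v integrable_on C j" "F j v integrable_on C j" 
        "(\<lambda>x. F (Suc j) v (x + ?h *\<^sub>R v)) integrable_on C j" for v
        unfolding C_def by (intro integrable_continuous contF contF2)+
      have hi: "((\<lambda>x. (2 * (\<Sum>v\<in>D. F (Suc j) v x) + 2 * (\<Sum>v\<in>D. F (Suc j) v (x + ?h *\<^sub>R v)) - (\<Sum>v\<in>D. F j v x)) / ?h\<^sup>2)
        has_integral ((2 * (\<Sum>v\<in>D. integral (C j) (F (Suc j) v)) +
       2 * (\<Sum>v\<in>D. integral (C j) (\<lambda>x. F (Suc j) v (x + ?h *\<^sub>R v))) - (\<Sum>v\<in>D. integral (C j) (F j v))) / ?h\<^sup>2)) (C j)"
        using D(1) i1
        by (intro has_integral_divide has_integral_diff has_integral_add has_integral_mult_right has_integral_sum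
            integrable_integral) auto
      then show ?thesis unfolding dd_eq by (rule integral_unique)
    qed
    also have "\<dots> \<le> (4 * (\<Sum>v\<in>D. integral (C (Suc j)) (F (Suc j) v)) - (\<Sum>v\<in>D. integral (C j) (F j v))) / ?h\<^sup>2"
    proof (rule divide_right_mono)
      have "(\<Sum>v\<in>D. integral (C j) (\<lambda>x. F (Suc j) v (x + ?h *\<^sub>R v))) \<le> (\<Sum>v\<in>D. integral (C (Suc j)) (F (Suc j) v))"
        by (intro sum_mono shift)
      moreover have "(\<Sum>v\<in>D. integral (C j) (F (Suc j) v)) \<le> (\<Sum>v\<in>D. integral (C (Suc j)) (F (Suc j) v))"
        using Csub Fnn by (intro sum_mono integral_subset_le) (auto simp: C_def intF)
      ultimately show "2 * (\<Sum>v\<in>D. integral (C j) (F (Suc j) v)) +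
       2 * (\<Sum>v\<in>D. integral (C j) (\<lambda>x. F (Suc j) v (x + ?h *\<^sub>R v))) - (\<Sum>v\<in>D. integral (C j) (F j v))
        \<le> 4 * (\<Sum>v\<in>D. integral (C (Suc j)) (F (Suc j) v)) - (\<Sum>v\<in>D. integral (C j) (F j v))" by linarith
    qed simp
    also have "\<dots> = 4 * (E (Suc j) - E j)"
      unfolding E_def h2[of j] using hpos[of "Suc j"] by (simp add: field_simps)
    finally show ?thesis .
  qed
  have E0: "0 \<le> E j" for j
    unfolding E_def using Fnn by (intro divide_nonneg_nonneg sum_nonneg integral_nonneg) (auto simp: C_def intF)
  \<comment> \<open>The Lipschitz bound on difference quotients, integrated over the largest cube,
    bounds every energy.\<close>
  define B where "B = (\<Sum>v\<in>D. L\<^sup>2 * (norm v)\<^sup>2) * measure lebesgue (cbox (\<chi> i. -2) (\<chi> i. 2) :: (real^'n) set)"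
  have EB: "E j \<le> B" for j
  proof -
    have "integral (C j) (F j v) \<le> (h j)\<^sup>2 * (L\<^sup>2 * (norm v)\<^sup>2) * measure lebesgue (cbox (\<chi> i. -2) (\<chi> i. 2) :: (real^'n) set)"
      (is "_ \<le> ?c * _") for v
    proof -
      have Fle: "F j v x \<le> ?c" for x
      proof -
        have "nrm (f (x + h j *\<^sub>R v) - f x) \<le> L * (h j * norm v)"
          using L[of "x + h j *\<^sub>R v" x] hpos[of j] by simp
        then have "(nrm (f (x + h j *\<^sub>R v) - f x))\<^sup>2 \<le> (L * (h j * norm v))\<^sup>2"
          by (rule power_mono) (use V in auto)
        then show ?thesis using V by (simp add: F_def nrm_sq power_mult_distrib mult_ac)
      qed
      have "integral (C j) (F j v) \<le> integral (cbox (\<chi> i. -2) (\<chi> i. 2)) (F j v)"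
      proof (rule integral_subset_le)
        show "C j \<subseteq> cbox (\<chi> i. - 2) (\<chi> i. 2)"
          using r1[of j] unfolding C_def mem_box_cart subset_iff by simp (smt (verit))
      qed (auto simp: C_def intF Fnn)
      also have "\<dots> \<le> integral (cbox (\<chi> i. -2) (\<chi> i. 2)) (\<lambda>x::real^'n. ?c)"
        using Fle by (intro integral_le intF) auto
      finally show ?thesis by (simp add: mult_ac)
    qed
    then have "(\<Sum>v\<in>D. integral (C j) (F j v)) \<le> (\<Sum>v\<in>D. (h j)\<^sup>2 * (L\<^sup>2 * (norm v)\<^sup>2) * measure lebesgue (cbox (\<chi> i. -2) (\<chi> i. 2) :: (real^'n) set))"
      by (intro sum_mono)
    also have "\<dots> = (h j)\<^sup>2 * B" by (simp add: B_def sum_distrib_left sum_distrib_right mult_ac)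
    finally show ?thesis unfolding E_def using hpos[of j] by (simp add: field_simps)
  qed
  have big: "e < integral (cbox (- 1) 1) (dd j)" if "N \<le> j" for j
    using spec[OF neg[unfolded not_ex], of j] that unfolding dd_def[abs_def] h_def by simp
  \<comment> \<open>Summing \<open>step\<close> over the levels from \<open>N\<close> on would make
    the energies grow linearly, past their common bound.\<close>
  have "4 * E (N + k) \<ge> real k * e" for k
  proof (induction k)
    case 0
    then show ?case using E0[of N] by simp
  next
    case (Suc k)
    have "e \<le> 4 * (E (Suc (N + k)) - E (N + k))"
      using big[of "Suc (N + k)"] step[of "N + k"] by simp
    then show ?case using Suc by (simp add: algebra_simps)
  qed
  then have "real k * e \<le> 4 * B" for k using EB[of "N + k"] by (meson mult_left_mono order_trans zero_le_numeral)
  moreover obtain k :: nat where "real k * e > 4 * B" using e reals_Archimedean3 by blast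
  ultimately show False by (meson not_le)
qed

text \<open>One base point has to serve all grid points at once. The second-difference densities,
  shifted by every grid vector, are added up and integrated over a cube of volume 1; where the sum
  is smallest, each summand is small.\<close>

lemma small_second_differences_grid:
  fixes f :: "real^'n \<Rightarrow> 'v" and D :: "(real^'n) set"
  assumes V: "\<And>x. f x \<in> V" and L: "\<And>x y. nrm (f x - f y) \<le> L * norm (x - y)"
    and D: "finite D" "\<And>v i. v \<in> D \<Longrightarrow> \<bar>v $ i\<bar> \<le> 1"
    and e: "0 < e"
  shows "\<exists>x0 h. 0 < h \<and> (\<forall>k::'n \<Rightarrow> nat. \<forall>v\<in>D. (\<forall>i. k i \<le> K) \<longrightarrow>
     nrm (f (x0 + h *\<^sub>R (\<chi> i. real (k i))) - 2 *\<^sub>R f (x0 + h *\<^sub>R (\<chi> i. real (k i)) + h *\<^sub>R v)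
       + f (x0 + h *\<^sub>R (\<chi> i. real (k i)) + (2 * h) *\<^sub>R v)) \<le> e * h)"
proof -
  define S where "S = {k::'n \<Rightarrow> nat. \<forall>i. k i \<le> K}"
  have finS: "finite S"
  proof -
    have "S = (\<Pi>\<^sub>E i\<in>UNIV. {..K})" by (auto simp: S_def PiE_def)
    then show ?thesis by (simp add: finite_PiE)
  qed
  \<comment> \<open>Chosen so that \<open>card S\<close> integrals of size at most \<open>e'\<close>
    add up to less than the square of \<open>e\<close>.\<close>
  define e' where "e' = e\<^sup>2 / (real (card S) + 1)"
  have e': "0 < e'" using e by (simp add: e'_def)
  \<comment> \<open>Taking \<open>j\<close> at least \<open>K\<close> gives the grid side length at
    most 1, since \<open>K\<close> is at most \<open>2 ^ K\<close>. Shifts of the cube from -1 to 0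
    then stay inside the cube from -1 to 1.\<close>
  obtain j :: nat where j: "K \<le> j" and int: "integral (cbox (- 1) 1) (\<lambda>x. \<Sum>v\<in>D.
     (nrm (f x - 2 *\<^sub>R f (x + (1/2^j) *\<^sub>R v) + f (x + (2/2^j) *\<^sub>R v)))\<^sup>2 / (1/2^j)\<^sup>2) \<le> e'"
    using small_second_differences[OF V L D e', of K] by blast
  define h :: real where "h = 1 / 2^j"
  define p where "p k = h *\<^sub>R ((\<chi> i. real (k i)) :: real^'n)" for k
  define dd where "dd x = (\<Sum>v\<in>D. (nrm (f x - 2 *\<^sub>R f (x + h *\<^sub>R v) + f (x + (2 * h) *\<^sub>R v)))\<^sup>2 / h\<^sup>2)" for x
  have h: "0 < h" by (simp add: h_def)
  have hK: "h * real K \<le> 1"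
  proof -
    have "real K \<le> 2 ^ K" by (simp add: of_nat_less_two_power less_imp_le)
    also have "\<dots> \<le> 2 ^ j" using j by simp
    finally show ?thesis by (simp add: h_def)
  qed
  have ddint: "integral (cbox (- 1) 1) dd \<le> e'" using int unfolding dd_def[abs_def] h_def by simp
  have ddnn: "0 \<le> dd x" for x by (simp add: dd_def sum_nonneg)
  have contdd: "continuous_on A dd" for A
  proof -
    have "continuous_on A (\<lambda>x. ip (f x - 2 *\<^sub>R f (x + h *\<^sub>R v) + f (x + (2 * h) *\<^sub>R v)) (f x - 2 *\<^sub>R f (x + h *\<^sub>R v) + f (x + (2 * h) *\<^sub>R v)))" for v
    proof (rule continuous_ip_lipschitz[where L = "4 * L"])
      fix x y
      have "(f x - 2 *\<^sub>R f (x + h *\<^sub>R v) + f (x + (2 * h) *\<^sub>R v)) - (f y - 2 *\<^sub>R f (y + h *\<^sub>R v) + f (y + (2 * h) *\<^sub>R v))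
        = ((f x - f y) + (f (x + (2 * h) *\<^sub>R v) - f (y + (2 * h) *\<^sub>R v))) - 2 *\<^sub>R (f (x + h *\<^sub>R v) - f (y + h *\<^sub>R v))"
        by (simp add: algebra_simps)
      also have "nrm \<dots> \<le> (nrm (f x - f y) + nrm (f (x + (2 * h) *\<^sub>R v) - f (y + (2 * h) *\<^sub>R v)))
         + \<bar>2\<bar> * nrm (f (x + h *\<^sub>R v) - f (y + h *\<^sub>R v))"
        using V by (intro order_trans[OF nrm_triangle_diff] add_mono nrm_triangle) (auto simp: nrm_scale)
      also have "\<dots> \<le> (L * norm (x - y) + L * norm (x - y)) + \<bar>2\<bar> * (L * norm (x - y))"
        using L[of x y] L[of "x + (2 * h) *\<^sub>R v" "y + (2 * h) *\<^sub>R v"] L[of "x + h *\<^sub>R v" "y + h *\<^sub>R v"]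
        by (intro add_mono mult_left_mono) auto
      finally show "nrm ((f x - 2 *\<^sub>R f (x + h *\<^sub>R v) + f (x + (2 * h) *\<^sub>R v)) - (f y - 2 *\<^sub>R f (y + h *\<^sub>R v) + f (y + (2 * h) *\<^sub>R v))) \<le> 4 * L * norm (x - y)"
        by simp
    qed (use V in auto)
    moreover have "f x - 2 *\<^sub>R f (x + h *\<^sub>R v) + f (x + (2 * h) *\<^sub>R v) \<in> V" for x v using V by auto
    ultimately show ?thesis unfolding dd_def using h by (auto intro!: continuous_intros simp: nrm_sq)
  qed
  define g where "g x = (\<Sum>k\<in>S. dd (x + p k))" for x
  have contddp: "continuous_on A (\<lambda>x. dd (x + p k))" for A k
    by (rule continuous_on_compose2[OF contdd[of UNIV]]) (auto intro!: continuous_intros)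
  have "integral (cbox (- 1) 0) g = (\<Sum>k\<in>S. integral (cbox (- 1) 0) (\<lambda>x. dd (x + p k)))"
    unfolding g_def using finS contddp by (intro integral_sum integrable_continuous) auto
  also have "\<dots> \<le> (\<Sum>k\<in>S. e')"
  proof (rule sum_mono)
    fix k assume k: "k \<in> S"
    have "integral (cbox (- 1) 0) (\<lambda>x. dd (x + p k)) = integral (cbox (p k + (- 1)) (p k + 0)) dd"
      using integral_shift_cbox[of "p k + (- 1)" "p k" "p k + 0" dd] by simp
    also have "\<dots> \<le> integral (cbox (- 1) 1) dd"
    proof (rule integral_subset_le)
      have "0 \<le> p k $ i \<and> p k $ i \<le> 1" for i
      proof -
        have "h * real (k i) \<le> h * real K" using k h by (simp add: S_def)
        from order_trans[OF this hK] show ?thesis using h by (simp add: p_def)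
      qed
      then show "cbox (p k + (- 1)) (p k + 0) \<subseteq> cbox (- 1) 1"
        unfolding mem_box_cart subset_iff by simp (smt (verit))
    qed (use contdd ddnn in \<open>auto intro: integrable_continuous\<close>)
    finally show "integral (cbox (- 1) 0) (\<lambda>x. dd (x + p k)) \<le> e'" using ddint by simp
  qed
  also have "\<dots> < e\<^sup>2" using e by (simp add: e'_def field_simps)
  finally have small: "integral (cbox (- 1) 0) g < e\<^sup>2" .
  have "\<exists>x0. g x0 < e\<^sup>2"
  proof (rule ccontr)
    assume "\<not> ?thesis"
    then have "integral (cbox (- 1) 0) (\<lambda>x::real^'n. e\<^sup>2) \<le> integral (cbox (- 1) 0) g"
      using contddp finS unfolding g_def
      by (intro integral_le integrable_continuous continuous_on_sum) (auto simp: not_less)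
    moreover have "measure lebesgue (cbox (- 1) 0 :: (real^'n) set) = 1"
      by (simp add: content_cbox_if_cart interval_ne_empty_cart)
    ultimately show False using small by simp
  qed
  then obtain x0 where x0: "g x0 < e\<^sup>2" by blast
  have "nrm (f (x0 + p k) - 2 *\<^sub>R f (x0 + p k + h *\<^sub>R v) + f (x0 + p k + (2 * h) *\<^sub>R v)) \<le> e * h" (is "?n \<le> _")
    if "k \<in> S" "v \<in> D" for k v
  proof -
    have "?n\<^sup>2 / h\<^sup>2 \<le> dd (x0 + p k)"
      unfolding dd_def using D that by (intro member_le_sum[of v D "\<lambda>v. (nrm (f (x0 + p k) - 2 *\<^sub>R f (x0 + p k + h *\<^sub>R v) + f (x0 + p k + (2 * h) *\<^sub>R v)))\<^sup>2 / h\<^sup>2"]) auto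
    also have "\<dots> \<le> g x0"
      unfolding g_def using finS that ddnn by (intro member_le_sum[of k S "\<lambda>k. dd (x0 + p k)"]) auto
    finally have "?n\<^sup>2 / h\<^sup>2 \<le> e\<^sup>2" using x0 by simp
    then have "?n\<^sup>2 \<le> (e * h)\<^sup>2" using h by (simp add: divide_le_eq power_mult_distrib)
    then show ?thesis by (rule power2_le_imp_le) (use e h in simp)
  qed
  then show ?thesis using h unfolding S_def p_def by blast
qed

end

section \<open>Almost affine behaviour at a fine scale\<close>

context semi_inner
begin

text \<open>Small second differences in the directions of the axes and of their differences make all
  mixed differences small. Increments are then almost constant along the grid, and the Lipschitz
  bound fills in the points between grid points.\<close>

lemma approximately_affine:
  fixes f :: "real^'n \<Rightarrow> 'v"
  assumes V: "\<And>x. f x \<in> V" and L: "\<And>x y. nrm (f x - f y) \<le> L * norm (x - y)" and e: "0 < e"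
  shows "\<exists>x0 r v. 0 < r \<and> (\<forall>i. v i \<in> V) \<and>
    (\<forall>x. (\<forall>i. x0 $ i \<le> x $ i \<and> x $ i \<le> x0 $ i + r) \<longrightarrow>
      nrm (f x - f x0 - (\<Sum>i\<in>UNIV. (x - x0) $ i *\<^sub>R v i)) \<le> e * r)"
proof -
  define n where "n = real CARD('n)"
  have n1: "1 \<le> n" by (simp add: n_def Suc_le_eq)
  have L0: "0 \<le> L"
    using L[of "axis undefined 1" 0] nrm_nonneg[OF V_diff[OF V V], of "axis undefined 1" 0]
    by (simp add: norm_axis_1)
  \<comment> \<open>So many grid steps that rounding to the grid, which costs
    \<open>2 * n * L\<close> steps, uses up at most half of the allowed error.\<close>
  obtain K :: nat where K: "4 * n * L / e < real K" using reals_Archimedean2 by blast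
  then have Kpos: "0 < real K" using L0 n1 e by (smt (verit) divide_nonneg_pos mult_nonneg_nonneg)
  have KL: "2 * n * L \<le> e * real K / 2" using K e by (simp add: field_simps)
  \<comment> \<open>Chosen so that the error accumulated over at most \<open>n * K\<close> grid
    steps, quadratic in that number, is the other half.\<close>
  define d where "d = e / (4 * n\<^sup>2 * real K)"
  have d: "0 < d" using e n1 Kpos by (simp add: d_def)
  define a :: "'n \<Rightarrow> real^'n" where "a i = axis i 1" for i
  define D where "D = range a \<union> (\<lambda>(i, j). a j - a i) ` UNIV"
  have finD: "finite D" by (simp add: D_def)
  have Dle: "\<bar>v $ i\<bar> \<le> 1" if "v \<in> D" for v i
    using that by (auto simp: D_def a_def axis_def)
  \<comment> \<open>The grid is larger by 2 because the differences in direction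
    \<open>a j - a i\<close> are based two steps away from \<open>k\<close>.\<close>
  obtain x0 h where h: "0 < h" and small: "\<And>(k::'n \<Rightarrow> nat) v. \<lbrakk>v \<in> D; \<And>i. k i \<le> K + 2\<rbrakk> \<Longrightarrow>
     nrm (f (x0 + h *\<^sub>R (\<chi> i. real (k i))) - 2 *\<^sub>R f (x0 + h *\<^sub>R (\<chi> i. real (k i)) + h *\<^sub>R v)
       + f (x0 + h *\<^sub>R (\<chi> i. real (k i)) + (2 * h) *\<^sub>R v)) \<le> d * h"
    using small_second_differences_grid[OF V L finD Dle d, of "K + 2"] by blast
  define g where "g k = f (x0 + h *\<^sub>R (\<chi> i. real (k i)))" for k :: "'n \<Rightarrow> nat"
  define up where "up k i = k(i := Suc (k i))" for k :: "'n \<Rightarrow> nat" and i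
  have gV: "g k \<in> V" for k by (simp add: g_def V)
  have pt: "x0 + h *\<^sub>R (\<chi> j. real (up k i j)) = x0 + h *\<^sub>R (\<chi> j. real (k j)) + h *\<^sub>R a i" for k i
    by (simp add: vec_eq_iff up_def a_def axis_def algebra_simps)
  have comm: "up (up k i) j = up (up k j) i" for k i j by (auto simp: up_def)
  have two: "(2 * h) *\<^sub>R w = h *\<^sub>R w + h *\<^sub>R w" for w :: "real^'n"
    by (simp only: mult_2 scaleR_left_distrib)
  have s1: "nrm (g k - 2 *\<^sub>R g (up k i) + g (up (up k i) i)) \<le> d * h" if "\<And>i. k i \<le> K" for k i
  proof -
    have "x0 + h *\<^sub>R (\<chi> j. real (up (up k i) i j)) = x0 + h *\<^sub>R (\<chi> j. real (k j)) + (2 * h) *\<^sub>R a i"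
      unfolding pt two by (simp add: algebra_simps)
    note eq = this
    have "a i \<in> D" by (simp add: D_def)
    moreover have "k l \<le> K + 2" for l using that[of l] by simp
    ultimately show ?thesis
      unfolding g_def pt[of k i] eq by (rule small)
  qed
  have s2: "nrm (g (up (up k i) i) - 2 *\<^sub>R g (up (up k i) j) + g (up (up k j) j)) \<le> d * h"
    if "\<And>i. k i \<le> K" for k i j
  proof -
    have 1: "x0 + h *\<^sub>R (\<chi> l. real (up (up k i) j l)) = x0 + h *\<^sub>R (\<chi> l. real (up (up k i) i l)) + h *\<^sub>R (a j - a i)"
      unfolding pt by (simp add: algebra_simps)
    have 2: "x0 + h *\<^sub>R (\<chi> l. real (up (up k j) j l)) = x0 + h *\<^sub>R (\<chi> l. real (up (up k i) i l)) + (2 * h) *\<^sub>R (a j - a i)"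
      unfolding pt two by (simp add: algebra_simps)
    have "up (up k i) i l \<le> K + 2" for l using that[of l] that[of i] by (auto simp: up_def)
    moreover have "a j - a i \<in> D" by (auto simp: D_def)
    ultimately show ?thesis unfolding g_def 1 2 by (intro small)
  qed
  \<comment> \<open>Polarisation: twice the mixed difference is the sum of the two pure second
    differences at \<open>k\<close> minus the one in direction \<open>a j - a i\<close>.\<close>
  have mixed: "nrm (g (up (up k i) j) - g (up k i) - (g (up k j) - g k)) \<le> 2 * d * h"
    if "\<And>i. k i \<le> K" for k i j
  proof -
    define A where "A = g (up (up k i) i) - 2 *\<^sub>R g (up (up k i) j) + g (up (up k j) j)"
    define B where "B = g k - 2 *\<^sub>R g (up k i) + g (up (up k i) i)"
    define C where "C = g k - 2 *\<^sub>R g (up k j) + g (up (up k j) j)"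
    have "2 *\<^sub>R (g (up (up k i) j) - g (up k i) - (g (up k j) - g k)) = B + C - A"
      unfolding A_def B_def C_def scaleR_2 by simp
    from arg_cong[OF this, of "scaleR (1/2)"]
    have "g (up (up k i) j) - g (up k i) - (g (up k j) - g k) = (1/2) *\<^sub>R (B + C - A)"
      unfolding scaleR_scaleR by simp
    moreover have "nrm (B + C - A) \<le> (nrm B + nrm C) + nrm A"
      using gV by (intro order_trans[OF nrm_triangle_diff] add_mono nrm_triangle) (auto simp: A_def B_def C_def)
    moreover have "A \<in> V" "B \<in> V" "C \<in> V" using gV by (auto simp: A_def B_def C_def)
    ultimately show ?thesis
      using s1[of k i, OF that] s1[of k j, OF that] s2[of k i j, OF that] mult_pos_pos[OF d h]
      unfolding A_def[symmetric] B_def[symmetric] C_def[symmetric] by (simp add: nrm_scale)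
  qed
  define zero where "zero = (\<lambda>i::'n. 0::nat)"
  define v where "v i = (1/h) *\<^sub>R (g (up zero i) - g zero)" for i
  have vV: "v i \<in> V" for i using gV by (simp add: v_def)
  have hv: "h *\<^sub>R v i = g (up zero i) - g zero" for i using h by (simp add: v_def)
  \<comment> \<open>Each unit step adds one mixed difference to the error of an increment, so this
    error grows linearly with the sum of the coordinates and the error of the value
    quadratically.\<close>
  have ind: "(\<forall>i. nrm (g (up k i) - g k - h *\<^sub>R v i) \<le> 2 * d * h * real (sum k UNIV)) \<and>
     nrm (g k - g zero - (\<Sum>i\<in>UNIV. (h * real (k i)) *\<^sub>R v i)) \<le> 2 * d * h * real (sum k UNIV) * real (sum k UNIV)"
    if "\<And>i. k i \<le> K" for k
    using that
  proof (induction "sum k UNIV" arbitrary: k)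
    case 0
    then have "k = zero" by (auto simp: zero_def)
    then show ?case by (simp add: hv) (simp add: zero_def)
  next
    case (Suc s)
    then obtain j where j: "k j \<noteq> 0" by (metis nat.distinct(1) sum.neutral)
    define k' where "k' = k(j := k j - 1)"
    have k: "k = up k' j" using j by (auto simp: k'_def up_def)
    have k'K: "k' i \<le> K" for i using Suc(3)[of i] by (auto simp: k'_def)
    have "sum k UNIV = (\<Sum>i\<in>UNIV. k' i + (if i = j then 1 else 0))"
      by (intro sum.cong) (auto simp: k up_def)
    then have "sum k UNIV = Suc (sum k' UNIV)" by (simp add: sum.distrib)
    then have s: "s = sum k' UNIV" using Suc(2) by simp
    note IH = Suc(1)[OF s k'K]
    have IH1: "nrm (g (up k' i) - g k' - h *\<^sub>R v i) \<le> 2 * d * h * real s" for i using IH s by simp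
    have 1: "nrm (g (up k i) - g k - h *\<^sub>R v i) \<le> 2 * d * h * real (Suc s)" for i
    proof -
      have "g (up k i) - g k - h *\<^sub>R v i = (g (up (up k' j) i) - g (up k' j) - (g (up k' i) - g k')) + (g (up k' i) - g k' - h *\<^sub>R v i)"
        by (simp add: k)
      also have "nrm \<dots> \<le> 2 * d * h + 2 * d * h * real s"
        using mixed[of k' j i, OF k'K] IH1[of i] gV vV by (intro order_trans[OF nrm_triangle] add_mono) auto
      finally show ?thesis by (simp add: algebra_simps)
    qed
    have "g k - g zero - (\<Sum>i\<in>UNIV. (h * real (k i)) *\<^sub>R v i) =
       (g (up k' j) - g k' - h *\<^sub>R v j) + (g k' - g zero - (\<Sum>i\<in>UNIV. (h * real (k' i)) *\<^sub>R v i))"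
    proof -
      have "(\<Sum>i\<in>UNIV. (h * real (k i)) *\<^sub>R v i) = (\<Sum>i\<in>UNIV. (h * real (k' i)) *\<^sub>R v i + (if i = j then h *\<^sub>R v i else 0))"
        by (intro sum.cong) (auto simp: k up_def algebra_simps)
      also have "\<dots> = (\<Sum>i\<in>UNIV. (h * real (k' i)) *\<^sub>R v i) + h *\<^sub>R v j"
        by (simp add: sum.distrib)
      finally show ?thesis by (simp add: k)
    qed
    also have "nrm \<dots> \<le> 2 * d * h * real s + 2 * d * h * real s * real s"
      using IH IH1[of j] gV vV s by (intro order_trans[OF nrm_triangle] add_mono) auto
    also have "\<dots> \<le> 2 * d * h * real (Suc s) * real (Suc s)"
      using d h by (simp add: algebra_simps)
    finally show ?case using 1 Suc(2) by simp
  qed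
  have vL: "nrm (v i) \<le> L" for i
  proof -
    have "nrm (g (up zero i) - g zero) \<le> L * norm (h *\<^sub>R a i)"
      using L[of "x0 + h *\<^sub>R (\<chi> j. real (up zero i j))" "x0 + h *\<^sub>R (\<chi> j. real (zero j))"]
      unfolding g_def pt by simp
    moreover have "nrm (v i) = nrm (g (up zero i) - g zero) / h"
      unfolding v_def using h gV by (subst nrm_scale) auto
    ultimately show ?thesis using h by (simp add: a_def norm_axis_1 divide_le_eq mult.commute)
  qed
  have g0: "g zero = f x0" by (simp add: g_def zero_def flip: zero_vec_def)
  have main: "nrm (f x - f x0 - (\<Sum>i\<in>UNIV. (x - x0) $ i *\<^sub>R v i)) \<le> e * (h * real K)"
    if x: "\<And>i. x0 $ i \<le> x $ i \<and> x $ i \<le> x0 $ i + h * real K" for x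
  proof -
    define k where "k i = nat \<lfloor>(x $ i - x0 $ i) / h\<rfloor>" for i
    have kf: "real (k i) = of_int \<lfloor>(x $ i - x0 $ i) / h\<rfloor>" for i
      using x[of i] h by (simp add: k_def)
    have k1: "h * real (k i) \<le> x $ i - x0 $ i" for i
      using of_int_floor_le[of "(x $ i - x0 $ i) / h"] h
      unfolding kf[symmetric] pos_le_divide_eq[OF h] by (simp add: mult.commute)
    have k2: "x $ i - x0 $ i \<le> h * real (k i) + h" for i
      using real_of_int_floor_add_one_ge[of "(x $ i - x0 $ i) / h"] h
      unfolding kf[symmetric] pos_divide_le_eq[OF h] by (simp add: algebra_simps)
    have kK: "k i \<le> K" for i
    proof -
      have "h * real (k i) \<le> h * real K" using k1[of i] x[of i] by simp
      then show ?thesis using h by simp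
    qed
    define y where "y = x0 + h *\<^sub>R (\<chi> i. real (k i))"
    have xy: "\<bar>(x - y) $ i\<bar> \<le> h" for i using k1[of i] k2[of i] by (simp add: y_def)
    have nxy: "norm (x - y) \<le> n * h"
    proof -
      have "norm (x - y) \<le> (\<Sum>i\<in>UNIV. \<bar>(x - y) $ i\<bar>)" by (rule norm_le_l1_cart)
      also have "\<dots> \<le> (\<Sum>i\<in>(UNIV::'n set). h)" using xy by (intro sum_mono) auto
      finally show ?thesis by (simp add: n_def)
    qed
    have sk: "real (sum k UNIV) \<le> n * real K"
    proof -
      have "sum k UNIV \<le> (\<Sum>i\<in>(UNIV::'n set). K)" using kK by (intro sum_mono) auto
      then have "real (sum k UNIV) \<le> real (CARD('n) * K)" by (intro of_nat_mono) simp
      then show ?thesis by (simp add: n_def)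
    qed
    have t1: "nrm (f x - f y) \<le> L * (n * h)"
      using L[of x y] nxy L0 by (meson mult_left_mono order_trans)
    have "nrm (f y - f x0 - (\<Sum>i\<in>UNIV. (y - x0) $ i *\<^sub>R v i)) \<le> 2 * d * h * real (sum k UNIV) * real (sum k UNIV)"
      using conjunct2[OF ind[OF kK]] unfolding g0 by (simp add: g_def y_def)
    also have "\<dots> \<le> 2 * d * h * (n * real K) * (n * real K)"
    proof -
      have "0 \<le> n * real K" using n1 Kpos by simp
      then show ?thesis using sk d h n1 Kpos by (intro mult_mono) (auto intro!: mult_nonneg_nonneg sum_nonneg)
    qed
    also have "\<dots> = e * (h * real K) / 2"
      using n1 Kpos by (simp add: d_def field_simps power2_eq_square)
    finally have t2: "nrm (f y - f x0 - (\<Sum>i\<in>UNIV. (y - x0) $ i *\<^sub>R v i)) \<le> e * (h * real K) / 2" .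
    have "nrm (\<Sum>i\<in>UNIV. (x - y) $ i *\<^sub>R v i) \<le> (\<Sum>i\<in>UNIV. nrm ((x - y) $ i *\<^sub>R v i))"
      using vV by (intro nrm_sum_le) auto
    also have "\<dots> \<le> (\<Sum>i\<in>(UNIV::'n set). h * L)"
      using vV vL xy h by (intro sum_mono) (auto simp: nrm_scale intro!: mult_mono simp del: vector_minus_component)
    also have "\<dots> = n * h * L" by (simp add: n_def)
    finally have t3: "nrm (\<Sum>i\<in>UNIV. (x - y) $ i *\<^sub>R v i) \<le> n * h * L" .
    have "f x - f x0 - (\<Sum>i\<in>UNIV. (x - x0) $ i *\<^sub>R v i) =
      ((f x - f y) + (f y - f x0 - (\<Sum>i\<in>UNIV. (y - x0) $ i *\<^sub>R v i))) - (\<Sum>i\<in>UNIV. (x - y) $ i *\<^sub>R v i)"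
      by (simp add: algebra_simps sum_subtractf)
    also have "nrm \<dots> \<le> (nrm (f x - f y) + nrm (f y - f x0 - (\<Sum>i\<in>UNIV. (y - x0) $ i *\<^sub>R v i))) + nrm (\<Sum>i\<in>UNIV. (x - y) $ i *\<^sub>R v i)"
      by (intro order_trans[OF nrm_triangle_diff] add_mono nrm_triangle order_refl V_add V_diff V_sum V_scale V vV)
    also have "\<dots> \<le> (L * (n * h) + e * (h * real K) / 2) + n * h * L" using t1 t2 t3 by linarith
    also have "\<dots> = 2 * n * L * h + e * (h * real K) / 2" by simp
    also have "\<dots> \<le> (e * real K / 2) * h + e * (h * real K) / 2"
      using mult_right_mono[OF KL, of h] h by linarith
    finally show ?thesis by simp
  qed
  show ?thesis
    using h Kpos vV main by (intro exI[of _ x0] exI[of _ "h * real K"] exI[of _ v]) auto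
qed

end

section \<open>Weighted block metrics and the m-adic metric\<close>

definition block :: "('n::finite \<Rightarrow> real) \<Rightarrow> real \<Rightarrow> real^'n \<Rightarrow> real^'n" where
  "block w a x = (\<chi> k. if w k = a then x $ k else 0)"

definition wdist :: "('n::finite \<Rightarrow> real) \<Rightarrow> real^'n \<Rightarrow> real^'n \<Rightarrow> real" where
  "wdist w x y = Max ((\<lambda>a. norm (block w a (x - y)) powr (1 / a)) ` range w)"

definition pdist :: "('n::finite \<Rightarrow> real) \<Rightarrow> nat \<Rightarrow> 'n point \<Rightarrow> 'n point \<Rightarrow> real" where
  "pdist w m p q = max (wdist w (fst p) (fst q)) (dist_madic m (snd p) (snd q))"

lemma block_nth [simp]: "block w a x $ k = (if w k = a then x $ k else 0)"
  by (simp add: block_def)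

lemma block_add: "block w a (x + y) = block w a x + block w a y"
  and block_diff: "block w a (x - y) = block w a x - block w a y"
  and block_scale: "block w a (r *\<^sub>R x) = r *\<^sub>R block w a x"
  and block_zero [simp]: "block w a 0 = 0"
  and block_minus: "block w a (- x) = - block w a x"
  and block_block: "block w a (block w b x) = (if a = b then block w a x else 0)"
  by (auto simp: vec_eq_iff)

lemma sum_block: "(\<Sum>a\<in>range w. block w a x) = x"
proof (rule vec_eq_iff[THEN iffD2], rule allI)
  fix k
  have "(\<Sum>a\<in>range w. block w a x) $ k = (\<Sum>a\<in>range w. if a = w k then x $ k else 0)"
    by (subst sum_component) (intro sum.cong, auto)
  then show "(\<Sum>a\<in>range w. block w a x) $ k = x $ k" by simp
qed

lemma block_eq_iff: "(\<forall>a\<in>range w. block w a x = block w a y) \<longleftrightarrow> x = y"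
  by (metis sum_block sum.cong)

lemma nth_le_norm_block: "\<bar>x $ k\<bar> \<le> norm (block w (w k) x)"
  using component_le_norm_cart[of "block w (w k) x" k] by simp

lemma norm_block_le: "norm (block w a x) \<le> norm x"
  by (rule norm_le_componentwise_cart) auto

text \<open>Removes the maximum and the roots, so that estimates can be proved block by
  block.\<close>

lemma wdist_mono_iff:
  assumes "\<And>k. 1 \<le> w k" "0 \<le> r"
  shows "wdist w x y \<le> r \<longleftrightarrow> (\<forall>a\<in>range w. norm (block w a (x - y)) \<le> r powr a)"
proof -
  have "norm (block w a (x - y)) powr (1 / a) \<le> r \<longleftrightarrow> norm (block w a (x - y)) \<le> r powr a"
    if "a \<in> range w" for a
  proof
    have a: "1 \<le> a" using that assms by auto
    {
      assume "norm (block w a (x - y)) powr (1 / a) \<le> r"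
      then have "(norm (block w a (x - y)) powr (1 / a)) powr a \<le> r powr a"
        using a by (intro powr_mono2) auto
      then show "norm (block w a (x - y)) \<le> r powr a" using a by (simp add: powr_powr)
    next
      assume "norm (block w a (x - y)) \<le> r powr a"
      then have "norm (block w a (x - y)) powr (1 / a) \<le> (r powr a) powr (1 / a)"
        using a by (intro powr_mono2) auto
      then show "norm (block w a (x - y)) powr (1 / a) \<le> r" using a assms by (simp add: powr_powr)
    }
  qed
  then show ?thesis unfolding wdist_def by (subst Max_le_iff) auto
qed

lemma wdist_nonneg [simp]: "0 \<le> wdist w x y"
proof -
  have "norm (block w (w undefined) (x - y)) powr (1 / w undefined) \<le> wdist w x y"
    unfolding wdist_def by (intro Max_ge) auto
  then show ?thesis using powr_ge_zero order_trans by blast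
qed

lemma wdist_commute: "wdist w x y = wdist w y x"
  unfolding wdist_def block_diff by (simp add: norm_minus_commute)

lemma norm_block_wdist:
  assumes "\<And>k. 1 \<le> w k"
  shows "norm (block w (w k) (x - y)) \<le> wdist w x y powr w k"
  using wdist_mono_iff[of w "wdist w x y" x y] assms by auto

lemma wdist_self [simp]: "wdist w x x = 0"
  unfolding wdist_def by simp

lemma wdist_eq_0: assumes "\<And>k. 1 \<le> w k" shows "wdist w x y = 0 \<longleftrightarrow> x = y"
proof
  assume 0: "wdist w x y = 0"
  have "norm (block w (w k) (x - y)) \<le> 0" for k
    using norm_block_wdist[of w k x y] assms 0 by simp
  then have "block w (w k) x = block w (w k) y" for k by (simp add: block_diff)
  then show "x = y" using block_eq_iff[of w x y] by blast
qed auto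

text \<open>After normalising the sum to 1 this is \<open>t powr a \<le> t\<close> on the unit
  interval. It is why weights at least 1 give a triangle inequality.\<close>

lemma powr_superadd: assumes "1 \<le> a" "0 \<le> x" "0 \<le> (y::real)"
  shows "x powr a + y powr a \<le> (x + y) powr a"
proof (cases "x + y = 0")
  case True
  then have "x = 0" "y = 0" using assms by auto
  then show ?thesis by simp
next
  case False
  then have pos: "0 < x + y" using assms by simp
  have le: "t powr a \<le> t" if "0 \<le> t" "t \<le> 1" for t :: real
  proof (cases "t = 0")
    case False
    then show ?thesis using powr_mono'[of 1 a t] that assms by simp
  qed simp
  have "(x / (x + y)) powr a + (y / (x + y)) powr a \<le> x / (x + y) + y / (x + y)"
    using assms pos by (intro add_mono le) auto
  also have "\<dots> = 1" using pos by (simp flip: add_divide_distrib)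
  finally have "(x powr a + y powr a) / (x + y) powr a \<le> 1"
    using assms pos by (simp add: powr_divide add_divide_distrib)
  then show ?thesis using pos by (simp add: divide_le_eq)
qed

lemma wdist_triangle: assumes w: "\<And>k. 1 \<le> w k"
  shows "wdist w x z \<le> wdist w x y + wdist w y z"
proof -
  have "norm (block w a (x - z)) \<le> (wdist w x y + wdist w y z) powr a" if "a \<in> range w" for a
  proof -
    obtain k where k: "a = w k" using \<open>a \<in> range w\<close> by blast
    have "block w a (x - z) = block w a (x - y) + block w a (y - z)" by (simp add: block_diff)
    then have "norm (block w a (x - z)) \<le> norm (block w a (x - y)) + norm (block w a (y - z))"
      by (simp only: norm_triangle_ineq)
    also have "\<dots> \<le> wdist w x y powr a + wdist w y z powr a"
      unfolding k by (intro add_mono norm_block_wdist w)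
    also have "\<dots> \<le> (wdist w x y + wdist w y z) powr a"
      using w by (intro powr_superadd) (auto simp: k)
    finally show ?thesis .
  qed
  then show ?thesis using w by (subst wdist_mono_iff) auto
qed

lemma madics_less: "a \<in> madics m \<Longrightarrow> a i < m"
  by (simp add: madics_def)

lemma madics_pos: "a \<in> madics m \<Longrightarrow> 0 < m"
  using madics_less[of a m 0] by simp

lemma madics_1: "a \<in> madics 1 \<Longrightarrow> b \<in> madics 1 \<Longrightarrow> a = b"
  using madics_less[of a 1] madics_less[of b 1] by (simp add: fun_eq_iff)

lemma zero_madics: "0 < m \<Longrightarrow> (\<lambda>_. 0) \<in> madics m"
  by (auto simp: madics_def)

text \<open>The integers are not well-ordered, so \<open>LEAST\<close> is meaningful only because
  the digits vanish far to the left. The proof moves the search to the naturals.\<close>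

lemma first_difference:
  assumes "a \<in> madics m" "b \<in> madics m" "a \<noteq> b"
  shows "a (LEAST k. a k \<noteq> b k) \<noteq> b (LEAST k. a k \<noteq> b k)"
    and "\<And>j. j < (LEAST k. a k \<noteq> b k) \<Longrightarrow> a j = b j"
proof -
  obtain N1 N2 where N: "\<And>i. i < N1 \<Longrightarrow> a i = 0" "\<And>i. i < N2 \<Longrightarrow> b i = 0"
    using assms by (auto simp: madics_def)
  define N where "N = min N1 N2"
  define P where "P n \<longleftrightarrow> a (N + int n) \<noteq> b (N + int n)" for n :: nat
  have ge: "N \<le> k" if "a k \<noteq> b k" for k
    using N(1)[of k] N(2)[of k] that by (cases "k < N") (auto simp: N_def)
  obtain k where k: "a k \<noteq> b k" using assms by blast
  have "P (nat (k - N))" using k ge[OF k] by (simp add: P_def)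
  then have PL: "P (LEAST n. P n)" by (rule LeastI)
  have eq: "(LEAST k. a k \<noteq> b k) = N + int (LEAST n. P n)"
  proof (rule Least_equality)
    show "a (N + int (LEAST n. P n)) \<noteq> b (N + int (LEAST n. P n))" using PL by (simp add: P_def)
    fix y assume y: "a y \<noteq> b y"
    then have "P (nat (y - N))" using ge[OF y] by (simp add: P_def)
    then have "(LEAST n. P n) \<le> nat (y - N)" by (rule Least_le)
    then show "N + int (LEAST n. P n) \<le> y" using ge[OF y] by linarith
  qed
  show "a (LEAST k. a k \<noteq> b k) \<noteq> b (LEAST k. a k \<noteq> b k)" unfolding eq by (rule P_def[THEN iffD1, OF PL])
  fix j assume j: "j < (LEAST k. a k \<noteq> b k)"
  show "a j = b j"
  proof (rule ccontr)
    assume ne: "a j \<noteq> b j"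
    then have "P (nat (j - N))" using ge[OF ne] by (simp add: P_def)
    then have "(LEAST n. P n) \<le> nat (j - N)" by (rule Least_le)
    then show False using j ge[OF ne] unfolding eq by linarith
  qed
qed

lemma dist_madic_nonneg [simp]: "0 \<le> dist_madic m a b"
  by (simp add: dist_madic_def)

lemma dist_madic_commute: "dist_madic m a b = dist_madic m b a"
  by (simp add: dist_madic_def eq_commute)

lemma dist_madic_self [simp]: "dist_madic m a a = 0"
  by (simp add: dist_madic_def)

lemma dist_madic_eq_0: "a \<in> madics m \<Longrightarrow> dist_madic m a b = 0 \<longleftrightarrow> a = b"
  using madics_pos[of a m] by (auto simp: dist_madic_def)

text \<open>Identifies metric balls with cylinders of common digits. From base 2 on, powers are
  strictly ordered and the exponent can be read off.\<close>

lemma dist_madic_le_iff: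
  assumes ab: "a \<in> madics m" "b \<in> madics m" and m: "2 \<le> m"
  shows "dist_madic m a b \<le> real m powi (- i - 1) \<longleftrightarrow> (\<forall>j<i. a j = b j)"
proof (cases "a = b")
  case False
  define k where "k = (LEAST k. a k \<noteq> b k)"
  note fd = first_difference[OF ab False, folded k_def]
  have "dist_madic m a b \<le> real m powi (- i - 1) \<longleftrightarrow> - (k + 1) \<le> - i - 1"
    using False m power_int_increasing[of "- k - 1" "- i - 1" "real m"]
      power_int_strict_increasing[of "- i - 1" "- k - 1" "real m"]
    by (auto simp: dist_madic_def k_def[symmetric] not_le)
  also have "\<dots> \<longleftrightarrow> i \<le> k" by linarith
  also have "\<dots> \<longleftrightarrow> (\<forall>j<i. a j = b j)"
  proof
    assume "i \<le> k"
    then show "\<forall>j<i. a j = b j" using fd(2) by simp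
  next
    assume "\<forall>j<i. a j = b j"
    then show "i \<le> k" using fd(1) by (meson not_le)
  qed
  finally show ?thesis .
qed (simp add: dist_madic_def)

lemma dist_madic_powi:
  assumes "a \<noteq> b" shows "\<exists>i. dist_madic m a b = real m powi (- i - 1)"
  using assms by (intro exI[of _ "LEAST k. a k \<noteq> b k"]) (simp add: dist_madic_def)

lemma dist_madic_ultra:
  assumes abc: "a \<in> madics m" "b \<in> madics m" "c \<in> madics m"
  shows "dist_madic m a c \<le> max (dist_madic m a b) (dist_madic m b c)"
\<comment> \<open>In base 1 the space is a single point, and powers of the base cannot compare
  distances.\<close>
proof (cases "a = b \<or> b = c \<or> m < 2")
  case True
  then consider "a = b" | "b = c" | "m = 1" using madics_pos[of a m] abc by linarith
  then show ?thesis using abc madics_1[of a c] by cases (auto simp: le_max_iff_disj)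
next
  case False
  then have m: "2 \<le> m" by simp
  obtain i j where i: "dist_madic m a b = real m powi (- i - 1)" and j: "dist_madic m b c = real m powi (- j - 1)"
    using dist_madic_powi[of a b m] dist_madic_powi[of b c m] False by blast
  have "\<forall>k<i. a k = b k" using dist_madic_le_iff[OF abc(1,2) m, of i] i by simp
  moreover have "\<forall>k<j. b k = c k" using dist_madic_le_iff[OF abc(2,3) m, of j] j by simp
  ultimately have "\<forall>k<min i j. a k = c k" by simp
  then have "dist_madic m a c \<le> real m powi (- min i j - 1)" using dist_madic_le_iff[OF abc(1,3) m] by blast
  also have "\<dots> \<le> max (dist_madic m a b) (dist_madic m b c)"
    unfolding i j by (cases "i \<le> j") auto
  finally show ?thesis .
qed

lemma pdist_nonneg [simp]: "0 \<le> pdist w m p q"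
  by (simp add: pdist_def le_max_iff_disj)

lemma pdist_commute: "pdist w m p q = pdist w m q p"
  by (simp add: pdist_def wdist_commute[of w "fst p"] dist_madic_commute[of m "snd p"])

lemma pdist_self [simp]: "pdist w m p p = 0"
  by (simp add: pdist_def)

lemma in_product_space: "p \<in> product_space m \<longleftrightarrow> snd p \<in> madics m"
  by (cases p) (auto simp: product_space_def)

lemma pdist_eq_0:
  assumes "\<And>k. 1 \<le> w k" "p \<in> product_space m"
  shows "pdist w m p q = 0 \<longleftrightarrow> p = q"
proof -
  have "pdist w m p q = 0 \<longleftrightarrow> wdist w (fst p) (fst q) = 0 \<and> dist_madic m (snd p) (snd q) = 0"
    unfolding pdist_def using wdist_nonneg[of w "fst p" "fst q"] dist_madic_nonneg[of m "snd p" "snd q"]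
    by linarith
  then show ?thesis
    using assms wdist_eq_0[of w "fst p" "fst q"] dist_madic_eq_0[of "snd p" m]
    by (auto simp: in_product_space prod_eq_iff)
qed

lemma pdist_triangle:
  assumes "\<And>k. 1 \<le> w k" "p \<in> product_space m" "q \<in> product_space m" "r \<in> product_space m"
  shows "pdist w m p r \<le> pdist w m p q + pdist w m q r"
proof -
  have "wdist w (fst p) (fst r) \<le> wdist w (fst p) (fst q) + wdist w (fst q) (fst r)"
    using assms by (intro wdist_triangle) auto
  moreover have "dist_madic m (snd p) (snd r) \<le> max (dist_madic m (snd p) (snd q)) (dist_madic m (snd q) (snd r))"
    using assms by (intro dist_madic_ultra) (auto simp: in_product_space)
  ultimately show ?thesis
    unfolding pdist_def using dist_madic_nonneg[of m "snd p" "snd q"] dist_madic_nonneg[of m "snd q" "snd r"]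
      wdist_nonneg[of w "fst p" "fst q"] wdist_nonneg[of w "fst q" "fst r"] by linarith
qed

text \<open>Along a segment whose direction only involves weights below \<open>b\<close>, the \<open>b\<close>-variation of the
  block metric vanishes, so a pseudometric dominated by the \<open>b\<close>-th power of the metric is zero.\<close>

lemma chain_vanish:
  fixes w :: "'n::finite \<Rightarrow> real" and D :: "'n point \<Rightarrow> 'n point \<Rightarrow> real"
  assumes w: "\<And>k. 1 \<le> w k" and s: "s \<in> madics m"
    and tri: "\<And>p q r. \<lbrakk>p \<in> product_space m; q \<in> product_space m; r \<in> product_space m\<rbrakk> \<Longrightarrow> D p r \<le> D p q + D q r"
    and le: "\<And>p q. \<lbrakk>p \<in> product_space m; q \<in> product_space m\<rbrakk> \<Longrightarrow> D p q \<le> C * pdist w m p q powr b"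
    and C: "0 \<le> C" and b: "0 < b"
    and eq: "\<And>k. b \<le> w k \<Longrightarrow> x $ k = y $ k"
  shows "D (x, s) (y, s) \<le> 0"
proof (cases "x = y")
  case True
  then show ?thesis using le[of "(x,s)" "(y,s)"] s b by (simp add: in_product_space)
next
  case False
  then obtain k0 where "x $ k0 \<noteq> y $ k0" by (auto simp: vec_eq_iff)
  then have k0: "w k0 < b" using eq[of k0] by force
  define S where "S = {a \<in> range w. a < b}"
  have S: "finite S" "S \<noteq> {}" using k0 by (auto simp: S_def)
  \<comment> \<open>The largest weight below \<open>b\<close> governs how fast the steps shrink when
    the segment is subdivided.\<close>
  define b' where "b' = Max S"
  have b'S: "b' \<in> S" unfolding b'_def using S by (rule Max_in)
  have b': "b' < b" "1 \<le> b'" using b'S w by (auto simp: S_def)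
  have b'max: "w k \<le> b'" if "w k < b" for k
    unfolding b'_def using S that by (intro Max_ge) (auto simp: S_def)
  define v where "v = y - x"
  define B where "B = 1 + norm v"
  have B: "1 \<le> B" by (simp add: B_def)
  have bound: "D (x, s) (y, s) \<le> C * B powr (b / b') * real n powr (1 - b / b')" if n: "B \<le> real n" for n :: nat
  proof -
    have n0: "0 < real n" using n B by simp
    define p where "p j = (x + (real j / real n) *\<^sub>R v, s)" for j :: nat
    have pX: "p j \<in> product_space m" for j using s by (simp add: p_def in_product_space)
    \<comment> \<open>Each of the \<open>n\<close> pieces has blocks of norm at most
      \<open>B / n\<close>, which is at most 1, and the weights that occur are at most
      \<open>b'\<close>; this root bounds the length of a piece. The total is at most
      \<open>n * r powr b\<close> up to the constant.\<close>
    define r where "r = (B / real n) powr (1 / b')"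
    have Bn: "0 < B / real n" "B / real n \<le> 1" using n n0 B by auto
    have stp: "pdist w m (p j) (p (Suc j)) \<le> r" for j
    proof -
      have "wdist w (x + (real j / real n) *\<^sub>R v) (x + (real (Suc j) / real n) *\<^sub>R v) \<le> r"
      proof (subst wdist_mono_iff[OF w], simp add: r_def, rule ballI)
        fix a assume "a \<in> range w"
        then obtain k where a: "a = w k" by blast
        have e: "x + (real j / real n) *\<^sub>R v - (x + (real (Suc j) / real n) *\<^sub>R v) = (- 1 / real n) *\<^sub>R v"
          by (simp add: algebra_simps add_divide_distrib diff_divide_distrib flip: scaleR_left_diff_distrib)
        have "norm (block w a ((- 1 / real n) *\<^sub>R v)) \<le> r powr a"
        proof (cases "a < b")
          case True
          have "norm (block w a ((- 1 / real n) *\<^sub>R v)) = norm (block w a v) / real n"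
            by (simp add: block_scale block_minus)
          also have "\<dots> \<le> B / real n"
            using norm_block_le[of w a v] n0 by (intro divide_right_mono) (auto simp: B_def)
          also have "\<dots> = (B / real n) powr 1" using Bn B by simp
          also have "\<dots> \<le> (B / real n) powr (a / b')"
            using Bn True b' b'max[of k] a by (intro powr_mono') (auto simp: divide_le_eq)
          also have "\<dots> = r powr a" using b' by (simp add: r_def powr_powr mult.commute)
          finally show ?thesis .
        next
          case False
          then have "block w a v = 0" using eq by (auto simp: vec_eq_iff v_def)
          then show ?thesis by (simp add: block_scale block_minus)
        qed
        then show "norm (block w a (x + (real j / real n) *\<^sub>R v - (x + (real (Suc j) / real n) *\<^sub>R v))) \<le> r powr a"
          unfolding e .
      qed
      then show ?thesis by (simp add: pdist_def p_def r_def)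
    qed
    have one: "D (p j) (p (Suc j)) \<le> C * r powr b" for j
    proof -
      have "D (p j) (p (Suc j)) \<le> C * pdist w m (p j) (p (Suc j)) powr b" by (intro le pX)
      also have "\<dots> \<le> C * r powr b"
        using stp[of j] b C by (intro mult_left_mono powr_mono2) auto
      finally show ?thesis .
    qed
    have chain: "D (p 0) (p j) \<le> real j * (C * r powr b)" if "1 \<le> j" for j
      using that
    proof (induction j rule: dec_induct)
      case base
      then show ?case using one[of 0] by simp
    next
      case (step j)
      then show ?case using tri[OF pX pX pX, of 0 "Suc j" j] one[of j] by (simp add: algebra_simps)
    qed
    have "D (x, s) (y, s) = D (p 0) (p n)" using n0 by (simp add: p_def v_def)
    also have "\<dots> \<le> real n * (C * r powr b)" using n0 by (intro chain) simp
    also have "r powr b = B powr (b / b') / real n powr (b / b')"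
      using n0 B by (simp add: r_def powr_powr powr_divide)
    also have "real n * (C * (B powr (b / b') / real n powr (b / b'))) = C * B powr (b / b') * real n powr (1 - b / b')"
      using n0 by (simp add: powr_diff)
    finally show ?thesis .
  qed
  \<comment> \<open>The exponent \<open>1 - b / b'\<close> is negative because
    \<open>b' < b\<close>.\<close>
  have lim: "(\<lambda>n. C * B powr (b / b') * real n powr (1 - b / b')) \<longlonglongrightarrow> C * B powr (b / b') * 0"
    using b' by (intro tendsto_intros tendsto_neg_powr filterlim_real_sequentially) auto
  have "D (x, s) (y, s) \<le> C * B powr (b / b') * 0"
    using lim
  proof (rule tendsto_lowerbound)
    show "\<forall>\<^sub>F n in sequentially. D (x, s) (y, s) \<le> C * B powr (b / b') * real n powr (1 - b / b')"
    proof (rule eventually_sequentiallyI[of "nat \<lceil>B\<rceil>"])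
      fix n assume "nat \<lceil>B\<rceil> \<le> n"
      then show "D (x, s) (y, s) \<le> C * B powr (b / b') * real n powr (1 - b / b')"
        by (intro bound) linarith
    qed
  qed simp
  then show ?thesis by simp
qed

section \<open>Invariant means\<close>

text \<open>Applying \<open>h\<close> to a point changes its orbit function
  \<open>g \<mapsto> act g p\<close> by right translation, so invariance on the right is the one
  that can be used.\<close>

definition right_mean :: "('g, 'r) monoid_scheme \<Rightarrow> 'g topology \<Rightarrow> (('g \<Rightarrow> real) \<Rightarrow> real) \<Rightarrow> bool" where
  "right_mean G T \<mu> \<longleftrightarrow>
     (\<forall>f\<in>bounded_continuous T. \<forall>h\<in>bounded_continuous T. \<mu> (\<lambda>x. f x + h x) = \<mu> f + \<mu> h) \<and>
     (\<forall>f\<in>bounded_continuous T. \<forall>a. \<mu> (\<lambda>x. a * f x) = a * \<mu> f) \<and>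
     (\<forall>f\<in>bounded_continuous T. (\<forall>x\<in>carrier G. 0 \<le> f x) \<longrightarrow> 0 \<le> \<mu> f) \<and>
     \<mu> (\<lambda>x. 1) = 1 \<and>
     (\<forall>f\<in>bounded_continuous T. \<forall>g\<in>carrier G. \<mu> (\<lambda>x. f (x \<otimes>\<^bsub>G\<^esub> g)) = \<mu> f)"

lemma bounded_continuousI:
  assumes "continuous_map T euclideanreal f" "\<And>x. x \<in> topspace T \<Longrightarrow> \<bar>f x\<bar> \<le> B"
  shows "f \<in> bounded_continuous T"
  using assms by (auto simp: bounded_continuous_def intro!: boundedI[of _ B])

lemma bounded_continuousD:
  assumes "f \<in> bounded_continuous T"
  shows "continuous_map T euclideanreal f" "\<exists>B. \<forall>x\<in>topspace T. \<bar>f x\<bar> \<le> B"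
  using assms by (auto simp: bounded_continuous_def bounded_iff)

lemma bounded_continuous_const: "(\<lambda>x. c) \<in> bounded_continuous T"
  by (rule bounded_continuousI[where B = "\<bar>c\<bar>"]) auto

lemma bounded_continuous_add:
  assumes "f \<in> bounded_continuous T" "h \<in> bounded_continuous T"
  shows "(\<lambda>x. f x + h x) \<in> bounded_continuous T"
proof -
  obtain A B where "\<forall>x\<in>topspace T. \<bar>f x\<bar> \<le> A" "\<forall>x\<in>topspace T. \<bar>h x\<bar> \<le> B"
    using assms bounded_continuousD by metis
  then have "\<bar>f x + h x\<bar> \<le> A + B" if "x \<in> topspace T" for x
    using that abs_triangle_ineq[of "f x" "h x"] by force
  then show ?thesis
    by (rule bounded_continuousI[OF continuous_map_add[OF assms[THEN bounded_continuousD(1)]]])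
qed

lemma bounded_continuous_mult:
  assumes "f \<in> bounded_continuous T" "h \<in> bounded_continuous T"
  shows "(\<lambda>x. f x * h x) \<in> bounded_continuous T"
proof -
  obtain A B where AB: "\<forall>x\<in>topspace T. \<bar>f x\<bar> \<le> A" "\<forall>x\<in>topspace T. \<bar>h x\<bar> \<le> B"
    using assms bounded_continuousD by metis
  have "\<bar>f x * h x\<bar> \<le> A * B" if "x \<in> topspace T" for x
    using AB that unfolding abs_mult by (intro mult_mono) (auto intro: order_trans[OF abs_ge_zero])
  then show ?thesis
    by (rule bounded_continuousI[OF continuous_map_real_mult[OF assms[THEN bounded_continuousD(1)]]])
qed

lemma bounded_continuous_scale:
  "f \<in> bounded_continuous T \<Longrightarrow> (\<lambda>x. a * f x) \<in> bounded_continuous T"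
  by (intro bounded_continuous_mult bounded_continuous_const)

lemma bounded_continuous_diff:
  assumes "f \<in> bounded_continuous T" "h \<in> bounded_continuous T"
  shows "(\<lambda>x. f x - h x) \<in> bounded_continuous T"
  using bounded_continuous_add[OF assms(1) bounded_continuous_scale[OF assms(2), of "-1"]] by simp

lemma bounded_continuous_sum:
  "(\<And>i. i \<in> I \<Longrightarrow> f i \<in> bounded_continuous T) \<Longrightarrow> (\<lambda>x. \<Sum>i\<in>I. f i x) \<in> bounded_continuous T"
  by (induction I rule: infinite_finite_induct)
     (auto intro: bounded_continuous_const bounded_continuous_add)

lemma bounded_continuous_compose:
  assumes "f \<in> bounded_continuous T" "continuous_map T T h"
  shows "(\<lambda>x. f (h x)) \<in> bounded_continuous T"
proof -
  obtain B where "\<forall>x\<in>topspace T. \<bar>f x\<bar> \<le> B" using assms bounded_continuousD by metis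
  then show ?thesis
    using assms continuous_map_compose[OF assms(2) bounded_continuousD(1)[OF assms(1)]]
    by (intro bounded_continuousI[where B = B]) (auto simp: o_def continuous_map_def Pi_iff)
qed

lemma right_mean_props:
  assumes "right_mean G T \<mu>" and T: "topspace T = carrier G"
    and f: "f \<in> bounded_continuous T" and h: "h \<in> bounded_continuous T"
  shows "\<mu> (\<lambda>x. f x + h x) = \<mu> f + \<mu> h" "\<mu> (\<lambda>x. a * f x) = a * \<mu> f"
    "\<mu> (\<lambda>x. f x - h x) = \<mu> f - \<mu> h" "\<mu> (\<lambda>x. a) = a"
    "(\<And>x. x \<in> carrier G \<Longrightarrow> f x \<le> h x) \<Longrightarrow> \<mu> f \<le> \<mu> h"
    "g \<in> carrier G \<Longrightarrow> \<mu> (\<lambda>x. f (x \<otimes>\<^bsub>G\<^esub> g)) = \<mu> f"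
proof -
  have add: "\<mu> (\<lambda>x. f x + h x) = \<mu> f + \<mu> h"
    if "f \<in> bounded_continuous T" "h \<in> bounded_continuous T" for f h
    using assms(1) that by (simp add: right_mean_def)
  have scale: "\<mu> (\<lambda>x. a * f x) = a * \<mu> f" if "f \<in> bounded_continuous T" for f a
    using assms(1) that by (simp add: right_mean_def)
  have diff: "\<mu> (\<lambda>x. h x - f x) = \<mu> h - \<mu> f"
    if "f \<in> bounded_continuous T" "h \<in> bounded_continuous T" for f h
    using add[OF that(2) bounded_continuous_scale[OF that(1)], of "-1"] scale[OF that(1), of "-1"] by simp
  show "\<mu> (\<lambda>x. f x + h x) = \<mu> f + \<mu> h" by (rule add[OF f h])
  show "\<mu> (\<lambda>x. a * f x) = a * \<mu> f" by (rule scale[OF f])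
  show "\<mu> (\<lambda>x. f x - h x) = \<mu> f - \<mu> h" by (rule diff[OF h f])
  show "\<mu> (\<lambda>x. a) = a"
    using scale[OF bounded_continuous_const, of a 1] assms(1) by (simp add: right_mean_def)
  show "\<mu> f \<le> \<mu> h" if "\<And>x. x \<in> carrier G \<Longrightarrow> f x \<le> h x"
  proof -
    have "0 \<le> \<mu> (\<lambda>x. h x - f x)"
      using assms(1) bounded_continuous_diff[OF h f] that by (simp add: right_mean_def)
    then show ?thesis using diff[OF f h] by simp
  qed
  show "g \<in> carrier G \<Longrightarrow> \<mu> (\<lambda>x. f (x \<otimes>\<^bsub>G\<^esub> g)) = \<mu> f"
    using assms(1) f by (simp add: right_mean_def)
qed

lemma topological_group_translations:
  assumes "topological_group G T" "g \<in> carrier G"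
  shows "continuous_map T T (\<lambda>x. g \<otimes>\<^bsub>G\<^esub> x)" "continuous_map T T (\<lambda>x. x \<otimes>\<^bsub>G\<^esub> g)"
proof -
  have m: "continuous_map (prod_topology T T) T (\<lambda>(g, h). g \<otimes>\<^bsub>G\<^esub> h)" and t: "topspace T = carrier G"
    using assms by (auto simp: topological_group_def)
  have "continuous_map T (prod_topology T T) (\<lambda>x. (g, x))" "continuous_map T (prod_topology T T) (\<lambda>x. (x, g))"
    using assms t by (auto simp: continuous_map_pairwise o_def)
  from this[THEN continuous_map_compose[OF _ m]]
  show "continuous_map T T (\<lambda>x. g \<otimes>\<^bsub>G\<^esub> x)" "continuous_map T T (\<lambda>x. x \<otimes>\<^bsub>G\<^esub> g)"
    by (simp_all add: o_def)
qed

text \<open>Composition with the continuous inversion exchanges left and right translations.\<close>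

lemma amenable_right_mean:
  assumes tg: "topological_group G T" and "amenable G T"
  shows "\<exists>\<mu>. right_mean G T \<mu>"
proof -
  obtain \<mu> :: "('a \<Rightarrow> real) \<Rightarrow> real" where
    m: "\<And>f h. \<lbrakk>f\<in>bounded_continuous T; h\<in>bounded_continuous T\<rbrakk> \<Longrightarrow> \<mu> (\<lambda>x. f x + h x) = \<mu> f + \<mu> h"
    "\<And>f a. f\<in>bounded_continuous T \<Longrightarrow> \<mu> (\<lambda>x. a * f x) = a * \<mu> f"
    "\<And>f. \<lbrakk>f\<in>bounded_continuous T; \<forall>x\<in>carrier G. 0 \<le> f x\<rbrakk> \<Longrightarrow> 0 \<le> \<mu> f"
    "\<mu> (\<lambda>x. 1) = 1"
    "\<And>f g. \<lbrakk>f\<in>bounded_continuous T; g\<in>carrier G\<rbrakk> \<Longrightarrow> \<mu> (\<lambda>x. f (g \<otimes>\<^bsub>G\<^esub> x)) = \<mu> f"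
    using assms(2) unfolding amenable_def by blast
  have T: "topspace T = carrier G" and inv: "continuous_map T T (\<lambda>g. inv\<^bsub>G\<^esub> g)" and gr: "group G"
    using tg by (auto simp: topological_group_def)
  interpret group G by (rule gr)
  define \<nu> where "\<nu> f = \<mu> (\<lambda>x. f (inv\<^bsub>G\<^esub> x))" for f
  have bi: "(\<lambda>x. f (inv\<^bsub>G\<^esub> x)) \<in> bounded_continuous T" if "f \<in> bounded_continuous T" for f
    using that inv by (rule bounded_continuous_compose)
  \<comment> \<open>The identity for inverses of products holds only inside the group, so it must be
    known that a mean ignores values outside the carrier.\<close>
  have eq: "\<mu> f = \<mu> h" if f: "f \<in> bounded_continuous T" and h: "h \<in> bounded_continuous T"
      and e: "\<And>x. x \<in> carrier G \<Longrightarrow> f x = h x" for f h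
  proof -
    have "0 \<le> \<mu> (\<lambda>x. f x + (-1) * h x)" "0 \<le> \<mu> (\<lambda>x. h x + (-1) * f x)"
      using f h e by (auto intro!: m(3) bounded_continuous_diff)
    moreover have "\<mu> (\<lambda>x. f x + (-1) * h x) = \<mu> f + (-1) * \<mu> h"
      unfolding m(2)[OF h, of "-1", symmetric] by (rule m(1)[OF f bounded_continuous_scale[OF h]])
    moreover have "\<mu> (\<lambda>x. h x + (-1) * f x) = \<mu> h + (-1) * \<mu> f"
      unfolding m(2)[OF f, of "-1", symmetric] by (rule m(1)[OF h bounded_continuous_scale[OF f]])
    ultimately show ?thesis by linarith
  qed
  have "right_mean G T \<nu>"
    unfolding right_mean_def
  proof (intro conjI ballI allI impI)
    fix f g assume f: "f \<in> bounded_continuous T" and g: "g \<in> carrier G"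
    have fg: "(\<lambda>x. f (x \<otimes>\<^bsub>G\<^esub> g)) \<in> bounded_continuous T"
      using f topological_group_translations(2)[OF tg g] by (rule bounded_continuous_compose)
    have "\<nu> (\<lambda>x. f (x \<otimes>\<^bsub>G\<^esub> g)) = \<mu> (\<lambda>x. f (inv\<^bsub>G\<^esub> x \<otimes>\<^bsub>G\<^esub> g))" by (simp add: \<nu>_def)
    also have "\<dots> = \<mu> (\<lambda>x. f (inv\<^bsub>G\<^esub> (inv\<^bsub>G\<^esub> g \<otimes>\<^bsub>G\<^esub> x)))"
    proof (rule eq)
      show "(\<lambda>x. f (inv\<^bsub>G\<^esub> x \<otimes>\<^bsub>G\<^esub> g)) \<in> bounded_continuous T" by (rule bi[OF fg])
      show "(\<lambda>x. f (inv\<^bsub>G\<^esub> (inv\<^bsub>G\<^esub> g \<otimes>\<^bsub>G\<^esub> x))) \<in> bounded_continuous T"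
        using bounded_continuous_compose[OF bi[OF f] topological_group_translations(1)[OF tg]] g by simp
    qed (use g in \<open>simp add: inv_mult_group\<close>)
    also have "\<dots> = \<nu> f" unfolding \<nu>_def using m(5)[OF bi[OF f], of "inv\<^bsub>G\<^esub> g"] g by simp
    finally show "\<nu> (\<lambda>x. f (x \<otimes>\<^bsub>G\<^esub> g)) = \<nu> f" .
  next
    fix f h assume "f \<in> bounded_continuous T" "h \<in> bounded_continuous T"
    then show "\<nu> (\<lambda>x. f x + h x) = \<nu> f + \<nu> h"
      unfolding \<nu>_def using m(1)[OF bi bi] by simp
  next
    fix f a assume "f \<in> bounded_continuous T"
    then show "\<nu> (\<lambda>x. a * f x) = a * \<nu> f" unfolding \<nu>_def using m(2)[OF bi] by simp
  next
    fix f assume "f \<in> bounded_continuous T" "\<forall>x\<in>carrier G. 0 \<le> f x"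
    then show "0 \<le> \<nu> f" unfolding \<nu>_def using m(3)[OF bi] by simp
  next
    show "\<nu> (\<lambda>x. 1) = 1" by (simp add: \<nu>_def m(4))
  qed
  then show ?thesis by blast
qed

lemma continuous_on_Max:
  fixes f :: "'b \<Rightarrow> 'a::topological_space \<Rightarrow> real"
  assumes "finite I" "I \<noteq> {}" "\<And>i. i \<in> I \<Longrightarrow> continuous_on S (f i)"
  shows "continuous_on S (\<lambda>x. Max ((\<lambda>i. f i x) ` I))"
  using assms
proof (induction I rule: finite_ne_induct)
  case (insert i I)
  then have "continuous_on S (\<lambda>x. max (f i x) (Max ((\<lambda>i. f i x) ` I)))"
    by (intro continuous_on_max) auto
  then show ?case using insert by simp
qed simp

lemma continuous_map_wdist:
  assumes w: "\<And>k. 1 \<le> w k"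
    and f: "continuous_map T euclidean f" and h: "continuous_map T euclidean h"
  shows "continuous_map T euclideanreal (\<lambda>x. wdist w (f x) (h x))"
proof -
  have blin: "linear (block w a)" for a by (rule linearI) (auto simp: block_add block_scale)
  have "continuous_on UNIV (\<lambda>v. Max ((\<lambda>a. norm (block w a v) powr (1 / a)) ` range w))"
  proof (rule continuous_on_Max)
    fix a assume "a \<in> range w"
    then have "1 \<le> a" using w by auto
    then show "continuous_on UNIV (\<lambda>v. norm (block w a v) powr (1 / a))"
      using linear_continuous_on[OF linear_conv_bounded_linear[THEN iffD1, OF blin[of a]], of UNIV]
      by (intro continuous_on_powr' continuous_on_norm continuous_on_const) auto
  qed auto
  then have "continuous_map euclidean euclidean (\<lambda>v. Max ((\<lambda>a. norm (block w a v) powr (1 / a)) ` range w))"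
    by simp
  from continuous_map_compose[OF continuous_map_diff[OF f h] this]
  show ?thesis by (simp add: wdist_def o_def)
qed

section \<open>Uniform quasisimilarity actions\<close>

text \<open>The setting after the linear change of coordinates. \<open>coco\<close> is the numerical
  content of cocompactness: any pair can be moved so that its first point is near the origin and its
  size is comparable to 1.\<close>

locale block_action =
  fixes G :: "('g, 'r) monoid_scheme" (structure) and T :: "'g topology"
    and w :: "'n::finite \<Rightarrow> real" and m :: nat and act :: "'g \<Rightarrow> 'n point \<Rightarrow> 'n point"
    and M R :: real
  assumes tg: "topological_group G T" and am: "amenable G T"
    and w1: "\<And>k. 1 \<le> w k" and m1: "1 \<le> m"
    and act_closed: "\<And>g p. \<lbrakk>g \<in> carrier G; p \<in> product_space m\<rbrakk> \<Longrightarrow> act g p \<in> product_space m"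
    and act_one: "\<And>p. p \<in> product_space m \<Longrightarrow> act \<one> p = p"
    and act_mult: "\<And>g h p. \<lbrakk>g \<in> carrier G; h \<in> carrier G; p \<in> product_space m\<rbrakk> \<Longrightarrow> act (g \<otimes> h) p = act g (act h p)"
    and act_cont: "\<And>p. p \<in> product_space m \<Longrightarrow> continuous_map T euclidean (\<lambda>g. fst (act g p))"
    and M1: "1 \<le> M"
    and quasi: "\<And>g. g \<in> carrier G \<Longrightarrow> \<exists>C>0. \<forall>p\<in>product_space m. \<forall>q\<in>product_space m.
       C / M * pdist w m p q \<le> pdist w m (act g p) (act g q) \<and> pdist w m (act g p) (act g q) \<le> M * C * pdist w m p q"
    and R0: "0 < R"
    and coco: "\<And>p q. \<lbrakk>p \<in> product_space m; q \<in> product_space m; p \<noteq> q\<rbrakk> \<Longrightarrow> \<exists>g\<in>carrier G.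
       pdist w m (act g p) (0, \<lambda>_. 0) \<le> R \<and> 1 / R \<le> pdist w m (act g p) (act g q) \<and> pdist w m (act g p) (act g q) \<le> R"
begin

sublocale group G using tg by (simp add: topological_group_def)

abbreviation X :: "'n point set" where "X \<equiv> product_space m"
abbreviation d :: "'n point \<Rightarrow> 'n point \<Rightarrow> real" where "d \<equiv> pdist w m"

lemma topspace_T: "topspace T = carrier G"
  using tg by (simp add: topological_group_def)

lemma pairX [simp]: "(x, s) \<in> X \<longleftrightarrow> s \<in> madics m"
  by (simp add: in_product_space)

lemma snd_madics: "p \<in> X \<Longrightarrow> snd p \<in> madics m"
  by (simp add: in_product_space)

lemma zeroX [simp]: "(\<lambda>_. 0) \<in> madics m"
  using m1 by (intro zero_madics) auto

lemma act_inv: "\<lbrakk>g \<in> carrier G; p \<in> X\<rbrakk> \<Longrightarrow> act (inv g) (act g p) = p"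
  using act_mult[of "inv g" g p] act_one[of p] by simp

lemma act_inv': "\<lbrakk>g \<in> carrier G; p \<in> X\<rbrakk> \<Longrightarrow> act g (act (inv g) p) = p"
  using act_mult[of g "inv g" p] act_one[of p] by simp

lemma act_inj: "\<lbrakk>g \<in> carrier G; p \<in> X; q \<in> X; act g p = act g q\<rbrakk> \<Longrightarrow> p = q"
  by (metis act_inv)

lemma d_pos: "\<lbrakk>p \<in> X; p \<noteq> q\<rbrakk> \<Longrightarrow> 0 < d p q"
  using pdist_eq_0[of w p m q, OF w1] pdist_nonneg[of w m p q] by (simp add: less_le)

lemmas d_tri = pdist_triangle[of w, OF w1]

lemma fst_le: "\<bar>fst p $ k - fst q $ k\<bar> \<le> norm (block w (w k) (fst p - fst q))"
  using nth_le_norm_block[of "fst p - fst q" k w] by simp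

lemma block_le_d: "norm (block w (w k) (fst p - fst q)) \<le> d p q powr w k"
proof -
  have "norm (block w (w k) (fst p - fst q)) \<le> wdist w (fst p) (fst q) powr w k"
    by (rule norm_block_wdist) (rule w1)
  also have "\<dots> \<le> d p q powr w k"
    using w1[of k] by (intro powr_mono2) (auto simp: pdist_def)
  finally show ?thesis .
qed

text \<open>Any positive power of an ultrametric is again a pseudometric. With an exponent above all
  weights it is bounded by a power of the distance that vanishes along every real path.\<close>

lemma same_snd:
  assumes g: "g \<in> carrier G" and s: "s \<in> madics m"
  shows "snd (act g (x, s)) = snd (act g (y, s))"
proof -
  obtain C where C: "0 < C" "\<And>p q. \<lbrakk>p \<in> X; q \<in> X\<rbrakk> \<Longrightarrow> d (act g p) (act g q) \<le> M * C * d p q"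
    using quasi[OF g] by blast
  \<comment> \<open>Larger than every weight, so that no coordinate has to agree when
    \<open>chain_vanish\<close> is applied.\<close>
  define b where "b = Max (range w) + 1"
  have wb: "w k < b" for k
  proof -
    have "w k \<le> Max (range w)" by (intro Max_ge) auto
    then show ?thesis unfolding b_def by linarith
  qed
  have b: "0 < b" using wb[of undefined] w1[of undefined] by simp
  define D where "D p q = dist_madic m (snd (act g p)) (snd (act g q)) powr b" for p q
  have sm: "snd (act g p) \<in> madics m" if "p \<in> X" for p
    using act_closed[OF g that] by (rule snd_madics)
  have "D (x, s) (y, s) \<le> 0"
  proof (rule chain_vanish[where w = w and m = m and b = b and C = "(M * C) powr b"])
    fix p q r assume pqr: "p \<in> X" "q \<in> X" "r \<in> X"
    have "dist_madic m (snd (act g p)) (snd (act g r)) \<le>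
       max (dist_madic m (snd (act g p)) (snd (act g q))) (dist_madic m (snd (act g q)) (snd (act g r)))"
      using pqr by (intro dist_madic_ultra sm)
    then have "D p r \<le> (max (dist_madic m (snd (act g p)) (snd (act g q))) (dist_madic m (snd (act g q)) (snd (act g r)))) powr b"
      unfolding D_def using b by (intro powr_mono2) auto
    also have "\<dots> \<le> D p q + D q r" unfolding D_def by (simp add: max_def)
    finally show "D p r \<le> D p q + D q r" .
  next
    fix p q assume pq: "p \<in> X" "q \<in> X"
    have "dist_madic m (snd (act g p)) (snd (act g q)) \<le> d (act g p) (act g q)" by (simp add: pdist_def)
    also have "\<dots> \<le> M * C * d p q" by (rule C(2)[OF pq])
    finally have "D p q \<le> (M * C * d p q) powr b"
      unfolding D_def using b by (intro powr_mono2) auto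
    then show "D p q \<le> (M * C) powr b * d p q powr b"
      using M1 C by (simp add: powr_mult)
  next
    fix k assume "b \<le> w k" then show "x $ k = y $ k" using wb[of k] by simp
  qed (use w1 s b in auto)
  then have "dist_madic m (snd (act g (x, s))) (snd (act g (y, s))) = 0"
    unfolding D_def by (metis powr_gt_zero not_less)
  then show ?thesis using dist_madic_eq_0[OF sm[of "(x, s)"]] s by simp
qed

text \<open>The difference of coordinate \<open>j\<close> after applying \<open>g\<close> is bounded
  by the power \<open>w j\<close> of the distance, so it vanishes along paths in coordinates of
  smaller weight.\<close>

lemma same_coordinate:
  assumes g: "g \<in> carrier G" and s: "s \<in> madics m"
    and eq: "\<And>k. w j \<le> w k \<Longrightarrow> x $ k = y $ k"
  shows "fst (act g (x, s)) $ j = fst (act g (y, s)) $ j"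
proof -
  obtain C where C: "0 < C" "\<And>p q. \<lbrakk>p \<in> X; q \<in> X\<rbrakk> \<Longrightarrow> d (act g p) (act g q) \<le> M * C * d p q"
    using quasi[OF g] by blast
  define D where "D p q = \<bar>fst (act g p) $ j - fst (act g q) $ j\<bar>" for p q
  have "D (x, s) (y, s) \<le> 0"
  proof (rule chain_vanish[where w = w and m = m and b = "w j" and C = "(M * C) powr w j"])
    fix p q assume pq: "p \<in> X" "q \<in> X"
    have "D p q \<le> d (act g p) (act g q) powr w j"
      unfolding D_def using fst_le block_le_d order_trans by blast
    also have "\<dots> \<le> (M * C * d p q) powr w j"
      using w1[of j] C(2)[OF pq] by (intro powr_mono2) auto
    finally show "D p q \<le> (M * C) powr w j * d p q powr w j"
      using M1 C by (simp add: powr_mult)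
  next
    show "0 < w j" using w1[of j] by simp
  qed (use w1 s eq in \<open>auto simp: D_def\<close>)
  then show ?thesis by (simp add: D_def)
qed

definition mean :: "('g \<Rightarrow> real) \<Rightarrow> real" where
  "mean = (SOME \<mu>. right_mean G T \<mu>)"

lemma right_mean_mean: "right_mean G T mean"
  unfolding mean_def using someI_ex[OF amenable_right_mean[OF tg am]] .

lemmas mean_add = right_mean_props(1)[OF right_mean_mean topspace_T]
  and mean_scale = right_mean_props(2)[OF right_mean_mean topspace_T]
  and mean_diff = right_mean_props(3)[OF right_mean_mean topspace_T]
  and mean_const = right_mean_props(4)[OF right_mean_mean topspace_T bounded_continuous_const bounded_continuous_const]
  and mean_mono = right_mean_props(5)[OF right_mean_mean topspace_T]
  and mean_right = right_mean_props(6)[OF right_mean_mean topspace_T]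

abbreviation org :: "'n point" where "org \<equiv> (0, \<lambda>_. 0)"
abbreviation unt :: "'n point" where "unt \<equiv> (axis undefined 1, \<lambda>_. 0)"

text \<open>The logarithmic size of the image of one fixed pair. The pair lies in a single real
  fibre and every image does too, so continuity of the real component suffices for continuity of
  \<open>phi\<close>.\<close>

definition phi :: "'g \<Rightarrow> real" where "phi g = ln (d (act g org) (act g unt))"
text \<open>\<open>phi\<close> itself is unbounded and additive only up to an error; its increments
  under right translation are bounded, and their mean is exactly additive.\<close>

definition log_ratio :: "'g \<Rightarrow> real" where "log_ratio g = mean (\<lambda>h. phi (h \<otimes> g) - phi h)"
definition ratio :: "'g \<Rightarrow> real" where "ratio g = exp (log_ratio g)"

lemma org_unt: "org \<noteq> unt"
  by (simp add: axis_eq_0_iff)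

lemma dgu: "g \<in> carrier G \<Longrightarrow> 0 < d (act g org) (act g unt)"
  using act_inj[of g org unt] org_unt by (intro d_pos act_closed) auto

lemma phi_cont: "continuous_map T euclideanreal phi"
proof -
  have c: "continuous_map T euclideanreal (\<lambda>g. wdist w (fst (act g org)) (fst (act g unt)))"
    by (intro continuous_map_wdist w1 act_cont) auto
  have e: "d (act g org) (act g unt) = wdist w (fst (act g org)) (fst (act g unt))" if "g \<in> carrier G" for g
    using same_snd[OF that zeroX, of 0 "axis undefined 1"] by (simp add: pdist_def)
  have "continuous_map T (top_of_set {0<..}) (\<lambda>g. wdist w (fst (act g org)) (fst (act g unt)))"
    using c dgu e by (auto simp: continuous_map_in_subtopology topspace_T)
  moreover have "continuous_map (top_of_set {0<..}) euclideanreal ln"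
    by (auto intro!: continuous_intros)
  ultimately have "continuous_map T euclideanreal (ln \<circ> (\<lambda>g. wdist w (fst (act g org)) (fst (act g unt))))"
    by (rule continuous_map_compose)
  then show ?thesis
    by (rule continuous_map_eq) (simp add: phi_def e topspace_T)
qed

text \<open>The unknown constant of \<open>h\<close> enters both \<open>phi (h \<otimes> g)\<close>
  and \<open>phi h\<close> and cancels; each of the two comparisons leaves one
  \<open>ln M\<close>.\<close>

lemma phi_diff:
  assumes g: "g \<in> carrier G" and h: "h \<in> carrier G"
  shows "\<bar>phi (h \<otimes> g) - phi h - (phi g - phi \<one>)\<bar> \<le> 2 * ln M"
proof -
  obtain C where C: "0 < C" "\<And>p q. \<lbrakk>p \<in> X; q \<in> X\<rbrakk> \<Longrightarrow> C / M * d p q \<le> d (act h p) (act h q)"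
     "\<And>p q. \<lbrakk>p \<in> X; q \<in> X\<rbrakk> \<Longrightarrow> d (act h p) (act h q) \<le> M * C * d p q"
    using quasi[OF h] by blast
  have est: "\<bar>ln (d (act h p) (act h q)) - (ln C + ln (d p q))\<bar> \<le> ln M" if pq: "p \<in> X" "q \<in> X" "p \<noteq> q" for p q
  proof -
    have pos: "0 < d p q" "0 < d (act h p) (act h q)" using pq h act_inj[OF h pq(1,2)] by (auto intro!: d_pos act_closed)
    have "ln (C / M * d p q) \<le> ln (d (act h p) (act h q))" "ln (d (act h p) (act h q)) \<le> ln (M * C * d p q)"
      using C pos M1 pq by (auto intro!: ln_mono)
    then show ?thesis using C(1) M1 pos by (simp add: ln_mult ln_div abs_le_iff)
  qed
  have "act g org \<noteq> act g unt" using act_inj[OF g, of org unt] org_unt by auto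
  then have "\<bar>phi (h \<otimes> g) - (ln C + phi g)\<bar> \<le> ln M"
    using est[of "act g org" "act g unt"] g h by (simp add: phi_def act_mult act_closed)
  moreover have "\<bar>phi h - (ln C + phi \<one>)\<bar> \<le> ln M"
    using est[of org unt] org_unt by (simp add: phi_def act_one)
  ultimately show ?thesis by linarith
qed

lemma phi_diff_bc: "g \<in> carrier G \<Longrightarrow> (\<lambda>h. phi (h \<otimes> g) - phi h) \<in> bounded_continuous T"
proof (rule bounded_continuousI[where B = "\<bar>phi g - phi \<one>\<bar> + 2 * ln M"])
  assume g: "g \<in> carrier G"
  show "continuous_map T euclideanreal (\<lambda>h. phi (h \<otimes> g) - phi h)"
    using continuous_map_compose[OF topological_group_translations(2)[OF tg g] phi_cont]
    by (intro continuous_map_diff phi_cont) (simp add: o_def)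
  fix h assume "h \<in> topspace T"
  then show "\<bar>phi (h \<otimes> g) - phi h\<bar> \<le> \<bar>phi g - phi \<one>\<bar> + 2 * ln M"
    using phi_diff[OF g, of h] by (simp add: topspace_T)
qed

lemma log_ratio_mult:
  assumes g: "g \<in> carrier G" and h: "h \<in> carrier G"
  shows "log_ratio (g \<otimes> h) = log_ratio g + log_ratio h"
proof -
  let ?f = "\<lambda>x. phi (x \<otimes> h) - phi x"
  have bc: "(\<lambda>x. ?f (x \<otimes> g)) \<in> bounded_continuous T"
    using phi_diff_bc[OF h] topological_group_translations(2)[OF tg g] by (rule bounded_continuous_compose)
  have "mean (\<lambda>x. ?f (x \<otimes> g)) = log_ratio h"
    unfolding log_ratio_def by (rule mean_right[OF phi_diff_bc[OF h] phi_diff_bc[OF h] g])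
  moreover have "mean (\<lambda>x. ?f (x \<otimes> g) + (phi (x \<otimes> g) - phi x)) = mean (\<lambda>x. ?f (x \<otimes> g)) + log_ratio g"
    unfolding log_ratio_def by (rule mean_add[OF bc phi_diff_bc[OF g]])
  moreover have "log_ratio (g \<otimes> h) = mean (\<lambda>x. ?f (x \<otimes> g) + (phi (x \<otimes> g) - phi x))"
  proof -
    \<comment> \<open>Cocycle identity of the increments. The two functions agree only on the
      carrier, so monotonicity of the mean is used in both directions.\<close>
    let ?l = "\<lambda>x. phi (x \<otimes> (g \<otimes> h)) - phi x" and ?r = "\<lambda>x. ?f (x \<otimes> g) + (phi (x \<otimes> g) - phi x)"
    have l: "?l \<in> bounded_continuous T" using g h by (intro phi_diff_bc) auto
    have r: "?r \<in> bounded_continuous T" by (rule bounded_continuous_add[OF bc phi_diff_bc[OF g]])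
    have e: "?l x = ?r x" if "x \<in> carrier G" for x using that g h by (simp add: m_assoc)
    have "mean ?l \<le> mean ?r" by (rule mean_mono[OF l r]) (simp add: e)
    moreover have "mean ?r \<le> mean ?l" by (rule mean_mono[OF r l]) (simp add: e)
    ultimately show ?thesis by (simp add: log_ratio_def)
  qed
  ultimately show ?thesis by simp
qed

lemma log_ratio_phi: "g \<in> carrier G \<Longrightarrow> \<bar>log_ratio g - (phi g - phi \<one>)\<bar> \<le> 2 * ln M"
proof -
  assume g: "g \<in> carrier G"
  have "mean (\<lambda>h. phi (h \<otimes> g) - phi h) \<le> mean (\<lambda>_. phi g - phi \<one> + 2 * ln M)"
    using phi_diff[OF g] by (intro mean_mono phi_diff_bc bounded_continuous_const g) (smt (verit))
  moreover have "mean (\<lambda>_. phi g - phi \<one> - 2 * ln M) \<le> mean (\<lambda>h. phi (h \<otimes> g) - phi h)"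
    using phi_diff[OF g] by (intro mean_mono phi_diff_bc bounded_continuous_const g) (smt (verit))
  ultimately show ?thesis unfolding log_ratio_def[symmetric] mean_const by linarith
qed

lemma log_ratio_one: "log_ratio \<one> = 0"
  using log_ratio_mult[of \<one> \<one>] by simp

lemma log_ratio_pow: "g \<in> carrier G \<Longrightarrow> log_ratio (g [^] (n::nat)) = real n * log_ratio g"
  by (induction n) (auto simp: log_ratio_one log_ratio_mult algebra_simps)

lemma pow_cont: "continuous_map T T (\<lambda>g. g [^] (n::nat))"
proof (induction n)
  case 0
  then show ?case by (simp add: topspace_T)
next
  case (Suc n)
  have "continuous_map (prod_topology T T) T (\<lambda>(g, h). g \<otimes> h)" using tg by (simp add: topological_group_def)
  from continuous_map_compose[OF _ this, of T "\<lambda>g. (g [^] n, g)"] Suc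
  show ?case by (simp add: continuous_map_pairwise o_def)
qed

text \<open>A mean of continuous functions need not depend continuously on \<open>g\<close>. Being a
  homomorphism at bounded distance from \<open>phi\<close>, however, \<open>log_ratio\<close> is the
  uniform limit of \<open>phi\<close> on n-th powers divided by \<open>n\<close>.\<close>

lemma log_ratio_cont: "continuous_map T euclideanreal log_ratio"
proof -
  have "continuous_map T Met_TC.mtopology log_ratio"
  proof (rule Met_TC.continuous_map_uniform_limit[where F = sequentially and f = "\<lambda>n g. (phi (g [^] Suc n) - phi \<one>) / real (Suc n)"])
    show "\<forall>\<^sub>F n in sequentially. continuous_map T Met_TC.mtopology (\<lambda>g. (phi (g [^] Suc n) - phi \<one>) / real (Suc n))"
      using continuous_map_compose[OF pow_cont[of "Suc n" for n] phi_cont]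
      by (auto simp: o_def intro!: always_eventually continuous_intros simp del: nat_pow_Suc)
    fix e :: real assume e: "0 < e"
    show "\<forall>\<^sub>F n in sequentially. \<forall>g\<in>topspace T. log_ratio g \<in> UNIV \<and> dist ((phi (g [^] Suc n) - phi \<one>) / real (Suc n)) (log_ratio g) < e"
    proof (rule eventually_sequentiallyI[of "nat \<lceil>2 * ln M / e\<rceil>"], intro ballI conjI UNIV_I)
      fix n g assume n: "nat \<lceil>2 * ln M / e\<rceil> \<le> n" and "g \<in> topspace T"
      then have g: "g \<in> carrier G" by (simp add: topspace_T)
      have "2 * ln M / e < real (Suc n)" using n by linarith
      then have nn: "2 * ln M < e * real (Suc n)" using e by (simp add: divide_less_eq mult.commute)
      have "\<bar>real (Suc n) * log_ratio g - (phi (g [^] Suc n) - phi \<one>)\<bar> \<le> 2 * ln M"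
        using log_ratio_phi[of "g [^] Suc n"] log_ratio_pow[OF g, of "Suc n"] g by simp
      then have "\<bar>(phi (g [^] Suc n) - phi \<one>) - log_ratio g * real (Suc n)\<bar> < e * real (Suc n)"
        using nn by (simp add: abs_minus_commute mult.commute)
      then have "\<bar>((phi (g [^] Suc n) - phi \<one>) - log_ratio g * real (Suc n)) / real (Suc n)\<bar> < e"
        unfolding abs_divide by (simp add: divide_less_eq)
      then show "dist ((phi (g [^] Suc n) - phi \<one>) / real (Suc n)) (log_ratio g) < e"
        by (simp add: dist_real_def diff_divide_distrib)
    qed
  qed auto
  then show ?thesis by simp
qed

lemma ratio_pos [simp]: "0 < ratio g"
  by (simp add: ratio_def)

lemma ratio_mult: "\<lbrakk>g \<in> carrier G; h \<in> carrier G\<rbrakk> \<Longrightarrow> ratio (g \<otimes> h) = ratio g * ratio h"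
  by (simp add: ratio_def log_ratio_mult exp_add)

lemma ratio_one [simp]: "ratio \<one> = 1"
  by (simp add: ratio_def log_ratio_one)

lemma ratio_inv: "g \<in> carrier G \<Longrightarrow> ratio (inv g) = 1 / ratio g"
  using ratio_mult[of "inv g" g] ratio_pos[of g] by (simp add: eq_divide_eq del: ratio_pos)

text \<open>Three factors \<open>M\<close> separate the constant of an element from its ratio, and
  the quasisimilarity inequality contributes the fourth.\<close>

definition K :: real where "K = M ^ 4"

lemma K1: "1 \<le> K"
  using M1 by (simp add: K_def)

lemma K_pos: "0 < K"
  using K1 by simp

lemma ratio_quasi:
  assumes g: "g \<in> carrier G" and pq: "p \<in> X" "q \<in> X"
  shows "ratio g / K * d p q \<le> d (act g p) (act g q)" "d (act g p) (act g q) \<le> K * ratio g * d p q"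
proof -
  obtain C where C: "0 < C" "\<And>p q. \<lbrakk>p \<in> X; q \<in> X\<rbrakk> \<Longrightarrow> C / M * d p q \<le> d (act g p) (act g q)"
     "\<And>p q. \<lbrakk>p \<in> X; q \<in> X\<rbrakk> \<Longrightarrow> d (act g p) (act g q) \<le> M * C * d p q"
    using quasi[OF g] by blast
  have u: "0 < d org unt" using org_unt by (intro d_pos) auto
  have "ln (C / M * d org unt) \<le> phi g" "phi g \<le> ln (M * C * d org unt)"
    unfolding phi_def using C u M1 dgu[OF g] by (auto intro!: ln_mono)
  moreover have "phi \<one> = ln (d org unt)" by (simp add: phi_def act_one)
  ultimately have "\<bar>phi g - phi \<one> - ln C\<bar> \<le> ln M"
    using C(1) M1 u by (simp add: ln_mult ln_div abs_le_iff)
  then have "\<bar>log_ratio g - ln C\<bar> \<le> 3 * ln M" using log_ratio_phi[OF g] by linarith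
  then have "log_ratio g \<le> ln (M^3 * C)" "ln C \<le> ln (M^3 * ratio g)"
    using M1 C(1) by (auto simp: ln_mult ln_realpow abs_le_iff ratio_def)
  then have 1: "ratio g \<le> M^3 * C" and 2: "C \<le> M^3 * ratio g"
    using M1 C(1) unfolding ratio_def
    by (auto simp: ln_ge_iff dest!: ln_le_cancel_iff[THEN iffD1, rotated 2])
  have "ratio g / K \<le> C / M"
    using 1 M1 by (simp add: K_def field_simps power4_eq_xxxx power3_eq_cube)
  then have "ratio g / K * d p q \<le> C / M * d p q" by (intro mult_right_mono) auto
  also have "\<dots> \<le> d (act g p) (act g q)" by (rule C(2)[OF pq])
  finally show "ratio g / K * d p q \<le> d (act g p) (act g q)" .
  have "M * C \<le> K * ratio g"
    using mult_left_mono[OF 2, of M] M1 by (simp add: K_def power4_eq_xxxx power3_eq_cube mult_ac)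
  then have "M * C * d p q \<le> K * ratio g * d p q" by (intro mult_right_mono) auto
  then show "d (act g p) (act g q) \<le> K * ratio g * d p q" using C(3)[OF pq] by simp
qed

end

section \<open>Functions into a vector space as a vector space\<close>

instantiation "fun" :: (type, real_vector) real_vector
begin

definition scaleR_fun :: "real \<Rightarrow> ('a \<Rightarrow> 'b) \<Rightarrow> 'a \<Rightarrow> 'b" where
  "scaleR_fun r f = (\<lambda>x. r *\<^sub>R f x)"

instance
  by standard (auto simp: scaleR_fun_def fun_eq_iff algebra_simps)

end

lemma scaleR_fun_apply [simp]: "(r *\<^sub>R f) x = r *\<^sub>R f x" for f :: "'a \<Rightarrow> 'b::real_vector"
  by (simp add: scaleR_fun_def)

lemma sum_fun_apply: "(\<Sum>i\<in>I. f i) x = (\<Sum>i\<in>I. f i x)" for f :: "'i \<Rightarrow> 'a \<Rightarrow> 'b::comm_monoid_add"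
  by (induction I rule: infinite_finite_induct) auto

lemma norm_axis: "norm (axis k (c::real)) = \<bar>c\<bar>"
  by (simp add: norm_eq_sqrt_inner inner_axis_axis)

section \<open>Dense orbits and invariant foliations\<close>

context block_action
begin

lemma ratio_neq [simp]: "ratio g \<noteq> 0"
  using ratio_pos[of g] by linarith

lemma ratio_nonneg [simp]: "0 \<le> ratio g"
  by (rule less_imp_le[OF ratio_pos])

lemma exists_at_distance: assumes "p \<in> X" "0 < t" shows "\<exists>q\<in>X. d p q = t"
proof -
  define k :: 'n where "k = undefined"
  define q where "q = (fst p - axis k (t powr w k), snd p)"
  have "wdist w (fst p) (fst q) \<le> t"
  proof (subst wdist_mono_iff[OF w1], use assms in simp, rule ballI)
    fix a assume "a \<in> range w"
    have "block w a (fst p - fst q) = (if a = w k then axis k (t powr w k) else 0)"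
      by (auto simp: vec_eq_iff q_def axis_def)
    then show "norm (block w a (fst p - fst q)) \<le> t powr a" by (simp add: norm_axis)
  qed
  moreover have "t \<le> wdist w (fst p) (fst q)"
  proof -
    have "block w (w k) (fst p - fst q) = axis k (t powr w k)"
      by (auto simp: vec_eq_iff q_def axis_def)
    then have "t powr w k \<le> wdist w (fst p) (fst q) powr w k"
      using norm_block_wdist[of w k "fst p" "fst q", OF w1] by (simp add: norm_axis)
    then show ?thesis
      using w1[of k] assms powr_less_mono2[of "w k" "wdist w (fst p) (fst q)" t] by (force simp: not_le[symmetric])
  qed
  ultimately have "d p q = t" using assms by (simp add: pdist_def q_def)
  then show ?thesis using assms by (intro bexI[of _ q]) (auto simp: q_def in_product_space)
qed

text \<open>Comparing two elements, each known only up to the factor \<open>R * K\<close>, costs its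
  square.\<close>

definition B :: real where "B = (R * K)\<^sup>2"

lemma B_pos: "0 < B"
  using R0 K_pos by (simp add: B_def)

text \<open>Cocompactness brings a pair at \<open>p0\<close> and a pair at \<open>p\<close> to
  bounded position and unit size. Composing one motion with the inverse of the other moves
  \<open>p0\<close> near \<open>p\<close>, and the sizes of the two pairs prescribe the ratio and
  the precision.\<close>

lemma dense_orbits:
  assumes p0: "p0 \<in> X" and p: "p \<in> X" and r: "0 < r" and e: "0 < e"
  shows "\<exists>g\<in>carrier G. r / B \<le> ratio g \<and> ratio g \<le> B * r \<and> d (act g p0) p \<le> e"
proof -
  \<comment> \<open>Makes the final distance bound \<open>K * (R * K * t) * (2 * R)\<close> equal to
    \<open>e\<close>.\<close>
  define t where "t = e / (2 * K\<^sup>2 * R\<^sup>2)"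
  have t: "0 < t" using e K_pos R0 by (simp add: t_def)
  \<comment> \<open>The pair at \<open>p0\<close> is taken \<open>r\<close> times smaller than the
    one at \<open>p\<close>, so that the composite has ratio about \<open>r\<close>.\<close>
  obtain p0' where p0': "p0' \<in> X" "d p0 p0' = t / r" using exists_at_distance[OF p0, of "t / r"] t r by auto
  obtain p' where p': "p' \<in> X" "d p p' = t" using exists_at_distance[OF p t] by auto
  have "p0 \<noteq> p0'" "p \<noteq> p'" using p0' p' t r by auto
  then obtain g0 g1 where g0: "g0 \<in> carrier G" "d (act g0 p0) org \<le> R" "1 / R \<le> d (act g0 p0) (act g0 p0')" "d (act g0 p0) (act g0 p0') \<le> R"
    and g1: "g1 \<in> carrier G" "d (act g1 p) org \<le> R" "1 / R \<le> d (act g1 p) (act g1 p')" "d (act g1 p) (act g1 p') \<le> R"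
    using coco[OF p0 p0'(1)] coco[OF p p'(1)] by metis
  have a0: "1 / R \<le> K * ratio g0 * (t / r)" "ratio g0 / K * (t / r) \<le> R"
    using ratio_quasi[OF g0(1) p0 p0'(1)] g0 p0' by auto
  have a1: "1 / R \<le> K * ratio g1 * t" "ratio g1 / K * t \<le> R"
    using ratio_quasi[OF g1(1) p p'(1)] g1 p' by auto
  define g where "g = inv g1 \<otimes> g0"
  have gG: "g \<in> carrier G" using g0 g1 by (simp add: g_def)
  have rg: "ratio g = ratio g0 / ratio g1" using g0 g1 by (simp add: g_def ratio_mult ratio_inv)
  note pos = ratio_pos[of g0] ratio_pos[of g1] R0 K_pos t r
  have u0: "ratio g0 \<le> R * K * r / t" "r \<le> R * K * t * ratio g0"
    using a0 pos by (simp_all add: field_simps)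
  have u1: "ratio g1 * t \<le> R * K" "1 \<le> R * K * t * ratio g1"
    using a1 pos by (simp_all add: field_simps)
  have "r / B \<le> ratio g"
  proof -
    have "r * (ratio g1 * t) \<le> (R * K * t * ratio g0) * (R * K)"
      by (rule mult_mono[OF u0(2) u1(1)]) (use pos in auto)
    then have "r * ratio g1 \<le> B * ratio g0"
      using pos by (simp add: B_def power2_eq_square mult_ac)
    then show ?thesis using pos B_pos by (simp add: rg divide_simps mult_ac)
  qed
  moreover have "ratio g \<le> B * r"
  proof -
    have "ratio g0 * t \<le> R * K * r" using u0(1) pos by (simp add: le_divide_eq)
    from mult_mono[OF this u1(2)] have "(ratio g0 * t) * 1 \<le> (R * K * r) * (R * K * t * ratio g1)"
      using pos by simp
    then have "ratio g0 \<le> B * r * ratio g1"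
      using pos by (simp add: B_def power2_eq_square mult_ac)
    then show ?thesis using pos by (simp add: rg divide_le_eq)
  qed
  moreover have "d (act g p0) p \<le> e"
  proof -
    have X0: "act g0 p0 \<in> X" and X1: "act g1 p \<in> X" using g0 g1 p0 p by (auto intro: act_closed)
    have "d (act g p0) p = d (act (inv g1) (act g0 p0)) (act (inv g1) (act g1 p))"
      using g0 g1 p0 p by (simp add: g_def act_mult act_inv)
    also have "\<dots> \<le> K * ratio (inv g1) * d (act g0 p0) (act g1 p)"
      using g1 X0 X1 by (intro ratio_quasi) auto
    also have "\<dots> \<le> K * (R * K * t) * (2 * R)"
    proof (intro mult_mono)
      show "ratio (inv g1) \<le> R * K * t" using g1 u1(2) pos by (simp add: ratio_inv divide_le_eq)
      have "d (act g0 p0) (act g1 p) \<le> d (act g0 p0) org + d org (act g1 p)" using X0 X1 by (intro d_tri) auto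
      then show "d (act g0 p0) (act g1 p) \<le> 2 * R" using g0 g1 pdist_commute[of w m org "act g1 p"] by simp
    qed (use pos in auto)
    also have "\<dots> = e" using pos by (simp add: t_def power2_eq_square)
    finally show ?thesis .
  qed
  ultimately show ?thesis using gG by blast
qed

text \<open>\<open>slice a\<close> relates points on a leaf of the coordinates of weight at most
  \<open>a\<close>, and \<open>lower a\<close> those on a leaf of the coordinates of weight less
  than \<open>a\<close>. Inside a slice the a-block tells the lower leaves apart.\<close>

definition slice :: "real \<Rightarrow> 'n point \<Rightarrow> 'n point \<Rightarrow> bool" where
  "slice a p q \<longleftrightarrow> snd p = snd q \<and> (\<forall>k. a < w k \<longrightarrow> fst p $ k = fst q $ k)"

definition lower :: "real \<Rightarrow> 'n point \<Rightarrow> 'n point \<Rightarrow> bool" where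
  "lower a p q \<longleftrightarrow> snd p = snd q \<and> (\<forall>k. a \<le> w k \<longrightarrow> fst p $ k = fst q $ k)"

lemma slice_refl [simp]: "slice a p p" and slice_sym: "slice a p q \<Longrightarrow> slice a q p"
  and slice_trans: "slice a p q \<Longrightarrow> slice a q r \<Longrightarrow> slice a p r"
  by (auto simp: slice_def)

lemma slice_act: assumes "g \<in> carrier G" "p \<in> X" "slice a p q" shows "slice a (act g p) (act g q)"
proof -
  have p: "p = (fst p, snd p)" and q: "q = (fst q, snd p)" using assms by (auto simp: slice_def prod_eq_iff)
  have s: "snd p \<in> madics m" using assms by (simp add: in_product_space)
  have "fst (act g (fst p, snd p)) $ k = fst (act g (fst q, snd p)) $ k" if "a < w k" for k
    using assms that by (intro same_coordinate s) (auto simp: slice_def)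
  then show ?thesis using same_snd[OF assms(1) s, of "fst p" "fst q"] unfolding slice_def p[symmetric] q[symmetric] by blast
qed

lemma lower_act: assumes "g \<in> carrier G" "p \<in> X" "lower a p q" shows "lower a (act g p) (act g q)"
proof -
  have p: "p = (fst p, snd p)" and q: "q = (fst q, snd p)" using assms by (auto simp: lower_def prod_eq_iff)
  have s: "snd p \<in> madics m" using assms by (simp add: in_product_space)
  have "fst (act g (fst p, snd p)) $ k = fst (act g (fst q, snd p)) $ k" if "a \<le> w k" for k
    using assms that by (intro same_coordinate s) (auto simp: lower_def)
  then show ?thesis using same_snd[OF assms(1) s, of "fst p" "fst q"] unfolding lower_def p[symmetric] q[symmetric] by blast
qed

lemma lower_block: "lower a p q \<Longrightarrow> block w a (fst p) = block w a (fst q)"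
  by (auto simp: lower_def vec_eq_iff)

text \<open>The distance between two leaves of the foliation by the coordinates of weight below \<open>a\<close> is
  read off the \<open>a\<close>-block, and leaves are permuted by the action.\<close>

lemma block_expand:
  assumes g: "g \<in> carrier G" and pq: "p \<in> X" "q \<in> X" and sl: "slice a p q" and a: "a \<in> range w"
  shows "(ratio g / K) powr a * norm (block w a (fst p - fst q)) \<le> norm (block w a (fst (act g p) - fst (act g q)))"
proof -
  obtain k0 where k0: "a = w k0" using a by blast
  have a1: "1 \<le> a" using w1 k0 by simp
  define N where "N = norm (block w a (fst (act g p) - fst (act g q)))"
  \<comment> \<open>The point on the lower leaf of \<open>act g q\<close> that differs from
    \<open>act g p\<close> in the a-block only. Pulled back by \<open>g\<close> it stays on the
    lower leaf of \<open>q\<close>, whose a-block is that of \<open>q\<close>.\<close>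
  define y where "y = ((\<chi> k. if w k = a then fst (act g q) $ k else fst (act g p) $ k), snd (act g p))"
  have sg: "slice a (act g p) (act g q)" by (rule slice_act[OF g pq(1) sl])
  have gX: "act g p \<in> X" "act g q \<in> X" using g pq by (auto intro: act_closed)
  have yX: "y \<in> X" using gX by (simp add: y_def in_product_space)
  have ly: "lower a (act g q) y" using sg by (auto simp: lower_def slice_def y_def)
  have iy: "act (inv g) y \<in> X" using g yX by (intro act_closed) auto
  have li: "lower a q (act (inv g) y)"
    using lower_act[OF _ gX(2) ly, of "inv g"] g pq by (simp add: act_inv)
  have dist: "d (act g p) y \<le> N powr (1 / a)"
  proof -
    have "wdist w (fst (act g p)) (fst y) \<le> N powr (1 / a)"
    proof (subst wdist_mono_iff[OF w1], simp, rule ballI)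
      fix b assume "b \<in> range w"
      have "block w b (fst (act g p) - fst y) = (if b = a then block w a (fst (act g p) - fst (act g q)) else 0)"
        by (auto simp: vec_eq_iff y_def)
      then show "norm (block w b (fst (act g p) - fst y)) \<le> (N powr (1 / a)) powr b"
        using a1 by (simp add: powr_powr N_def)
    qed
    then show ?thesis by (simp add: pdist_def y_def)
  qed
  have "norm (block w a (fst p - fst q)) = norm (block w a (fst p - fst (act (inv g) y)))"
    using lower_block[OF li] by (simp add: block_diff)
  also have "\<dots> \<le> d p (act (inv g) y) powr a" unfolding k0 by (rule block_le_d)
  finally have 1: "norm (block w a (fst p - fst q)) \<le> d p (act (inv g) y) powr a" .
  have "ratio g / K * d p (act (inv g) y) \<le> d (act g p) y"
    using ratio_quasi(1)[OF g pq(1) iy] g yX by (simp add: act_inv')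
  then have "ratio g / K * d p (act (inv g) y) \<le> N powr (1 / a)" using dist by simp
  moreover have "0 \<le> ratio g / K * d p (act (inv g) y)"
    using K_pos by (intro mult_nonneg_nonneg divide_nonneg_nonneg) (simp_all add: less_imp_le)
  ultimately have "(ratio g / K * d p (act (inv g) y)) powr a \<le> (N powr (1 / a)) powr a"
    using a1 by (intro powr_mono2) auto
  moreover have "(ratio g / K * d p (act (inv g) y)) powr a = (ratio g / K) powr a * d p (act (inv g) y) powr a"
    by (rule powr_mult)
  moreover have "(N powr (1 / a)) powr a = N" using a1 by (simp add: powr_powr N_def)
  ultimately have "(ratio g / K) powr a * d p (act (inv g) y) powr a \<le> N" by simp
  moreover have "(ratio g / K) powr a * norm (block w a (fst p - fst q)) \<le> (ratio g / K) powr a * d p (act (inv g) y) powr a"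
    using 1 by (intro mult_left_mono) auto
  ultimately show ?thesis by (simp add: N_def)
qed

section \<open>The equivariant embedding of a block\<close>

definition V :: "('g \<Rightarrow> real^'n) set" where
  "V = {f. \<forall>k. (\<lambda>g. f g $ k) \<in> bounded_continuous T}"

definition ip :: "('g \<Rightarrow> real^'n) \<Rightarrow> ('g \<Rightarrow> real^'n) \<Rightarrow> real" where
  "ip f h = mean (\<lambda>g. f g \<bullet> h g)"

lemma inner_bc: "\<lbrakk>f \<in> V; h \<in> V\<rbrakk> \<Longrightarrow> (\<lambda>g. f g \<bullet> h g) \<in> bounded_continuous T"
  unfolding inner_vec_def V_def by (auto intro!: bounded_continuous_sum bounded_continuous_mult)

sublocale semi_inner V ip
proof
  show "subspace V"
    by (rule subspaceI)
       (auto simp: V_def bounded_continuous_const bounded_continuous_add bounded_continuous_scale)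
next
  fix x y z assume v: "x \<in> V" "y \<in> V" "z \<in> V"
  show "ip (x + y) z = ip x z + ip y z"
    unfolding ip_def by (simp add: inner_add_left mean_add inner_bc v)
next
  fix x z r assume v: "x \<in> V" "z \<in> V"
  show "ip (r *\<^sub>R x) z = r * ip x z"
    unfolding ip_def scaleR_fun_apply inner_scaleR_left by (rule mean_scale[OF inner_bc inner_bc]) (use v in auto)
  show "ip x z = ip z x" by (simp add: ip_def inner_commute)
next
  fix x assume v: "x \<in> V"
  have "mean (\<lambda>_. 0) \<le> ip x x"
    unfolding ip_def by (intro mean_mono inner_bc bounded_continuous_const v) simp
  then show "0 \<le> ip x x" by (simp add: mean_const)
qed

lemma ip_cong:
  assumes "f \<in> V" "h \<in> V" "f' \<in> V" "h' \<in> V"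
    and "\<And>g. g \<in> carrier G \<Longrightarrow> f g \<bullet> h g = f' g \<bullet> h' g"
  shows "ip f h = ip f' h'"
proof (rule antisym)
  show "ip f h \<le> ip f' h'" unfolding ip_def using assms by (intro mean_mono inner_bc) auto
  show "ip f' h' \<le> ip f h" unfolding ip_def using assms by (intro mean_mono inner_bc) auto
qed

text \<open>Functions are defined on the whole type, while the mean sees only the carrier.
  Identities that hold on the group therefore become equalities modulo null vectors.\<close>

lemma null_cong: "\<lbrakk>f \<in> V; h \<in> V; \<And>g. g \<in> carrier G \<Longrightarrow> f g = h g\<rbrakk> \<Longrightarrow> nrm (f - h) = 0"
  using ip_cong[of "f - h" "f - h" 0 0] by (simp add: nrm_def)

text \<open>The right regular representation; invariance of the mean makes it isometric.\<close>

definition trans :: "'g \<Rightarrow> ('g \<Rightarrow> real^'n) \<Rightarrow> 'g \<Rightarrow> real^'n" where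
  "trans g f = (\<lambda>h. f (h \<otimes> g))"

lemma trans_V: "\<lbrakk>g \<in> carrier G; f \<in> V\<rbrakk> \<Longrightarrow> trans g f \<in> V"
  using bounded_continuous_compose[OF _ topological_group_translations(2)[OF tg]]
  by (auto simp: trans_def V_def)

lemma trans_ip: "\<lbrakk>g \<in> carrier G; f \<in> V; h \<in> V\<rbrakk> \<Longrightarrow> ip (trans g f) (trans g h) = ip f h"
  unfolding ip_def trans_def by (rule mean_right[OF inner_bc inner_bc]) auto

lemma trans_linear: "trans g (f + h) = trans g f + trans g h" "trans g (r *\<^sub>R f) = r *\<^sub>R trans g f"
  "trans g (f - h) = trans g f - trans g h" "trans g 0 = 0"
  by (auto simp: trans_def fun_eq_iff)

text \<open>Subtracting the orbit of the origin makes the function bounded. The exponential is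
  \<open>1 / ratio g powr a\<close>, in a form whose continuity follows from that of
  \<open>log_ratio\<close>.\<close>

definition Phi :: "real \<Rightarrow> 'n point \<Rightarrow> 'g \<Rightarrow> real^'n" where
  "Phi a p g = exp (- a * log_ratio g) *\<^sub>R block w a (fst (act g p) - fst (act g org))"

lemma Phi_diff: "(Phi a p - Phi a q) g = exp (- a * log_ratio g) *\<^sub>R block w a (fst (act g p) - fst (act g q))"
  by (simp add: Phi_def block_diff flip: scaleR_right_diff_distrib)

lemma exp_ratio: "exp (- a * log_ratio g) = 1 / ratio g powr a"
  by (simp add: ratio_def powr_def exp_minus inverse_eq_divide)

lemma Phi_diff_le:
  assumes g: "g \<in> carrier G" and pq: "p \<in> X" "q \<in> X" and a: "a \<in> range w"
  shows "norm ((Phi a p - Phi a q) g) \<le> (K * d p q) powr a"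
proof -
  obtain k0 where k0: "a = w k0" using a by blast
  have "norm (block w a (fst (act g p) - fst (act g q))) \<le> d (act g p) (act g q) powr a"
    unfolding k0 by (rule block_le_d)
  also have "\<dots> \<le> (K * ratio g * d p q) powr a"
    using w1[of k0] k0 by (intro powr_mono2 ratio_quasi g pq) auto
  also have "\<dots> = (K * d p q) powr a * ratio g powr a"
    using K_pos ratio_pos[of g] by (simp add: powr_mult mult_ac)
  finally show ?thesis
    unfolding Phi_diff exp_ratio using ratio_pos[of g] by (simp add: divide_le_eq)
qed

text \<open>The factor of \<open>ratio g\<close> in the expansion of the a-block cancels the
  rescaling. The bound is thus uniform in \<open>g\<close> and survives the mean.\<close>

lemma Phi_diff_ge:
  assumes g: "g \<in> carrier G" and pq: "p \<in> X" "q \<in> X" and a: "a \<in> range w" and sl: "slice a p q"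
  shows "norm (block w a (fst p - fst q)) / K powr a \<le> norm ((Phi a p - Phi a q) g)"
proof -
  have "0 < ratio g powr a" "0 < K powr a" using K_pos by simp_all
  then show ?thesis
    using block_expand[OF g pq sl a] K_pos ratio_pos[of g]
    unfolding Phi_diff exp_ratio by (simp add: powr_divide divide_simps mult_ac del: ratio_pos)
qed

lemma Phi_V: assumes p: "p \<in> X" and a: "a \<in> range w" shows "Phi a p \<in> V"
  unfolding V_def
proof (rule CollectI, rule allI)
  fix k
  show "(\<lambda>g. Phi a p g $ k) \<in> bounded_continuous T"
  proof (rule bounded_continuousI)
    have c: "continuous_map T euclideanreal (\<lambda>g. fst (act g p) $ k)" if "p \<in> X" for p
      using continuous_map_compose[OF act_cont[OF that], of euclidean "\<lambda>x. x $ k"] by (simp add: o_def continuous_on_component)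
    have e: "continuous_map T euclideanreal (\<lambda>g. exp (- a * log_ratio g))"
      using continuous_map_compose[OF continuous_map_real_mult_left[OF log_ratio_cont], of euclideanreal exp "- a"]
      by (simp add: o_def continuous_on_exp)
    show "continuous_map T euclideanreal (\<lambda>g. Phi a p g $ k)"
      unfolding Phi_def using c[OF p] c[of org] e
      by (cases "w k = a") (auto intro!: continuous_map_real_mult continuous_map_diff)
    fix g assume "g \<in> topspace T"
    then have g: "g \<in> carrier G" by (simp add: topspace_T)
    have "Phi a p g = (Phi a p - Phi a org) g" by (simp add: Phi_def)
    then show "\<bar>Phi a p g $ k\<bar> \<le> (K * d p org) powr a"
      using component_le_norm_cart[of "Phi a p g" k] Phi_diff_le[OF g p _ a, of org] by simp
  qed
qed

lemma Phi_nrm_le: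
  assumes pq: "p \<in> X" "q \<in> X" and a: "a \<in> range w"
  shows "nrm (Phi a p - Phi a q) \<le> (K * d p q) powr a"
proof -
  let ?f = "Phi a p - Phi a q"
  have V: "?f \<in> V" using assms by (intro V_diff Phi_V)
  have "?f g \<bullet> ?f g \<le> ((K * d p q) powr a)\<^sup>2" if "g \<in> carrier G" for g
    using power_mono[OF Phi_diff_le[OF that pq a] norm_ge_zero, of 2] by (simp only: power2_norm_eq_inner)
  then have "ip ?f ?f \<le> mean (\<lambda>_. ((K * d p q) powr a)\<^sup>2)"
    unfolding ip_def by (intro mean_mono inner_bc V bounded_continuous_const)
  then have "(nrm ?f)\<^sup>2 \<le> ((K * d p q) powr a)\<^sup>2" using V by (simp add: nrm_sq mean_const)
  then show ?thesis by (rule power2_le_imp_le) simp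
qed

lemma Phi_nrm_ge:
  assumes pq: "p \<in> X" "q \<in> X" and a: "a \<in> range w" and sl: "slice a p q"
  shows "norm (block w a (fst p - fst q)) \<le> K powr a * nrm (Phi a p - Phi a q)"
proof -
  let ?f = "Phi a p - Phi a q" and ?c = "norm (block w a (fst p - fst q)) / K powr a"
  have V: "?f \<in> V" using assms by (intro V_diff Phi_V)
  have "?c\<^sup>2 \<le> ?f g \<bullet> ?f g" if "g \<in> carrier G" for g
    using power_mono[OF Phi_diff_ge[OF that pq a sl], of 2] by (simp add: power2_norm_eq_inner)
  then have "mean (\<lambda>_. ?c\<^sup>2) \<le> ip ?f ?f"
    unfolding ip_def by (intro mean_mono inner_bc V bounded_continuous_const)
  then have "?c\<^sup>2 \<le> (nrm ?f)\<^sup>2" using V by (simp add: nrm_sq mean_const)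
  then have "?c \<le> nrm ?f" by (rule power2_le_imp_le) (use V in simp)
  then show ?thesis using K_pos by (simp add: divide_le_eq mult.commute)
qed

text \<open>The seminorm of a difference of orbit functions is a pseudometric bounded by the a-th
  power of the distance, so \<open>chain_vanish\<close> applies to it.\<close>

lemma Phi_lower:
  assumes pq: "p \<in> X" "q \<in> X" and a: "a \<in> range w" and l: "lower a p q"
  shows "nrm (Phi a p - Phi a q) = 0"
proof -
  have pe: "p = (fst p, snd p)" and qe: "q = (fst q, snd p)" using l by (auto simp: lower_def prod_eq_iff)
  have s: "snd p \<in> madics m" using pq by (simp add: in_product_space)
  have a1: "1 \<le> a" using a w1 by auto
  have "nrm (Phi a (fst p, snd p) - Phi a (fst q, snd p)) \<le> 0"
  proof (rule chain_vanish[where w = w and m = m and b = a and C = "K powr a" and D = "\<lambda>p q. nrm (Phi a p - Phi a q)"])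
    fix p q r assume "p \<in> X" "q \<in> X" "r \<in> X"
    then show "nrm (Phi a p - Phi a r) \<le> nrm (Phi a p - Phi a q) + nrm (Phi a q - Phi a r)"
      by (intro nrm_triangle3 Phi_V a)
  next
    fix p q assume "p \<in> X" "q \<in> X"
    then show "nrm (Phi a p - Phi a q) \<le> K powr a * d p q powr a"
      using Phi_nrm_le[of p q a] a K_pos by (simp add: powr_mult)
  next
    fix k assume "a \<le> w k" then show "fst p $ k = fst q $ k" using l by (simp add: lower_def)
  qed (use s w1 a1 in auto)
  then have "nrm (Phi a p - Phi a q) \<le> 0" unfolding pe[symmetric] qe[symmetric] .
  then show ?thesis using nrm_nonneg[OF V_diff[OF Phi_V[OF pq(1) a] Phi_V[OF pq(2) a]]] by simp
qed

text \<open>Moving the points by \<open>g\<close> shifts the argument to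
  \<open>h \<otimes> g\<close>; multiplicativity of \<open>ratio\<close> turns the mismatch of the
  rescaling into the constant \<open>ratio g powr a\<close>.\<close>

lemma Phi_act:
  assumes "g \<in> carrier G" "h \<in> carrier G" "p \<in> X" "q \<in> X"
  shows "(Phi a (act g p) - Phi a (act g q)) h = (ratio g powr a *\<^sub>R trans g (Phi a p - Phi a q)) h"
proof -
  have "exp (- a * log_ratio h) = ratio g powr a * exp (- a * log_ratio (h \<otimes> g))"
    using assms ratio_pos[of g] ratio_pos[of h] unfolding exp_ratio by (simp add: ratio_mult powr_mult)
  then show ?thesis
    unfolding Phi_diff scaleR_fun_apply trans_def using assms by (simp add: act_mult)
qed

end

section \<open>Linear dependencies and their limits\<close>

lemma convergent_subsequence_coordinates:
  fixes l :: "nat \<Rightarrow> nat \<Rightarrow> real"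
  assumes "\<And>n k. k < N \<Longrightarrow> \<bar>l n k\<bar> \<le> 1"
  shows "\<exists>r L. strict_mono (r :: nat \<Rightarrow> nat) \<and> (\<forall>k<N. (\<lambda>n. l (r n) k) \<longlonglongrightarrow> L k)"
  using assms
proof (induction N)
  case 0
  then show ?case by (intro exI[of _ id]) (auto simp: strict_mono_def)
next
  case (Suc N)
  then obtain r L where r: "strict_mono r" "\<forall>k<N. (\<lambda>n. l (r n) k) \<longlonglongrightarrow> L k" by auto
  have "seq_compact {-1..1::real}" by (intro compact_imp_seq_compact) auto
  moreover have "l (r n) N \<in> {-1..1}" for n using Suc(2)[of N "r n"] by (simp add: abs_le_iff)
  ultimately obtain L' r' where r': "strict_mono (r' :: nat \<Rightarrow> nat)" "((\<lambda>n. l (r n) N) \<circ> r') \<longlonglongrightarrow> L'"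
    by (elim seq_compactE[where f = "\<lambda>n. l (r n) N"]) auto
  have "(\<lambda>n. l (r (r' n)) k) \<longlonglongrightarrow> (L(N := L')) k" if "k < Suc N" for k
  proof (cases "k = N")
    case True
    then show ?thesis using r'(2) by (simp add: o_def)
  next
    case False
    then have "(\<lambda>n. l (r n) k) \<longlonglongrightarrow> L k" using r(2) that by simp
    from LIMSEQ_subseq_LIMSEQ[OF this r'(1)] show ?thesis using False by (simp add: o_def)
  qed
  then show ?case
    using strict_mono_o[OF r(1) r'(1)] by (intro exI[of _ "r \<circ> r'"] exI[of _ "L(N := L')"]) (auto simp: o_def)
qed

text \<open>Bounded coefficient vectors have a convergent subsequence. The lower bound on their
  absolute sum keeps the limit nontrivial, and the seminorm of the combination depends continuously
  on the coefficients.\<close>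

lemma (in semi_inner) limit_dependency:
  fixes z :: "nat \<Rightarrow> 'v"
  assumes z: "\<And>k. z k \<in> V"
    and dep: "\<And>e. 0 < e \<Longrightarrow> \<exists>l. (\<forall>k<N. \<bar>l k\<bar> \<le> 1) \<and> 1 \<le> (\<Sum>k<N. \<bar>l k\<bar>) \<and> nrm (\<Sum>k<N. l k *\<^sub>R z k) \<le> e"
  shows "\<exists>l. (\<exists>k<N. l k \<noteq> 0) \<and> nrm (\<Sum>k<N. l k *\<^sub>R z k) = 0"
proof -
  have "\<exists>l. (\<forall>k<N. \<bar>l k\<bar> \<le> 1) \<and> 1 \<le> (\<Sum>k<N. \<bar>l k\<bar>) \<and> nrm (\<Sum>k<N. l k *\<^sub>R z k) \<le> inverse (real (Suc n))" for n
    by (intro dep) simp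
  then obtain l where l: "\<And>n k. k < N \<Longrightarrow> \<bar>l n k\<bar> \<le> 1" "\<And>n. 1 \<le> (\<Sum>k<N. \<bar>l n k\<bar>)"
    "\<And>n. nrm (\<Sum>k<N. l n k *\<^sub>R z k) \<le> inverse (real (Suc n))"
    by metis
  obtain r L where r: "strict_mono r" and L: "\<And>k. k < N \<Longrightarrow> (\<lambda>n. l (r n) k) \<longlonglongrightarrow> L k"
    using convergent_subsequence_coordinates[of N l] l(1) by blast
  have "(\<lambda>n. \<Sum>k<N. \<bar>l (r n) k\<bar>) \<longlonglongrightarrow> (\<Sum>k<N. \<bar>L k\<bar>)"
    using L by (intro tendsto_intros) auto
  then have one: "1 \<le> (\<Sum>k<N. \<bar>L k\<bar>)" by (rule LIMSEQ_le_const) (use l(2) in auto)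
  have ne: "\<exists>k<N. L k \<noteq> 0"
  proof (rule ccontr)
    assume "\<not> ?thesis"
    then have "(\<Sum>k<N. \<bar>L k\<bar>) = 0" by simp
    then show False using one by simp
  qed
  have le: "nrm (\<Sum>k<N. L k *\<^sub>R z k) \<le> inverse (real (Suc (r n))) + (\<Sum>k<N. \<bar>L k - l (r n) k\<bar> * nrm (z k))" for n
  proof -
    have "(\<Sum>k<N. L k *\<^sub>R z k) = (\<Sum>k<N. l (r n) k *\<^sub>R z k) + (\<Sum>k<N. (L k - l (r n) k) *\<^sub>R z k)"
      by (simp add: scaleR_left_diff_distrib sum_subtractf)
    also have "nrm \<dots> \<le> nrm (\<Sum>k<N. l (r n) k *\<^sub>R z k) + nrm (\<Sum>k<N. (L k - l (r n) k) *\<^sub>R z k)"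
      using z by (intro nrm_triangle) auto
    also have "nrm (\<Sum>k<N. (L k - l (r n) k) *\<^sub>R z k) \<le> (\<Sum>k<N. nrm ((L k - l (r n) k) *\<^sub>R z k))"
      using z by (intro nrm_sum_le) auto
    finally show ?thesis using l(3)[of "r n"] z by (simp add: nrm_scale)
  qed
  have "(\<lambda>n. inverse (real (Suc (r n))) + (\<Sum>k<N. \<bar>L k - l (r n) k\<bar> * nrm (z k))) \<longlonglongrightarrow> 0 + (\<Sum>k<N. \<bar>L k - L k\<bar> * nrm (z k))"
    using LIMSEQ_subseq_LIMSEQ[OF LIMSEQ_inverse_real_of_nat r] L
    by (intro tendsto_intros) (auto simp: o_def)
  then have "nrm (\<Sum>k<N. L k *\<^sub>R z k) \<le> 0 + (\<Sum>k<N. \<bar>L k - L k\<bar> * nrm (z k))"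
    by (rule LIMSEQ_le_const) (use le in blast)
  then have "nrm (\<Sum>k<N. L k *\<^sub>R z k) \<le> 0" by simp
  moreover have "(\<Sum>k<N. L k *\<^sub>R z k) \<in> V" using z by auto
  ultimately have "nrm (\<Sum>k<N. L k *\<^sub>R z k) = 0" by (simp add: order_antisym)
  then show ?thesis using ne by blast
qed

lemma block_dependency:
  fixes y :: "nat \<Rightarrow> real^'n"
  assumes y: "\<And>k i. w i \<noteq> a \<Longrightarrow> y k $ i = 0"
  defines "N \<equiv> Suc (card {i. w i = a})"
  shows "\<exists>l. (\<forall>k<N. \<bar>l k\<bar> \<le> 1) \<and> 1 \<le> (\<Sum>k<N. \<bar>l k\<bar>) \<and> (\<Sum>k<N. l k *\<^sub>R y k) = 0"
proof -
  have "\<exists>l. (\<exists>k<N. l k \<noteq> 0) \<and> (\<Sum>k<N. l k *\<^sub>R y k) = 0"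
  \<comment> \<open>Linear dependence is a property of the set of values, so a repeated vector has
    to be treated separately.\<close>
  proof (cases "inj_on y {..<N}")
    case False
    then obtain i j where ij: "i < N" "j < N" "i \<noteq> j" "y i = y j" by (auto simp: inj_on_def)
    define l :: "nat \<Rightarrow> real" where "l k = (if k = i then 1 else 0) - (if k = j then 1 else 0)" for k
    have "(\<Sum>k<N. l k *\<^sub>R y k) = (\<Sum>k<N. if k = i then y k else 0) - (\<Sum>k<N. if k = j then y k else 0)"
      unfolding sum_subtractf[symmetric] by (intro sum.cong) (auto simp: l_def)
    then have "(\<Sum>k<N. l k *\<^sub>R y k) = 0" using ij by simp
    then show ?thesis using ij by (intro exI[of _ l]) (auto simp: l_def)
  next
    case True
    define S where "S = {x::real^'n. \<forall>i. i \<notin> {i. w i = a} \<longrightarrow> x $ i = 0}"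
    have "dim S \<le> card {i. w i = a}"
    proof -
      have "S \<subseteq> span ((\<lambda>i. axis i 1) ` {i. w i = a})"
      proof
        fix x assume "x \<in> S"
        then have "x = (\<Sum>i\<in>{i. w i = a}. x $ i *\<^sub>R axis i 1)"
          by (auto simp: S_def vec_eq_iff axis_def if_distrib[of "\<lambda>t. _ * t"] sum.If_cases cong: if_cong)
        also have "\<dots> \<in> span ((\<lambda>i. axis i 1) ` {i. w i = a})"
          by (intro span_sum span_scale span_base) auto
        finally show "x \<in> span ((\<lambda>i. axis i 1) ` {i. w i = a})" .
      qed
      then have "dim S \<le> card ((\<lambda>i. axis i 1 :: real^'n) ` {i. w i = a})" by (intro dim_le_card) auto
      also have "\<dots> \<le> card {i. w i = a}" by (rule card_image_le) simp
      finally show ?thesis .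
    qed
    moreover have "y ` {..<N} \<subseteq> S" using y by (auto simp: S_def)
    moreover have "card (y ` {..<N}) = N" using True by (simp add: card_image)
    ultimately have "dependent (y ` {..<N})"
      using independent_card_le_dim[of "y ` {..<N}" S] by (auto simp: N_def)
    then obtain u where u: "\<exists>v\<in>y ` {..<N}. u v \<noteq> 0" "(\<Sum>v\<in>y ` {..<N}. u v *\<^sub>R v) = 0"
      by (auto simp: dependent_finite)
    then show ?thesis
      by (intro exI[of _ "\<lambda>k. u (y k)"]) (auto simp: sum.reindex[OF True])
  qed
  then obtain l where l: "\<exists>k<N. l k \<noteq> 0" "(\<Sum>k<N. l k *\<^sub>R y k) = 0" by blast
  define s where "s = (\<Sum>k<N. \<bar>l k\<bar>)"
  have le: "\<bar>l k\<bar> \<le> s" if "k < N" for k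
    unfolding s_def using that by (intro member_le_sum[of k "{..<N}" "\<lambda>k. \<bar>l k\<bar>"]) auto
  have s: "0 < s" using l(1) le by (meson abs_ge_zero abs_le_zero_iff not_less order_trans)
  have "(\<Sum>k<N. (l k / s) *\<^sub>R y k) = (1 / s) *\<^sub>R (\<Sum>k<N. l k *\<^sub>R y k)"
    by (simp add: scaleR_sum_right)
  then have "(\<Sum>k<N. (l k / s) *\<^sub>R y k) = 0" using l by simp
  moreover have "(\<Sum>k<N. \<bar>l k / s\<bar>) = 1" using s by (simp add: s_def flip: sum_divide_distrib)
  moreover have "\<forall>k<N. \<bar>l k / s\<bar> \<le> 1" using le s by simp
  ultimately show ?thesis by (intro exI[of _ "\<lambda>k. l k / s"]) auto
qed

section \<open>Flatness of slices\<close>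

context block_action
begin

text \<open>On points that have only an a-block, the a-th power of the distance is at most the
  Euclidean distance, so the embedding is Lipschitz there. Composing with the block projection gives
  a Lipschitz map on the whole space.\<close>

lemma Phi_approximately_affine:
  assumes a: "a \<in> range w" and e: "0 < e"
  shows "\<exists>x r v. 0 < r \<and> (\<forall>i. v i \<in> V) \<and> block w a x = x \<and>
    (\<forall>y. block w a y = y \<longrightarrow> norm (y - x) \<le> r \<longrightarrow>
      nrm (Phi a (y, \<lambda>_. 0) - Phi a (x, \<lambda>_. 0) - (\<Sum>i\<in>UNIV. (y - x) $ i *\<^sub>R v i)) \<le> e * r)"
proof -
  define f where "f x = Phi a (block w a x, \<lambda>_. 0)" for x :: "real^'n"
  have a1: "1 \<le> a" using a w1 by auto
  have fV: "f x \<in> V" for x by (simp add: f_def Phi_V a)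
  have L: "nrm (f x - f y) \<le> K powr a * norm (x - y)" for x y
  proof -
    have "d (block w a x, \<lambda>_. 0) (block w a y, \<lambda>_. 0) \<le> norm (x - y) powr (1 / a)"
    proof -
      have "wdist w (block w a x) (block w a y) \<le> norm (x - y) powr (1 / a)"
      proof (subst wdist_mono_iff[OF w1], simp, rule ballI)
        fix b
        show "norm (block w b (block w a x - block w a y)) \<le> (norm (x - y) powr (1 / a)) powr b"
          using a1 norm_block_le[of w a "x - y"] by (simp add: powr_powr block_diff block_block)
      qed
      then show ?thesis by (simp add: pdist_def)
    qed
    then have "(K * d (block w a x, \<lambda>_. 0) (block w a y, \<lambda>_. 0)) powr a \<le> (K * norm (x - y) powr (1 / a)) powr a"
      using a1 K_pos by (intro powr_mono2 mult_left_mono) auto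
    also have "\<dots> = K powr a * norm (x - y)" using a1 by (simp add: powr_mult powr_powr)
    finally show ?thesis
      unfolding f_def using Phi_nrm_le[of "(block w a x, \<lambda>_. 0)" "(block w a y, \<lambda>_. 0)" a] a by simp
  qed
  obtain x0 r v where r: "0 < r" and v: "\<And>i. v i \<in> V" and aff: "\<And>x. (\<And>i. x0 $ i \<le> x $ i \<and> x $ i \<le> x0 $ i + r) \<Longrightarrow>
      nrm (f x - f x0 - (\<Sum>i\<in>UNIV. (x - x0) $ i *\<^sub>R v i)) \<le> (e / 4) * r"
    using approximately_affine[OF fV L, of "e / 4"] e by auto
  \<comment> \<open>The centre of the cube. The estimate on the cube becomes one on a ball of radius
    \<open>r / 2\<close>, and the errors \<open>e / 4 * r\<close> at the point and at the centre add
    up to \<open>e * (r / 2)\<close>.\<close>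
  define c where "c = x0 + (\<chi> i. r / 2)"
  define x where "x = block w a c"
  have "nrm (Phi a (y, \<lambda>_. 0) - Phi a (x, \<lambda>_. 0) - (\<Sum>i\<in>UNIV. (y - x) $ i *\<^sub>R v i)) \<le> e * (r / 2)"
    if y: "block w a y = y" "norm (y - x) \<le> r / 2" for y
  proof -
    define y' where "y' = c + (y - x)"
    have by': "block w a y' = y" using y(1) by (simp add: y'_def block_add block_diff x_def block_block)
    have box: "x0 $ i \<le> y' $ i \<and> y' $ i \<le> x0 $ i + r" for i
      using component_le_norm_cart[of "y - x" i] y(2) unfolding y'_def c_def by (simp add: abs_le_iff)
    have boxc: "x0 $ i \<le> c $ i \<and> c $ i \<le> x0 $ i + r" for i using r by (simp add: c_def)
    let ?u = "f y' - f x0 - (\<Sum>i\<in>UNIV. (y' - x0) $ i *\<^sub>R v i)" and ?v = "f c - f x0 - (\<Sum>i\<in>UNIV. (c - x0) $ i *\<^sub>R v i)"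
    have eq: "Phi a (y, \<lambda>_. 0) - Phi a (x, \<lambda>_. 0) - (\<Sum>i\<in>UNIV. (y - x) $ i *\<^sub>R v i) = ?u - ?v"
    proof -
      have "(\<Sum>i\<in>UNIV. (y' - x0) $ i *\<^sub>R v i) = (\<Sum>i\<in>UNIV. (c - x0) $ i *\<^sub>R v i) + (\<Sum>i\<in>UNIV. (y - x) $ i *\<^sub>R v i)"
        unfolding sum.distrib[symmetric] y'_def by (intro sum.cong) (simp_all flip: scaleR_left_distrib)
      then show ?thesis by (simp add: f_def by' x_def)
    qed
    have "nrm (?u - ?v) \<le> nrm ?u + nrm ?v"
      by (intro nrm_triangle_diff V_diff V_sum V_scale fV v)
    moreover have "nrm ?u \<le> (e / 4) * r" by (rule aff[OF box])
    moreover have "nrm ?v \<le> (e / 4) * r" by (rule aff[OF boxc])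
    ultimately show ?thesis unfolding eq by linarith
  qed
  then show ?thesis
    using r v by (intro exI[of _ x] exI[of _ "r / 2"] exI[of _ v]) (auto simp: x_def block_block)
qed

text \<open>The image of a slice is flat: a configuration in a slice is moved by a suitable group element
  to a scale and place where the embedding is almost affine of rank at most the size of the block.\<close>

lemma slice_flat:
  assumes a: "a \<in> range w" and b: "b \<in> X" and ps: "\<And>k. ps k \<in> X" "\<And>k. slice a b (ps k)"
  defines "N \<equiv> Suc (card {i. w i = a})"
  shows "\<exists>l. (\<exists>k<N. l k \<noteq> 0) \<and> nrm (\<Sum>k<N. l k *\<^sub>R (Phi a (ps k) - Phi a b)) = 0"
proof (rule limit_dependency)
  show "Phi a (ps k) - Phi a b \<in> V" for k by (intro V_diff Phi_V a b ps)
  fix e :: real assume e: "0 < e"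
  obtain k0 where k0: "a = w k0" using a by blast
  have a1: "1 \<le> a" using k0 w1 by simp
  define D1 where "D1 = 1 + (\<Sum>k<N. d b (ps k))"
  have D1: "1 \<le> D1" by (simp add: D1_def sum_nonneg)
  have dD1: "d b (ps k) \<le> D1" if "k < N" for k
    using member_le_sum[of k "{..<N}" "\<lambda>k. d b (ps k)"] that by (simp add: D1_def)
  \<comment> \<open>The factor by which a dependency found at scale \<open>r\<close> is magnified
    when it is carried back: \<open>r / Q\<close> equals \<open>(t / B) powr a\<close>.\<close>
  define Q where "Q = (2 * K * B\<^sup>2 * D1) powr a"
  have Q: "0 < Q" using K_pos B_pos D1 by (simp add: Q_def)
  have N0: "0 < real N" by (simp add: N_def)
  \<comment> \<open>Each of the \<open>N\<close> terms contributes an error of at most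
    \<open>4 * e1 * r\<close>; after magnification by \<open>Q\<close> their sum is at most
    \<open>e\<close>.\<close>
  define e1 where "e1 = e / (4 * real N * Q)"
  have e1: "0 < e1" using e Q N0 by (simp add: e1_def)
  obtain x r v where r: "0 < r" and v: "\<And>i. v i \<in> V" and bx: "block w a x = x" and aff: "\<And>y. block w a y = y \<Longrightarrow> norm (y - x) \<le> r \<Longrightarrow>
      nrm (Phi a (y, \<lambda>_. 0) - Phi a (x, \<lambda>_. 0) - (\<Sum>i\<in>UNIV. (y - x) $ i *\<^sub>R v i)) \<le> e1 * r"
    using Phi_approximately_affine[OF a e1] by blast
  \<comment> \<open>With ratio about \<open>t\<close>, a configuration of radius \<open>D1\<close>
    shrinks so far that its a-blocks stay within \<open>r\<close> of \<open>x\<close>.\<close>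
  define t where "t = r powr (1 / a) / (2 * K * B * D1)"
  have t: "0 < t" using r K_pos B_pos D1 by (simp add: t_def)
  \<comment> \<open>The first bound keeps the moved base point inside the ball; the second makes its
    deviation from \<open>p\<close> negligible in the embedding.\<close>
  define h where "h = min (K * B * t * D1) ((e1 * r) powr (1 / a) / K)"
  have h: "0 < h" using K_pos B_pos t D1 e1 r by (simp add: h_def)
  define p where "p = (x, \<lambda>_::int. 0::nat)"
  have pX: "p \<in> X" by (simp add: p_def)
  obtain g where g: "g \<in> carrier G" "t / B \<le> ratio g" "ratio g \<le> B * t" "d (act g b) p \<le> h"
    using dense_orbits[OF b pX t h] by blast
  have gX: "act g q \<in> X" if "q \<in> X" for q using g that by (intro act_closed)
  define y where "y q = block w a (fst (act g q))" for q
  have Kh: "(K * h) powr a \<le> e1 * r"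
  proof -
    have "K * h \<le> (e1 * r) powr (1 / a)" using K_pos by (simp add: h_def min_def field_simps)
    then have "(K * h) powr a \<le> ((e1 * r) powr (1 / a)) powr a" using a1 K_pos h by (intro powr_mono2) auto
    then show ?thesis using a1 e1 r by (simp add: powr_powr)
  qed
  have near: "norm (y q - x) \<le> r" if q: "q \<in> X" "d b q \<le> D1" for q
  proof -
    have "d (act g q) p \<le> d (act g q) (act g b) + d (act g b) p" by (intro d_tri gX q b pX)
    also have "d (act g q) (act g b) \<le> K * ratio g * d q b" by (rule ratio_quasi(2)[OF g(1) q(1) b])
    also have "\<dots> \<le> K * (B * t) * D1"
      using q(2) g K_pos B_pos t by (intro mult_mono) (auto simp: pdist_commute[of w m q])
    also have "d (act g b) p \<le> K * B * t * D1" using g(4) by (simp add: h_def)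
    finally have dd: "d (act g q) p \<le> 2 * K * B * t * D1" by (simp add: mult_ac)
    have "norm (y q - x) = norm (block w a (fst (act g q) - fst p))"
      by (simp add: y_def p_def block_diff bx)
    also have "\<dots> \<le> d (act g q) p powr a" unfolding k0 by (rule block_le_d)
    also have "\<dots> \<le> (2 * K * B * t * D1) powr a" using dd a1 by (intro powr_mono2) auto
    also have "2 * K * B * t * D1 = r powr (1 / a)" using K_pos B_pos D1 by (simp add: t_def)
    finally show ?thesis using a1 r by (simp add: powr_powr)
  qed
  \<comment> \<open>A moved point may be replaced by its a-block alone. Dropping the lower
    coordinates changes nothing modulo null vectors. The higher coordinates and the m-adic component
    are shared by the slice and lie within \<open>h\<close> of those of \<open>p\<close>.\<close>
  have close: "nrm (Phi a (act g q) - Phi a (y q, \<lambda>_. 0)) \<le> e1 * r" if q: "q \<in> X" "slice a b q" for q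
  proof -
    define q' where "q' = ((\<chi> k. if w k < a then 0 else fst (act g q) $ k), snd (act g q))"
    have q'X: "q' \<in> X" using gX[OF q(1)] by (simp add: q'_def in_product_space)
    have l: "lower a (act g q) q'" by (auto simp: lower_def q'_def)
    have sg: "slice a (act g b) (act g q)" by (rule slice_act[OF g(1) b q(2)])
    have "d q' (y q, \<lambda>_. 0) \<le> d (act g b) p"
    proof -
      have "wdist w (fst q') (y q) \<le> d (act g b) p"
      proof (subst wdist_mono_iff[OF w1], simp, rule ballI)
        fix c assume "c \<in> range w"
        then obtain k1 where k1: "c = w k1" by blast
        show "norm (block w c (fst q' - y q)) \<le> d (act g b) p powr c"
        proof (cases "c \<le> a")
          case True
          then have "block w c (fst q' - y q) = 0" by (auto simp: vec_eq_iff q'_def y_def)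
          then show ?thesis by simp
        next
          case False
          have "fst p $ k = 0" if "w k = c" for k
          proof -
            have "x $ k = block w a x $ k" by (simp add: bx)
            then show ?thesis using that False by (simp add: p_def)
          qed
          then have "block w c (fst q' - y q) = block w c (fst (act g b) - fst p)"
            using False sg by (auto simp: vec_eq_iff q'_def y_def slice_def)
          then show ?thesis unfolding k1 using block_le_d by simp
        qed
      qed
      moreover have "dist_madic m (snd q') (\<lambda>_. 0) \<le> d (act g b) p"
        using sg by (simp add: q'_def slice_def p_def pdist_def)
      ultimately show ?thesis by (simp add: pdist_def)
    qed
    then have "nrm (Phi a q' - Phi a (y q, \<lambda>_. 0)) \<le> (K * h) powr a"
      using g(4) K_pos a1 by (intro order_trans[OF Phi_nrm_le[OF q'X _ a]] powr_mono2 mult_left_mono) auto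
    moreover have "nrm (Phi a (act g q) - Phi a q') = 0" by (rule Phi_lower[OF gX[OF q(1)] q'X a l])
    moreover have "nrm (Phi a (act g q) - Phi a (y q, \<lambda>_. 0)) \<le> nrm (Phi a (act g q) - Phi a q') + nrm (Phi a q' - Phi a (y q, \<lambda>_. 0))"
      by (intro nrm_triangle3 Phi_V a gX q q'X) simp
    ultimately show ?thesis using Kh by linarith
  qed
  have "(y (ps k) - y b) $ i = 0" if "w i \<noteq> a" for k i using that by (simp add: y_def)
  \<comment> \<open>The dependency holds exactly among the a-blocks of the moved points, so the
    linear part of the affine approximation annihilates it and only the errors remain.\<close>
  then obtain l where l: "\<And>k. k < N \<Longrightarrow> \<bar>l k\<bar> \<le> 1" "1 \<le> (\<Sum>k<N. \<bar>l k\<bar>)" "(\<Sum>k<N. l k *\<^sub>R (y (ps k) - y b)) = 0"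
    using block_dependency[of w a "\<lambda>k. y (ps k) - y b"] unfolding N_def[symmetric] by blast
  define A where "A z = (\<Sum>i\<in>UNIV. z $ i *\<^sub>R v i)" for z :: "real^'n"
  have AV: "A z \<in> V" for z using v by (simp add: A_def)
  have err: "nrm (Phi a (act g q) - Phi a (x, \<lambda>_. 0) - A (y q - x)) \<le> 2 * e1 * r"
    if q: "q \<in> X" "slice a b q" "d b q \<le> D1" for q
  proof -
    let ?u = "Phi a (act g q) - Phi a (y q, \<lambda>_. 0)" and ?v = "Phi a (y q, \<lambda>_. 0) - Phi a (x, \<lambda>_. 0) - A (y q - x)"
    have eq: "Phi a (act g q) - Phi a (x, \<lambda>_. 0) - A (y q - x) = ?u + ?v" by simp
    have bl: "block w a (y q) = y q" by (simp add: y_def block_block)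
    have "nrm (?u + ?v) \<le> nrm ?u + nrm ?v"
      by (intro nrm_triangle V_diff Phi_V a AV gX q) auto
    moreover have "nrm ?u \<le> e1 * r" by (rule close[OF q(1,2)])
    moreover have "nrm ?v \<le> e1 * r" unfolding A_def by (rule aff[OF bl near[OF q(1,3)]])
    ultimately show ?thesis unfolding eq by linarith
  qed
  define E where "E q = Phi a (act g q) - Phi a (x, \<lambda>_. 0) - A (y q - x)" for q
  have EV: "E q \<in> V" if "q \<in> X" for q unfolding E_def by (intro V_diff Phi_V a AV gX that) simp
  have lin: "(\<Sum>k<N. l k *\<^sub>R (Phi a (act g (ps k)) - Phi a (act g b))) = (\<Sum>k<N. l k *\<^sub>R (E (ps k) - E b))"
  proof -
    have "(\<Sum>k<N. l k *\<^sub>R A (y (ps k) - y b)) = (\<Sum>k<N. \<Sum>i\<in>UNIV. (l k * (y (ps k) - y b) $ i) *\<^sub>R v i)"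
      unfolding A_def scaleR_sum_right by simp
    also have "\<dots> = (\<Sum>i\<in>UNIV. \<Sum>k<N. (l k * (y (ps k) - y b) $ i) *\<^sub>R v i)" by (rule sum.swap)
    also have "\<dots> = A (\<Sum>k<N. l k *\<^sub>R (y (ps k) - y b))"
      unfolding A_def by (simp add: scaleR_sum_left)
    finally have 0: "(\<Sum>k<N. l k *\<^sub>R A (y (ps k) - y b)) = 0" by (simp add: l(3)) (simp add: A_def)
    have 1: "Phi a (act g (ps k)) - Phi a (act g b) = (E (ps k) - E b) + A (y (ps k) - y b)" for k
      by (simp add: E_def A_def scaleR_left_diff_distrib sum_subtractf)
    show ?thesis unfolding 1 scaleR_add_right sum.distrib 0 by simp
  qed
  have "nrm (\<Sum>k<N. l k *\<^sub>R (E (ps k) - E b)) \<le> (\<Sum>k<N. nrm (l k *\<^sub>R (E (ps k) - E b)))"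
    by (intro nrm_sum_le V_scale V_diff EV ps b)
  also have "\<dots> \<le> (\<Sum>k<N. 4 * e1 * r)"
  proof (rule sum_mono)
    fix k assume "k \<in> {..<N}"
    then have k: "k < N" by simp
    have "nrm (l k *\<^sub>R (E (ps k) - E b)) = \<bar>l k\<bar> * nrm (E (ps k) - E b)"
      by (intro nrm_scale V_diff EV ps b)
    also have "\<dots> \<le> 1 * nrm (E (ps k) - E b)"
      using l(1)[OF k] by (intro mult_right_mono nrm_nonneg V_diff EV ps b)
    also have "\<dots> \<le> nrm (E (ps k)) + nrm (E b)"
      using nrm_triangle_diff[OF EV[OF ps(1)] EV[OF b]] by simp
    also have "\<dots> \<le> 2 * e1 * r + 2 * e1 * r"
      unfolding E_def using D1 by (intro add_mono err ps b dD1 k) auto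
    finally show "nrm (l k *\<^sub>R (E (ps k) - E b)) \<le> 4 * e1 * r" by simp
  qed
  finally have small: "nrm (\<Sum>k<N. l k *\<^sub>R (Phi a (act g (ps k)) - Phi a (act g b))) \<le> 4 * real N * e1 * r"
    unfolding lin by simp
  define u where "u = (\<Sum>k<N. l k *\<^sub>R (Phi a (ps k) - Phi a b))"
  define u' where "u' = (\<Sum>k<N. l k *\<^sub>R (Phi a (act g (ps k)) - Phi a (act g b)))"
  have uV: "u \<in> V" unfolding u_def by (intro V_sum V_scale V_diff Phi_V a ps b)
  have u'V: "u' \<in> V" unfolding u'_def by (intro V_sum V_scale V_diff Phi_V a gX ps b)
  \<comment> \<open>Back to the original configuration: translation is isometric, so the combination
    is only scaled, by \<open>ratio g powr a\<close>.\<close>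
  have "u' h = (ratio g powr a *\<^sub>R trans g u) h" if "h \<in> carrier G" for h
    using Phi_act[OF g(1) that ps(1) b, of a]
    unfolding u_def u'_def trans_def by (simp add: sum_fun_apply scaleR_sum_right del: minus_apply) (simp add: mult.commute)
  then have "nrm (u' - ratio g powr a *\<^sub>R trans g u) = 0"
    by (intro null_cong u'V V_scale trans_V g uV)
  then have "nrm u' = ratio g powr a * nrm u"
    using nrm_null_eq[OF u'V V_scale[OF trans_V[OF g(1) uV]]] trans_V[OF g(1) uV]
    by (simp add: nrm_scale) (simp add: nrm_def trans_ip g uV)
  then have "ratio g powr a * nrm u \<le> 4 * real N * e1 * r" using small by (simp add: u'_def)
  moreover have "r / Q \<le> ratio g powr a"
  proof -
    have "r / Q = (t / B) powr a"
      using K_pos B_pos D1 r a1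
      by (simp add: t_def Q_def powr_divide powr_mult powr_powr power2_eq_square mult_ac)
    also have "\<dots> \<le> ratio g powr a" using g t B_pos a1 by (intro powr_mono2) auto
    finally show ?thesis .
  qed
  ultimately have "r / Q * nrm u \<le> 4 * real N * e1 * r"
    using mult_right_mono[of "r / Q" "ratio g powr a" "nrm u"] uV by simp
  then have "nrm u \<le> 4 * real N * e1 * Q" using r Q by (simp add: field_simps)
  also have "\<dots> = e" using Q N0 by (simp add: e1_def)
  finally show "\<exists>l. (\<forall>k<N. \<bar>l k\<bar> \<le> 1) \<and> 1 \<le> (\<Sum>k<N. \<bar>l k\<bar>) \<and> nrm (\<Sum>k<N. l k *\<^sub>R (Phi a (ps k) - Phi a b)) \<le> e"
    using l(1,2) unfolding u_def by blast
qed

end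

section \<open>The flat spanned by a slice\<close>

text \<open>The image is open by invariance of domain and closed by properness, and a subspace is
  connected.\<close>

lemma proper_injective_onto:
  fixes f :: "'a::euclidean_space \<Rightarrow> 'a"
  assumes U: "subspace U" and f: "continuous_on U f" "inj_on f U" "f ` U \<subseteq> U"
    and proper: "\<And>r. bounded {x \<in> U. norm (f x) \<le> r}"
  shows "f ` U = U"
proof -
  have clU: "closed U" by (rule closed_subspace[OF U])
  have "openin (top_of_set U) (f ` U)"
    using f U by (intro invariance_of_domain_subspaces[where U = U]) auto
  moreover have "closed (f ` U)"
    unfolding closed_sequential_limits
  proof (intro allI impI, elim conjE)
    fix y l assume y: "\<forall>n. y n \<in> f ` U" and l: "y \<longlonglongrightarrow> l"
    from y have "\<forall>n. \<exists>x. x \<in> U \<and> y n = f x" by blast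
    then obtain x where x: "\<And>n. x n \<in> U" "\<And>n. y n = f (x n)" by metis
    obtain r where r: "\<And>n. norm (y n) \<le> r"
      using convergent_imp_bounded[OF l] by (auto simp: bounded_iff)
    define S where "S = closure {x \<in> U. norm (f x) \<le> r}"
    have "seq_compact S"
      using proper[of r] unfolding S_def by (intro compact_imp_seq_compact) (simp add: compact_closure)
    moreover have "x n \<in> S" for n
      using x r closure_subset[of "{x \<in> U. norm (f x) \<le> r}"] by (auto simp: S_def)
    ultimately obtain x' \<rho> where \<rho>: "strict_mono (\<rho> :: nat \<Rightarrow> nat)" "(x \<circ> \<rho>) \<longlonglongrightarrow> x'"
      by (elim seq_compactE[where f = x]) auto
    have x'U: "x' \<in> U"
      by (rule closed_sequentially[OF clU _ \<rho>(2)]) (simp add: x)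
    have "(f \<circ> (x \<circ> \<rho>)) \<longlonglongrightarrow> f x'"
      using continuous_on_tendsto_compose[OF f(1) \<rho>(2) x'U] x(1) by (simp add: o_def)
    moreover have "(f \<circ> (x \<circ> \<rho>)) \<longlonglongrightarrow> l"
      using LIMSEQ_subseq_LIMSEQ[OF l \<rho>(1)] x(2) by (simp add: o_def)
    ultimately have "l = f x'" using LIMSEQ_unique by blast
    then show "l \<in> f ` U" using x'U by blast
  qed
  then have "closedin (top_of_set U) (f ` U)" using f(3) by (intro closed_subset) auto
  moreover have "connected U" by (intro convex_connected subspace_imp_convex U)
  moreover have "f ` U \<noteq> {}" using subspace_0[OF U] by auto
  ultimately show ?thesis using connected_clopen by blast
qed

context semi_inner
begin

lemma nrm_fixed:
  assumes "orthonormal u J" "v \<in> V" "nrm (v - proj u J v) = 0"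
  shows "(nrm v)\<^sup>2 = (\<Sum>j\<in>J. (ip v (u j))\<^sup>2)"
  using nrm_null_eq[OF assms(2) proj_V[OF assms(1)] assms(3)] nrm_proj[OF assms(1,2)] by simp

lemma nrm_minus_proj_le:
  assumes "orthonormal u J" "v \<in> V" shows "nrm (v - proj u J v) \<le> 2 * nrm v"
  using nrm_triangle_diff[OF assms(2) proj_V[OF assms(1)], of v] nrm_proj_le[OF assms] by simp

text \<open>Because \<open>u'\<close> lies in the span of \<open>u\<close>, projecting to
  \<open>u'\<close> factors through the projection to \<open>u\<close>, and projections do not
  increase the seminorm.\<close>

lemma proj_contained:
  assumes u: "orthonormal u J" and u': "orthonormal u' J"
    and fx: "\<And>j. j \<in> J \<Longrightarrow> nrm (u' j - proj u J (u' j)) = 0" and v: "v \<in> V"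
  shows "(\<Sum>j\<in>J. (ip v (u' j))\<^sup>2) \<le> (\<Sum>j\<in>J. (ip v (u j))\<^sup>2)"
proof -
  have u'V: "u' j \<in> V" if "j \<in> J" for j using u' that by (simp add: orthonormal_def)
  have "ip v (u' j) = ip (proj u J v) (u' j)" if "j \<in> J" for j
    using proj_orthogonal[OF u v u'V[OF that] fx[OF that]] ip_diff[OF v proj_V[OF u] u'V[OF that], of v] by simp
  then have "(\<Sum>j\<in>J. (ip v (u' j))\<^sup>2) = (nrm (proj u' J (proj u J v)))\<^sup>2"
    by (simp add: nrm_proj[OF u' proj_V[OF u]])
  also have "\<dots> \<le> (nrm (proj u J v))\<^sup>2"
    by (intro power_mono nrm_proj_le u' proj_V u nrm_nonneg)
  finally show ?thesis by (simp add: nrm_proj[OF u v])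
qed

end

context block_action
begin

definition dirs :: "real \<Rightarrow> 'n point \<Rightarrow> ('g \<Rightarrow> real^'n) set" where
  "dirs a b = {Phi a p - Phi a b |p. p \<in> X \<and> slice a b p}"

lemma dirs_I: "p \<in> X \<Longrightarrow> slice a b p \<Longrightarrow> Phi a p - Phi a b \<in> dirs a b"
  unfolding dirs_def by blast

text \<open>An orthonormal basis, modulo null vectors, of the directions of one slice. The condition
  on \<open>J\<close> makes frame coordinates into vectors of the a-block.\<close>

definition slice_frame :: "real \<Rightarrow> 'n point \<Rightarrow> ('n \<Rightarrow> 'g \<Rightarrow> real^'n) \<Rightarrow> 'n set \<Rightarrow> bool" where
  "slice_frame a b u J \<longleftrightarrow> J \<subseteq> {i. w i = a} \<and> orthonormal u J \<and> (\<forall>j\<in>J. u j \<in> span (dirs a b)) \<and>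
     (\<forall>z\<in>dirs a b. nrm (z - proj u J z) = 0)"

lemma dirs_V: "\<lbrakk>a \<in> range w; b \<in> X\<rbrakk> \<Longrightarrow> dirs a b \<subseteq> V"
  by (auto simp: dirs_def intro!: V_diff Phi_V)

lemma exists_slice_frame:
  assumes a: "a \<in> range w" and b: "b \<in> X"
  shows "\<exists>u J. slice_frame a b u J"
proof -
  have "\<exists>l. (\<exists>k\<le>card {i. w i = a}. l k \<noteq> 0) \<and> nrm (\<Sum>k\<le>card {i. w i = a}. l k *\<^sub>R z k) = 0"
    if z: "\<And>k::nat. z k \<in> dirs a b" for z
  proof -
    have "\<exists>p. p \<in> X \<and> slice a b p \<and> z k = Phi a p - Phi a b" for k
      using z[of k] unfolding dirs_def by blast
    then obtain p where p: "\<And>k. p k \<in> X" "\<And>k. slice a b (p k)" "\<And>k. z k = Phi a (p k) - Phi a b" by metis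
    have "z = (\<lambda>k. Phi a (p k) - Phi a b)" using p(3) by blast
    then show ?thesis
      using slice_flat[OF a b p(1,2)] unfolding lessThan_Suc_atMost less_Suc_eq_le by simp
  qed
  from exists_orthonormal[of "{i. w i = a}" "dirs a b", OF _ dirs_V[OF a b] this]
  show ?thesis unfolding slice_frame_def by auto
qed

text \<open>Varying only the a-block of the base point, the frame coordinates become a biLipschitz
  map of the block space into itself, hence onto. The image of a slice thus fills its flat and is
  not merely contained in it.\<close>

lemma slice_onto:
  assumes a: "a \<in> range w" and b: "b \<in> X" and fr: "slice_frame a b u J"
  shows "\<exists>p\<in>X. slice a b p \<and> (\<forall>j\<in>J. ip (Phi a p - Phi a b) (u j) = t j)"
proof -
  define U where "U = {x::real^'n. block w a x = x}"
  define P where "P x = (fst b + x, snd b)" for x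
  define f where "f x = (\<chi> j. if j \<in> J then ip (Phi a (P x) - Phi a b) (u j) else 0)" for x
  have a1: "1 \<le> a" using a w1 by auto
  have J: "J \<subseteq> {i. w i = a}" and on: "orthonormal u J" and fixd: "\<And>z. z \<in> dirs a b \<Longrightarrow> nrm (z - proj u J z) = 0"
    using fr by (auto simp: slice_frame_def)
  have uV: "u j \<in> V" if "j \<in> J" for j using on that by (simp add: orthonormal_def)
  have PX: "P x \<in> X" for x using b by (simp add: P_def in_product_space)
  have Usupp: "x $ k = 0" if "x \<in> U" "w k \<noteq> a" for x k
  proof -
    have "x $ k = block w a x $ k" using that by (simp add: U_def)
    then show ?thesis using that by simp
  qed
  have sl: "slice a b (P x)" if "x \<in> U" for x
    using that by (auto simp: slice_def P_def Usupp)
  have subU: "subspace U" by (rule subspaceI) (auto simp: U_def block_add block_scale)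
  have fU: "f x \<in> U" for x using J by (auto simp: f_def U_def vec_eq_iff)
  \<comment> \<open>Differences of directions have null residual, so their frame coordinates carry
    the whole seminorm.\<close>
  have iso: "norm (f x - f y) = nrm (Phi a (P x) - Phi a (P y))" if xy: "x \<in> U" "y \<in> U" for x y
  proof -
    let ?zx = "Phi a (P x) - Phi a b" and ?zy = "Phi a (P y) - Phi a b"
    have z: "?zx \<in> dirs a b" "?zy \<in> dirs a b" using sl PX xy by (auto intro: dirs_I)
    then have "?zx - ?zy \<in> span (dirs a b)" by (intro span_diff span_base)
    then have n0: "nrm ((?zx - ?zy) - proj u J (?zx - ?zy)) = 0"
      by (intro span_fixed[OF on dirs_V[OF a b] fixd])
    have "(nrm (?zx - ?zy))\<^sup>2 = (\<Sum>j\<in>J. (ip (?zx - ?zy) (u j))\<^sup>2)"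
      by (rule nrm_fixed[OF on _ n0]) (intro V_diff Phi_V a PX b)
    also have "\<dots> = (\<Sum>j\<in>J. ((f x - f y) $ j)\<^sup>2)"
      by (intro sum.cong) (auto simp: f_def ip_diff Phi_V[OF PX a] Phi_V[OF b a] uV)
    also have "\<dots> = (\<Sum>j\<in>UNIV. ((f x - f y) $ j)\<^sup>2)"
      by (rule sum.mono_neutral_left) (auto simp: f_def)
    also have "\<dots> = (norm (f x - f y))\<^sup>2"
      unfolding power2_norm_eq_inner inner_vec_def by (simp add: power2_eq_square)
    finally have "(norm (f x - f y))\<^sup>2 = (nrm (?zx - ?zy))\<^sup>2" by simp
    then have "norm (f x - f y) = nrm (?zx - ?zy)"
      by (rule power2_eq_imp_eq) (intro norm_ge_zero nrm_nonneg V_diff Phi_V a PX b)+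
    then show ?thesis by simp
  qed
  have low: "norm (x - y) \<le> K powr a * norm (f x - f y)" if xy: "x \<in> U" "y \<in> U" for x y
  proof -
    have "block w a (fst (P x) - fst (P y)) = x - y" using xy by (simp add: P_def U_def block_diff block_add)
    moreover have "slice a (P x) (P y)" using sl xy slice_trans slice_sym by blast
    ultimately show ?thesis using Phi_nrm_ge[OF PX PX a, of x y] iso[OF xy] by simp
  qed
  have up: "norm (f x - f y) \<le> K powr a * norm (x - y)" if xy: "x \<in> U" "y \<in> U" for x y
  proof -
    have "d (P x) (P y) \<le> norm (x - y) powr (1 / a)"
    proof -
      have "wdist w (fst b + x) (fst b + y) \<le> norm (x - y) powr (1 / a)"
      proof (subst wdist_mono_iff[OF w1], simp, rule ballI)
        fix c
        have e: "x - y = block w a (x - y)" using xy by (simp add: U_def block_diff)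
        have "block w c (x - y) = (if c = a then block w c (x - y) else 0)"
          using arg_cong[OF e, of "block w c"] unfolding block_block .
        then show "norm (block w c (fst b + x - (fst b + y))) \<le> (norm (x - y) powr (1 / a)) powr c"
          using a1 norm_block_le[of w a "x - y"] by (simp add: powr_powr split: if_splits)
      qed
      then show ?thesis by (simp add: pdist_def P_def)
    qed
    then have "(K * d (P x) (P y)) powr a \<le> (K * norm (x - y) powr (1 / a)) powr a"
      using a1 K_pos by (intro powr_mono2 mult_left_mono) auto
    also have "\<dots> = K powr a * norm (x - y)" using a1 by (simp add: powr_mult powr_powr)
    finally show ?thesis using Phi_nrm_le[OF PX PX a, of x y] iso[OF xy] by simp
  qed
  have "f ` U = U"
  proof (rule proper_injective_onto[OF subU])
    have "(K powr a)-lipschitz_on U f"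
      using up by (auto intro!: lipschitz_onI simp: dist_norm)
    then show "continuous_on U f" by (rule lipschitz_on_continuous_on)
    show "inj_on f U"
    proof (rule inj_onI)
      fix x y assume "x \<in> U" "y \<in> U" "f x = f y"
      then show "x = y" using low[of x y] by simp
    qed
    show "f ` U \<subseteq> U" using fU by auto
    fix r
    show "bounded {x \<in> U. norm (f x) \<le> r}"
    proof (rule boundedI[where B = "K powr a * (r + norm (f 0))"])
      fix x assume "x \<in> {x \<in> U. norm (f x) \<le> r}"
      then have x: "x \<in> U" "norm (f x) \<le> r" by auto
      have "norm (f x - f 0) \<le> r + norm (f 0)" using x(2) norm_triangle_ineq4[of "f x" "f 0"] by linarith
      then have "K powr a * norm (f x - f 0) \<le> K powr a * (r + norm (f 0))" by (intro mult_left_mono) auto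
      then show "norm x \<le> K powr a * (r + norm (f 0))" using low[OF x(1) subspace_0[OF subU]] by simp
    qed
  qed
  moreover have "(\<chi> j. if j \<in> J then t j else 0) \<in> U" using J by (auto simp: U_def vec_eq_iff)
  ultimately have "(\<chi> j. if j \<in> J then t j else 0) \<in> f ` U" by simp
  then obtain x where x: "x \<in> U" "(\<chi> j. if j \<in> J then t j else 0) = f x" by blast
  then have "\<forall>j\<in>J. ip (Phi a (P x) - Phi a b) (u j) = t j"
    by (auto simp: f_def vec_eq_iff split: if_splits)
  then show ?thesis using PX sl x(1) by blast
qed

text \<open>Two slices stay at bounded distance in the embedding, so the affine spaces they fill are
  parallel.\<close>

lemma slices_parallel:
  assumes a: "a \<in> range w" and b: "b \<in> X" and b': "b' \<in> X" and fr: "slice_frame a b u J" and z: "z \<in> dirs a b'"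
  shows "nrm (z - proj u J z) = 0"
proof -
  obtain u' J' where fr': "slice_frame a b' u' J'" using exists_slice_frame[OF a b'] by blast
  have on: "orthonormal u J" and on': "orthonormal u' J'" and fixd: "\<And>z. z \<in> dirs a b \<Longrightarrow> nrm (z - proj u J z) = 0"
    and fixd': "\<And>z. z \<in> dirs a b' \<Longrightarrow> nrm (z - proj u' J' z) = 0"
    using fr fr' by (auto simp: slice_frame_def)
  have zV: "z \<in> V" using z dirs_V[OF a b'] by blast
  have a1: "1 \<le> a" using a w1 by auto
  define C where "C = (K * d b' b) powr a + nrm (Phi a b' - Phi a b)"
  have bound: "real n * nrm (z - proj u J z) \<le> 2 * C" for n :: nat
  proof -
    \<comment> \<open>Since the slice fills its flat, some point of it realises \<open>n\<close>
      times the given direction. Any deviation of \<open>z\<close> from the flat of \<open>b\<close>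
      is magnified by \<open>n\<close> as well.\<close>
    obtain p where p: "p \<in> X" "slice a b' p" "\<And>j. j \<in> J' \<Longrightarrow> ip (Phi a p - Phi a b') (u' j) = real n * ip z (u' j)"
      using slice_onto[OF a b' fr', of "\<lambda>j. real n * ip z (u' j)"] by blast
    define y where "y = (Phi a p - Phi a b') - real n *\<^sub>R z"
    have zp: "Phi a p - Phi a b' \<in> dirs a b'" using p(1,2) by (rule dirs_I)
    have zpV: "Phi a p - Phi a b' \<in> V" using zp dirs_V[OF a b'] by blast
    have yV: "y \<in> V" unfolding y_def by (rule V_diff[OF zpV V_scale[OF zV]])
    have "y \<in> span (dirs a b')" unfolding y_def by (rule span_diff[OF span_base[OF zp] span_scale[OF span_base[OF z]]])
    then have fy: "nrm (y - proj u' J' y) = 0" by (intro span_fixed[OF on' dirs_V[OF a b'] fixd'])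
    have "ip y (u' j) = 0" if "j \<in> J'" for j
    proof -
      have "u' j \<in> V" using on' that by (simp add: orthonormal_def)
      then show ?thesis unfolding y_def using zpV zV p(3)[OF that] p(1) b' a by (simp add: ip_diff ip_scale Phi_V)
    qed
    then have ny: "nrm y = 0" using nrm_fixed[OF on' yV fy] by simp
    \<comment> \<open>\<open>q\<close> carries the a-block of \<open>p\<close> over to the slice of
      \<open>b\<close>, and \<open>p'\<close> changes \<open>p\<close> only in lower coordinates.
      They differ only where \<open>b'\<close> and \<open>b\<close> differ, so their distance is
      bounded independently of \<open>n\<close>.\<close>
    define q where "q = ((\<chi> k. if w k = a then fst p $ k else fst b $ k), snd b)"
    define p' where "p' = ((\<chi> k. if w k < a then fst b $ k else fst p $ k), snd b')"
    have qX: "q \<in> X" using b by (simp add: q_def in_product_space)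
    have p'X: "p' \<in> X" using b' by (simp add: p'_def in_product_space)
    have slq: "slice a b q" by (auto simp: slice_def q_def)
    have lp: "lower a p p'" using p(2) by (auto simp: lower_def p'_def slice_def)
    have "d p' q \<le> d b' b"
    proof -
      have "wdist w (fst p') (fst q) \<le> d b' b"
      proof (subst wdist_mono_iff[OF w1], simp, rule ballI)
        fix c assume "c \<in> range w"
        then obtain k1 where k1: "c = w k1" by blast
        show "norm (block w c (fst p' - fst q)) \<le> d b' b powr c"
        proof (cases "c \<le> a")
          case True
          then have "block w c (fst p' - fst q) = 0" by (auto simp: vec_eq_iff q_def p'_def)
          then show ?thesis by simp
        next
          case False
          then have "block w c (fst p' - fst q) = block w c (fst b' - fst b)"
            using p(2) by (auto simp: vec_eq_iff q_def p'_def slice_def)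
          then show ?thesis unfolding k1 using block_le_d by simp
        qed
      qed
      then show ?thesis by (simp add: pdist_def p'_def q_def)
    qed
    then have "nrm (Phi a p' - Phi a q) \<le> (K * d b' b) powr a"
      using K_pos a1 by (intro order_trans[OF Phi_nrm_le[OF p'X qX a]] powr_mono2 mult_left_mono) auto
    moreover have "nrm (Phi a p - Phi a p') = 0" by (rule Phi_lower[OF p(1) p'X a lp])
    moreover have "nrm (Phi a p - Phi a q) \<le> nrm (Phi a p - Phi a p') + nrm (Phi a p' - Phi a q)"
      by (intro nrm_triangle3 Phi_V a p p'X qX)
    ultimately have pq: "nrm (Phi a p - Phi a q) \<le> (K * d b' b) powr a" by linarith
    define zq where "zq = Phi a q - Phi a b"
    have zq: "zq \<in> dirs a b" using qX slq unfolding zq_def by (rule dirs_I)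
    have zqV: "zq \<in> V" using zq dirs_V[OF a b] by blast
    define r where "r = real n *\<^sub>R z - zq"
    have rV: "r \<in> V" unfolding r_def using zV zqV by (intro V_diff V_scale)
    have "nrm r \<le> C"
    proof -
      let ?s = "Phi a p - Phi a q" and ?t = "Phi a b' - Phi a b"
      have sV: "?s \<in> V" "?t \<in> V" by (intro V_diff Phi_V a p qX b b')+
      have r: "r = (?s - ?t) - y" by (simp add: r_def y_def zq_def)
      have "nrm ((?s - ?t) - y) \<le> nrm (?s - ?t) + nrm y" by (intro nrm_triangle_diff V_diff[OF sV] yV)
      moreover have "nrm (?s - ?t) \<le> nrm ?s + nrm ?t" by (rule nrm_triangle_diff[OF sV])
      ultimately show ?thesis unfolding r C_def using pq ny by linarith
    qed
    moreover have "nrm (real n *\<^sub>R (z - proj u J z)) \<le> 2 * nrm r"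
    proof -
      let ?e = "zq - proj u J zq" and ?f = "r - proj u J r"
      have eV: "?e \<in> V" "?f \<in> V" by (intro V_diff zqV rV proj_V on)+
      have "proj u J (real n *\<^sub>R z - zq) = real n *\<^sub>R proj u J z - proj u J zq"
        using proj_diff[OF on V_scale[OF zV] zqV] proj_scale[OF on zV] by simp
      then have eq: "real n *\<^sub>R (z - proj u J z) = ?e + ?f"
        by (simp add: r_def scaleR_diff_right)
      have "nrm (?e + ?f) \<le> nrm ?e + nrm ?f" by (rule nrm_triangle[OF eV])
      moreover have "nrm ?e = 0" by (rule fixd[OF zq])
      moreover have "nrm ?f \<le> 2 * nrm r" by (rule nrm_minus_proj_le[OF on rV])
      ultimately show ?thesis unfolding eq by linarith
    qed
    moreover have "nrm (real n *\<^sub>R (z - proj u J z)) = real n * nrm (z - proj u J z)"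
      using nrm_scale[OF V_diff[OF zV proj_V[OF on, of z]], of "real n"] by simp
    ultimately show ?thesis by linarith
  qed
  have nn: "0 \<le> nrm (z - proj u J z)" by (intro nrm_nonneg V_diff zV proj_V on)
  show ?thesis
  proof (rule ccontr)
    assume "nrm (z - proj u J z) \<noteq> 0"
    then have "0 < nrm (z - proj u J z)" using nn by simp
    then obtain n :: nat where "2 * C < real n * nrm (z - proj u J z)" using reals_Archimedean3 by blast
    then show False using bound[of n] by simp
  qed
qed

text \<open>The action permutes the slices, and translation carries the directions of one slice to
  multiples of those of another. As all slices are parallel, the direction space is invariant under
  translation.\<close>

lemma trans_frame:
  assumes a: "a \<in> range w" and fr: "slice_frame a org u J" and g: "g \<in> carrier G" and j: "j \<in> J"
  shows "nrm (trans g (u j) - proj u J (trans g (u j))) = 0"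
proof -
  have on: "orthonormal u J" and us: "u j \<in> span (dirs a org)" using fr j by (auto simp: slice_frame_def)
  have oX: "org \<in> X" by simp
  have goX: "act g org \<in> X" using g by (intro act_closed) auto
  define Z where "Z = trans g ` dirs a org"
  have ZV: "Z \<subseteq> V" unfolding Z_def using dirs_V[OF a oX] trans_V[OF g] by auto
  have fixZ: "nrm (z - proj u J z) = 0" if zZ: "z \<in> Z" for z
  proof -
    obtain f where f: "f \<in> dirs a org" "z = trans g f" using zZ unfolding Z_def by blast
    obtain p where p: "p \<in> X" "slice a org p" "z = trans g (Phi a p - Phi a org)"
      using f unfolding dirs_def by blast
    have gp: "act g p \<in> X" using g p by (intro act_closed)
    define y where "y = Phi a (act g p) - Phi a (act g org)"
    have yd: "y \<in> dirs a (act g org)" unfolding y_def by (rule dirs_I[OF gp slice_act[OF g oX p(2)]])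
    have yV: "y \<in> V" using yd dirs_V[OF a goX] by blast
    have zV: "z \<in> V" using zZ ZV by blast
    define c where "c = 1 / ratio g powr a"
    have "(c *\<^sub>R y) h = z h" if "h \<in> carrier G" for h
      using Phi_act[OF g that p(1) oX, of a] by (simp add: y_def p(3) c_def del: minus_apply)
    then have n: "nrm (z - c *\<^sub>R y) = 0" by (intro null_cong V_scale zV yV) simp
    have fy: "nrm (y - proj u J y) = 0" by (rule slices_parallel[OF a oX goX fr yd])
    let ?n = "z - c *\<^sub>R y"
    have nV: "?n \<in> V" by (intro V_diff V_scale zV yV)
    have pz: "proj u J z = proj u J ?n + c *\<^sub>R proj u J y"
      using proj_diff[OF on zV V_scale[OF yV], of c] proj_scale[OF on yV, of c] by simp
    have eq: "z - proj u J z = (?n - proj u J ?n) + c *\<^sub>R (y - proj u J y)"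
      unfolding pz by (simp add: scaleR_diff_right)
    have "nrm ((?n - proj u J ?n) + c *\<^sub>R (y - proj u J y)) \<le> nrm (?n - proj u J ?n) + nrm (c *\<^sub>R (y - proj u J y))"
      by (intro nrm_triangle V_diff V_scale nV yV proj_V on)
    moreover have "nrm (?n - proj u J ?n) \<le> 2 * nrm ?n" by (rule nrm_minus_proj_le[OF on nV])
    moreover have "nrm (c *\<^sub>R (y - proj u J y)) = \<bar>c\<bar> * nrm (y - proj u J y)"
      by (intro nrm_scale V_diff yV proj_V on)
    ultimately have "nrm (z - proj u J z) \<le> 0" unfolding eq using n fy by simp
    then show ?thesis using nrm_nonneg[OF V_diff[OF zV proj_V[OF on, of z]]] by simp
  qed
  have "trans g (u j) \<in> span Z"
  proof -
    have "u j \<in> {f. trans g f \<in> span Z}"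
    proof (rule subsetD[OF span_minimal us])
      show "dirs a org \<subseteq> {f. trans g f \<in> span Z}" by (auto simp: Z_def intro: span_base)
      show "subspace {f. trans g f \<in> span Z}"
        by (rule subspaceI) (auto simp: trans_linear span_zero span_add span_scale)
    qed
    then show ?thesis by simp
  qed
  then show ?thesis by (intro span_fixed[OF on ZV fixZ])
qed

text \<open>The frame coordinates of \<open>Phi\<close>. Along a slice the projection loses nothing,
  so the lower bound of the embedding passes to these coordinates.\<close>

lemma exists_block_similarity:
  assumes a: "a \<in> range w"
  shows "\<exists>\<psi> :: 'n point \<Rightarrow> real^'n. (\<forall>p\<in>X. block w a (\<psi> p) = \<psi> p) \<and>
    (\<forall>p\<in>X. \<forall>q\<in>X. norm (\<psi> p - \<psi> q) \<le> (K * d p q) powr a) \<and>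
    (\<forall>p\<in>X. \<forall>q\<in>X. slice a p q \<longrightarrow> norm (block w a (fst p - fst q)) \<le> K powr a * norm (\<psi> p - \<psi> q)) \<and>
    (\<forall>g\<in>carrier G. \<forall>p\<in>X. \<forall>q\<in>X. norm (\<psi> (act g p) - \<psi> (act g q)) = ratio g powr a * norm (\<psi> p - \<psi> q))"
proof -
  have oX: "org \<in> X" by simp
  obtain u J where fr: "slice_frame a org u J" using exists_slice_frame[OF a oX] by blast
  have J: "J \<subseteq> {i. w i = a}" and on: "orthonormal u J" using fr by (auto simp: slice_frame_def)
  have uV: "u j \<in> V" if "j \<in> J" for j using on that by (simp add: orthonormal_def)
  define \<psi> where "\<psi> p = (\<chi> j. if j \<in> J then ip (Phi a p) (u j) else 0)" for p
  have nsq: "(norm (\<psi> p - \<psi> q))\<^sup>2 = (\<Sum>j\<in>J. (ip (Phi a p - Phi a q) (u j))\<^sup>2)" if pq: "p \<in> X" "q \<in> X" for p q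
  proof -
    have "(norm (\<psi> p - \<psi> q))\<^sup>2 = (\<Sum>j\<in>UNIV. ((\<psi> p - \<psi> q) $ j)\<^sup>2)"
      unfolding power2_norm_eq_inner inner_vec_def by (simp add: power2_eq_square)
    also have "\<dots> = (\<Sum>j\<in>J. ((\<psi> p - \<psi> q) $ j)\<^sup>2)"
      by (rule sum.mono_neutral_right) (auto simp: \<psi>_def)
    also have "\<dots> = (\<Sum>j\<in>J. (ip (Phi a p - Phi a q) (u j))\<^sup>2)"
      using pq uV a by (intro sum.cong) (auto simp: \<psi>_def ip_diff Phi_V)
    finally show ?thesis .
  qed
  have npr: "norm (\<psi> p - \<psi> q) = nrm (proj u J (Phi a p - Phi a q))" if pq: "p \<in> X" "q \<in> X" for p q
  proof (rule power2_eq_imp_eq)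
    show "(norm (\<psi> p - \<psi> q))\<^sup>2 = (nrm (proj u J (Phi a p - Phi a q)))\<^sup>2"
      unfolding nsq[OF pq] by (rule nrm_proj[OF on V_diff[OF Phi_V[OF pq(1) a] Phi_V[OF pq(2) a]], symmetric])
  qed (intro norm_ge_zero nrm_nonneg proj_V on)+
  have le: "norm (\<psi> p - \<psi> q) \<le> nrm (Phi a p - Phi a q)" if pq: "p \<in> X" "q \<in> X" for p q
    unfolding npr[OF pq] using pq a by (intro nrm_proj_le on) (auto simp: Phi_V)
  \<comment> \<open>The translated frame is an orthonormal family inside the direction space, so its
    coefficients are dominated by those of the frame itself. The reverse inequality is this one for
    the inverse element.\<close>
  have half: "ratio g powr a * norm (\<psi> p - \<psi> q) \<le> norm (\<psi> (act g p) - \<psi> (act g q))"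
    if g: "g \<in> carrier G" and pq: "p \<in> X" "q \<in> X" for g p q
  proof -
    have gX: "act g p \<in> X" "act g q \<in> X" using g pq by (auto intro: act_closed)
    let ?v = "Phi a p - Phi a q" and ?v' = "Phi a (act g p) - Phi a (act g q)" and ?c = "ratio g powr a"
    have vV: "?v \<in> V" "?v' \<in> V" by (intro V_diff Phi_V a pq gX)+
    have on': "orthonormal (\<lambda>j. trans g (u j)) J"
      using on g by (auto simp: orthonormal_def trans_V trans_ip)
    have e: "ip ?v' (trans g (u j)) = ?c * ip ?v (u j)" if "j \<in> J" for j
    proof -
      have tV: "trans g (u j) \<in> V" "trans g ?v \<in> V" using g uV[OF that] vV by (auto intro: trans_V)
      have "ip ?v' (trans g (u j)) = ip (?c *\<^sub>R trans g ?v) (trans g (u j))"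
        using Phi_act[OF g _ pq, of _ a] by (intro ip_cong vV V_scale tV) (simp del: minus_apply)
      also have "\<dots> = ?c * ip ?v (u j)" using tV g uV[OF that] vV by (simp add: ip_scale trans_ip)
      finally show ?thesis .
    qed
    have "(?c * norm (\<psi> p - \<psi> q))\<^sup>2 = (\<Sum>j\<in>J. (ip ?v' (trans g (u j)))\<^sup>2)"
      by (simp add: e power_mult_distrib nsq[OF pq] sum_distrib_left)
    also have "\<dots> \<le> (\<Sum>j\<in>J. (ip ?v' (u j))\<^sup>2)"
      by (rule proj_contained[OF on on' trans_frame[OF a fr g] vV(2)])
    also have "\<dots> = (norm (\<psi> (act g p) - \<psi> (act g q)))\<^sup>2" by (simp add: nsq[OF gX])
    finally show ?thesis by (rule power2_le_imp_le) simp
  qed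
  have full: "norm (\<psi> (act g p) - \<psi> (act g q)) = ratio g powr a * norm (\<psi> p - \<psi> q)"
    if g: "g \<in> carrier G" and pq: "p \<in> X" "q \<in> X" for g p q
  proof (rule antisym[OF _ half[OF g pq]])
    have gX: "act g p \<in> X" "act g q \<in> X" using g pq by (auto intro: act_closed)
    have "ratio (inv g) powr a * norm (\<psi> (act g p) - \<psi> (act g q)) \<le> norm (\<psi> p - \<psi> q)"
      using half[OF inv_closed[OF g] gX] g pq by (simp add: act_inv)
    then show "norm (\<psi> (act g p) - \<psi> (act g q)) \<le> ratio g powr a * norm (\<psi> p - \<psi> q)"
      using g by (simp add: ratio_inv powr_divide divide_le_eq mult.commute)
  qed
  have fixd: "nrm (Phi a p - Phi a q) = norm (\<psi> p - \<psi> q)" if pq: "p \<in> X" "q \<in> X" "slice a p q" for p q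
  proof -
    have "Phi a p - Phi a q \<in> dirs a q" by (rule dirs_I[OF pq(1) slice_sym[OF pq(3)]])
    then have "nrm ((Phi a p - Phi a q) - proj u J (Phi a p - Phi a q)) = 0"
      by (rule slices_parallel[OF a oX pq(2) fr])
    then show ?thesis unfolding npr[OF pq(1,2)] by (intro nrm_null_eq V_diff Phi_V pq a proj_V on)
  qed
  show ?thesis
  proof (intro exI[of _ \<psi>] conjI ballI impI)
    fix p show "block w a (\<psi> p) = \<psi> p" using J by (auto simp: \<psi>_def vec_eq_iff)
  next
    fix p q assume pq: "p \<in> X" "q \<in> X"
    show "norm (\<psi> p - \<psi> q) \<le> (K * d p q) powr a"
      using le[OF pq] Phi_nrm_le[OF pq a] by simp
    show "norm (block w a (fst p - fst q)) \<le> K powr a * norm (\<psi> p - \<psi> q)" if "slice a p q"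
      using Phi_nrm_ge[OF pq a that] fixd[OF pq that] by simp
  qed (use full in auto)
qed

end

section \<open>Similarities of the real factor\<close>

lemma norm_le_sum_blocks:
  assumes w: "\<And>k. 1 \<le> w k"
  shows "norm (x - y) \<le> (\<Sum>a\<in>range w. wdist w x y powr a)"
proof -
  have "norm (x - y) = norm (\<Sum>a\<in>range w. block w a (x - y))" by (simp add: sum_block)
  also have "\<dots> \<le> (\<Sum>a\<in>range w. norm (block w a (x - y)))" by (rule norm_sum)
  also have "\<dots> \<le> (\<Sum>a\<in>range w. wdist w x y powr a)"
    using norm_block_wdist[of w _ x y] w by (intro sum_mono) auto
  finally show ?thesis .
qed

lemma wdist_le_norm:
  assumes w: "\<And>k. 1 \<le> w k"
  shows "wdist w x y \<le> 1 + norm (x - y)"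
proof (subst wdist_mono_iff[OF w], simp, rule ballI)
  fix a assume "a \<in> range w"
  then have a: "1 \<le> a" using w by auto
  have "norm (block w a (x - y)) \<le> (1 + norm (x - y)) powr 1"
    using norm_block_le[of w a "x - y"] by simp
  also have "\<dots> \<le> (1 + norm (x - y)) powr a" using a by (intro powr_mono) auto
  finally show "norm (block w a (x - y)) \<le> (1 + norm (x - y)) powr a" .
qed

context block_action
begin

text \<open>The maps of the single blocks are added up. Each controls its block only within a slice,
  so the lower bound first corrects the coordinates of larger weight, at a cost already
  bounded.\<close>

lemma exists_real_similarity:
  "\<exists>\<Psi> :: 'n point \<Rightarrow> real^'n. \<exists>L\<ge>1. (\<forall>p\<in>X. \<forall>q\<in>X. wdist w (\<Psi> p) (\<Psi> q) \<le> K * d p q) \<and>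
    (\<forall>p\<in>X. \<forall>q\<in>X. wdist w (fst p) (fst q) \<le> L * max (wdist w (\<Psi> p) (\<Psi> q)) (dist_madic m (snd p) (snd q))) \<and>
    (\<forall>g\<in>carrier G. \<forall>p\<in>X. \<forall>q\<in>X. wdist w (\<Psi> (act g p)) (\<Psi> (act g q)) = ratio g * wdist w (\<Psi> p) (\<Psi> q)) \<and>
    (\<forall>s\<in>madics m. range (\<lambda>x. \<Psi> (x, s)) = UNIV)"
proof -
  let ?P = "\<lambda>a (\<psi> :: 'n point \<Rightarrow> real^'n). (\<forall>p\<in>X. block w a (\<psi> p) = \<psi> p) \<and>
    (\<forall>p\<in>X. \<forall>q\<in>X. norm (\<psi> p - \<psi> q) \<le> (K * d p q) powr a) \<and>
    (\<forall>p\<in>X. \<forall>q\<in>X. slice a p q \<longrightarrow> norm (block w a (fst p - fst q)) \<le> K powr a * norm (\<psi> p - \<psi> q)) \<and>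
    (\<forall>g\<in>carrier G. \<forall>p\<in>X. \<forall>q\<in>X. norm (\<psi> (act g p) - \<psi> (act g q)) = ratio g powr a * norm (\<psi> p - \<psi> q))"
  have "\<forall>a\<in>range w. \<exists>\<psi>. ?P a \<psi>"
    by (intro ballI exists_block_similarity)
  from bchoice[OF this] obtain \<psi> where \<psi>: "\<forall>a\<in>range w. ?P a (\<psi> a)" ..
  have bl: "\<And>a p. \<lbrakk>a \<in> range w; p \<in> X\<rbrakk> \<Longrightarrow> block w a (\<psi> a p) = \<psi> a p" using \<psi> by blast
  have up: "\<And>a p q. \<lbrakk>a \<in> range w; p \<in> X; q \<in> X\<rbrakk> \<Longrightarrow> norm (\<psi> a p - \<psi> a q) \<le> (K * d p q) powr a" using \<psi> by blast
  have low: "\<And>a p q. \<lbrakk>a \<in> range w; p \<in> X; q \<in> X; slice a p q\<rbrakk> \<Longrightarrow> norm (block w a (fst p - fst q)) \<le> K powr a * norm (\<psi> a p - \<psi> a q)" using \<psi> by blast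
  have sim: "\<And>a g p q. \<lbrakk>a \<in> range w; g \<in> carrier G; p \<in> X; q \<in> X\<rbrakk> \<Longrightarrow> norm (\<psi> a (act g p) - \<psi> a (act g q)) = ratio g powr a * norm (\<psi> a p - \<psi> a q)" using \<psi> by blast
  define \<Psi> where "\<Psi> p = (\<Sum>a\<in>range w. \<psi> a p)" for p
  have bP: "block w a (\<Psi> p) = \<psi> a p" if a: "a \<in> range w" and p: "p \<in> X" for a p
  proof -
    have lin: "linear (block w a)" by (rule linearI) (auto simp: block_add block_scale)
    have "block w a (\<Psi> p) = (\<Sum>c\<in>range w. block w a (block w c (\<psi> c p)))"
      unfolding \<Psi>_def linear_sum[OF lin] using bl p by (intro sum.cong) auto
    also have "\<dots> = (\<Sum>c\<in>range w. if c = a then block w a (\<psi> a p) else 0)"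
      by (intro sum.cong) (auto simp: block_block)
    finally show ?thesis using a p by (simp add: bl)
  qed
  have bd: "norm (block w a (\<Psi> p - \<Psi> q)) = norm (\<psi> a p - \<psi> a q)" if "a \<in> range w" "p \<in> X" "q \<in> X" for a p q
    using that by (simp add: block_diff bP)
  have upper: "wdist w (\<Psi> p) (\<Psi> q) \<le> K * d p q" if pq: "p \<in> X" "q \<in> X" for p q
    using pq K_pos up by (subst wdist_mono_iff[OF w1]) (auto simp: bd)
  have simle: "wdist w (\<Psi> (act g p)) (\<Psi> (act g q)) \<le> ratio g * wdist w (\<Psi> p) (\<Psi> q)"
    if g: "g \<in> carrier G" and pq: "p \<in> X" "q \<in> X" for g p q
  proof (subst wdist_mono_iff[OF w1], simp, rule ballI)
    fix a assume a: "a \<in> range w"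
    then obtain k where k: "a = w k" by blast
    have gX: "act g p \<in> X" "act g q \<in> X" using g pq by (auto intro: act_closed)
    have "norm (block w a (\<Psi> (act g p) - \<Psi> (act g q))) = ratio g powr a * norm (block w a (\<Psi> p - \<Psi> q))"
      using a g pq gX by (simp add: bd sim)
    also have "\<dots> \<le> ratio g powr a * wdist w (\<Psi> p) (\<Psi> q) powr a"
      unfolding k by (intro mult_left_mono norm_block_wdist w1) simp
    finally show "norm (block w a (\<Psi> (act g p) - \<Psi> (act g q))) \<le> (ratio g * wdist w (\<Psi> p) (\<Psi> q)) powr a"
      by (simp add: powr_mult)
  qed
  have simeq: "wdist w (\<Psi> (act g p)) (\<Psi> (act g q)) = ratio g * wdist w (\<Psi> p) (\<Psi> q)"
    if g: "g \<in> carrier G" and pq: "p \<in> X" "q \<in> X" for g p q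
  proof (rule antisym[OF simle[OF that]])
    have gX: "act g p \<in> X" "act g q \<in> X" using g pq by (auto intro: act_closed)
    have "wdist w (\<Psi> p) (\<Psi> q) \<le> ratio (inv g) * wdist w (\<Psi> (act g p)) (\<Psi> (act g q))"
      using simle[OF inv_closed[OF g] gX] g pq by (simp add: act_inv)
    then show "ratio g * wdist w (\<Psi> p) (\<Psi> q) \<le> wdist w (\<Psi> (act g p)) (\<Psi> (act g q))"
      using g ratio_pos[of g] by (simp add: ratio_inv le_divide_eq mult.commute del: ratio_pos)
  qed
  define \<delta> where "\<delta> p q = max (wdist w (\<Psi> p) (\<Psi> q)) (dist_madic m (snd p) (snd q))" for p q
  have d0: "0 \<le> \<delta> p q" for p q by (simp add: \<delta>_def le_max_iff_disj)
  \<comment> \<open>Descending induction over the weights, measured by the number of weights above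
    \<open>a\<close>.\<close>
  have cascade: "\<exists>L\<ge>1. \<forall>a\<in>range w. card {c \<in> range w. a < c} < n \<longrightarrow>
     (\<forall>p\<in>X. \<forall>q\<in>X. norm (block w a (fst p - fst q)) \<le> (L * \<delta> p q) powr a)" for n
  proof (induction n)
    case 0
    then show ?case by auto
  next
    case (Suc n)
    then obtain L where L: "1 \<le> L" and IH: "\<And>a p q. \<lbrakk>a \<in> range w; card {c \<in> range w. a < c} < n; p \<in> X; q \<in> X\<rbrakk> \<Longrightarrow>
      norm (block w a (fst p - fst q)) \<le> (L * \<delta> p q) powr a" by blast
    \<comment> \<open>\<open>K * L + 1\<close> collects the displacement to the slice and the
      distance itself; the outer \<open>K\<close> comes from the lower bound along the
      slice.\<close>
    define L' where "L' = K * (K * L + 1)"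
    have L': "1 \<le> L'"
    proof -
      have "1 * 1 \<le> K * (K * L + 1)" using K1 L by (intro mult_mono) auto
      then show ?thesis by (simp add: L'_def)
    qed
    have "norm (block w a (fst p - fst q)) \<le> (L' * \<delta> p q) powr a"
      if a: "a \<in> range w" and n: "card {c \<in> range w. a < c} < Suc n" and pq: "p \<in> X" "q \<in> X" for a p q
    proof -
      have a1: "1 \<le> a" using a w1 by auto
      \<comment> \<open>\<open>p\<close> with the higher coordinates and the m-adic part of
        \<open>q\<close>: it lies in the slice of \<open>q\<close>, its a-block is that of
        \<open>p\<close>, and the induction hypothesis bounds its distance to
        \<open>p\<close>.\<close>
      define p' where "p' = ((\<chi> k. if a < w k then fst q $ k else fst p $ k), snd q)"
      have p'X: "p' \<in> X" using pq by (simp add: p'_def in_product_space)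
      have sl: "slice a p' q" by (auto simp: slice_def p'_def)
      have "wdist w (fst p') (fst p) \<le> L * \<delta> p q"
      proof (subst wdist_mono_iff[OF w1], use L d0 in simp, rule ballI)
        fix c assume c: "c \<in> range w"
        show "norm (block w c (fst p' - fst p)) \<le> (L * \<delta> p q) powr c"
        proof (cases "a < c")
          case True
          have "card {e \<in> range w. c < e} < card {e \<in> range w. a < e}"
          proof (rule psubset_card_mono)
            have "c \<in> {e \<in> range w. a < e}" using c True by blast
            moreover have "c \<notin> {e \<in> range w. c < e}" by simp
            ultimately show "{e \<in> range w. c < e} \<subset> {e \<in> range w. a < e}" using True by force
          qed simp
          then have "norm (block w c (fst p - fst q)) \<le> (L * \<delta> p q) powr c"
            using n by (intro IH c pq) linarith
          moreover have "block w c (fst p' - fst p) = - block w c (fst p - fst q)"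
            using True by (auto simp: vec_eq_iff p'_def)
          ultimately show ?thesis by simp
        next
          case False
          then have "block w c (fst p' - fst p) = 0" by (auto simp: vec_eq_iff p'_def)
          then show ?thesis by simp
        qed
      qed
      moreover have "dist_madic m (snd p') (snd p) \<le> L * \<delta> p q"
      proof -
        have "dist_madic m (snd p') (snd p) \<le> \<delta> p q" by (simp add: p'_def \<delta>_def dist_madic_commute[of m "snd q"])
        also have "\<dots> \<le> L * \<delta> p q" using L d0[of p q] mult_right_mono[of 1 L "\<delta> p q"] by simp
        finally show ?thesis .
      qed
      ultimately have dp: "d p' p \<le> L * \<delta> p q" by (simp add: pdist_def)
      have bq: "block w a (fst p - fst q) = block w a (fst p' - fst q)" by (auto simp: vec_eq_iff p'_def)
      have 1: "norm (block w a (fst p' - fst q)) \<le> K powr a * norm (\<psi> a p' - \<psi> a q)"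
        by (rule low[OF a p'X pq(2) sl])
      have 2: "norm (\<psi> a p' - \<psi> a q) \<le> norm (\<psi> a p' - \<psi> a p) + norm (\<psi> a p - \<psi> a q)"
        using norm_triangle_ineq[of "\<psi> a p' - \<psi> a p" "\<psi> a p - \<psi> a q"] by simp
      have 3: "norm (\<psi> a p' - \<psi> a p) \<le> (K * (L * \<delta> p q)) powr a"
        using dp K_pos a1 by (intro order_trans[OF up[OF a p'X pq(1)]] powr_mono2 mult_left_mono) auto
      have 4: "norm (\<psi> a p - \<psi> a q) \<le> \<delta> p q powr a"
      proof -
        obtain k where k: "a = w k" using a by blast
        have "norm (\<psi> a p - \<psi> a q) \<le> wdist w (\<Psi> p) (\<Psi> q) powr a"
          unfolding bd[OF a pq, symmetric] unfolding k by (rule norm_block_wdist[OF w1])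
        also have "\<dots> \<le> \<delta> p q powr a" using a1 by (intro powr_mono2) (auto simp: \<delta>_def)
        finally show ?thesis .
      qed
      have "(K * (L * \<delta> p q)) powr a + \<delta> p q powr a \<le> (K * (L * \<delta> p q) + \<delta> p q) powr a"
        using a1 K_pos L d0[of p q] by (intro powr_superadd) auto
      then have "norm (\<psi> a p' - \<psi> a q) \<le> (K * (L * \<delta> p q) + \<delta> p q) powr a" using 2 3 4 by linarith
      then have "K powr a * norm (\<psi> a p' - \<psi> a q) \<le> K powr a * (K * (L * \<delta> p q) + \<delta> p q) powr a"
        by (intro mult_left_mono) auto
      then have "norm (block w a (fst p - fst q)) \<le> K powr a * (K * (L * \<delta> p q) + \<delta> p q) powr a"
        using 1 unfolding bq by linarith
      also have "\<dots> = (L' * \<delta> p q) powr a"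
        unfolding powr_mult[symmetric] by (simp add: L'_def algebra_simps)
      finally show ?thesis .
    qed
    then show ?case using L' by blast
  qed
  have cardlt: "card {c \<in> range w. a < c} < Suc (card (range w))" for a
    by (rule le_imp_less_Suc, rule card_mono) auto
  obtain L where L: "1 \<le> L" and lowL: "\<And>a p q. \<lbrakk>a \<in> range w; p \<in> X; q \<in> X\<rbrakk> \<Longrightarrow> norm (block w a (fst p - fst q)) \<le> (L * \<delta> p q) powr a"
    using cascade[of "Suc (card (range w))"] cardlt by blast
  have lower_bound: "wdist w (fst p) (fst q) \<le> L * \<delta> p q" if pq: "p \<in> X" "q \<in> X" for p q
    using lowL pq L d0 by (subst wdist_mono_iff[OF w1]) auto
  \<comment> \<open>On a single real fibre the m-adic distance vanishes, so the map is biLipschitz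
    for \<open>wdist\<close>. This gives continuity, injectivity and properness in the Euclidean
    sense.\<close>
  have onto: "range (\<lambda>x. \<Psi> (x, s)) = UNIV" if s: "s \<in> madics m" for s
  proof (rule proper_injective_onto)
    define f where "f x = \<Psi> (x, s)" for x
    have fX: "(x, s) \<in> X" for x using s by simp
    have fl: "wdist w x y \<le> L * wdist w (f x) (f y)" for x y
      using lower_bound[OF fX fX, of x y] by (simp add: f_def \<delta>_def max_absorb1)
    have fu: "wdist w (f x) (f y) \<le> K * wdist w x y" for x y
      using upper[OF fX fX, of x y] by (simp add: f_def pdist_def max_absorb1)
    have cw: "continuous_on UNIV (\<lambda>x. wdist w x y)" for y
      using continuous_map_wdist[of w euclidean "\<lambda>x. x" "\<lambda>_. y", OF w1] by simp
    have "continuous_on UNIV f"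
      unfolding continuous_on_def
    proof
      fix y
      have "((\<lambda>x. wdist w x y) \<longlongrightarrow> 0) (at y)"
        using cw[of y, unfolded continuous_on_def, rule_format, of y] by simp
      then have "((\<lambda>x. \<Sum>a\<in>range w. (K * wdist w x y) powr a) \<longlongrightarrow> (\<Sum>a\<in>range w. (K * 0) powr a)) (at y)"
        using K_pos
        by (intro tendsto_sum tendsto_powr' tendsto_mult_left tendsto_const)
           (auto intro!: order_less_le_trans[OF _ w1] always_eventually)
      then have lim: "((\<lambda>x. \<Sum>a\<in>range w. (K * wdist w x y) powr a) \<longlongrightarrow> 0) (at y)" by simp
      have "((\<lambda>x. f x - f y) \<longlongrightarrow> 0) (at y)"
      proof (rule Lim_null_comparison[OF always_eventually lim], rule allI)
        fix x
        have "norm (f x - f y) \<le> (\<Sum>a\<in>range w. wdist w (f x) (f y) powr a)"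
          by (rule norm_le_sum_blocks) (rule w1)
        also have "\<dots> \<le> (\<Sum>a\<in>range w. (K * wdist w x y) powr a)"
          using fu order_trans[OF zero_le_one w1] by (intro sum_mono powr_mono2) auto
        finally show "norm (f x - f y) \<le> (\<Sum>a\<in>range w. (K * wdist w x y) powr a)" .
      qed
      then show "(f \<longlongrightarrow> f y) (at y within UNIV)" by (simp add: LIM_zero_iff)
    qed
    then show "continuous_on UNIV (\<lambda>x. \<Psi> (x, s))" by (simp add: f_def[abs_def])
    show "inj (\<lambda>x. \<Psi> (x, s))"
    proof (rule injI)
      fix x y assume "\<Psi> (x, s) = \<Psi> (y, s)"
      then have "wdist w x y \<le> 0" using fl[of x y] by (simp add: f_def)
      then have "wdist w x y = 0" using wdist_nonneg[of w x y] by simp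
      then show "x = y" using wdist_eq_0[of w x y, OF w1] by simp
    qed
    fix r
    have "bounded {x. norm (f x) \<le> r}"
    proof (rule boundedI)
      fix x assume "x \<in> {x. norm (f x) \<le> r}"
      then have "norm (f x - f 0) \<le> r + norm (f 0)" using norm_triangle_ineq4[of "f x" "f 0"] by simp
      then have "wdist w (f x) (f 0) \<le> 1 + (r + norm (f 0))"
        using wdist_le_norm[of w "f x" "f 0", OF w1] by linarith
      then have "L * wdist w (f x) (f 0) \<le> L * (1 + (r + norm (f 0)))" using L by (intro mult_left_mono) auto
      then have "wdist w x 0 \<le> L * (1 + (r + norm (f 0)))" using fl[of x 0] by linarith
      then have "(\<Sum>a\<in>range w. wdist w x 0 powr a) \<le> (\<Sum>a\<in>range w. (L * (1 + (r + norm (f 0)))) powr a)"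
        using order_trans[OF zero_le_one w1] by (intro sum_mono powr_mono2) auto
      then show "norm x \<le> (\<Sum>a\<in>range w. (L * (1 + (r + norm (f 0)))) powr a)"
        using norm_le_sum_blocks[of w x 0, OF w1] by simp
    qed
    then show "bounded {x \<in> UNIV. norm (\<Psi> (x, s)) \<le> r}" by (simp add: f_def)
  qed auto
  show ?thesis
    using L upper lower_bound simeq onto unfolding \<delta>_def by blast
qed

end

section \<open>Similarity groups of the m-adics\<close>

text \<open>If \<open>g\<close> determines \<open>f\<close>, then \<open>f\<close> has no more
  values than \<open>g\<close>. It is applied in both directions between balls and digit
  strings.\<close>

lemma card_image_factor:
  assumes "finite (g ` A)" "\<And>x y. \<lbrakk>x \<in> A; y \<in> A; g x = g y\<rbrakk> \<Longrightarrow> f x = f y"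
  shows "finite (f ` A)" "card (f ` A) \<le> card (g ` A)"
proof -
  have "f ` A = (\<lambda>c. f (inv_into A g c)) ` (g ` A)"
  proof -
    have "f x = f (inv_into A g (g x))" if "x \<in> A" for x
      using assms(2)[OF that inv_into_into[of "g x" g A]] that by (simp add: f_inv_into_f)
    then show ?thesis by (auto simp: image_iff)
  qed
  then show "finite (f ` A)" "card (f ` A) \<le> card (g ` A)"
    using assms(1) by (simp, metis card_image_le)
qed

lemma powi_bracket:
  assumes "1 < b" "0 < (x::real)" shows "\<exists>k::int. b powi k \<le> x \<and> x < b powi (k + 1)"
proof -
  define k where "k = \<lfloor>log b x\<rfloor>"
  have "b powi k = b powr of_int k" "b powi (k + 1) = b powr (of_int k + 1)"
    using assms powr_real_of_int'[of b k] powr_real_of_int'[of b "k + 1"] by auto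
  moreover have "of_int k \<le> log b x" "log b x < of_int k + 1" by (auto simp: k_def)
  ultimately show ?thesis using assms by (auto simp: le_log_iff log_less_iff intro!: exI[of _ k])
qed

lemma powi_le_cancel: "1 < (b::real) \<Longrightarrow> b powi i \<le> b powi j \<longleftrightarrow> i \<le> j"
  using power_int_increasing[of i j b] power_int_strict_increasing[of j i b] by (meson less_imp_le not_le)

lemma powi_less_cancel: "1 < (b::real) \<Longrightarrow> b powi i < b powi j \<longleftrightarrow> i < j"
  using powi_le_cancel[of b j i] by (meson not_le)

definition digits :: "int \<Rightarrow> int \<Rightarrow> (int \<Rightarrow> nat) \<Rightarrow> int \<Rightarrow> nat" where
  "digits i j s = restrict s {i..<j}"

lemma digits_eq_iff: "digits i j s = digits i j t \<longleftrightarrow> (\<forall>k. i \<le> k \<and> k < j \<longrightarrow> s k = t k)"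
  by (auto simp: digits_def restrict_def fun_eq_iff)

lemma
  assumes "A \<subseteq> madics m"
  shows digits_finite: "finite (digits i j ` A)"
    and digits_card: "card (digits i j ` A) \<le> m ^ nat (j - i)"
proof -
  have sub: "digits i j ` A \<subseteq> (\<Pi>\<^sub>E k\<in>{i..<j}. {..<m})"
    using assms by (auto simp: digits_def madics_def)
  have fin: "finite (\<Pi>\<^sub>E k\<in>{i..<j}. {..<m})" by (intro finite_PiE) auto
  have card: "card (\<Pi>\<^sub>E k\<in>{i..<j}. {..<m}) = m ^ nat (j - i)" by (simp add: card_PiE)
  show "finite (digits i j ` A)" using finite_subset[OF sub fin] .
  show "card (digits i j ` A) \<le> m ^ nat (j - i)"
    using card_mono[OF fin sub] unfolding card .
qed

definition cell :: "nat \<Rightarrow> int \<Rightarrow> (int \<Rightarrow> nat) \<Rightarrow> (int \<Rightarrow> nat) set" where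
  "cell m i s = {t \<in> madics m. \<forall>k<i. t k = s k}"

lemma cell_subset: "cell m i s \<subseteq> madics m" by (auto simp: cell_def)

lemma digits_cell_card:
  assumes s: "s \<in> madics m"
  shows "card (digits i j ` cell m i s) = m ^ nat (j - i)"
proof -
  have "digits i j ` cell m i s = (\<Pi>\<^sub>E k\<in>{i..<j}. {..<m})"
  proof (intro equalityI subsetI)
    fix c assume c: "c \<in> (\<Pi>\<^sub>E k\<in>{i..<j}. {..<m})"
    define t where "t k = (if k < i then s k else if k < j then c k else 0)" for k
    have "t k < m" for k using c madics_less[OF s, of k] by (auto simp: t_def PiE_def Pi_iff)
    moreover obtain N where N: "\<And>k. k < N \<Longrightarrow> s k = 0" using s by (auto simp: madics_def)
    then have "\<forall>k<min N i. t k = 0" by (simp add: t_def)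
    ultimately have "t \<in> madics m" unfolding madics_def by blast
    then have "t \<in> cell m i s" by (auto simp: cell_def t_def)
    moreover have "digits i j t = c"
      using c by (auto simp: digits_def t_def restrict_def PiE_def extensional_def fun_eq_iff)
    ultimately show "c \<in> digits i j ` cell m i s" by blast
  qed (auto simp: digits_def cell_def madics_def)
  then show ?thesis by (simp add: card_PiE)
qed

text \<open>A group that scales an ultrametric exactly; the original m-adic metric enters through
  its comparison with \<open>rho\<close>.\<close>

locale madic_similarity = group G for G :: "('g, 'r) monoid_scheme" (structure) +
  fixes m :: nat and act :: "'g \<Rightarrow> (int \<Rightarrow> nat) \<Rightarrow> (int \<Rightarrow> nat)" and ratio :: "'g \<Rightarrow> real"
    and rho :: "(int \<Rightarrow> nat) \<Rightarrow> (int \<Rightarrow> nat) \<Rightarrow> real" and K B :: real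
  assumes m2: "2 \<le> m"
    and act_closed: "\<And>g s. \<lbrakk>g \<in> carrier G; s \<in> madics m\<rbrakk> \<Longrightarrow> act g s \<in> madics m"
    and act_one: "\<And>s. s \<in> madics m \<Longrightarrow> act \<one> s = s"
    and act_mult: "\<And>g h s. \<lbrakk>g \<in> carrier G; h \<in> carrier G; s \<in> madics m\<rbrakk> \<Longrightarrow> act (g \<otimes> h) s = act g (act h s)"
    and ratio_pos: "\<And>g. g \<in> carrier G \<Longrightarrow> 0 < ratio g"
    and ratio_mult: "\<And>g h. \<lbrakk>g \<in> carrier G; h \<in> carrier G\<rbrakk> \<Longrightarrow> ratio (g \<otimes> h) = ratio g * ratio h"
    and K1: "1 \<le> K" and B0: "0 < B"
    and rho_lower: "\<And>s t. \<lbrakk>s \<in> madics m; t \<in> madics m\<rbrakk> \<Longrightarrow> dist_madic m s t \<le> rho s t"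
    and rho_upper: "\<And>s t. \<lbrakk>s \<in> madics m; t \<in> madics m\<rbrakk> \<Longrightarrow> rho s t \<le> K * dist_madic m s t"
    and rho_sym: "\<And>s t. \<lbrakk>s \<in> madics m; t \<in> madics m\<rbrakk> \<Longrightarrow> rho s t = rho t s"
    and rho_ultra: "\<And>s t u. \<lbrakk>s \<in> madics m; t \<in> madics m; u \<in> madics m\<rbrakk> \<Longrightarrow> rho s u \<le> max (rho s t) (rho t u)"
    and rho_act: "\<And>g s t. \<lbrakk>g \<in> carrier G; s \<in> madics m; t \<in> madics m\<rbrakk> \<Longrightarrow> rho (act g s) (act g t) = ratio g * rho s t"
    and dense: "\<And>s t r e. \<lbrakk>s \<in> madics m; t \<in> madics m; 0 < r; 0 < e\<rbrakk> \<Longrightarrow>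
       \<exists>g\<in>carrier G. r / B \<le> ratio g \<and> ratio g \<le> B * r \<and> rho (act g s) t \<le> e"
begin

abbreviation Q :: "(int \<Rightarrow> nat) set" where "Q \<equiv> madics m"

lemma m1: "1 < real m" using m2 by simp

lemma zeroQ: "(\<lambda>_. 0) \<in> Q" using m2 by (intro zero_madics) auto

lemma rho_self: "s \<in> Q \<Longrightarrow> rho s s = 0"
  using rho_upper[of s s] rho_lower[of s s] by simp

lemma rho_nonneg: "s \<in> Q \<Longrightarrow> t \<in> Q \<Longrightarrow> 0 \<le> rho s t"
  using rho_lower[of s t] dist_madic_nonneg[of m s t] by linarith

lemma rho_eq_0: "s \<in> Q \<Longrightarrow> t \<in> Q \<Longrightarrow> rho s t \<le> 0 \<Longrightarrow> s = t"
  using rho_lower[of s t] dist_madic_nonneg[of m s t] dist_madic_eq_0[of s m t] by linarith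

lemma isosceles: "\<lbrakk>s \<in> Q; t \<in> Q; u \<in> Q; rho s t < rho t u\<rbrakk> \<Longrightarrow> rho s u = rho t u"
  using rho_ultra[of s t u] rho_ultra[of t s u] rho_sym[of s t] by (simp add: max_def split: if_splits)

lemma ratio_one: "ratio \<one> = 1"
  using ratio_mult[of \<one> \<one>] ratio_pos[of \<one>] by simp

lemma ratio_inv: "g \<in> carrier G \<Longrightarrow> ratio (inv g) = 1 / ratio g"
  using ratio_mult[of "inv g" g] ratio_pos[of g] by (simp add: ratio_one eq_divide_eq)

lemma ratio_nat_pow: "g \<in> carrier G \<Longrightarrow> ratio (g [^] (n::nat)) = ratio g ^ n"
  by (induction n) (auto simp: ratio_one ratio_mult)

lemma ratio_int_pow: assumes g: "g \<in> carrier G" shows "ratio (g [^] (n::int)) = ratio g powi n"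
proof (cases n rule: int_cases2)
  case (nonneg k)
  then show ?thesis using ratio_nat_pow[OF g, of k] by (simp add: int_pow_int)
next
  case (nonpos k)
  then have "g [^] n = inv (g [^] k)" using g by (simp add: int_pow_neg int_pow_int)
  then show ?thesis
    using nonpos g ratio_nat_pow[OF g, of k] by (simp add: ratio_inv power_int_minus inverse_eq_divide)
qed

lemma act_inv: "\<lbrakk>g \<in> carrier G; s \<in> Q\<rbrakk> \<Longrightarrow> act (inv g) (act g s) = s"
  using act_mult[of "inv g" g s] act_one[of s] by simp

lemma act_inv': "\<lbrakk>g \<in> carrier G; s \<in> Q\<rbrakk> \<Longrightarrow> act g (act (inv g) s) = s"
  using act_mult[of g "inv g" s] act_one[of s] by simp

lemma far_point: assumes s: "s \<in> Q" shows "\<exists>t\<in>Q. v < rho s t"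
proof -
  have "0 < max v 1" by simp
  then obtain k where k: "max v 1 < real m powi (k + 1)" using powi_bracket[OF m1] by blast
  \<comment> \<open>Changing the single digit of index \<open>j\<close> produces the distance
    \<open>real m powi (k + 2)\<close>.\<close>
  define j where "j = - k - 3"
  define t where "t = s(j := if s j = 0 then 1 else 0)"
  obtain N where N: "\<And>i. i < N \<Longrightarrow> s i = 0" using s by (auto simp: madics_def)
  have "t i < m" for i using madics_less[OF s, of i] m2 by (simp add: t_def)
  moreover have "\<forall>i<min N j. t i = 0" using N by (simp add: t_def)
  ultimately have tQ: "t \<in> Q" unfolding madics_def by blast
  have "\<not> dist_madic m s t \<le> real m powi (- (j + 1) - 1)"
    unfolding dist_madic_le_iff[OF s tQ m2] by (auto simp: t_def intro!: exI[of _ j])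
  moreover have "- (j + 1) - 1 = k + 1" by (simp add: j_def)
  ultimately have "v < dist_madic m s t" using k by (simp only:)
  then show ?thesis using rho_lower[OF s tQ] tQ by (intro bexI[of _ t]) auto
qed

text \<open>Points within \<open>2 * v\<close> of \<open>q\<close> agree below one index, and a
  fixed number of further digits tells apart any two of them at distance at least
  \<open>v\<close>.\<close>

lemma doubling:
  "\<exists>N. \<forall>q v S. q \<in> Q \<longrightarrow> 0 < v \<longrightarrow> finite S \<longrightarrow> S \<subseteq> Q \<longrightarrow> (\<forall>s\<in>S. rho q s \<le> 2 * v) \<longrightarrow>
     (\<forall>s\<in>S. \<forall>t\<in>S. s \<noteq> t \<longrightarrow> v \<le> rho s t) \<longrightarrow> card S \<le> N"
proof -
  obtain L :: nat where L: "2 * m * K < real m ^ L" using real_arch_pow[OF m1] by blast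
  have "card S \<le> m ^ L"
    if q: "q \<in> Q" and v: "0 < v" and S: "S \<subseteq> Q" and near: "\<And>s. s \<in> S \<Longrightarrow> rho q s \<le> 2 * v"
      and sep: "\<And>s t. \<lbrakk>s \<in> S; t \<in> S; s \<noteq> t\<rbrakk> \<Longrightarrow> v \<le> rho s t" for q v S
  proof -
    obtain k where k: "real m powi k \<le> 2 * v" "2 * v < real m powi (k + 1)"
      using powi_bracket[OF m1, of "2 * v"] v by auto
    define i where "i = - k - 2"
    have "inj_on (digits i (i + int L)) S"
    proof (rule inj_onI, rule ccontr)
      fix s t assume st: "s \<in> S" "t \<in> S" and eq: "digits i (i + int L) s = digits i (i + int L) t" and ne: "s \<noteq> t"
      have sQ: "s \<in> Q" "t \<in> Q" using st S by auto
      have below: "\<forall>j<i. q j = u j" if "u \<in> S" for u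
      proof -
        have uQ: "u \<in> Q" using that S by auto
        have "dist_madic m q u \<le> real m powi (- i - 1)"
        proof -
          have "- i - 1 = k + 1" by (simp add: i_def)
          then show ?thesis using rho_lower[OF q uQ] near[OF that] k by (simp only:)
        qed
        then show ?thesis using dist_madic_le_iff[OF q uQ m2] by blast
      qed
      have "\<forall>j<i + int L. s j = t j"
        using below[OF st(1)] below[OF st(2)] eq unfolding digits_eq_iff by (metis not_le)
      then have "dist_madic m s t \<le> real m powi (- (i + int L) - 1)"
        using dist_madic_le_iff[OF sQ m2] by blast
      also have "real m powi (- (i + int L) - 1) = real m powi k * real m / real m ^ L"
        using m2 by (simp add: i_def power_int_diff power_int_add)
      also have "\<dots> \<le> 2 * v * real m / real m ^ L"
        using k(1) by (intro divide_right_mono mult_right_mono) auto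
      also have "\<dots> < v / K" using L v K1 m2 by (simp add: field_simps)
      finally have "K * dist_madic m s t < v" using K1 by (simp add: field_simps)
      then have "rho s t < v" using rho_upper[OF sQ] by linarith
      then show False using sep[OF st ne] by simp
    qed
    then have "card S = card (digits i (i + int L) ` S)" by (simp add: card_image)
    also have "\<dots> \<le> m ^ nat (i + int L - i)" by (rule digits_card[OF S])
    finally show ?thesis by simp
  qed
  then show ?thesis by (intro exI[of _ "m ^ L"] allI impI) simp
qed

text \<open>An element with ratio too close to 1 would move one point to \<open>N + 1\<close> points
  in the shell between \<open>v\<close> and \<open>2 * v\<close>, pairwise at least \<open>v\<close>
  apart.\<close>

lemma ratio_gap: "\<exists>N. \<forall>g\<in>carrier G. 1 < ratio g \<longrightarrow> 2 < ratio g ^ N"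
proof -
  obtain N where N: "\<And>q v S. \<lbrakk>q \<in> Q; 0 < v; finite S; S \<subseteq> Q; \<forall>s\<in>S. rho q s \<le> 2 * v;
     \<forall>s\<in>S. \<forall>t\<in>S. s \<noteq> t \<longrightarrow> v \<le> rho s t\<rbrakk> \<Longrightarrow> card S \<le> N"
    using doubling by blast
  have "2 < ratio g ^ N" if g: "g \<in> carrier G" and gt: "1 < ratio g" for g
  proof (rule ccontr)
    assume neg: "\<not> 2 < ratio g ^ N"
    define q where "q = (\<lambda>_::int. 0::nat)"
    have q: "q \<in> Q" by (simp add: q_def zeroQ)
    have gq: "act g q \<in> Q" by (rule act_closed[OF g q])
    \<comment> \<open>Farther from \<open>q\<close> than \<open>q\<close> is displaced by
      \<open>g\<close>. By the isosceles property each application of \<open>g\<close> then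
      multiplies the distance to \<open>q\<close> exactly by the ratio.\<close>
    obtain y where y: "y \<in> Q" "rho (act g q) q < rho q y" using far_point[OF q, of "rho (act g q) q"] by blast
    define v where "v = rho q y"
    have v: "0 < v" using y(2) rho_nonneg[OF gq q] by (simp add: v_def)
    define z where "z j = ((act g) ^^ j) y" for j
    have zQ: "z j \<in> Q" for j by (induction j) (auto simp: z_def y intro: act_closed[OF g])
    have rz: "rho q (z j) = ratio g ^ j * v" for j
    proof (induction j)
      case 0
      then show ?case by (simp add: z_def v_def)
    next
      case (Suc j)
      have "rho (act g q) (z (Suc j)) = ratio g ^ Suc j * v"
        using rho_act[OF g q zQ[of j]] Suc by (simp add: z_def)
      moreover have "v \<le> ratio g ^ Suc j * v"
        using v one_le_power[OF less_imp_le[OF gt], of "Suc j"] by simp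
      ultimately have "rho q (act g q) < rho (act g q) (z (Suc j))"
        using y(2) rho_sym[OF q gq] by (simp add: v_def)
      then show ?case using isosceles[OF q gq zQ] \<open>rho (act g q) (z (Suc j)) = _\<close> by simp
    qed
    have mono: "ratio g ^ i * v < ratio g ^ j * v" if "i < j" for i j
      using that gt v by (simp add: power_strict_increasing)
    have sep: "v \<le> rho (z i) (z j)" if "i < j" for i j
    proof -
      have "rho (z i) q < rho q (z j)" using mono[OF that] rho_sym[OF q zQ[of i]] by (simp add: rz)
      then have "rho (z i) (z j) = ratio g ^ j * v" using isosceles[OF zQ q zQ] by (simp add: rz)
      then show ?thesis using v one_le_power[OF less_imp_le[OF gt], of j] by simp
    qed
    have inj: "inj_on z {..N}"
    proof (rule inj_onI)
      fix i j assume "z i = z j"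
      then show "i = j" using mono[of i j] mono[of j i] rz[of i] rz[of j] by (metis less_irrefl linorder_neqE_nat)
    qed
    have "card (z ` {..N}) \<le> N"
    proof (rule N[OF q v])
      show "\<forall>s\<in>z ` {..N}. rho q s \<le> 2 * v"
      proof (rule ballI, elim imageE)
        fix s j assume "s = z j" "j \<in> {..N}"
        then have "ratio g ^ j \<le> ratio g ^ N" using gt by (intro power_increasing) auto
        then have "ratio g ^ j \<le> 2" using neg by linarith
        then show "rho q s \<le> 2 * v" using \<open>s = z j\<close> rz v by simp
      qed
      show "\<forall>s\<in>z ` {..N}. \<forall>t\<in>z ` {..N}. s \<noteq> t \<longrightarrow> v \<le> rho s t"
      proof (intro ballI impI, elim imageE)
        fix s t i j assume st: "s \<noteq> t" "s = z i" "t = z j"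
        then consider "i < j" | "j < i" by force
        then show "v \<le> rho s t"
          using sep[of i j] sep[of j i] st rho_sym[OF zQ[of i] zQ[of j]] by cases auto
      qed
    qed (use zQ in auto)
    then show False using card_image[OF inj] by simp
  qed
  then show ?thesis by blast
qed

lemma exists_generator: "\<exists>g\<in>carrier G. 1 < ratio g \<and> (\<forall>h\<in>carrier G. \<exists>k::int. ratio h = ratio g powi k)"
proof -
  obtain N where N: "\<And>g. \<lbrakk>g \<in> carrier G; 1 < ratio g\<rbrakk> \<Longrightarrow> 2 < ratio g ^ N" using ratio_gap by blast
  define S where "S = {ratio g |g. g \<in> carrier G \<and> 1 < ratio g}"
  obtain g2 where "g2 \<in> carrier G" "2 * B / B \<le> ratio g2" using dense[OF zeroQ zeroQ, of "2 * B" 1] B0 by auto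
  then have g2: "g2 \<in> carrier G" "1 < ratio g2" using B0 by auto
  then have "ratio g2 \<in> S" by (auto simp: S_def)
  then have Sne: "S \<noteq> {}" by auto
  have bdd: "bdd_below S" by (rule bdd_belowI[of _ 1]) (auto simp: S_def)
  define c where "c = Inf S"
  have cle: "c \<le> x" if "x \<in> S" for x unfolding c_def using that bdd by (rule cInf_lower)
  have c1: "1 \<le> c" unfolding c_def using Sne by (intro cInf_greatest) (auto simp: S_def)
  have quot: "x / y \<in> S" if xy: "x \<in> S" "y \<in> S" "y < x" for x y
  proof -
    obtain g h where gh: "g \<in> carrier G" "h \<in> carrier G" "x = ratio g" "y = ratio h" using xy by (auto simp: S_def)
    have "ratio (g \<otimes> inv h) = x / y" using gh by (simp add: ratio_mult ratio_inv)
    moreover have "1 < x / y" using xy(3) gh ratio_pos[of h] by simp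
    ultimately show ?thesis using gh by (force simp: S_def intro!: exI[of _ "g \<otimes> inv h"])
  qed
  \<comment> \<open>If the infimum were not attained, two ratios just above it would have a quotient
    in the gap next to 1.\<close>
  have "c \<in> S"
  proof (rule ccontr)
    assume nc: "c \<notin> S"
    have N0: "N \<noteq> 0" using N[OF g2] by (cases N) auto
    have r2: "1 < root N 2" using N0 by simp
    then have "c < c * root N 2" using c1 by simp
    then obtain x where x: "x \<in> S" "x < c * root N 2" using cInf_lessD[OF Sne, of "c * root N 2"] by (auto simp: c_def)
    have "c < x" using cle[OF x(1)] nc x(1) by (metis order_le_imp_less_or_eq)
    then obtain y where y: "y \<in> S" "y < x" using cInf_lessD[OF Sne, of x] by (auto simp: c_def)
    have "x / y < root N 2"
    proof -
      have "x < y * root N 2" using x(2) mult_right_mono[OF cle[OF y(1)], of "root N 2"] r2 by linarith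
      then show ?thesis using cle[OF y(1)] c1 by (simp add: divide_less_eq mult.commute)
    qed
    moreover have "1 < x / y" using quot[OF x(1) y] by (auto simp: S_def)
    ultimately have "(x / y) ^ N < root N 2 ^ N" using N0 by (intro power_strict_mono) auto
    then have "(x / y) ^ N < 2" using N0 by simp
    moreover have "2 < (x / y) ^ N" using quot[OF x(1) y] N by (auto simp: S_def)
    ultimately show False by simp
  qed
  then obtain g where g: "g \<in> carrier G" "1 < ratio g" "ratio g = c" by (auto simp: S_def)
  have "\<exists>k::int. ratio h = ratio g powi k" if h: "h \<in> carrier G" for h
  proof -
    obtain k where k: "ratio g powi k \<le> ratio h" "ratio h < ratio g powi (k + 1)"
      using powi_bracket[OF g(2) ratio_pos[OF h]] by blast
    \<comment> \<open>Division with remainder: the ratio of \<open>f\<close> is at least 1 and below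
      the least ratio exceeding 1, hence equal to 1.\<close>
    define f where "f = h \<otimes> g [^] (- k)"
    have fG: "f \<in> carrier G" using g h by (simp add: f_def)
    have rf: "ratio f = ratio h / ratio g powi k"
      using g h by (simp add: f_def ratio_mult ratio_int_pow power_int_minus divide_inverse)
    have pk: "0 < ratio g powi k" using g by simp
    have "1 \<le> ratio f" using k(1) pk by (simp add: rf)
    moreover have "ratio f < c" using k(2) pk g(2,3) by (simp add: rf divide_less_eq power_int_add mult.commute)
    ultimately have "ratio f = 1" using cle[of "ratio f"] fG by (force simp: S_def)
    then show ?thesis using pk by (intro exI[of _ k]) (simp add: rf)
  qed
  then show ?thesis using g by blast
qed

definition gen :: 'g where
  "gen = (SOME g. g \<in> carrier G \<and> 1 < ratio g \<and> (\<forall>h\<in>carrier G. \<exists>k::int. ratio h = ratio g powi k))"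

definition c0 :: real where "c0 = ratio gen"

lemma gen: "gen \<in> carrier G" "1 < c0" "\<And>h. h \<in> carrier G \<Longrightarrow> \<exists>k::int. ratio h = c0 powi k"
proof -
  have "\<exists>g. g \<in> carrier G \<and> 1 < ratio g \<and> (\<forall>h\<in>carrier G. \<exists>k::int. ratio h = ratio g powi k)"
    using exists_generator by blast
  from someI_ex[OF this]
  show "gen \<in> carrier G" "1 < c0" "\<And>h. h \<in> carrier G \<Longrightarrow> \<exists>k::int. ratio h = c0 powi k"
    by (auto simp: gen_def c0_def)
qed

lemma c0_pos [simp]: "0 < c0 powi k" using gen(2) by simp

section \<open>Balls and transitivity on each level\<close>

definition ball :: "int \<Rightarrow> (int \<Rightarrow> nat) \<Rightarrow> (int \<Rightarrow> nat) set" where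
  "ball k q = {t \<in> Q. rho q t \<le> c0 powi k}"

lemma ball_subset: "ball k q \<subseteq> Q" by (auto simp: ball_def)

lemma center_ball: "q \<in> Q \<Longrightarrow> q \<in> ball k q"
  by (simp add: ball_def rho_self less_imp_le)

lemma ball_eq_iff: assumes "q \<in> Q" "t \<in> Q" shows "ball k q = ball k t \<longleftrightarrow> rho q t \<le> c0 powi k"
proof
  assume "ball k q = ball k t"
  then show "rho q t \<le> c0 powi k" using center_ball[OF assms(2), of k] by (auto simp: ball_def)
next
  assume r: "rho q t \<le> c0 powi k"
  have "rho q u \<le> c0 powi k \<longleftrightarrow> rho t u \<le> c0 powi k" if "u \<in> Q" for u
    using rho_ultra[OF assms(1,2) that] rho_ultra[OF assms(2,1) that] rho_sym[OF assms] r
    by (auto simp: le_max_iff_disj)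
  then show "ball k q = ball k t" by (auto simp: ball_def)
qed

lemma ball_mono: "i \<le> j \<Longrightarrow> ball i q \<subseteq> ball j q"
  using power_int_increasing[of i j c0] gen(2) by (force simp: ball_def)

lemma act_ball:
  assumes g: "g \<in> carrier G" and q: "q \<in> Q" and r: "ratio g = c0 powi j"
  shows "act g ` ball k q = ball (k + j) (act g q)"
proof (intro equalityI subsetI)
  have cc: "c0 powi (k + j) = c0 powi j * c0 powi k" using gen(2) by (simp add: power_int_add)
  {
    fix t assume "t \<in> act g ` ball k q"
    then obtain u where u: "u \<in> Q" "rho q u \<le> c0 powi k" "t = act g u" by (auto simp: ball_def)
    then have "rho (act g q) t \<le> c0 powi (k + j)" using rho_act[OF g q u(1)] r cc by simp
    then show "t \<in> ball (k + j) (act g q)" using u act_closed[OF g u(1)] by (simp add: ball_def)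
  next
    fix t assume "t \<in> ball (k + j) (act g q)"
    then have t: "t \<in> Q" "rho (act g q) t \<le> c0 powi (k + j)" by (auto simp: ball_def)
    have iQ: "act (inv g) t \<in> Q" using g t by (intro act_closed) auto
    have "c0 powi j * rho q (act (inv g) t) \<le> c0 powi j * c0 powi k"
      using rho_act[OF g q iQ] t r cc g by (simp add: act_inv')
    then have "act (inv g) t \<in> ball k q" using iQ by (simp add: ball_def)
    then show "t \<in> act g ` ball k q" using act_inv'[OF g t(1)] by force
  }
qed

text \<open>Some group element carries the ball of level \<open>k\<close> around \<open>q\<close>
  onto the ball of level \<open>k'\<close> around \<open>q'\<close>. Formulated by distances, it
  passes to larger balls at once.\<close>

definition related :: "(int \<Rightarrow> nat) \<Rightarrow> int \<Rightarrow> (int \<Rightarrow> nat) \<Rightarrow> int \<Rightarrow> bool" where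
  "related q k q' k' \<longleftrightarrow> (\<exists>g\<in>carrier G. ratio g = c0 powi (k' - k) \<and> rho (act g q) q' \<le> c0 powi k')"

lemma related_trans:
  assumes Q: "q \<in> Q" "q' \<in> Q" "q'' \<in> Q" and "related q k q' k'" "related q' k' q'' k''"
  shows "related q k q'' k''"
proof -
  obtain g h where g: "g \<in> carrier G" "ratio g = c0 powi (k' - k)" "rho (act g q) q' \<le> c0 powi k'"
    and h: "h \<in> carrier G" "ratio h = c0 powi (k'' - k')" "rho (act h q') q'' \<le> c0 powi k''"
    using assms(4,5) by (auto simp: related_def)
  have 1: "act g q \<in> Q" "act h (act g q) \<in> Q" "act h q' \<in> Q" using g h Q by (auto intro!: act_closed)
  have "rho (act h (act g q)) (act h q') \<le> c0 powi k''"
  proof -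
    have "rho (act h (act g q)) (act h q') \<le> c0 powi (k'' - k') * c0 powi k'"
      using rho_act[OF h(1) 1(1) Q(2)] h g by simp
    then show ?thesis using gen(2) by (simp flip: power_int_add)
  qed
  then have "rho (act h (act g q)) q'' \<le> c0 powi k''"
    using rho_ultra[OF 1(2,3) Q(3)] h(3) by simp
  moreover have "ratio (h \<otimes> g) = c0 powi (k'' - k)"
    using g h gen(2) by (simp add: ratio_mult flip: power_int_add)
  ultimately show ?thesis
    using g h Q unfolding related_def by (intro bexI[of _ "h \<otimes> g"]) (auto simp: act_mult)
qed

lemma related_sym:
  assumes Q: "q \<in> Q" "q' \<in> Q" and "related q k q' k'" shows "related q' k' q k"
proof -
  obtain g where g: "g \<in> carrier G" "ratio g = c0 powi (k' - k)" "rho (act g q) q' \<le> c0 powi k'"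
    using assms(3) by (auto simp: related_def)
  have ig: "inv g \<in> carrier G" using g by simp
  have r: "ratio (inv g) = c0 powi (k - k')"
  proof -
    have "c0 powi (k - k') = inverse (c0 powi (k' - k))" by (metis minus_diff_eq power_int_minus)
    then show ?thesis using g by (simp add: ratio_inv inverse_eq_divide)
  qed
  have gQ: "act g q \<in> Q" "act (inv g) q' \<in> Q" using g Q by (auto intro!: act_closed)
  have "rho q (act (inv g) q') = c0 powi (k - k') * rho (act g q) q'"
    using rho_act[OF ig gQ(1) Q(2)] g Q r by (simp add: act_inv)
  also have "\<dots> \<le> c0 powi (k - k') * c0 powi k'" using g(3) by (intro mult_left_mono) (auto intro: less_imp_le)
  also have "\<dots> = c0 powi k" using gen(2) by (simp flip: power_int_add)
  finally show ?thesis using ig r rho_sym[OF Q(1) gQ(2)] unfolding related_def by auto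
qed

lemma related_shift: "related q k q' k' \<Longrightarrow> 0 \<le> j \<Longrightarrow> related q (k + j) q' (k' + j)"
  using power_int_increasing[of k' "k' + j" c0] gen(2) by (force simp: related_def)

lemma related_same_center:
  "\<lbrakk>q \<in> Q; q' \<in> Q; rho q q' \<le> c0 powi k\<rbrakk> \<Longrightarrow> related q k q' k"
  unfolding related_def by (intro bexI[of _ \<one>]) (auto simp: ratio_one act_one)

text \<open>There are finitely many orbits of balls, and passing to the next larger ball induces a
  surjection on orbits, hence a bijection; since any two balls have a common enlargement, balls of
  equal level lie in one orbit.\<close>

lemma related_level:
  assumes q: "q \<in> Q" and q': "q' \<in> Q" shows "related q k q' k"
proof -
  define q0 where "q0 = (\<lambda>_::int. 0::nat)"
  have q0: "q0 \<in> Q" by (simp add: q0_def zeroQ)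
  obtain E :: nat where E: "B < c0 ^ E" using real_arch_pow[OF gen(2)] by blast
  \<comment> \<open>Density up to the factor \<open>B\<close> puts every ball in the orbit of a ball
    around \<open>q0\<close> whose level lies strictly between \<open>- E\<close> and
    \<open>E\<close>.\<close>
  have orb: "\<exists>e. - int E < e \<and> e < int E \<and> related q0 (- e) t k" if t: "t \<in> Q" for t k
  proof -
    obtain g where g: "g \<in> carrier G" "c0 powi k / B \<le> ratio g" "ratio g \<le> B * c0 powi k" "rho (act g q0) t \<le> c0 powi k"
      using dense[OF q0 t, of "c0 powi k" "c0 powi k"] by auto
    obtain l where l: "ratio g = c0 powi l" using gen(3)[OF g(1)] by blast
    define e where "e = l - k"
    have cl: "c0 powi l = c0 powi e * c0 powi k" using gen(2) by (simp add: e_def flip: power_int_add)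
    have "c0 powi e \<le> B" using g(3) unfolding l cl by simp
    then have "c0 powi e < c0 powi int E" using E by simp
    then have 1: "e < int E" using powi_less_cancel[OF gen(2)] by blast
    have "c0 powi k \<le> B * c0 powi l" using g(2) B0 unfolding l by (simp add: divide_le_eq mult.commute)
    then have "1 \<le> B * c0 powi e" unfolding cl by simp
    then have "c0 powi (- e) \<le> B" using gen(2) by (simp add: power_int_minus field_simps)
    then have "c0 powi (- e) < c0 powi int E" using E by simp
    then have 2: "- e < int E" using powi_less_cancel[OF gen(2)] by blast
    have "related q0 (- e) t k" using g(1,4) l unfolding related_def by (intro bexI[of _ g]) (auto simp: e_def)
    then show ?thesis using 1 2 by (intro exI[of _ e]) auto
  qed
  \<comment> \<open>The pigeonhole argument gives a period of at most \<open>2 * E\<close> that may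
    depend on the ball; the factorial is a multiple of all of them.\<close>
  define f where "f = int (fact (2 * E))"
  have period: "related t k t (k + f)" if t: "t \<in> Q" for t k
  proof -
    have "\<forall>j. \<exists>e. - int E < e \<and> e < int E \<and> related q0 (- e) t (k - int j)" using orb[OF t] by blast
    then obtain e where e: "\<And>j. - int E < e j \<and> e j < int E \<and> related q0 (- e j) t (k - int j)" by metis
    \<comment> \<open>There are \<open>2 * E + 1\<close> levels but only \<open>2 * E - 1\<close>
      possible values.\<close>
    have "\<not> inj_on e {..2 * E}"
    proof
      assume "inj_on e {..2 * E}"
      then have "card {..2 * E} \<le> card {- int E<..<int E}"
        using e by (intro card_inj_on_le[of e]) auto
      then show False by simp
    qed
    then obtain i j where ij: "i < j" "j \<le> 2 * E" "e i = e j"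
      unfolding inj_on_def by (metis atMost_iff linorder_neqE_nat)
    define D where "D = int j - int i"
    have "related t (k - int j) t (k - int i)"
      using related_trans[OF t q0 t related_sym[OF q0 t]] e[of j] e[of i] ij(3) by metis
    from related_shift[OF this, of "int j"] have D1: "related t k t (k + D)" by (simp add: D_def algebra_simps)
    have Dn: "related t k t (k + int n * D)" for n
    proof (induction n)
      case 0
      then show ?case using related_same_center[OF t t, of k] by (simp add: rho_self t less_imp_le)
    next
      case (Suc n)
      have "related t (k + int n * D) t (k + D + int n * D)"
        using ij(1) by (intro related_shift D1) (simp add: D_def)
      from related_trans[OF t t t Suc this] show ?case by (simp add: algebra_simps)
    qed
    have "nat D dvd fact (2 * E)" using ij by (intro dvd_fact) (auto simp: D_def)
    then obtain n where "fact (2 * E) = nat D * n" by (auto simp: dvd_def)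
    then have "f = int n * D" using ij(1) by (simp add: f_def D_def)
    then show ?thesis using Dn[of n] by simp
  qed
  have f0: "0 < f" by (simp add: f_def)
  have periods: "related t k t (k + int n * f)" if t: "t \<in> Q" for t n
  proof (induction n)
    case 0
    then show ?case using related_same_center[OF t t, of k] by (simp add: rho_self t less_imp_le)
  next
    case (Suc n)
    from related_trans[OF t t t Suc period[OF t]] show ?case by (simp add: algebra_simps)
  qed
  \<comment> \<open>Raised by a suitable multiple of the common period, the two balls become one
    ball, and periodicity leads from it back to either of them.\<close>
  have "0 < max 1 (rho q q')" by simp
  then obtain l where l: "max 1 (rho q q') < c0 powi (l + 1)" using powi_bracket[OF gen(2)] by blast
  obtain n :: nat where n: "l + 1 - k \<le> int n * f"
    using f0 by (intro that[of "nat (l + 1 - k)"]) (smt (verit) int_nat_eq mult_le_cancel_left1 mult_nonneg_nonneg of_nat_0_le_iff)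
  have "rho q q' \<le> c0 powi (l + 1)" using l by simp
  also have "\<dots> \<le> c0 powi (k + int n * f)" using n gen(2) by (intro power_int_increasing) auto
  finally have "related q (k + int n * f) q' (k + int n * f)" by (rule related_same_center[OF q q'])
  from related_trans[OF q q q' periods[OF q] this]
  have "related q k q' (k + int n * f)" .
  from related_trans[OF q q' q' this related_sym[OF q' q' periods[OF q']]]
  show ?thesis .
qed

lemma level_transitive:
  assumes q: "q \<in> Q" and q': "q' \<in> Q"
  shows "\<exists>g\<in>carrier G. ratio g = c0 powi (k' - k) \<and> rho (act g q) q' \<le> c0 powi k'"
proof -
  have gG: "gen [^] (k' - k) \<in> carrier G" using gen(1) by simp
  have aQ: "act (gen [^] (k' - k)) q \<in> Q" by (rule act_closed[OF gG q])
  have "related q k (act (gen [^] (k' - k)) q) k'"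
    unfolding related_def using gG gen(1) aQ
    by (intro bexI[of _ "gen [^] (k' - k)"]) (auto simp: ratio_int_pow rho_self c0_def[symmetric] less_imp_le)
  from related_trans[OF q aQ q' this related_level[OF aQ q']]
  show ?thesis by (simp add: related_def)
qed

end

text \<open>Descent as in Euclid's algorithm: equal powers of \<open>x < y\<close> force
  \<open>x\<close> to divide \<open>y\<close>, and \<open>x\<close> and \<open>y div x\<close> again
  have equal powers.\<close>

lemma common_base:
  fixes m s :: nat
  assumes "2 \<le> m" "2 \<le> s" "m ^ b = s ^ a" "1 \<le> b"
  shows "\<exists>c i j. 1 \<le> i \<and> 1 \<le> j \<and> m = c ^ i \<and> s = c ^ j"
  using assms
proof (induction "m + s" arbitrary: m s a b rule: less_induct)
  case less
  have a1: "1 \<le> a"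
  proof (rule ccontr)
    assume "\<not> 1 \<le> a"
    then have "m ^ b = 1" using less.prems by simp
    then show False using less.prems by simp
  qed
  have red: "\<exists>c i j. 1 \<le> i \<and> 1 \<le> j \<and> x = c ^ i \<and> y = c ^ j"
    if xy: "x < y" "2 \<le> x" "x ^ e = y ^ f" "1 \<le> e" "1 \<le> f" "x + y = m + s" for x y e f :: nat
  proof -
    have "f < e"
    proof (rule ccontr)
      assume "\<not> f < e"
      then have "y ^ e \<le> y ^ f" using xy by (intro power_increasing) auto
      moreover have "x ^ e < y ^ e" using xy by (intro power_strict_mono) auto
      ultimately show False using xy by simp
    qed
    then have "x ^ f dvd y ^ f" using xy(3) by (metis le_imp_power_dvd less_imp_le)
    then have "x dvd y" using xy(5) by (simp add: pow_divides_pow_iff)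
    then obtain z where z: "y = x * z" by (auto simp: dvd_def)
    have z2: "2 \<le> z" using xy(1) z by (cases z; cases "z - 1") auto
    have "x ^ (e - f) = z ^ f"
    proof -
      have "x ^ f * x ^ (e - f) = x ^ f * z ^ f"
        using xy(3) \<open>f < e\<close> by (simp add: z power_mult_distrib flip: power_add)
      then show ?thesis using xy(2) by simp
    qed
    moreover have "x + z < m + s" using xy(1,2,6) z z2 by (simp add: nat_less_add_iff1) (metis One_nat_def Suc_1 Suc_le_lessD lessI less_trans mult.commute n_less_m_mult_n add_less_cancel_left z xy(6))
    ultimately have "\<exists>c i j. 1 \<le> i \<and> 1 \<le> j \<and> x = c ^ i \<and> z = c ^ j"
      using xy(2) z2 \<open>f < e\<close> by (intro less.hyps[of x z "e - f" f]) auto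
    then obtain c i j where "1 \<le> i" "1 \<le> j" "x = c ^ i" "z = c ^ j" by blast
    then show ?thesis using z by (intro exI[of _ c] exI[of _ i] exI[of _ "i + j"]) (simp add: power_add)
  qed
  consider "m = s" | "m < s" | "s < m" by linarith
  then show ?case
  proof cases
    case 1
    then show ?thesis by (intro exI[of _ m] exI[of _ 1]) simp
  next
    case 2
    then show ?thesis using red[of m s b a] less.prems a1 by auto
  next
    case 3
    then show ?thesis using red[of s m a b] less.prems a1 by (metis add.commute)
  qed
qed

lemma le_of_powers_le:
  fixes a b C :: real
  assumes "0 < a" "0 < b" "\<And>n. a ^ n \<le> C * b ^ n" shows "a \<le> b"
proof (rule ccontr)
  assume "\<not> a \<le> b"
  then have "1 < a / b" using assms by simp
  then obtain n where "C < (a / b) ^ n" using real_arch_pow by blast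
  then have "C * b ^ n < a ^ n" using assms(2) by (simp add: power_divide less_divide_eq)
  then show False using assms(3)[of n] by simp
qed

section \<open>Counting balls against cells\<close>

context madic_similarity
begin

lemma ball_eqI:
  assumes "s \<in> Q" "t \<in> Q" "\<And>l. l < i \<Longrightarrow> s l = t l" "K * real m powi (- i - 1) \<le> c0 powi j"
  shows "ball j s = ball j t"
proof -
  have "dist_madic m s t \<le> real m powi (- i - 1)" using dist_madic_le_iff[OF assms(1,2) m2] assms(3) by blast
  then have "K * dist_madic m s t \<le> K * real m powi (- i - 1)" using K1 by (intro mult_left_mono) auto
  then have "rho s t \<le> c0 powi j" using rho_upper[OF assms(1,2)] assms(4) by linarith
  then show ?thesis using ball_eq_iff[OF assms(1,2)] by simp
qed

lemma ball_eqD: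
  assumes "s \<in> Q" "t \<in> Q" "ball j s = ball j t" "c0 powi j \<le> real m powi (- i - 1)" "l < i"
  shows "s l = t l"
proof -
  have "dist_madic m s t \<le> real m powi (- i - 1)"
    using ball_eq_iff[OF assms(1,2), of j] assms(3,4) rho_lower[OF assms(1,2)] by simp
  then show ?thesis using dist_madic_le_iff[OF assms(1,2) m2] assms(5) by blast
qed

lemma balls_le_digits:
  assumes A: "A \<subseteq> cell m i0 q" and K: "K * real m powi (- i1 - 1) \<le> c0 powi j"
  shows "finite (ball j ` A)" "card (ball j ` A) \<le> m ^ nat (i1 - i0)"
proof -
  have AQ: "A \<subseteq> Q" using A cell_subset by blast
  have fac: "ball j x = ball j y" if xy: "x \<in> A" "y \<in> A" "digits i0 i1 x = digits i0 i1 y" for x y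
  proof (rule ball_eqI[OF _ _ _ K])
    fix l assume l: "l < i1"
    have "x \<in> cell m i0 q" "y \<in> cell m i0 q" using xy A by auto
    then show "x l = y l"
      using xy(3) l unfolding digits_eq_iff cell_def by (cases "l < i0") auto
  qed (use xy AQ in auto)
  show "finite (ball j ` A)" by (rule card_image_factor(1)[OF digits_finite[OF AQ] fac])
  have "card (ball j ` A) \<le> card (digits i0 i1 ` A)" by (rule card_image_factor(2)[OF digits_finite[OF AQ] fac])
  then show "card (ball j ` A) \<le> m ^ nat (i1 - i0)" using digits_card[OF AQ, of i0 i1] by simp
qed

lemma ball_in_cell:
  assumes "q \<in> Q" "c0 powi k \<le> real m powi (- i - 1)" shows "ball k q \<subseteq> cell m i q"
proof
  fix t assume t: "t \<in> ball k q"
  then have "t \<in> Q" "rho q t \<le> real m powi (- i - 1)" using assms by (auto simp: ball_def)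
  then have "dist_madic m q t \<le> real m powi (- i - 1)" using rho_lower[OF assms(1)] by force
  then show "t \<in> cell m i q" using \<open>t \<in> Q\<close> dist_madic_le_iff[OF assms(1) _ m2] by (auto simp: cell_def)
qed

lemma exists_exponent: "0 < x \<Longrightarrow> \<exists>i. real m powi (- i - 1) \<le> x \<and> x < real m powi (- i)"
proof -
  assume "0 < x"
  then obtain k where k: "real m powi k \<le> x" "x < real m powi (k + 1)" using powi_bracket[OF m1] by blast
  have "- (- k - 1) - 1 = k" "- (- k - 1) = k + 1" by auto
  then show ?thesis using k by metis
qed

lemma finite_balls: assumes q: "q \<in> Q" shows "finite (ball j ` ball k q)"
proof -
  obtain i1 where "real m powi (- i1 - 1) \<le> c0 powi j / K" using exists_exponent[of "c0 powi j / K"] K1 by auto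
  then have 1: "K * real m powi (- i1 - 1) \<le> c0 powi j" using K1 by (simp add: le_divide_eq mult.commute)
  obtain i where "c0 powi k < real m powi (- i)" using exists_exponent[of "c0 powi k"] by auto
  then have "c0 powi k \<le> real m powi (- (i - 1) - 1)" by simp
  from ball_in_cell[OF q this] show ?thesis by (rule balls_le_digits(1)[OF _ 1])
qed

text \<open>The number of children of one sample ball; transitivity makes it the number for every
  ball.\<close>

definition nkids :: nat where
  "nkids = card (ball (- 1) ` ball 0 (\<lambda>_. 0))"

lemma card_kids: assumes q: "q \<in> Q" shows "card (ball (k - 1) ` ball k q) = nkids"
proof -
  have le: "card (ball (k' - 1) ` ball k' q') \<le> card (ball (k - 1) ` ball k q)"
    if q: "q \<in> Q" and q': "q' \<in> Q" for q q' k k'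
  proof -
    obtain g where g: "g \<in> carrier G" "ratio g = c0 powi (k' - k)" "rho (act g q) q' \<le> c0 powi k'"
      using level_transitive[OF q q'] by blast
    have gq: "act g q \<in> Q" by (rule act_closed[OF g(1) q])
    have b: "act g ` ball k q = ball k' q'"
      using act_ball[OF g(1) q g(2), of k] ball_eq_iff[OF gq q', of k'] g(3) by simp
    have "ball (k' - 1) ` ball k' q' = (\<lambda>B. act g ` B) ` (ball (k - 1) ` ball k q)"
    proof -
      have "ball (k' - 1) (act g t) = act g ` ball (k - 1) t" if "t \<in> ball k q" for t
        using act_ball[OF g(1) _ g(2), of t "k - 1"] that ball_subset by auto
      then show ?thesis unfolding b[symmetric] image_image by (intro image_cong) auto
    qed
    then show ?thesis by (simp add: card_image_le finite_balls[OF q])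
  qed
  show ?thesis
    unfolding nkids_def using le[OF q zeroQ, of 0 k] le[OF zeroQ q, of k 0] by simp
qed

text \<open>\<open>A\<close> is a disjoint union of balls of level \<open>j\<close>, and every ball
  splits into \<open>nkids\<close> balls at each further level.\<close>

lemma card_subballs:
  assumes A: "A \<subseteq> Q" "\<And>t. t \<in> A \<Longrightarrow> ball j t \<subseteq> A" and fin: "finite (ball j ` A)"
  shows "card (ball (j - int n) ` A) = card (ball j ` A) * nkids ^ n"
proof -
  have step: "finite (ball (l - 1) ` A) \<and> card (ball (l - 1) ` A) = card (ball l ` A) * nkids"
    if l: "\<And>t. t \<in> A \<Longrightarrow> ball l t \<subseteq> A" and fin: "finite (ball l ` A)" for l
  proof -
    define P where "P C = ball (l - 1) ` C" for C
    have "A = \<Union> (ball l ` A)" using l A(1) center_ball by blast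
    then have eq: "ball (l - 1) ` A = (\<Union>C\<in>ball l ` A. P C)" unfolding P_def by (metis image_Union image_image)
    have fP: "finite (P C)" if C: "C \<in> ball l ` A" for C
      using that finite_balls A(1) by (auto simp: P_def)
    have cP: "card (P C) = nkids" if C: "C \<in> ball l ` A" for C
      using that card_kids A(1) by (auto simp: P_def)
    have dis: "P C \<inter> P D = {}" if CD: "C \<in> ball l ` A" "D \<in> ball l ` A" "C \<noteq> D" for C D
    proof (rule ccontr)
      assume "P C \<inter> P D \<noteq> {}"
      then obtain x y where xy: "x \<in> C" "y \<in> D" "ball (l - 1) x = ball (l - 1) y" by (auto simp: P_def)
      obtain s t where st: "s \<in> A" "t \<in> A" "C = ball l s" "D = ball l t" using CD by auto
      have Qs: "s \<in> Q" "t \<in> Q" "x \<in> Q" "y \<in> Q" using st xy A(1) ball_subset by blast+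
      have "rho x y \<le> c0 powi (l - 1)" using xy(3) ball_eq_iff[OF Qs(3,4)] by simp
      also have "\<dots> \<le> c0 powi l" using gen(2) by (intro power_int_increasing) auto
      finally have "ball l x = ball l y" using ball_eq_iff[OF Qs(3,4)] by simp
      moreover have "ball l s = ball l x" "ball l t = ball l y"
        using xy st ball_eq_iff[OF Qs(1,3)] ball_eq_iff[OF Qs(2,4)] by (auto simp: ball_def)
      ultimately show False using CD(3) st by simp
    qed
    have "card (ball (l - 1) ` A) = (\<Sum>C\<in>ball l ` A. card (P C))"
      unfolding eq using fin fP dis by (intro card_UN_disjoint) auto
    also have "\<dots> = card (ball l ` A) * nkids" using cP by simp
    finally show ?thesis using fin fP unfolding eq by blast
  qed
  have "finite (ball (j - int n) ` A) \<and> card (ball (j - int n) ` A) = card (ball j ` A) * nkids ^ n"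
  proof (induction n)
    case 0
    then show ?case using fin by simp
  next
    case (Suc n)
    have "ball (j - int n) t \<subseteq> A" if "t \<in> A" for t
      using A(2)[OF that] ball_mono[of "j - int n" j t] by auto
    from step[OF this] Suc have "finite (ball (j - int n - 1) ` A) \<and> card (ball (j - int n - 1) ` A) = card (ball j ` A) * nkids ^ n * nkids"
      by auto
    then show ?case by (simp add: algebra_simps)
  qed
  then show ?thesis ..
qed

lemma ball_self_contained: "q \<in> Q \<Longrightarrow> t \<in> ball k q \<Longrightarrow> ball k t \<subseteq> ball k q"
  using ball_eq_iff[of q t k] by (auto simp: ball_def)

lemma card_descendants: assumes q: "q \<in> Q" shows "card (ball (k - int n) ` ball k q) = nkids ^ n"
proof -
  have "ball k ` ball k q = {ball k q}"
    using ball_eq_iff[OF q] center_ball[OF q, of k] by (auto simp: ball_def)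
  then show ?thesis
    using card_subballs[of "ball k q" k n] ball_subset ball_self_contained[OF q] by simp
qed

lemma nkids_pos: "0 < nkids"
proof -
  have "ball (- 1) ` ball 0 (\<lambda>_. 0) \<noteq> {}" using center_ball[OF zeroQ] by blast
  then show ?thesis unfolding nkids_def using finite_balls[OF zeroQ] by (simp add: card_gt_0_iff)
qed

text \<open>A ball contains \<open>nkids ^ n\<close> balls that are \<open>n\<close> levels smaller.
  Counting digit strings bounds this number between constant multiples of \<open>c0 ^ n\<close>, and
  n-th powers absorb the constants.\<close>

lemma nkids_eq_c0: "real nkids = c0"
proof (rule antisym)
  define q where "q = (\<lambda>_::int. 0::nat)"
  have q: "q \<in> Q" by (simp add: q_def zeroQ)
  have cn: "c0 powi (- int n) = 1 / c0 ^ n" for n by (simp add: power_int_minus inverse_eq_divide)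
  have c0p: "0 < c0" using gen(2) by simp
  show "real nkids \<le> c0"
  proof (rule le_of_powers_le)
    fix n
    have "0 < c0 powi (- int n) / K" using K1 by simp
    then obtain i where i: "real m powi (- i - 1) \<le> c0 powi (- int n) / K" "c0 powi (- int n) / K < real m powi (- i)"
      using exists_exponent by blast
    have 1: "K * real m powi (- i - 1) \<le> c0 powi (- int n)" using i(1) K1 by (simp add: le_divide_eq mult.commute)
    have sub: "ball 0 q \<subseteq> cell m (- 1) q" by (rule ball_in_cell[OF q]) simp
    have "card (ball (- int n) ` ball 0 q) \<le> m ^ nat (i - (- 1))" by (rule balls_le_digits(2)[OF sub 1])
    then have "nkids ^ n \<le> m ^ nat (i + 1)" using card_descendants[OF q, of 0 n] by simp
    then have "real (nkids ^ n) \<le> real (m ^ nat (i + 1))" by (rule of_nat_mono)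
    also have "\<dots> = real m powi (i + 1)"
    proof -
      have "real m powi (- i - 1) \<le> 1"
      proof -
        have "c0 powi (- int n) / K \<le> 1" using K1 gen(2) by (simp add: cn divide_le_eq) (metis mult_mono' one_le_power less_imp_le mult_1 zero_le_one)
        then show ?thesis using i(1) by simp
      qed
      then have "real m powi (- i - 1) \<le> real m powi 0" by simp
      then have "0 \<le> i + 1" using powi_le_cancel[OF m1, of "- i - 1" 0] by simp
      then show ?thesis by (simp add: power_int_def)
    qed
    also have "\<dots> = real m / real m powi (- i)" using m2 by (simp add: power_int_minus power_int_add field_simps)
    also have "\<dots> \<le> real m / (c0 powi (- int n) / K)"
      using i(2) \<open>0 < c0 powi (- int n) / K\<close> m2 by (intro divide_left_mono mult_pos_pos) auto
    also have "\<dots> = real m * K * c0 ^ n" by (simp add: cn)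
    finally show "real nkids ^ n \<le> real m * K * c0 ^ n" by simp
  qed (use nkids_pos c0p in auto)
  obtain i0 where i0: "real m powi (- i0 - 1) \<le> 1 / K" using exists_exponent[of "1 / K"] K1 by auto
  have sub: "cell m i0 q \<subseteq> ball 0 q"
  proof
    fix t assume t: "t \<in> cell m i0 q"
    then have tQ: "t \<in> Q" using cell_subset by blast
    have "K * real m powi (- i0 - 1) \<le> c0 powi 0" using i0 K1 by (simp add: le_divide_eq mult.commute)
    then have "ball 0 q = ball 0 t" using t by (intro ball_eqI[OF q tQ]) (auto simp: cell_def)
    then show "t \<in> ball 0 q" using center_ball[OF tQ] by simp
  qed
  show "c0 \<le> real nkids"
  proof (rule le_of_powers_le)
    fix n
    \<comment> \<open>Conversely, a ball of level \<open>- int n\<close> determines the digits below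
      \<open>i' - 1\<close>.\<close>
    obtain i' where i': "real m powi (- i' - 1) \<le> c0 powi (- int n)" "c0 powi (- int n) < real m powi (- i')"
      using exists_exponent[of "c0 powi (- int n)"] by auto
    define i where "i = i' - 1"
    have ci: "c0 powi (- int n) \<le> real m powi (- i - 1)" using i'(2) by (simp add: i_def)
    have fin: "finite (ball (- int n) ` cell m i0 q)"
      using finite_subset[OF image_mono[OF sub] finite_balls[OF q]] .
    have "real m powi (i - i0) \<le> real (m ^ nat (i - i0))"
    proof (cases "0 \<le> i - i0")
      case False
      then have "real m powi (i - i0) \<le> real m powi 0" using m1 by (intro power_int_increasing) auto
      then show ?thesis using False by simp
    qed (simp add: power_int_def)
    also have "m ^ nat (i - i0) = card (digits i0 i ` cell m i0 q)" by (rule digits_cell_card[OF q, symmetric])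
    also have "real \<dots> \<le> real (card (ball (- int n) ` cell m i0 q))"
    proof (rule of_nat_mono, rule card_image_factor(2)[OF fin])
      fix x y assume xy: "x \<in> cell m i0 q" "y \<in> cell m i0 q" "ball (- int n) x = ball (- int n) y"
      then show "digits i0 i x = digits i0 i y"
        unfolding digits_eq_iff using ball_eqD[OF _ _ xy(3) ci] cell_subset by blast
    qed
    also have "\<dots> \<le> real (card (ball (- int n) ` ball 0 q))"
      using card_mono[OF finite_balls[OF q] image_mono[OF sub]] by simp
    also have "\<dots> = real nkids ^ n" using card_descendants[OF q, of 0 n] by simp
    finally have le: "real m powi (i - i0) \<le> real nkids ^ n" .
    have "real m powi i' * real m \<ge> c0 ^ n"
    proof -
      have "1 / (real m powi i' * real m) \<le> 1 / c0 ^ n"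
        using i'(1) m2 by (simp add: cn power_int_diff power_int_minus inverse_eq_divide)
      then show ?thesis using c0p m2 by (simp add: field_simps)
    qed
    moreover have "real m powi (i - i0) = real m powi i' * real m powi (- 1 - i0)"
      using m2 by (simp add: i_def algebra_simps flip: power_int_add)
    ultimately have "c0 ^ n \<le> real m * (real m powi (i - i0) / real m powi (- 1 - i0))"
      using m2 by (simp add: mult.commute)
    also have "\<dots> \<le> real m * (real nkids ^ n / real m powi (- 1 - i0))"
      using le m2 by (intro mult_left_mono divide_right_mono) auto
    finally show "c0 ^ n \<le> (real m / real m powi (- 1 - i0)) * real nkids ^ n" by simp
  qed (use nkids_pos c0p in auto)
qed

lemma nkids_ge_2: "2 \<le> nkids"
  using gen(2) unfolding nkids_eq_c0[symmetric] by simp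

lemma c0_powi_minus: "c0 powi (- int n) = 1 / real nkids ^ n"
  unfolding nkids_eq_c0 by (simp add: power_int_minus inverse_eq_divide)

text \<open>The ratio between the number of small balls in an m-adic cell and the size of the cell is
  compared along a nested chain of cells starting where this ratio is almost maximal: on such a
  chain it is almost constant, and the pigeonhole principle on the numerators yields equal powers.\<close>

lemma equal_powers: "\<exists>a b. 1 \<le> b \<and> m ^ b = nkids ^ a"
proof -
  let ?s = nkids
  \<comment> \<open>The least depth whose ball radius is at most the radius
    \<open>real m powi (- int i - 1)\<close> of a cell of index \<open>i\<close>; from there on
    cells are unions of balls.\<close>
  define k where "k i = (LEAST k. m ^ (i + 1) \<le> ?s ^ k)" for i
  have kex: "\<exists>k. m ^ (i + 1) \<le> ?s ^ k" for i
  proof -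
    obtain k where "real (m ^ (i + 1)) < real ?s ^ k" using real_arch_pow[of "real ?s"] nkids_ge_2 by auto
    then have "real (m ^ (i + 1)) \<le> real (?s ^ k)" by simp
    then show ?thesis by (metis of_nat_le_iff)
  qed
  have k1: "m ^ (i + 1) \<le> ?s ^ k i" for i unfolding k_def by (rule LeastI_ex[OF kex])
  have k0: "k i \<noteq> 0" for i
  proof
    assume "k i = 0"
    then have "m ^ (i + 1) \<le> 1" using k1[of i] by simp
    moreover have "1 < m ^ (i + 1)" using m2 by (intro one_less_power) auto
    ultimately show False by simp
  qed
  have k2: "?s ^ k i < ?s * m ^ (i + 1)" for i
  proof -
    have "\<not> m ^ (i + 1) \<le> ?s ^ (k i - 1)"
      using not_less_Least[of "k i - 1" "\<lambda>k. m ^ (i + 1) \<le> ?s ^ k"] k0[of i] by (simp add: k_def)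
    then have "?s * ?s ^ (k i - 1) < ?s * m ^ (i + 1)" using nkids_pos by simp
    then show ?thesis using k0[of i] by (metis Suc_pred' gr0I power_Suc)
  qed
  have kmono: "k i \<le> k j" if "i \<le> j" for i j
  proof -
    have "m ^ (i + 1) \<le> m ^ (j + 1)" using that m2 by (intro power_increasing) auto
    from order_trans[OF this k1] have "m ^ (i + 1) \<le> ?s ^ k j" .
    then show ?thesis unfolding k_def[of i] by (rule Least_le)
  qed
  define n where "n i q = card (ball (- int (k i)) ` cell m (int i) q)" for i :: nat and q
  have ck: "c0 powi (- int (k i)) \<le> real m powi (- int i - 1)" for i
  proof -
    have "real m powi (- int i - 1) = 1 / real (m ^ (i + 1))"
      by (simp add: power_int_diff power_int_minus inverse_eq_divide mult.commute m2)
    moreover have "1 / real (?s ^ k i) \<le> 1 / real (m ^ (i + 1))"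
      using of_nat_mono[OF k1[of i], where 'a = real] m2 nkids_pos
      by (intro divide_left_mono mult_pos_pos) (auto simp del: power_Suc)
    ultimately show ?thesis by (simp add: c0_powi_minus)
  qed
  have sat: "ball (- int (k i)) t \<subseteq> cell m (int i) q" if "t \<in> cell m (int i) q" for i t q
    using ball_in_cell[OF _ ck[of i], of t] that by (auto simp: cell_def)
  \<comment> \<open>Minimality of \<open>k i\<close> means that \<open>e\<close> digits beyond the
    cell determine the ball, so the number of balls in a cell is bounded by \<open>N\<close>,
    independently of the cell.\<close>
  obtain e where e: "K * ?s < real m ^ e" using real_arch_pow[OF m1] by blast
  define N where "N = m ^ e"
  have fin: "finite (ball (- int (k i)) ` cell m (int i) q)" and nN: "n i q \<le> N" for i q
  proof -
    have "K * real m powi (- (int i + int e) - 1) \<le> c0 powi (- int (k i))"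
    proof -
      have "real (?s ^ k i) \<le> real ?s * real (m ^ (i + 1))" using k2[of i] by (simp flip: of_nat_mult del: of_nat_power)
      then have "K * real (?s ^ k i) \<le> K * (real ?s * real (m ^ (i + 1)))" using K1 by (intro mult_left_mono) auto
      also have "\<dots> = (K * real ?s) * real (m ^ (i + 1))" by simp
      also have "\<dots> \<le> real m ^ e * real (m ^ (i + 1))" using e by (intro mult_right_mono) auto
      finally have "K * real (?s ^ k i) \<le> real m ^ (i + e + 1)" by (simp add: power_add mult_ac)
      then have "K * (1 / real m ^ (i + e + 1)) \<le> 1 / real ?s ^ k i"
        using nkids_pos m2 by (simp add: divide_simps mult_ac del: power_Suc)
      moreover have "real m powi (- (int i + int e) - 1) = 1 / real m ^ (i + e + 1)"
      proof -
        have "- (int i + int e) - 1 = - int (i + e + 1)" by simp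
        then show ?thesis by (simp only: power_int_minus power_int_of_nat inverse_eq_divide)
      qed
      ultimately show ?thesis by (simp only: c0_powi_minus)
    qed
    from balls_le_digits[OF order_refl this, of "int i" q]
    show "finite (ball (- int (k i)) ` cell m (int i) q)" "n i q \<le> N" by (simp_all add: n_def N_def)
  qed
  have n1: "1 \<le> n i q" if "q \<in> Q" for i q
  proof -
    have "q \<in> cell m (int i) q" using that by (simp add: cell_def)
    then have "ball (- int (k i)) ` cell m (int i) q \<noteq> {}" by blast
    then show ?thesis using fin[of i q] by (simp add: n_def Suc_le_eq card_gt_0_iff)
  qed
  have updQ: "q(l := a) \<in> Q" if qa: "q \<in> Q" "a < m" for q a and l :: int
  proof -
    obtain N where N: "\<And>i. i < N \<Longrightarrow> q i = 0" using qa(1) by (auto simp: madics_def)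
    have "\<forall>i<min N l. (q(l := a)) i = 0" using N by simp
    moreover have "\<forall>i. (q(l := a)) i < m" using qa madics_less[OF qa(1)] by simp
    ultimately show ?thesis unfolding madics_def by blast
  qed
  have add: "n i q * ?s ^ (k (Suc i) - k i) = (\<Sum>a<m. n (Suc i) (q(int i := a)))" if q: "q \<in> Q" for i q
  proof -
    have cells: "cell m (int i) q = (\<Union>a<m. cell m (int (Suc i)) (q(int i := a)))"
    proof (intro equalityI subsetI)
      fix t assume t: "t \<in> cell m (int i) q"
      then have "t \<in> cell m (int (Suc i)) (q(int i := t (int i)))" by (auto simp: cell_def)
      moreover have "t (int i) < m" using t madics_less by (auto simp: cell_def)
      ultimately show "t \<in> (\<Union>a<m. cell m (int (Suc i)) (q(int i := a)))" by blast
    qed (auto simp: cell_def)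
    have "n i q * ?s ^ (k (Suc i) - k i) = card (ball (- int (k i) - int (k (Suc i) - k i)) ` cell m (int i) q)"
      unfolding n_def using cell_subset sat fin by (intro card_subballs[symmetric]) auto
    also have "- int (k i) - int (k (Suc i) - k i) = - int (k (Suc i))" using kmono[of i "Suc i"] by simp
    also have "card (ball (- int (k (Suc i))) ` cell m (int i) q) = card (\<Union>a<m. ball (- int (k (Suc i))) ` cell m (int (Suc i)) (q(int i := a)))"
      unfolding cells by (simp add: image_UN)
    also have "\<dots> = (\<Sum>a<m. n (Suc i) (q(int i := a)))"
      unfolding n_def
    proof (rule card_UN_disjoint)
      show "\<forall>a\<in>{..<m}. \<forall>b\<in>{..<m}. a \<noteq> b \<longrightarrow> ball (- int (k (Suc i))) ` cell m (int (Suc i)) (q(int i := a)) \<inter>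
        ball (- int (k (Suc i))) ` cell m (int (Suc i)) (q(int i := b)) = {}"
      proof (intro ballI impI, rule ccontr)
        fix a b assume ab: "a \<noteq> b" and "ball (- int (k (Suc i))) ` cell m (int (Suc i)) (q(int i := a)) \<inter>
          ball (- int (k (Suc i))) ` cell m (int (Suc i)) (q(int i := b)) \<noteq> {}"
        then obtain x y where xy: "x \<in> cell m (int (Suc i)) (q(int i := a))" "y \<in> cell m (int (Suc i)) (q(int i := b))"
          "ball (- int (k (Suc i))) x = ball (- int (k (Suc i))) y" by auto
        have "x \<in> Q" "y \<in> Q" using xy(1,2) by (auto simp: cell_def)
        then have "x (int i) = y (int i)" using ball_eqD[OF _ _ xy(3) ck[of "Suc i"], of "int i"] by simp
        then show False using xy ab by (simp add: cell_def)
      qed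
    qed (use fin[of "Suc i"] in auto)
    finally show ?thesis .
  qed
  \<comment> \<open>The density of small balls. Its value on a cell is the average of its values on
    the \<open>m\<close> subcells.\<close>
  define th where "th i q = real (n i q) * real m ^ i / real ?s ^ k i" for i q
  have thpos: "0 < th i q" if "q \<in> Q" for i q
    using n1[OF that, of i] m2 nkids_pos by (simp add: th_def)
  have thN: "th i q \<le> real N" for i q
  proof -
    have "real m ^ i \<le> real ?s ^ k i"
    proof -
      have "m ^ i \<le> m ^ (i + 1)" using m2 by (intro power_increasing) auto
      from order_trans[OF this k1] have "m ^ i \<le> ?s ^ k i" .
      then show ?thesis by (metis of_nat_le_iff of_nat_power)
    qed
    then have "real (n i q) * real m ^ i \<le> real N * real ?s ^ k i" using nN[of i q] by (intro mult_mono) auto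
    then show ?thesis using nkids_pos by (simp add: th_def divide_le_eq)
  qed
  have thadd: "(\<Sum>a<m. th (Suc i) (q(int i := a))) = real m * th i q" if q: "q \<in> Q" for i q
  proof -
    have "(\<Sum>a<m. th (Suc i) (q(int i := a))) = real (\<Sum>a<m. n (Suc i) (q(int i := a))) * real m ^ Suc i / real ?s ^ k (Suc i)"
      by (simp add: th_def sum_distrib_right sum_divide_distrib)
    also have "\<dots> = real (n i q) * real ?s ^ (k (Suc i) - k i) * real m ^ Suc i / real ?s ^ k (Suc i)"
      unfolding add[OF q, symmetric] by simp
    also have "real ?s ^ k (Suc i) = real ?s ^ (k (Suc i) - k i) * real ?s ^ k i"
      using kmono[of i "Suc i"] by (simp flip: power_add)
    also have "real (n i q) * real ?s ^ (k (Suc i) - k i) * real m ^ Suc i / (real ?s ^ (k (Suc i) - k i) * real ?s ^ k i) = real m * th i q"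
      using nkids_pos by (simp add: th_def)
    finally show ?thesis .
  qed
  define Th where "Th = Sup {th i q |i q. q \<in> Q}"
  have bdd: "bdd_above {th i q |i q. q \<in> Q}" using thN by (intro bdd_aboveI[of _ "real N"]) auto
  have thle: "th i q \<le> Th" if "q \<in> Q" for i q
    unfolding Th_def using bdd that by (intro cSup_upper) auto
  have Thpos: "0 < Th" using thpos[OF zeroQ, of 0] thle[OF zeroQ, of 0] by linarith
  \<comment> \<open>A deficit from the supremum can grow by the factor \<open>m\<close> at each
    subcell. After \<open>N\<close> steps it is still only a small part of
    \<open>Th\<close>.\<close>
  define \<delta> where "\<delta> = Th / (4 * real m ^ N * real m ^ N)"
  have d0: "0 < \<delta>" using Thpos m2 by (simp add: \<delta>_def)
  have "Th - \<delta> < Th" using d0 by simp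
  then obtain i q where q: "q \<in> Q" and iq: "Th - \<delta> < th i q"
    unfolding Th_def using less_cSup_iff[OF _ bdd, of "Th - \<delta>"] zeroQ unfolding Th_def by blast
  have chain: "Th - real m ^ l * \<delta> \<le> th (i + l) q" for l
  proof (induction l)
    case 0
    then show ?case using iq by simp
  next
    case (Suc l)
    let ?i = "i + l"
    have "q (int ?i) < m" by (rule madics_less[OF q])
    then have "real m * th ?i q = th (Suc ?i) (q(int ?i := q (int ?i))) + (\<Sum>a\<in>{..<m} - {q (int ?i)}. th (Suc ?i) (q(int ?i := a)))"
      unfolding thadd[OF q, symmetric] by (intro sum.remove) auto
    also have "\<dots> \<le> th (Suc ?i) q + (\<Sum>a\<in>{..<m} - {q (int ?i)}. Th)"
      using updQ[OF q] by (intro add_mono sum_mono thle) auto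
    also have "(\<Sum>a\<in>{..<m} - {q (int ?i)}. Th) = (real m - 1) * Th"
      using \<open>q (int ?i) < m\<close> by (simp add: of_nat_diff)
    finally have "real m * th ?i q - (real m - 1) * Th \<le> th (Suc ?i) q" by simp
    moreover have "real m * (Th - real m ^ l * \<delta>) \<le> real m * th ?i q" using Suc by (intro mult_left_mono) auto
    ultimately show ?case by (simp add: algebra_simps)
  qed
  have "\<not> inj_on (\<lambda>l. n (i + l) q) {..N}"
  proof
    assume "inj_on (\<lambda>l. n (i + l) q) {..N}"
    then have "card {..N} \<le> card {1..N}" using n1[OF q] nN by (intro card_inj_on_le) auto
    then show False by simp
  qed
  then obtain l l' where ll: "l < l'" "l' \<le> N" "n (i + l) q = n (i + l') q"
    unfolding inj_on_def by (metis atMost_iff linorder_neqE_nat)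
  define b where "b = l' - l"
  define a where "a = k (i + l') - k (i + l)"
  have lb: "i + l' = (i + l) + b" using ll by (simp add: b_def)
  have ka: "k (i + l') = k (i + l) + a" using kmono[of "i + l" "i + l'"] ll by (simp add: a_def)
  let ?x = "th (i + l) q" and ?y = "th (i + l') q"
  have y: "?y = real (n (i + l) q) * real m ^ ((i + l) + b) / real ?s ^ (k (i + l) + a)"
    unfolding th_def ka[symmetric] lb[symmetric] ll(3) ..
  \<comment> \<open>With equal numerators the two densities differ exactly by the quotient of the
    powers \<open>m ^ b\<close> and \<open>?s ^ a\<close>. As they are almost equal, these integers
    differ by less than 1.\<close>
  have xy: "?y * real ?s ^ a = ?x * real m ^ b"
    unfolding y th_def[of "i + l"] using nkids_pos by (simp add: power_add)
  define \<eta> where "\<eta> = Th / (4 * real m ^ N)"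
  have near: "Th - \<eta> \<le> th (i + j) q" if "j \<le> N" for j
  proof -
    have "real m ^ j * \<delta> \<le> real m ^ N * \<delta>"
      using that m2 d0 by (intro mult_right_mono power_increasing) auto
    also have "\<dots> = \<eta>" using m2 by (simp add: \<delta>_def \<eta>_def)
    finally show ?thesis using chain[of j] by simp
  qed
  have mN: "1 \<le> real m ^ N" using m2 by simp
  have e4: "\<eta> \<le> Th / 4" using mN Thpos by (simp add: \<eta>_def divide_le_eq field_simps)
  have "\<bar>?x - ?y\<bar> \<le> \<eta>" using near[of l] near[of l'] ll thle[OF q] by (simp add: abs_le_iff) (smt (verit))
  then have "real m ^ b * \<bar>?x - ?y\<bar> \<le> real m ^ N * \<eta>"
    using m2 ll by (intro mult_mono power_increasing) (auto simp: b_def)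
  also have "\<dots> = Th / 4" using m2 by (simp add: \<eta>_def)
  also have "\<dots> < ?y" using near[of l'] ll e4 Thpos by simp
  finally have "\<bar>real m ^ b * ?x - real m ^ b * ?y\<bar> < ?y" by (simp add: abs_mult flip: right_diff_distrib)
  then have "\<bar>?y * (real ?s ^ a - real m ^ b)\<bar> < ?y" by (simp add: right_diff_distrib xy mult.commute)
  then have "\<bar>real ?s ^ a - real m ^ b\<bar> < 1" using thpos[OF q, of "i + l'"] by (simp add: abs_mult)
  then have "\<bar>real (?s ^ a) - real (m ^ b)\<bar> < 1" by simp
  moreover have "x = y" if "\<bar>real x - real y\<bar> < 1" for x y :: nat using that by linarith
  ultimately have "?s ^ a = m ^ b" by blast
  then show ?thesis using ll by (intro exI[of _ a] exI[of _ b]) (auto simp: b_def)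
qed

lemma common_base_nkids: "\<exists>c i j. 1 \<le> i \<and> 1 \<le> j \<and> m = c ^ i \<and> nkids = c ^ j"
proof -
  obtain a b where "1 \<le> b" "m ^ b = nkids ^ a" using equal_powers by blast
  then show ?thesis using common_base[OF m2 nkids_ge_2] by blast
qed

end

section \<open>The homogeneous tree of balls\<close>

text \<open>Used to give label 0 to the child that contains the origin.\<close>

lemma exists_labelling:
  assumes "finite A" "x \<in> A"
  shows "\<exists>f. bij_betw f A {..<card A} \<and> f x = (0::nat)"
proof -
  obtain f where f: "bij_betw f A {..<card A}"
    using ex_bij_betw_finite_nat[OF assms(1)] by (auto simp: atLeast0LessThan)
  have c: "0 < card A" using assms by (auto simp: card_gt_0_iff)
  have fx: "f x < card A" using f assms(2) by (auto dest: bij_betwE)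
  have "bij_betw (Transposition.transpose (f x) 0) {..<card A} {..<card A}"
    by (intro bij_betw_transpose_iff) (use c fx in auto)
  from bij_betw_trans[OF f this] show ?thesis
    by (intro exI[of _ "Transposition.transpose (f x) 0 \<circ> f"]) simp
qed

context madic_similarity
begin

abbreviation q0 :: "int \<Rightarrow> nat" where "q0 \<equiv> (\<lambda>_. 0)"

text \<open>The labelling is chosen for each ball as a set, so points of the same ball share it
  whatever centre is used to name the ball.\<close>

lemma exists_labels:
  "\<exists>L. \<forall>k. \<forall>q\<in>Q. bij_betw (L k (ball k q)) (ball (k - 1) ` ball k q) {..<nkids} \<and>
     (q0 \<in> ball k q \<longrightarrow> L k (ball k q) (ball (k - 1) q0) = (0::nat))"
proof -
  have "\<exists>f. \<forall>C\<in>ball k ` Q. bij_betw (f C) (ball (k - 1) ` C) {..<nkids} \<and>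
     (q0 \<in> C \<longrightarrow> f C (ball (k - 1) q0) = (0::nat))" for k
  proof (rule bchoice, rule ballI)
    fix C assume "C \<in> ball k ` Q"
    then obtain q where q: "q \<in> Q" "C = ball k q" by blast
    \<comment> \<open>Away from the origin the child with label 0 is arbitrary.\<close>
    define x where "x = (if q0 \<in> C then ball (k - 1) q0 else ball (k - 1) q)"
    have "x \<in> ball (k - 1) ` C" using q center_ball[OF q(1), of k] by (auto simp: x_def)
    moreover have "finite (ball (k - 1) ` C)" using finite_balls q by simp
    moreover have "card (ball (k - 1) ` C) = nkids" using card_kids q by simp
    ultimately obtain f where "bij_betw f (ball (k - 1) ` C) {..<nkids}" "f x = (0::nat)"
      using exists_labelling[of "ball (k - 1) ` C" x] by auto
    then show "\<exists>y. bij_betw y (ball (k - 1) ` C) {..<nkids} \<and> (q0 \<in> C \<longrightarrow> y (ball (k - 1) q0) = 0)"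
      by (intro exI[of _ f]) (auto simp: x_def)
  qed
  then have "\<forall>k. \<exists>f. \<forall>C\<in>ball k ` Q. bij_betw (f C) (ball (k - 1) ` C) {..<nkids} \<and>
     (q0 \<in> C \<longrightarrow> f C (ball (k - 1) q0) = (0::nat))" by blast
  from choice[OF this] show ?thesis by blast
qed

definition label :: "int \<Rightarrow> (int \<Rightarrow> nat) set \<Rightarrow> (int \<Rightarrow> nat) set \<Rightarrow> nat" where
  "label = (SOME L. \<forall>k. \<forall>q\<in>Q. bij_betw (L k (ball k q)) (ball (k - 1) ` ball k q) {..<nkids} \<and>
     (q0 \<in> ball k q \<longrightarrow> L k (ball k q) (ball (k - 1) q0) = (0::nat)))"

lemma label:
  assumes "q \<in> Q"
  shows label_bij: "bij_betw (label k (ball k q)) (ball (k - 1) ` ball k q) {..<nkids}"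
    and label_zero: "q0 \<in> ball k q \<Longrightarrow> label k (ball k q) (ball (k - 1) q0) = 0"
  using someI_ex[OF exists_labels] assms unfolding label_def by blast+

text \<open>The digit with index \<open>i\<close> of \<open>code q\<close> tells which child of the ball of level \<open>- i - 1\<close> around
  \<open>q\<close> contains \<open>q\<close>.\<close>

definition code :: "(int \<Rightarrow> nat) \<Rightarrow> int \<Rightarrow> nat" where
  "code q i = label (- i - 1) (ball (- i - 1) q) (ball (- i - 1 - 1) q)"

lemma exists_level: "\<exists>k. x \<le> c0 powi k"
proof -
  have "0 < max 1 x" by simp
  then obtain k where "max 1 x < c0 powi (k + 1)" using powi_bracket[OF gen(2)] by blast
  then show ?thesis by (intro exI[of _ "k + 1"]) simp
qed

lemma ball_eq_mono:
  assumes "s \<in> Q" "t \<in> Q" "ball i s = ball i t" "i \<le> j" shows "ball j s = ball j t"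
proof -
  have "rho s t \<le> c0 powi i" using assms ball_eq_iff by blast
  also have "\<dots> \<le> c0 powi j" using assms(4) gen(2) by (intro power_int_increasing) auto
  finally show ?thesis using ball_eq_iff[OF assms(1,2)] by blast
qed

lemma child_mem: "q \<in> Q \<Longrightarrow> ball (k - 1) q \<in> ball (k - 1) ` ball k q"
  using center_ball by blast

lemma code_less: "q \<in> Q \<Longrightarrow> code q i < nkids"
  unfolding code_def using bij_betwE[OF label_bij[of q "- i - 1"]] child_mem[of q "- i - 1"] by auto

text \<open>Sufficiently large balls around \<open>q\<close> are balls around the origin, and the
  child there has label 0, so the digits vanish far to the left.\<close>

lemma code_madics: assumes q: "q \<in> Q" shows "code q \<in> madics nkids"
proof -
  obtain k where k: "rho q q0 \<le> c0 powi k" using exists_level by blast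
  have "code q i = 0" if i: "i < - k - 2" for i
  proof -
    have "ball k q = ball k q0" using k ball_eq_iff[OF q zeroQ] by blast
    then have b1: "ball (- i - 1 - 1) q = ball (- i - 1 - 1) q0" and b2: "ball (- i - 1) q = ball (- i - 1) q0"
      using i ball_eq_mono[OF q zeroQ, of k] by auto
    have "q0 \<in> ball (- i - 1) q" unfolding b2 by (rule center_ball[OF zeroQ])
    then show ?thesis unfolding code_def b1 by (rule label_zero[OF q])
  qed
  then show ?thesis using code_less[OF q] unfolding madics_def by blast
qed

lemma code_agree:
  assumes q: "q \<in> Q" and t: "t \<in> Q"
  shows "(\<forall>i<j. code q i = code t i) \<longleftrightarrow> ball (- j - 1) q = ball (- j - 1) t"
proof
  assume b: "ball (- j - 1) q = ball (- j - 1) t"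
  show "\<forall>i<j. code q i = code t i"
  proof (intro allI impI)
    fix i assume "i < j"
    then have "ball (- i - 1) q = ball (- i - 1) t" "ball (- i - 1 - 1) q = ball (- i - 1 - 1) t"
      using ball_eq_mono[OF q t b] by auto
    then show "code q i = code t i" by (simp add: code_def)
  qed
next
  assume c: "\<forall>i<j. code q i = code t i"
  obtain k where "rho q t \<le> c0 powi k" using exists_level by blast
  then have k: "ball k q = ball k t" using ball_eq_iff[OF q t] by blast
  \<comment> \<open>Descent from a ball that contains both points: at each level equal digits select
    the same child, since labels are injective.\<close>
  have "ball (max k (- j - 1) - int n) q = ball (max k (- j - 1) - int n) t"
    if "int n \<le> max k (- j - 1) - (- j - 1)" for n
    using that
  proof (induction n)
    case 0
    then show ?case using ball_eq_mono[OF q t k] by simp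
  next
    case (Suc n)
    define l where "l = max k (- j - 1) - int n"
    have bl: "ball l q = ball l t" using Suc by (simp add: l_def)
    have "- l - 1 < j" using Suc(2) by (simp add: l_def)
    then have "code q (- l - 1) = code t (- l - 1)" using c by blast
    then have "label l (ball l q) (ball (l - 1) q) = label l (ball l q) (ball (l - 1) t)"
      using bl by (simp add: code_def)
    moreover have "ball (l - 1) t \<in> ball (l - 1) ` ball l q" using child_mem[OF t] bl by simp
    ultimately have "ball (l - 1) q = ball (l - 1) t"
      using bij_betw_imp_inj_on[OF label_bij[OF q, of l]] child_mem[OF q, of l] by (auto dest: inj_onD)
    then show ?case by (simp add: l_def algebra_simps)
  qed
  from this[of "nat (max k (- j - 1) - (- j - 1))"]
  show "ball (- j - 1) q = ball (- j - 1) t" by simp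
qed

abbreviation cdist :: "(int \<Rightarrow> nat) \<Rightarrow> (int \<Rightarrow> nat) \<Rightarrow> real" where
  "cdist q t \<equiv> dist_madic nkids (code q) (code t)"

text \<open>The code metric has the same balls as \<open>rho\<close> at powers of \<open>c0\<close>;
  it amounts to \<open>rho\<close> rounded up to such a power.\<close>

lemma cdist_le_iff:
  assumes q: "q \<in> Q" and t: "t \<in> Q"
  shows "cdist q t \<le> c0 powi k \<longleftrightarrow> rho q t \<le> c0 powi k"
proof -
  have "cdist q t \<le> real nkids powi (- (- k - 1) - 1) \<longleftrightarrow> (\<forall>i < - k - 1. code q i = code t i)"
    by (rule dist_madic_le_iff[OF code_madics[OF q] code_madics[OF t] nkids_ge_2])
  also have "\<dots> \<longleftrightarrow> ball (- (- k - 1) - 1) q = ball (- (- k - 1) - 1) t" by (rule code_agree[OF q t])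
  finally show ?thesis using ball_eq_iff[OF q t] by (simp add: nkids_eq_c0)
qed

lemma cdist_cases: "cdist q t = 0 \<or> (\<exists>k. cdist q t = c0 powi k)"
proof (cases "code q = code t")
  case False
  then show ?thesis using dist_madic_powi[of "code q" "code t" nkids] by (auto simp: nkids_eq_c0)
qed simp

lemma code_inj: "inj_on code Q"
proof (rule inj_onI)
  fix q t assume qt: "q \<in> Q" "t \<in> Q" "code q = code t"
  have le: "rho q t \<le> c0 powi k" for k
  proof -
    have "cdist q t \<le> c0 powi k" using qt(3) by (simp add: less_imp_le)
    then show ?thesis using cdist_le_iff[OF qt(1,2)] by blast
  qed
  have "rho q t \<le> 0"
  proof (rule ccontr)
    assume "\<not> rho q t \<le> 0"
    then obtain k where "c0 powi k \<le> rho q t" using powi_bracket[OF gen(2), of "rho q t"] by auto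
    moreover have "c0 powi (k - 1) < c0 powi k" using powi_less_cancel[OF gen(2)] by simp
    ultimately show False using le[of "k - 1"] by simp
  qed
  then show "q = t" by (rule rho_eq_0[OF qt(1,2)])
qed

lemma cdist_bounds:
  assumes q: "q \<in> Q" and t: "t \<in> Q"
  shows "rho q t \<le> cdist q t" "cdist q t \<le> c0 * rho q t"
proof -
  consider "cdist q t = 0" | k where "cdist q t = c0 powi k" using cdist_cases by blast
  then have "rho q t \<le> cdist q t \<and> cdist q t \<le> c0 * rho q t"
  proof cases
    case 1
    then have "code q = code t" using dist_madic_eq_0[OF code_madics[OF q]] by blast
    then have "q = t" using code_inj q t by (auto dest: inj_onD)
    then show ?thesis by (simp add: rho_self t)
  next
    case (2 k)
    have "\<not> cdist q t \<le> c0 powi (k - 1)" using 2 powi_less_cancel[OF gen(2), of "k - 1" k] by simp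
    then have "c0 powi (k - 1) < rho q t" using cdist_le_iff[OF q t] by force
    then have "c0 * c0 powi (k - 1) \<le> c0 * rho q t" using gen(2) by (intro mult_left_mono) auto
    moreover have "c0 * c0 powi (k - 1) = c0 powi k" using gen(2) by (simp add: power_int_diff)
    ultimately show ?thesis using 2 cdist_le_iff[OF q t, of k] by simp
  qed
  then show "rho q t \<le> cdist q t" "cdist q t \<le> c0 * rho q t" by auto
qed

text \<open>Ratios are powers of \<open>c0\<close>, so scaling by them commutes with the rounding.
  The comparison at all powers determines values that are themselves 0 or powers.\<close>

lemma cdist_act:
  assumes g: "g \<in> carrier G" and q: "q \<in> Q" and t: "t \<in> Q"
  shows "cdist (act g q) (act g t) = ratio g * cdist q t"
proof -
  obtain j where j: "ratio g = c0 powi j" using gen(3)[OF g] by blast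
  have gQ: "act g q \<in> Q" "act g t \<in> Q" using g q t by (auto intro: act_closed)
  have iff: "cdist (act g q) (act g t) \<le> c0 powi k \<longleftrightarrow> ratio g * cdist q t \<le> c0 powi k" for k
  proof -
    have cc: "c0 powi k = c0 powi j * c0 powi (k - j)" using gen(2) by (simp flip: power_int_add)
    have "cdist (act g q) (act g t) \<le> c0 powi k \<longleftrightarrow> c0 powi j * rho q t \<le> c0 powi j * c0 powi (k - j)"
      unfolding cdist_le_iff[OF gQ] rho_act[OF g q t] j cc[symmetric] ..
    also have "\<dots> \<longleftrightarrow> rho q t \<le> c0 powi (k - j)" by (rule mult_le_cancel_left_pos[OF c0_pos])
    also have "\<dots> \<longleftrightarrow> cdist q t \<le> c0 powi (k - j)" by (rule cdist_le_iff[OF q t, symmetric])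
    also have "\<dots> \<longleftrightarrow> c0 powi j * cdist q t \<le> c0 powi j * c0 powi (k - j)"
      by (rule mult_le_cancel_left_pos[OF c0_pos, symmetric])
    finally show ?thesis unfolding j cc[symmetric] .
  qed
  have le: "x \<le> y" if y: "y = 0 \<or> (\<exists>k. y = c0 powi k)" and x: "x = 0 \<or> (\<exists>k. x = c0 powi k)" and xy: "\<And>k. y \<le> c0 powi k \<Longrightarrow> x \<le> c0 powi k" for x y :: real
    using y
  proof
    assume y0: "y = 0"
    show ?thesis
    proof (rule ccontr)
      assume "\<not> x \<le> y"
      then obtain k where "x = c0 powi k" using x y0 by auto
      moreover have "x \<le> c0 powi (k - 1)" using xy[of "k - 1"] y0 by (simp add: less_imp_le)
      ultimately show False using powi_less_cancel[OF gen(2), of "k - 1" k] by simp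
    qed
  next
    assume "\<exists>k. y = c0 powi k"
    then show ?thesis using xy by auto
  qed
  have c1: "ratio g * cdist q t = 0 \<or> (\<exists>k. ratio g * cdist q t = c0 powi k)"
    using cdist_cases[of q t]
  proof
    assume "\<exists>k. cdist q t = c0 powi k"
    then obtain k where "cdist q t = c0 powi k" ..
    then have "ratio g * cdist q t = c0 powi (j + k)" using gen(2) by (simp add: j power_int_add)
    then show ?thesis by blast
  qed simp
  have "cdist (act g q) (act g t) \<le> ratio g * cdist q t" by (rule le[OF c1 cdist_cases]) (simp only: iff)
  moreover have "ratio g * cdist q t \<le> cdist (act g q) (act g t)" by (rule le[OF cdist_cases c1]) (simp only: iff)
  ultimately show ?thesis by (rule antisym)
qed

text \<open>Following the prescribed children gives nested balls whose centres converge digit by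
  digit.\<close>

lemma code_onto: "code ` Q = madics nkids"
proof (intro equalityI subsetI)
  fix a assume "a \<in> code ` Q"
  then show "a \<in> madics nkids" using code_madics by blast
next
  fix a assume a: "a \<in> madics nkids"
  obtain N where N: "\<And>i. i < N \<Longrightarrow> a i = 0" using a by (auto simp: madics_def)
  have "\<exists>q\<in>Q. \<forall>i<N + int n. code q i = a i" for n
  proof (induction n)
    case 0
    have "code q0 i = 0" for i
      unfolding code_def by (rule label_zero[OF zeroQ center_ball[OF zeroQ]])
    then show ?case using N zeroQ by (intro bexI[of _ q0]) auto
  next
    case (Suc n)
    then obtain q where q: "q \<in> Q" "\<And>i. i < N + int n \<Longrightarrow> code q i = a i" by blast
    define i where "i = N + int n"
    have "a i \<in> {..<nkids}" using madics_less[OF a] by simp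
    then have "a i \<in> label (- i - 1) (ball (- i - 1) q) ` ball (- i - 1 - 1) ` ball (- i - 1) q"
      by (simp only: bij_betw_imp_surj_on[OF label_bij[OF q(1), of "- i - 1"]])
    then obtain C where C: "a i = label (- i - 1) (ball (- i - 1) q) C" "C \<in> ball (- i - 1 - 1) ` ball (- i - 1) q"
      by (rule imageE)
    from C(2) obtain t where t: "C = ball (- i - 1 - 1) t" "t \<in> ball (- i - 1) q" by (rule imageE)
    have tQ: "t \<in> Q" using t(2) ball_subset by (rule subsetD[rotated])
    have bt: "ball (- i - 1) q = ball (- i - 1) t" using t(2) ball_eq_iff[OF q(1) tQ] by (simp add: ball_def)
    have "code t i = a i" unfolding code_def C(1) t(1) bt ..
    moreover have "code t l = a l" if "l < i" for l
      using code_agree[OF q(1) tQ, of i] bt q(2) that by (simp add: i_def)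
    moreover have "l < i \<or> l = i" if "l < N + int (Suc n)" for l using that by (auto simp: i_def)
    ultimately show ?case using tQ by (intro bexI[of _ t]) auto
  qed
  then obtain y where y: "\<And>n. y n \<in> Q" "\<And>n i. i < N + int n \<Longrightarrow> code (y n) i = a i" by metis
  define lev where "lev n = - (N + int n) - 1" for n
  have yy: "ball (lev n) (y n) = ball (lev n) (y n')" if "n \<le> n'" for n n'
    unfolding lev_def using y that by (intro code_agree[THEN iffD1] y) auto
  \<comment> \<open>\<open>P n l\<close> says that the n-th ball is small enough to determine the
    digit of index \<open>l\<close>.\<close>
  define P where "P n l \<longleftrightarrow> c0 powi (lev n) \<le> real m powi (- (l + 1) - 1)" for n l
  have Pex: "\<exists>n. P n l" for l
  proof -
    obtain k where k: "c0 powi k \<le> real m powi (- (l + 1) - 1)" using powi_bracket[OF gen(2), of "real m powi (- (l + 1) - 1)"] m2 by auto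
    have "c0 powi (lev (nat (- k - N))) \<le> c0 powi k"
      using gen(2) by (intro power_int_increasing) (auto simp: lev_def)
    then show ?thesis using k unfolding P_def by (meson order_trans)
  qed
  have Pmono: "P n' l'" if "P n l" "n \<le> n'" "l' \<le> l" for n n' l l'
  proof -
    have "c0 powi (lev n') \<le> c0 powi (lev n)" using that gen(2) by (intro power_int_increasing) (auto simp: lev_def)
    moreover have "real m powi (- (l + 1) - 1) \<le> real m powi (- (l' + 1) - 1)" using that m1 by (intro power_int_increasing) auto
    ultimately show ?thesis using that(1) unfolding P_def by linarith
  qed
  \<comment> \<open>Each digit of the limit is taken from the first ball that determines it; all
    later centres share that digit.\<close>
  define q where "q l = y (LEAST n. P n l) l" for l
  have qy: "q l = y n l" if P: "P n l" for n l
  proof -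
    define n0 where "n0 = (LEAST n. P n l)"
    have "n0 \<le> n" unfolding n0_def by (rule Least_le[of "\<lambda>n. P n l", OF P])
    moreover have "P n0 l" unfolding n0_def by (rule LeastI[of "\<lambda>n. P n l", OF P])
    ultimately have "y n0 l = y n l"
      using ball_eqD[OF y(1) y(1) yy, of n0 n "l + 1" l] by (simp add: P_def)
    then show ?thesis by (simp add: q_def n0_def)
  qed
  have qQ: "q \<in> Q"
  proof -
    obtain k where "c0 powi lev 0 < real m powi (- k)" using exists_exponent[of "c0 powi lev 0"] by auto
    then have P0: "P 0 (k - 2)" by (simp add: P_def)
    obtain M where M: "\<And>i. i < M \<Longrightarrow> y 0 i = 0" using y(1)[of 0] by (auto simp: madics_def)
    have "q i = 0" if "i < min M (k - 2)" for i
      using qy[OF Pmono[OF P0 order_refl, of i]] M that by simp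
    moreover have "q i < m" for i unfolding q_def by (rule madics_less[OF y(1)])
    ultimately show ?thesis unfolding madics_def by blast
  qed
  have "ball (lev n) q = ball (lev n) (y n)" for n
  proof -
    obtain i where "real m powi (- i - 1) \<le> c0 powi lev n / K" using exists_exponent[of "c0 powi lev n / K"] K1 by auto
    then have i: "K * real m powi (- i - 1) \<le> c0 powi lev n" using K1 by (simp add: le_divide_eq mult.commute)
    obtain n1 where "P n1 i" using Pex by blast
    then have Pm: "P (max n n1) l" if "l \<le> i" for l using Pmono[of n1 i "max n n1" l] that by simp
    have "ball (lev n) q = ball (lev n) (y (max n n1))"
      by (rule ball_eqI[OF qQ y(1) _ i]) (use qy[OF Pm] in auto)
    then show ?thesis using yy[of n "max n n1"] by simp
  qed
  then have "\<forall>i<N + int n. code q i = code (y n) i" for n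
    unfolding code_agree[OF qQ y(1)] lev_def by simp
  then have eq: "code q i = a i" if "i < N + int n" for i n using y(2) that by metis
  have "code q i = a i" for i by (rule eq[of i "nat (i - N) + 1"]) auto
  then have "code q = a" by blast
  then show "a \<in> code ` Q" using qQ by blast
qed

lemma exists_madic_conjugacy:
  "\<exists>s h L. 1 \<le> s \<and> (\<exists>(c::nat) i j. 1 \<le> i \<and> 1 \<le> j \<and> m = c ^ i \<and> s = c ^ j) \<and> 1 \<le> L \<and> bij_betw h Q (madics s) \<and>
    (\<forall>q\<in>Q. \<forall>t\<in>Q. dist_madic m q t \<le> dist_madic s (h q) (h t) \<and> dist_madic s (h q) (h t) \<le> L * dist_madic m q t) \<and>
    (\<forall>g\<in>carrier G. \<forall>q\<in>Q. \<forall>t\<in>Q. dist_madic s (h (act g q)) (h (act g t)) = ratio g * dist_madic s (h q) (h t))"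
proof (rule exI[of _ nkids], rule exI[of _ code], rule exI[of _ "c0 * K"], intro conjI ballI)
  show "1 \<le> nkids" using nkids_pos by simp
  show "\<exists>c i j. 1 \<le> i \<and> 1 \<le> j \<and> m = c ^ i \<and> nkids = c ^ j" by (rule common_base_nkids)
  have "1 * 1 \<le> c0 * K" using gen(2) K1 by (intro mult_mono) auto
  then show "1 \<le> c0 * K" by simp
  show "bij_betw code Q (madics nkids)" using code_inj code_onto by (simp add: bij_betw_def)
  fix q t assume qt: "q \<in> Q" "t \<in> Q"
  show "dist_madic m q t \<le> cdist q t" using rho_lower[OF qt] cdist_bounds(1)[OF qt] by simp
  have "c0 * rho q t \<le> c0 * (K * dist_madic m q t)"
    using rho_upper[OF qt] gen(2) by (intro mult_left_mono) auto
  then show "cdist q t \<le> c0 * K * dist_madic m q t" using cdist_bounds(2)[OF qt] by simp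
  fix g assume "g \<in> carrier G"
  then show "cdist (act g q) (act g t) = ratio g * cdist q t" using qt by (rule cdist_act)
qed

end

section \<open>Conjugation to similarities\<close>

context block_action
begin

text \<open>The choice of 0 is immaterial by \<open>same_snd\<close>.\<close>

definition madic_act :: "'g \<Rightarrow> (int \<Rightarrow> nat) \<Rightarrow> int \<Rightarrow> nat" where
  "madic_act g s = snd (act g (0, s))"

text \<open>A supremum replaces the mean here because it preserves the ultrametric
  inequality.\<close>

definition rho :: "(int \<Rightarrow> nat) \<Rightarrow> (int \<Rightarrow> nat) \<Rightarrow> real" where
  "rho s t = (SUP g\<in>carrier G. dist_madic m (madic_act g s) (madic_act g t) / ratio g)"

lemma madic_act_closed: "\<lbrakk>g \<in> carrier G; s \<in> madics m\<rbrakk> \<Longrightarrow> madic_act g s \<in> madics m"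
  unfolding madic_act_def by (rule snd_madics[OF act_closed]) auto

lemma snd_act: "\<lbrakk>g \<in> carrier G; p \<in> X\<rbrakk> \<Longrightarrow> snd (act g p) = madic_act g (snd p)"
  unfolding madic_act_def using same_snd[of g "snd p" "fst p" 0] snd_madics by simp

lemma madic_act_one: "s \<in> madics m \<Longrightarrow> madic_act \<one> s = s"
  by (simp add: madic_act_def act_one)

lemma madic_act_mult:
  "\<lbrakk>g \<in> carrier G; h \<in> carrier G; s \<in> madics m\<rbrakk> \<Longrightarrow> madic_act (g \<otimes> h) s = madic_act g (madic_act h s)"
  using snd_act[of g "act h (0, s)"] act_closed[of h "(0, s)"] by (simp add: madic_act_def act_mult)

lemma d_zero: "d (0, s) (0, t) = dist_madic m s t"
  using wdist_eq_0[of w 0 0, OF w1] by (simp add: pdist_def)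

lemma madic_act_quotient_le:
  assumes "g \<in> carrier G" "s \<in> madics m" "t \<in> madics m"
  shows "dist_madic m (madic_act g s) (madic_act g t) / ratio g \<le> K * dist_madic m s t"
proof -
  have "dist_madic m (madic_act g s) (madic_act g t) \<le> d (act g (0, s)) (act g (0, t))"
    by (simp add: pdist_def madic_act_def)
  also have "\<dots> \<le> K * ratio g * d (0, s) (0, t)" using assms by (intro ratio_quasi) auto
  finally show ?thesis by (simp add: d_zero divide_le_eq mult_ac)
qed

lemma rho_bdd:
  "\<lbrakk>s \<in> madics m; t \<in> madics m\<rbrakk> \<Longrightarrow>
    bdd_above ((\<lambda>g. dist_madic m (madic_act g s) (madic_act g t) / ratio g) ` carrier G)"
  using madic_act_quotient_le by (intro bdd_aboveI2[where M = "K * dist_madic m s t"]) auto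

lemma rho_ge:
  "\<lbrakk>g \<in> carrier G; s \<in> madics m; t \<in> madics m\<rbrakk> \<Longrightarrow>
    dist_madic m (madic_act g s) (madic_act g t) / ratio g \<le> rho s t"
  unfolding rho_def by (rule cSUP_upper[OF _ rho_bdd])

lemma rho_le:
  "(\<And>g. g \<in> carrier G \<Longrightarrow> dist_madic m (madic_act g s) (madic_act g t) / ratio g \<le> c) \<Longrightarrow> rho s t \<le> c"
  unfolding rho_def by (rule cSUP_least) auto

lemma rho_lower: "\<lbrakk>s \<in> madics m; t \<in> madics m\<rbrakk> \<Longrightarrow> dist_madic m s t \<le> rho s t"
  using rho_ge[of \<one> s t] by (simp add: madic_act_one)

lemma rho_upper: "\<lbrakk>s \<in> madics m; t \<in> madics m\<rbrakk> \<Longrightarrow> rho s t \<le> K * dist_madic m s t"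
  by (intro rho_le madic_act_quotient_le)

lemma rho_act_le:
  assumes g: "g \<in> carrier G" and st: "s \<in> madics m" "t \<in> madics m"
  shows "rho (madic_act g s) (madic_act g t) \<le> ratio g * rho s t"
proof (rule rho_le)
  fix h assume h: "h \<in> carrier G"
  have "dist_madic m (madic_act (h \<otimes> g) s) (madic_act (h \<otimes> g) t) / ratio (h \<otimes> g) \<le> rho s t"
    using h g st by (intro rho_ge) auto
  then show "dist_madic m (madic_act h (madic_act g s)) (madic_act h (madic_act g t)) / ratio h \<le> ratio g * rho s t"
    using h g st by (simp add: madic_act_mult ratio_mult divide_le_eq mult_ac)
qed

lemma rho_act:
  assumes g: "g \<in> carrier G" and st: "s \<in> madics m" "t \<in> madics m"
  shows "rho (madic_act g s) (madic_act g t) = ratio g * rho s t"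
proof (rule antisym[OF rho_act_le[OF assms]])
  have e: "madic_act (inv g) (madic_act g u) = u" if "u \<in> madics m" for u
    using madic_act_mult[of "inv g" g u] g that by (simp add: madic_act_one)
  have "rho s t \<le> ratio (inv g) * rho (madic_act g s) (madic_act g t)"
    using rho_act_le[of "inv g" "madic_act g s" "madic_act g t"] g st by (simp add: madic_act_closed e)
  then show "ratio g * rho s t \<le> rho (madic_act g s) (madic_act g t)"
    using g by (simp add: ratio_inv le_divide_eq mult_ac)
qed

lemma madic_similarity_rho: "2 \<le> m \<Longrightarrow> madic_similarity G m madic_act ratio rho K B"
proof (unfold_locales)
  fix s t u assume stu: "s \<in> madics m" "t \<in> madics m" "u \<in> madics m"
  show "rho s u \<le> max (rho s t) (rho t u)"
  proof (rule rho_le)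
    fix g assume g: "g \<in> carrier G"
    let ?D = "\<lambda>a b. dist_madic m (madic_act g a) (madic_act g b)"
    have "?D s u \<le> max (?D s t) (?D t u)" using g stu by (intro dist_madic_ultra madic_act_closed)
    then have "?D s u / ratio g \<le> max (?D s t) (?D t u) / ratio g" by (intro divide_right_mono) auto
    also have "\<dots> = max (?D s t / ratio g) (?D t u / ratio g)" by (simp add: max_divide_distrib_right)
    also have "\<dots> \<le> max (rho s t) (rho t u)" using g stu by (intro max.mono rho_ge)
    finally show "?D s u / ratio g \<le> max (rho s t) (rho t u)" .
  qed
next
  fix s t :: "int \<Rightarrow> nat" and r e :: real
  assume st: "s \<in> madics m" "t \<in> madics m" and re: "0 < r" "0 < e"
  have "0 < e / K" using re K_pos by simp
  then obtain g where g: "g \<in> carrier G" "r / B \<le> ratio g" "ratio g \<le> B * r" "d (act g (0, s)) (0, t) \<le> e / K"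
    using dense_orbits[of "(0, s)" "(0, t)" r "e / K"] st re by auto
  have "dist_madic m (madic_act g s) t \<le> d (act g (0, s)) (0, t)" by (simp add: pdist_def madic_act_def)
  then have "K * dist_madic m (madic_act g s) t \<le> K * (e / K)" using g(4) K_pos by (intro mult_left_mono) auto
  moreover have "rho (madic_act g s) t \<le> K * dist_madic m (madic_act g s) t"
    using st g by (intro rho_upper madic_act_closed)
  ultimately have "rho (madic_act g s) t \<le> e" using K_pos by simp
  then show "\<exists>g\<in>carrier G. r / B \<le> ratio g \<and> ratio g \<le> B * r \<and> rho (madic_act g s) t \<le> e" using g by blast
next
  fix s t show "rho s t = rho t s" unfolding rho_def by (simp add: dist_madic_commute)
qed (auto simp: madic_act_closed madic_act_one madic_act_mult ratio_mult K1 B_pos rho_lower rho_upper rho_act)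

lemma exists_madic_part:
  "\<exists>s h L. 1 \<le> s \<and> (\<exists>(c::nat) i j. 1 \<le> i \<and> 1 \<le> j \<and> m = c ^ i \<and> s = c ^ j) \<and> 1 \<le> L \<and> bij_betw h (madics m) (madics s) \<and>
    (\<forall>q\<in>madics m. \<forall>t\<in>madics m. dist_madic m q t \<le> dist_madic s (h q) (h t) \<and> dist_madic s (h q) (h t) \<le> L * dist_madic m q t) \<and>
    (\<forall>g\<in>carrier G. \<forall>q\<in>madics m. \<forall>t\<in>madics m. dist_madic s (h (madic_act g q)) (h (madic_act g t)) = ratio g * dist_madic s (h q) (h t))"
\<comment> \<open>In base 1 the m-adic factor is a point and the identity serves.\<close>
proof (cases "2 \<le> m")
  case True
  then interpret S: madic_similarity G m madic_act ratio rho K B by (rule madic_similarity_rho)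
  show ?thesis by (rule S.exists_madic_conjugacy)
next
  case False
  then have m: "m = 1" using m1 by simp
  have one: "s = t" if "s \<in> madics m" "t \<in> madics m" for s t using that by (auto simp: m madics_def)
  have z: "dist_madic m s t = 0" if "s \<in> madics m" "t \<in> madics m" for s t using one[OF that] by simp
  have "\<exists>(c::nat) i j. 1 \<le> i \<and> 1 \<le> j \<and> m = c ^ i \<and> m = c ^ j" by (intro exI[of _ m] exI[of _ 1]) simp
  moreover have "bij_betw id (madics m) (madics m)" by simp
  ultimately show ?thesis
    using m1 by (intro exI[of _ m] exI[of _ id] exI[of _ 1]) (auto simp: z madic_act_closed)
qed

text \<open>The m-adic component is changed independently of the real one, while the real map is
  onto on every m-adic fibre; hence the combined map is a bijection.\<close>

theorem exists_similarity_conjugacy: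
  "\<exists>s F L. 1 \<le> s \<and> (\<exists>(c::nat) i j. 1 \<le> i \<and> 1 \<le> j \<and> m = c ^ i \<and> s = c ^ j) \<and> 1 \<le> L \<and>
    bij_betw F X (product_space s) \<and>
    (\<forall>p\<in>X. \<forall>q\<in>X. d p q \<le> L * pdist w s (F p) (F q) \<and> pdist w s (F p) (F q) \<le> L * d p q) \<and>
    (\<forall>g\<in>carrier G. \<forall>p\<in>X. \<forall>q\<in>X. pdist w s (F (act g p)) (F (act g q)) = ratio g * pdist w s (F p) (F q))"
proof -
  obtain s h L1 where s: "1 \<le> s" "\<exists>(c::nat) i j. 1 \<le> i \<and> 1 \<le> j \<and> m = c ^ i \<and> s = c ^ j" and L1: "1 \<le> L1"
    and h: "bij_betw h (madics m) (madics s)"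
    and h_bil: "\<And>q t. \<lbrakk>q \<in> madics m; t \<in> madics m\<rbrakk> \<Longrightarrow> dist_madic m q t \<le> dist_madic s (h q) (h t) \<and> dist_madic s (h q) (h t) \<le> L1 * dist_madic m q t"
    and h_act: "\<And>g q t. \<lbrakk>g \<in> carrier G; q \<in> madics m; t \<in> madics m\<rbrakk> \<Longrightarrow> dist_madic s (h (madic_act g q)) (h (madic_act g t)) = ratio g * dist_madic s (h q) (h t)"
    using exists_madic_part by blast
  obtain \<Psi> :: "'n point \<Rightarrow> real^'n" and L2 where L2: "1 \<le> L2"
    and up: "\<And>p q. \<lbrakk>p \<in> X; q \<in> X\<rbrakk> \<Longrightarrow> wdist w (\<Psi> p) (\<Psi> q) \<le> K * d p q"
    and low: "\<And>p q. \<lbrakk>p \<in> X; q \<in> X\<rbrakk> \<Longrightarrow> wdist w (fst p) (fst q) \<le> L2 * max (wdist w (\<Psi> p) (\<Psi> q)) (dist_madic m (snd p) (snd q))"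
    and sim: "\<And>g p q. \<lbrakk>g \<in> carrier G; p \<in> X; q \<in> X\<rbrakk> \<Longrightarrow> wdist w (\<Psi> (act g p)) (\<Psi> (act g q)) = ratio g * wdist w (\<Psi> p) (\<Psi> q)"
    and onto: "\<And>s. s \<in> madics m \<Longrightarrow> range (\<lambda>x. \<Psi> (x, s)) = UNIV"
    using exists_real_similarity by blast
  define F where "F p = (\<Psi> p, h (snd p))" for p
  define L where "L = max L2 (max K L1)"
  have L: "L2 \<le> L" "K \<le> L" "L1 \<le> L" by (auto simp: L_def)
  have L1': "1 \<le> L" using L L2 by linarith
  have upper: "pdist w s (F p) (F q) \<le> L * d p q" if pq: "p \<in> X" "q \<in> X" for p q
  proof -
    have "K * d p q \<le> L * d p q" using L by (intro mult_right_mono) auto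
    then have "wdist w (\<Psi> p) (\<Psi> q) \<le> L * d p q" using up[OF pq] by linarith
    moreover have "dist_madic s (h (snd p)) (h (snd q)) \<le> L * d p q"
    proof -
      have "L1 * dist_madic m (snd p) (snd q) \<le> L * d p q"
        using L L1 by (intro mult_mono) (auto simp: pdist_def)
      then show ?thesis using h_bil[OF snd_madics[OF pq(1)] snd_madics[OF pq(2)]] by linarith
    qed
    ultimately show ?thesis by (simp add: F_def pdist_def[of w s])
  qed
  have lower: "d p q \<le> L * pdist w s (F p) (F q)" if pq: "p \<in> X" "q \<in> X" for p q
  proof -
    let ?D = "pdist w s (F p) (F q)"
    have D: "0 \<le> ?D" by simp
    have m: "dist_madic m (snd p) (snd q) \<le> ?D"
      using h_bil[OF snd_madics[OF pq(1)] snd_madics[OF pq(2)]] by (simp add: F_def pdist_def le_max_iff_disj)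
    have "max (wdist w (\<Psi> p) (\<Psi> q)) (dist_madic m (snd p) (snd q)) \<le> ?D"
      using m by (simp add: F_def pdist_def)
    then have "L2 * max (wdist w (\<Psi> p) (\<Psi> q)) (dist_madic m (snd p) (snd q)) \<le> L * ?D"
      using L L2 by (intro mult_mono) (auto simp: le_max_iff_disj)
    moreover have "1 * ?D \<le> L * ?D" using L1' D by (rule mult_right_mono)
    ultimately show ?thesis using low[OF pq] m by (simp add: pdist_def[of w m])
  qed
  have "inj_on F X"
  proof (rule inj_onI, rule ccontr)
    fix p q assume pq: "p \<in> X" "q \<in> X" "F p = F q" "p \<noteq> q"
    have "pdist w s (F p) (F q) = 0" using wdist_eq_0[of w "fst (F q)" "fst (F q)", OF w1] unfolding pq(3) by (simp add: pdist_def)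
    then show False using lower[OF pq(1,2)] d_pos[OF pq(1,4)] by simp
  qed
  moreover have "F ` X = product_space s"
  proof (intro equalityI subsetI)
    fix p assume "p \<in> F ` X"
    then show "p \<in> product_space s" using bij_betwE[OF h] snd_madics by (auto simp: F_def in_product_space)
  next
    fix p :: "'n point" assume "p \<in> product_space s"
    then have "snd p \<in> h ` madics m" using bij_betw_imp_surj_on[OF h] by (simp add: in_product_space)
    then obtain t where t: "t \<in> madics m" "snd p = h t" by blast
    have "fst p \<in> range (\<lambda>x. \<Psi> (x, t))" using onto[OF t(1)] by simp
    then obtain x where "fst p = \<Psi> (x, t)" by blast
    then have "p = F (x, t)" using t by (simp add: F_def prod_eq_iff)
    then show "p \<in> F ` X" using t by (intro image_eqI[of _ _ "(x, t)"]) auto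
  qed
  ultimately have "bij_betw F X (product_space s)" by (simp add: bij_betw_def)
  moreover have "pdist w s (F (act g p)) (F (act g q)) = ratio g * pdist w s (F p) (F q)"
    if "g \<in> carrier G" "p \<in> X" "q \<in> X" for g p q
    using that sim[OF that] h_act[of g "snd p" "snd q"] snd_madics
    by (simp add: F_def pdist_def snd_act max_mult_distrib_left)
  ultimately show ?thesis
    by (intro exI[of _ s] exI[of _ F] exI[of _ L] conjI ballI s L1' upper lower) assumption+
qed

end

section \<open>Real spectral decomposition\<close>

definition cnj_vec :: "complex^'n \<Rightarrow> complex^'n" where "cnj_vec v = (\<chi> i. cnj (v $ i))"

lemma cnj_vec_mult: "complex_mat A *v cnj_vec v = cnj_vec (complex_mat A *v v)"
  by (simp add: vec_eq_iff matrix_vector_mult_def cnj_vec_def)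

lemma cnj_vec_simps: "cnj_vec (c *s v) = cnj c *s cnj_vec v" "cnj_vec (complex_vec x) = complex_vec x"
  "cnj_vec (\<Sum>i\<in>I. f i) = (\<Sum>i\<in>I. cnj_vec (f i))"
  by (simp_all add: vec_eq_iff cnj_vec_def sum_component)

lemma cnj_vec_fixed: "cnj_vec v = v \<Longrightarrow> complex_vec (\<chi> i. Re (v $ i)) = v"
  by (simp add: vec_eq_iff cnj_vec_def complex_eq_iff)

lemma complex_vec_inj: "complex_vec x = complex_vec y \<longleftrightarrow> x = y"
  by (simp add: vec_eq_iff)

lemma inj_on_complex_vec: "inj_on complex_vec S"
  by (rule inj_onI) (rule complex_vec_inj[THEN iffD1])

lemma complex_vec_sum: "complex_vec (\<Sum>i\<in>I. f i) = (\<Sum>i\<in>I. complex_vec (f i))"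
  by (simp add: vec_eq_iff sum_component)

locale diagonalized =
  fixes A :: "real^'n^'n" and P D :: "complex^'n^'n"
  assumes P: "invertible P" and diag: "diagonal_mat D" and AP: "complex_mat A ** P = P ** D"
begin

lemma P_inv: "P ** matrix_inv P = mat 1" "matrix_inv P ** P = mat 1"
  using P unfolding invertible_def matrix_inv_def by (metis (mono_tags, lifting) someI_ex)+

definition U :: "complex^'n \<Rightarrow> complex^'n" where "U v = matrix_inv P *v v"

abbreviation evec :: "'n \<Rightarrow> complex^'n" where "evec k \<equiv> column k P"
abbreviation re :: "'n \<Rightarrow> real" where "re k \<equiv> Re (D $ k $ k)"

lemma P_U [simp]: "P *v U v = v"
  by (simp add: U_def matrix_vector_mul_assoc P_inv)

lemma U_P [simp]: "U (P *v v) = v"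
  by (simp add: U_def matrix_vector_mul_assoc P_inv)

lemma U_simps: "U (v + w) = U v + U w" "U (v - w) = U v - U w" "U (c *s v) = c *s U v"
  "U (\<Sum>i\<in>I. f i) = (\<Sum>i\<in>I. U (f i))" "U 0 = 0"
  by (simp_all add: U_def matrix_vector_right_distrib matrix_vector_mult_diff_distrib vec.scale vec.sum)

lemma U_eqI: "(\<And>k. U v $ k = U w $ k) \<Longrightarrow> v = w"
  by (metis P_U vec_eq_iff)

lemma U_evec: "U (evec k) = axis k 1"
proof -
  have "P *v axis k 1 = evec k"
    by (simp add: vec_eq_iff matrix_vector_mult_def column_def axis_def if_distrib cong: if_cong)
  then show ?thesis by (metis U_P)
qed

lemma U_mult: "U (complex_mat A *v v) $ k = D $ k $ k * U v $ k"
proof -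
  have "complex_mat A *v v = P *v (D *v U v)"
    by (metis AP P_U matrix_vector_mul_assoc)
  then have "U (complex_mat A *v v) $ k = (D *v U v) $ k" by simp
  also have "\<dots> = (\<Sum>j\<in>UNIV. D $ k $ j * U v $ j)" by (simp add: matrix_vector_mult_def)
  also have "\<dots> = (\<Sum>j\<in>UNIV. if j = k then D $ k $ k * U v $ k else 0)"
    using diag by (intro sum.cong) (auto simp: diagonal_mat_def)
  finally show ?thesis by simp
qed

lemma expand: "v = (\<Sum>k\<in>UNIV. U v $ k *s evec k)"
  using matrix_mult_sum[of P "U v"] by simp

lemma eigen_evec: "complex_mat A *v evec k = D $ k $ k *s evec k"
  by (rule U_eqI) (simp add: U_mult U_simps U_evec axis_def)

lemma eigenvalues_eq: "eigenvalues (complex_mat A) = range (\<lambda>k. D $ k $ k)"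
proof (intro equalityI subsetI)
  fix z assume "z \<in> eigenvalues (complex_mat A)"
  then obtain v where v: "v \<noteq> 0" "complex_mat A *v v = z *s v" by (auto simp: eigenvalues_def)
  then obtain k where k: "U v $ k \<noteq> 0" using U_eqI[of v 0] by (auto simp: U_simps)
  have "D $ k $ k * U v $ k = U (z *s v) $ k" using U_mult[of v k] v(2) by metis
  then have "D $ k $ k * U v $ k = z * U v $ k" by (simp only: U_simps(3) vector_smult_component)
  then have "D $ k $ k = z" using k by simp
  then show "z \<in> range (\<lambda>k. D $ k $ k)" by blast
next
  fix z assume "z \<in> range (\<lambda>k. D $ k $ k)"
  then obtain k where z: "z = D $ k $ k" by blast
  have "evec k \<noteq> 0"
  proof
    assume "evec k = 0"
    then have "axis k (1::complex) = 0" using U_evec[of k] by (simp add: U_simps)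
    then show False by (simp add: axis_eq_0_iff)
  qed
  then show "z \<in> eigenvalues (complex_mat A)" unfolding eigenvalues_def z using eigen_evec[of k] by blast
qed

lemma real_parts_eq: "real_parts A = range re"
  by (auto simp: real_parts_def eigenvalues_eq)

lemma generalized_eigenspace_iff:
  "v \<in> generalized_eigenspace (complex_mat A) z \<longleftrightarrow> (\<forall>k. U v $ k \<noteq> 0 \<longrightarrow> D $ k $ k = z)"
proof -
  have pow: "U (((\<lambda>w. complex_mat A *v w - z *s w) ^^ j) v) $ k = (D $ k $ k - z) ^ j * U v $ k" for j k
    by (induction j) (auto simp: U_simps U_mult algebra_simps)
  show ?thesis
  proof
    assume "v \<in> generalized_eigenspace (complex_mat A) z"
    then obtain j where j: "((\<lambda>w. complex_mat A *v w - z *s w) ^^ j) v = 0"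
      by (auto simp: generalized_eigenspace_def)
    have "(D $ k $ k - z) ^ j * U v $ k = 0" for k
      using pow[of j k] by (simp add: j U_simps)
    then show "\<forall>k. U v $ k \<noteq> 0 \<longrightarrow> D $ k $ k = z" by auto
  next
    assume "\<forall>k. U v $ k \<noteq> 0 \<longrightarrow> D $ k $ k = z"
    then have "U (((\<lambda>w. complex_mat A *v w - z *s w) ^^ 1) v) $ k = U 0 $ k" for k
      unfolding pow by (auto simp: U_simps)
    then have "((\<lambda>w. complex_mat A *v w - z *s w) ^^ 1) v = 0"
      by (rule U_eqI)
    then show "v \<in> generalized_eigenspace (complex_mat A) z"
      unfolding generalized_eigenspace_def by blast
  qed
qed

text \<open>The complex spectral subspace in eigenvector coordinates; its real points form
  \<open>real_part_space A \<alpha>\<close>.\<close>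

definition E :: "real \<Rightarrow> (complex^'n) set" where
  "E \<alpha> = {v. \<forall>k. re k \<noteq> \<alpha> \<longrightarrow> U v $ k = 0}"

lemma span_generalized_eigenspaces:
  "vec.span (\<Union>z\<in>{z \<in> eigenvalues (complex_mat A). Re z = \<alpha>}. generalized_eigenspace (complex_mat A) z) = E \<alpha>"
    (is "vec.span ?S = _")
proof (intro equalityI)
  have "vec.subspace (E \<alpha>)" by (rule vec.subspaceI) (auto simp: E_def U_simps)
  moreover have "?S \<subseteq> E \<alpha>" by (auto simp: E_def generalized_eigenspace_iff)
  ultimately show "vec.span ?S \<subseteq> E \<alpha>" by (intro vec.span_minimal)
  show "E \<alpha> \<subseteq> vec.span ?S"
  proof
    fix v assume v: "v \<in> E \<alpha>"
    have "U v $ k *s evec k \<in> vec.span ?S" for k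
    proof (cases "re k = \<alpha>")
      case True
      have "evec k \<in> generalized_eigenspace (complex_mat A) (D $ k $ k)"
        by (auto simp: generalized_eigenspace_iff U_evec axis_def)
      then have "evec k \<in> ?S" using True eigenvalues_eq by blast
      then show ?thesis by (intro vec.span_scale vec.span_base)
    next
      case False
      then show ?thesis using v by (simp add: E_def vec.span_zero)
    qed
    then show "v \<in> vec.span ?S" by (subst expand) (rule vec.span_sum)
  qed
qed

lemma real_part_space_iff: "x \<in> real_part_space A \<alpha> \<longleftrightarrow> complex_vec x \<in> E \<alpha>"
  by (simp add: real_part_space_def span_generalized_eigenspaces)

text \<open>The matrix is real, so conjugating an eigenvector conjugates its eigenvalue, and the
  real part is unchanged.\<close>

lemma cnj_E: assumes v: "v \<in> E \<alpha>" shows "cnj_vec v \<in> E \<alpha>"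
proof -
  have ev: "U (cnj_vec (evec k)) $ j = 0" if "re j \<noteq> re k" for j k
  proof -
    have "complex_mat A *v cnj_vec (evec k) = cnj (D $ k $ k) *s cnj_vec (evec k)"
      by (simp add: cnj_vec_mult eigen_evec cnj_vec_simps)
    then have "D $ j $ j * U (cnj_vec (evec k)) $ j = U (cnj (D $ k $ k) *s cnj_vec (evec k)) $ j"
      using U_mult[of "cnj_vec (evec k)" j] by metis
    then have "D $ j $ j * U (cnj_vec (evec k)) $ j = cnj (D $ k $ k) * U (cnj_vec (evec k)) $ j"
      by (simp only: U_simps(3) vector_smult_component)
    moreover have "D $ j $ j \<noteq> cnj (D $ k $ k)" using that by (auto dest: arg_cong[of _ _ Re])
    ultimately show ?thesis by (metis mult_cancel_right)
  qed
  have "cnj_vec v = (\<Sum>k\<in>UNIV. cnj (U v $ k) *s cnj_vec (evec k))"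
    by (subst expand) (simp add: cnj_vec_simps)
  then have s: "U (cnj_vec v) $ j = (\<Sum>k\<in>UNIV. cnj (U v $ k) * U (cnj_vec (evec k)) $ j)" for j
    by (simp add: U_simps sum_component)
  moreover have "cnj (U v $ k) * U (cnj_vec (evec k)) $ j = 0" if "re j \<noteq> \<alpha>" for j k
    using v ev[of j k] that by (cases "re k = \<alpha>") (auto simp: E_def)
  ultimately have "U (cnj_vec v) $ j = 0" if "re j \<noteq> \<alpha>" for j
    unfolding s using that by (intro sum.neutral) blast
  then show ?thesis by (simp add: E_def)
qed

definition comp :: "real \<Rightarrow> complex^'n \<Rightarrow> complex^'n" where
  "comp \<alpha> v = P *v (\<chi> k. if re k = \<alpha> then U v $ k else 0)"

lemma comp_E: "comp \<alpha> v \<in> E \<alpha>"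
  by (simp add: comp_def E_def)

lemma comp_unique:
  assumes c: "\<And>\<alpha>. \<alpha> \<in> range re \<Longrightarrow> c \<alpha> \<in> E \<alpha>" and v: "v = (\<Sum>\<alpha>\<in>range re. c \<alpha>)" and \<alpha>: "\<alpha> \<in> range re"
  shows "c \<alpha> = comp \<alpha> v"
proof -
  have "U (c \<alpha>) $ k = (if re k = \<alpha> then U v $ k else 0)" for k
  proof (cases "re k = \<alpha>")
    case True
    have "U v $ k = (\<Sum>\<gamma>\<in>range re. U (c \<gamma>) $ k)" by (simp add: v U_simps sum_component)
    also have "\<dots> = (\<Sum>\<gamma>\<in>range re. if \<gamma> = \<alpha> then U (c \<alpha>) $ k else 0)"
      using c True by (intro sum.cong) (auto simp: E_def)
    also have "\<dots> = U (c \<alpha>) $ k" using \<alpha> by simp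
    finally show ?thesis using True by simp
  next
    case False
    then show ?thesis using c[OF \<alpha>] by (simp add: E_def)
  qed
  then show ?thesis unfolding comp_def by (intro U_eqI) simp
qed

lemma sum_comp: "(\<Sum>\<alpha>\<in>range re. comp \<alpha> v) = v"
proof -
  have "U (\<Sum>\<alpha>\<in>range re. comp \<alpha> v) $ k = U v $ k" for k
  proof -
    have "U (\<Sum>\<alpha>\<in>range re. comp \<alpha> v) $ k = (\<Sum>\<alpha>\<in>range re. if \<alpha> = re k then U v $ k else 0)"
      unfolding U_simps sum_component by (intro sum.cong) (auto simp: comp_def)
    then show ?thesis by simp
  qed
  then show ?thesis by (rule U_eqI)
qed

text \<open>Conjugation maps the decomposition of a real vector to another decomposition of the same
  vector, and decompositions are unique.\<close>

lemma comp_real: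
  assumes "\<alpha> \<in> range re"
  shows "complex_vec (\<chi> i. Re (comp \<alpha> (complex_vec x) $ i)) = comp \<alpha> (complex_vec x)"
proof (rule cnj_vec_fixed)
  have "complex_vec x = (\<Sum>\<alpha>\<in>range re. cnj_vec (comp \<alpha> (complex_vec x)))"
    by (simp add: sum_comp cnj_vec_simps flip: cnj_vec_simps(3))
  from comp_unique[OF cnj_E[OF comp_E] this assms]
  show "cnj_vec (comp \<alpha> (complex_vec x)) = comp \<alpha> (complex_vec x)" .
qed

lemma components_unique:
  assumes c: "\<And>\<alpha>. \<alpha> \<in> range re \<Longrightarrow> c \<alpha> \<in> real_part_space A \<alpha>" "\<And>\<alpha>. \<alpha> \<notin> range re \<Longrightarrow> c \<alpha> = 0"
    and x: "x = (\<Sum>\<alpha>\<in>range re. c \<alpha>)"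
  shows "components A x = c"
  unfolding components_def real_parts_eq
proof (rule the_equality)
  fix b assume b: "(\<forall>\<alpha>\<in>range re. b \<alpha> \<in> real_part_space A \<alpha>) \<and> (\<forall>\<alpha>. \<alpha> \<notin> range re \<longrightarrow> b \<alpha> = 0) \<and> x = (\<Sum>\<alpha>\<in>range re. b \<alpha>)"
  show "b = c"
  proof
    fix \<alpha>
    show "b \<alpha> = c \<alpha>"
    proof (cases "\<alpha> \<in> range re")
      case True
      have "complex_vec (b \<alpha>) = comp \<alpha> (complex_vec x)"
        using b True by (intro comp_unique[of "\<lambda>\<alpha>. complex_vec (b \<alpha>)"]) (auto simp: real_part_space_iff complex_vec_sum simp del: sum_component of_real_sum)
      moreover have "complex_vec (c \<alpha>) = comp \<alpha> (complex_vec x)"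
        using c x True by (intro comp_unique[of "\<lambda>\<alpha>. complex_vec (c \<alpha>)"]) (auto simp: real_part_space_iff complex_vec_sum simp del: sum_component of_real_sum)
      ultimately show ?thesis using complex_vec_inj by metis
    qed (use b c in auto)
  qed
qed (use assms in auto)

lemma components:
  shows components_space: "\<alpha> \<in> range re \<Longrightarrow> components A x \<alpha> \<in> real_part_space A \<alpha>"
    and sum_components: "(\<Sum>\<alpha>\<in>range re. components A x \<alpha>) = x"
proof -
  define c where "c \<alpha> = (if \<alpha> \<in> range re then (\<chi> i. Re (comp \<alpha> (complex_vec x) $ i)) else 0)" for \<alpha>
  have cc: "complex_vec (c \<alpha>) = comp \<alpha> (complex_vec x)" if "\<alpha> \<in> range re" for \<alpha>
    using that comp_real by (simp only: c_def if_True)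
  have 1: "c \<alpha> \<in> real_part_space A \<alpha>" if "\<alpha> \<in> range re" for \<alpha>
    unfolding real_part_space_iff cc[OF that] by (rule comp_E)
  have "complex_vec x = complex_vec (\<Sum>\<alpha>\<in>range re. c \<alpha>)"
    unfolding complex_vec_sum by (subst sum_comp[symmetric]) (intro sum.cong refl cc[symmetric])
  then have 2: "x = (\<Sum>\<alpha>\<in>range re. c \<alpha>)" unfolding complex_vec_inj .
  have "components A x = c" by (rule components_unique[OF 1 _ 2]) (auto simp: c_def)
  then show "\<alpha> \<in> range re \<Longrightarrow> components A x \<alpha> \<in> real_part_space A \<alpha>" "(\<Sum>\<alpha>\<in>range re. components A x \<alpha>) = x"
    using 1 2 by auto
qed

lemma subspace_real_part_space: "subspace (real_part_space A \<alpha>)"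
proof (rule subspaceI)
  have z: "complex_vec (0::real^'n) = 0" and a: "complex_vec (x + y) = complex_vec x + complex_vec y"
    and s: "complex_vec (r *\<^sub>R x) = of_real r *s complex_vec x" for x y :: "real^'n" and r
    by (simp_all add: vec_eq_iff)
  show "0 \<in> real_part_space A \<alpha>" unfolding real_part_space_iff z by (simp add: E_def U_simps)
  show "x + y \<in> real_part_space A \<alpha>" if "x \<in> real_part_space A \<alpha>" "y \<in> real_part_space A \<alpha>" for x y
    using that unfolding real_part_space_iff a by (simp add: E_def U_simps)
  show "r *\<^sub>R x \<in> real_part_space A \<alpha>" if "x \<in> real_part_space A \<alpha>" for r x
    using that unfolding real_part_space_iff s by (simp add: E_def U_simps)
qed

text \<open>A complex relation among real vectors splits into two real relations, given by the real
  and imaginary parts of its coefficients.\<close>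

lemma independent_complex_vec:
  assumes B: "independent B" "finite B" shows "vec.independent (complex_vec ` (B :: (real^'n) set))"
proof (rule vec.independent_if_scalars_zero)
  fix f x assume f: "(\<Sum>v\<in>complex_vec ` B. f v *s v) = 0" and x: "x \<in> complex_vec ` B"
  note inj_on_complex_vec[of B]
  then have s: "(\<Sum>b\<in>B. f (complex_vec b) *s complex_vec b) = 0"
    using f by (simp add: sum.reindex)
  have "(\<Sum>b\<in>B. Re (f (complex_vec b)) *\<^sub>R b) $ i = Re ((\<Sum>b\<in>B. f (complex_vec b) *s complex_vec b) $ i)" for i
    by (simp add: sum_component)
  then have "(\<Sum>b\<in>B. Re (f (complex_vec b)) *\<^sub>R b) = 0" unfolding s by (simp add: vec_eq_iff)
  then have 1: "Re (f (complex_vec b)) = 0" if "b \<in> B" for b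
    using independentD[OF B(1,2) order_refl, of "\<lambda>b. Re (f (complex_vec b))"] that by blast
  have "(\<Sum>b\<in>B. Im (f (complex_vec b)) *\<^sub>R b) $ i = Im ((\<Sum>b\<in>B. f (complex_vec b) *s complex_vec b) $ i)" for i
    by (simp add: sum_component)
  then have "(\<Sum>b\<in>B. Im (f (complex_vec b)) *\<^sub>R b) = 0" unfolding s by (simp add: vec_eq_iff)
  then have 2: "Im (f (complex_vec b)) = 0" if "b \<in> B" for b
    using independentD[OF B(1,2) order_refl, of "\<lambda>b. Im (f (complex_vec b))"] that by blast
  show "f x = 0" using x 1 2 by (auto simp: complex_eq_iff)
qed (use B in simp)

lemma E_span: "E \<alpha> \<subseteq> vec.span (evec ` {k. re k = \<alpha>})"
proof
  fix v assume v: "v \<in> E \<alpha>"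
  have "U v $ k *s evec k \<in> vec.span (evec ` {k. re k = \<alpha>})" for k
  proof (cases "re k = \<alpha>")
    case True
    then show ?thesis by (intro vec.span_scale vec.span_base) auto
  next
    case False
    then show ?thesis using v by (simp add: E_def vec.span_zero)
  qed
  then show "v \<in> vec.span (evec ` {k. re k = \<alpha>})" by (subst expand) (rule vec.span_sum)
qed

lemma dim_real_part_space_le: "dim (real_part_space A \<alpha>) \<le> card {k. re k = \<alpha>}"
proof -
  obtain B where B: "B \<subseteq> real_part_space A \<alpha>" "independent B" "card B = dim (real_part_space A \<alpha>)"
    by (rule basis_exists)
  have fB: "finite B" using B(2) by (rule finiteI_independent)
  have "complex_vec ` B \<subseteq> E \<alpha>"
  proof (rule image_subsetI)
    fix x assume "x \<in> B"
    then show "complex_vec x \<in> E \<alpha>" unfolding real_part_space_iff[symmetric] using B(1) by (rule subsetD[rotated])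
  qed
  then have sub: "complex_vec ` B \<subseteq> vec.span (evec ` {k. re k = \<alpha>})" using E_span by (rule subset_trans)
  have fin: "finite (evec ` {k. re k = \<alpha>})" by (rule finite_imageI) simp
  have "card (complex_vec ` B) = card B" by (rule card_image[OF inj_on_complex_vec])
  moreover have "card (complex_vec ` B) \<le> card (evec ` {k. re k = \<alpha>})"
    by (rule vec.independent_span_bound[OF fin independent_complex_vec[OF B(2) fB] sub, THEN conjunct2])
  moreover have "card (evec ` {k. re k = \<alpha>}) \<le> card {k. re k = \<alpha>}" by (rule card_image_le) simp
  ultimately show ?thesis using B(3) by linarith
qed

lemma sum_card_re: "(\<Sum>\<alpha>\<in>range re. card {k. re k = \<alpha>}) = CARD('n)"
proof -
  have "(\<Sum>\<alpha>\<in>range re. card {k. re k = \<alpha>}) = card (\<Union>\<alpha>\<in>range re. {k. re k = \<alpha>})"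
    by (rule card_UN_disjoint[symmetric]) auto
  also have "(\<Union>\<alpha>\<in>range re. {k. re k = \<alpha>}) = UNIV" by auto
  finally show ?thesis by simp
qed

lemma sum_dim_real_part_space: "CARD('n) \<le> (\<Sum>\<alpha>\<in>range re. dim (real_part_space A \<alpha>))"
proof -
  have "\<forall>\<alpha>. \<exists>B. finite B \<and> real_part_space A \<alpha> \<subseteq> span B \<and> card B = dim (real_part_space A \<alpha>)"
    using basis_exists finiteI_independent by metis
  from choice[OF this] obtain B where B: "\<And>\<alpha>. finite (B \<alpha>)" "\<And>\<alpha>. real_part_space A \<alpha> \<subseteq> span (B \<alpha>)"
    "\<And>\<alpha>. card (B \<alpha>) = dim (real_part_space A \<alpha>)" by blast
  have "x \<in> span (\<Union>\<alpha>\<in>range re. B \<alpha>)" for x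
  proof -
    have "components A x \<alpha> \<in> span (\<Union>\<alpha>\<in>range re. B \<alpha>)" if "\<alpha> \<in> range re" for \<alpha>
      using components_space[OF that, of x] B(2)[of \<alpha>] span_mono[of "B \<alpha>" "\<Union>\<alpha>\<in>range re. B \<alpha>"] that by blast
    then have "(\<Sum>\<alpha>\<in>range re. components A x \<alpha>) \<in> span (\<Union>\<alpha>\<in>range re. B \<alpha>)" by (rule span_sum)
    then show ?thesis by (simp add: sum_components)
  qed
  then have "dim (UNIV :: (real^'n) set) \<le> card (\<Union>\<alpha>\<in>range re. B \<alpha>)"
    using B(1) by (intro dim_le_card) auto
  also have "\<dots> \<le> (\<Sum>\<alpha>\<in>range re. card (B \<alpha>))" by (rule card_UN_le) simp
  finally show ?thesis by (simp add: B(3))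
qed

text \<open>Each dimension is at most the number of eigenvectors concerned, and the dimensions add
  up to at least the full one, so no inequality can be strict.\<close>

lemma dim_real_part_space: "dim (real_part_space A \<alpha>) = card {k. re k = \<alpha>}"
proof (cases "\<alpha> \<in> range re")
  case True
  show ?thesis
  proof (rule ccontr)
    assume "dim (real_part_space A \<alpha>) \<noteq> card {k. re k = \<alpha>}"
    then have "dim (real_part_space A \<alpha>) < card {k. re k = \<alpha>}" using dim_real_part_space_le[of \<alpha>] by simp
    then have "(\<Sum>\<alpha>\<in>range re. dim (real_part_space A \<alpha>)) < (\<Sum>\<alpha>\<in>range re. card {k. re k = \<alpha>})"
      using True dim_real_part_space_le by (intro sum_strict_mono_ex1) auto
    then show False using sum_dim_real_part_space sum_card_re by simp
  qed
next
  case False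
  then have "card {k. re k = \<alpha>} = 0" by auto
  then show ?thesis using dim_real_part_space_le[of \<alpha>] by simp
qed
text \<open>The metric sees only the norm of each component, so it suffices to map each spectral
  subspace isometrically to the coordinate block of the same dimension.\<close>

lemma exists_linear_model:
  "\<exists>f. bij f \<and> (\<forall>x y. \<forall>\<alpha>\<in>range re. norm (components A x \<alpha> - components A y \<alpha>) = norm (block re \<alpha> (f x - f y)))"
proof -
  let ?V = "real_part_space A" and ?W = "\<lambda>\<alpha>. range (block re \<alpha>) :: (real^'n) set"
  have W: "?W \<alpha> = {x :: real^'n. \<forall>k. k \<notin> {k. re k = \<alpha>} \<longrightarrow> x $ k = 0}" for \<alpha>
  proof (intro equalityI subsetI)
    fix x :: "real^'n" assume "x \<in> {x. \<forall>k. k \<notin> {k. re k = \<alpha>} \<longrightarrow> x $ k = 0}"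
    then have "block re \<alpha> x = x" unfolding vec_eq_iff block_nth by auto
    then show "x \<in> ?W \<alpha>" by (metis rangeI)
  next
    fix x assume "x \<in> ?W \<alpha>"
    then obtain y where "x = block re \<alpha> y" by blast
    then show "x \<in> {x. \<forall>k. k \<notin> {k. re k = \<alpha>} \<longrightarrow> x $ k = 0}" by simp
  qed
  have dimW: "dim (?W \<alpha>) = card {k. re k = \<alpha>}" for \<alpha>
    by (subst W, subst dim_vec_eq[symmetric], rule dim_substandard_cart)
  have subW: "subspace (?W \<alpha>)" for \<alpha>
    unfolding W by (rule subspaceI) simp_all
  have "\<exists>h. linear h \<and> h ` ?V \<alpha> = ?W \<alpha> \<and> (\<forall>x\<in>?V \<alpha>. norm (h x) = norm x)" for \<alpha>
    by (rule isometry_subspaces[OF subspace_real_part_space[of \<alpha>] subW[of \<alpha>]])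
       (simp_all only: dimW dim_real_part_space, blast)
  then have "\<forall>\<alpha>. \<exists>h. linear h \<and> h ` ?V \<alpha> = ?W \<alpha> \<and> (\<forall>x\<in>?V \<alpha>. norm (h x) = norm x)" ..
  from choice[OF this] obtain h where h: "\<And>\<alpha>. linear (h \<alpha>)" "\<And>\<alpha>. h \<alpha> ` ?V \<alpha> = ?W \<alpha>"
    "\<And>\<alpha> x. x \<in> ?V \<alpha> \<Longrightarrow> norm (h \<alpha> x) = norm x" by blast
  define f where "f x = (\<Sum>\<alpha>\<in>range re. h \<alpha> (components A x \<alpha>))" for x
  have bl: "block re \<alpha> (f x) = h \<alpha> (components A x \<alpha>)" if \<alpha>: "\<alpha> \<in> range re" for \<alpha> x
  proof -
    have lin: "linear (block re \<alpha>)" by (rule linearI) (auto simp: block_add block_scale)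
    have bh: "block re \<alpha> (h \<gamma> (components A x \<gamma>)) = (if \<gamma> = \<alpha> then h \<alpha> (components A x \<alpha>) else 0)" if "\<gamma> \<in> range re" for \<gamma>
    proof -
      have "h \<gamma> (components A x \<gamma>) \<in> ?W \<gamma>" using components_space[OF that] h(2) by blast
      then obtain y where "h \<gamma> (components A x \<gamma>) = block re \<gamma> y" by blast
      then show ?thesis by (auto simp: block_block)
    qed
    have "block re \<alpha> (f x) = (\<Sum>\<gamma>\<in>range re. block re \<alpha> (h \<gamma> (components A x \<gamma>)))"
      unfolding f_def by (rule linear_sum[OF lin])
    also have "\<dots> = (\<Sum>\<gamma>\<in>range re. if \<gamma> = \<alpha> then h \<alpha> (components A x \<alpha>) else 0)"
      by (intro sum.cong refl bh)
    finally show ?thesis using \<alpha> by simp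
  qed
  have nrm: "norm (components A x \<alpha> - components A y \<alpha>) = norm (block re \<alpha> (f x - f y))" if \<alpha>: "\<alpha> \<in> range re" for \<alpha> x y
  proof -
    have "components A x \<alpha> - components A y \<alpha> \<in> ?V \<alpha>"
      using \<alpha> by (intro subspace_diff subspace_real_part_space components_space)
    then show ?thesis using h(3) by (simp add: block_diff bl[OF \<alpha>] linear_diff[OF h(1), symmetric])
  qed
  have "inj f"
  proof (rule injI)
    fix x y assume "f x = f y"
    then have "components A x \<alpha> = components A y \<alpha>" if "\<alpha> \<in> range re" for \<alpha> using nrm[OF that, of x y] by simp
    then have "(\<Sum>\<alpha>\<in>range re. components A x \<alpha>) = (\<Sum>\<alpha>\<in>range re. components A y \<alpha>)" by (rule sum.cong[OF refl])
    then show "x = y" by (simp add: sum_components)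
  qed
  moreover have "\<exists>x. f x = y" for y
  proof -
    have "\<forall>\<alpha>. \<exists>v\<in>?V \<alpha>. h \<alpha> v = block re \<alpha> y"
    proof
      fix \<alpha>
      have "block re \<alpha> y \<in> h \<alpha> ` ?V \<alpha>" unfolding h(2) by blast
      then show "\<exists>v\<in>?V \<alpha>. h \<alpha> v = block re \<alpha> y" by force
    qed
    then obtain v where v: "\<And>\<alpha>. v \<alpha> \<in> ?V \<alpha>" "\<And>\<alpha>. h \<alpha> (v \<alpha>) = block re \<alpha> y" by metis
    let ?c = "\<lambda>\<alpha>. if \<alpha> \<in> range re then v \<alpha> else 0"
    have c: "components A (\<Sum>\<alpha>\<in>range re. v \<alpha>) = ?c"
      by (rule components_unique) (auto simp: v)
    have "f (\<Sum>\<alpha>\<in>range re. v \<alpha>) = (\<Sum>\<alpha>\<in>range re. block re \<alpha> y)"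
      unfolding f_def c by (intro sum.cong refl) (simp add: v)
    then show ?thesis unfolding sum_block by (rule exI)
  qed
  ultimately have "bij f" unfolding bij_def surj_def by (metis)
  then show ?thesis using nrm by blast
qed

end

text \<open>Dividing the real parts by the least one turns the exponents of the metric into
  reciprocals of weights.\<close>

lemma (in diagonalized) dist_mat_wdist:
  assumes f: "\<And>x y \<alpha>. \<alpha> \<in> range re \<Longrightarrow> norm (components A x \<alpha> - components A y \<alpha>) = norm (block re \<alpha> (f x - f y))"
    and pos: "\<And>k. 0 < re k"
  shows "dist_mat A x y = wdist (\<lambda>k. re k / Min (range re)) (f x) (f y)"
proof -
  let ?m = "Min (range re)"
  have "0 < ?m" using pos by (subst Min_gr_iff) auto
  then have m: "?m \<noteq> 0" by linarith
  have bl: "block (\<lambda>k. re k / ?m) (\<alpha> / ?m) v = block re \<alpha> v" for \<alpha> v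
    using m by (simp add: vec_eq_iff)
  have "(\<lambda>\<alpha>. norm (components A x \<alpha> - components A y \<alpha>) powr (?m / \<alpha>)) ` range re =
     (\<lambda>\<alpha>. norm (block re \<alpha> (f x - f y)) powr (?m / \<alpha>)) ` range re"
    using f by (intro image_cong) auto
  also have "\<dots> = (\<lambda>a. norm (block (\<lambda>k. re k / ?m) a (f x - f y)) powr (1 / a)) ` range (\<lambda>k. re k / ?m)"
    unfolding image_image bl by simp
  finally show ?thesis unfolding dist_mat_def wdist_def real_parts_eq by (rule arg_cong)
qed

lemma (in diagonalized) weight_ge_1:
  assumes pos: "\<And>k. 0 < re k" shows "1 \<le> re k / Min (range re)"
proof -
  have "0 < Min (range re)" using pos by simp
  moreover have "Min (range re) \<le> re k" by (intro Min_le) auto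
  ultimately show ?thesis by (simp add: le_divide_eq)
qed

section \<open>Sorted diagonalizations and the matrix of real parts\<close>

lemma diagonalization_diagonalized:
  assumes "diagonalization (complex_mat A) D" obtains P where "diagonalized A P D"
proof -
  obtain P where P: "diagonal_mat D" "invertible P" "complex_mat A = P ** D ** matrix_inv P"
    using assms by (auto simp: diagonalization_def)
  have "matrix_inv P ** P = mat 1"
    using P(2) unfolding invertible_def matrix_inv_def by (metis (mono_tags, lifting) someI_ex)
  then have "complex_mat A ** P = P ** D"
    unfolding P(3) matrix_mul_assoc[symmetric] by (simp add: matrix_mul_rid)
  then show ?thesis using P that by (simp add: diagonalized_def)
qed

lemma (in diagonalized) diagonalization: "diagonalization (complex_mat A) D"
proof -
  have "complex_mat A = complex_mat A ** (P ** matrix_inv P)" by (simp add: P_inv matrix_mul_rid)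
  also have "\<dots> = P ** D ** matrix_inv P" by (simp only: matrix_mul_assoc AP)
  finally show ?thesis using P diag by (auto simp: diagonalization_def)
qed

lemma (in diagonalized) permute:
  assumes s: "bij s"
  shows "diagonalized A (\<chi> i k. P $ i $ s k) (\<chi> i j. if i = j then D $ s i $ s i else 0)"
proof
  let ?P = "\<chi> i k. P $ i $ s k" and ?R = "\<chi> k j. matrix_inv P $ s k $ j"
  have inj: "s k = s l \<longleftrightarrow> k = l" for k l using s by (auto dest: bij_is_inj injD)
  have "(?R ** ?P) $ k $ l = (matrix_inv P ** P) $ s k $ s l" for k l
    by (simp add: matrix_matrix_mult_def)
  then have "?R ** ?P = mat 1" unfolding P_inv by (simp add: vec_eq_iff mat_def inj)
  then show "invertible ?P" unfolding invertible_def using matrix_left_right_inverse by blast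
  show "diagonal_mat (\<chi> i j. if i = j then D $ s i $ s i else 0)" by (simp add: diagonal_mat_def)
  have "(complex_mat A ** ?P) $ i $ k = (complex_mat A ** P) $ i $ s k" for i k
    by (simp add: matrix_matrix_mult_def)
  moreover have "(P ** D) $ i $ j = P $ i $ j * D $ j $ j" for i j
  proof -
    have "(P ** D) $ i $ j = (\<Sum>l\<in>UNIV. if l = j then P $ i $ j * D $ j $ j else 0)"
      using diag unfolding matrix_matrix_mult_def vec_lambda_beta
      by (intro sum.cong) (auto simp: diagonal_mat_def)
    then show ?thesis by simp
  qed
  moreover have "(?P ** (\<chi> i j. if i = j then D $ s i $ s i else 0)) $ i $ k = P $ i $ s k * D $ s k $ s k" for i k
    by (simp add: matrix_matrix_mult_def if_distrib cong: if_cong)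
  ultimately show "complex_mat A ** ?P = ?P ** (\<chi> i j. if i = j then D $ s i $ s i else 0)"
    unfolding vec_eq_iff AP by metis
qed

lemma exists_sorting:
  fixes f :: "'n::{finite,linorder} \<Rightarrow> 'a::linorder"
  shows "\<exists>s :: 'n \<Rightarrow> 'n. bij s \<and> mono (\<lambda>k. f (s k))"
proof -
  define xs where "xs = sort_key f (sorted_list_of_set (UNIV :: 'n set))"
  define idx where "idx k = card {..<k}" for k :: 'n
  have xs: "distinct xs" "set xs = UNIV" "sorted (map f xs)" "length xs = CARD('n)"
    by (simp_all add: xs_def)
  have less: "idx j < idx k" if "j < k" for j k
    unfolding idx_def using that by (intro psubset_card_mono) auto
  have bound: "idx k < length xs" for k
    unfolding idx_def xs by (intro psubset_card_mono) auto
  have "inj (\<lambda>k. xs ! idx k)"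
    by (rule injI) (metis less bound xs(1) nth_eq_iff_index_eq less_irrefl neqE)
  then have "bij (\<lambda>k. xs ! idx k)" using finite_UNIV_inj_surj[of "\<lambda>k. xs ! idx k"] by (simp add: bij_def)
  moreover have "mono (\<lambda>k. f (xs ! idx k))"
  proof (rule monoI)
    fix j k :: 'n assume "j \<le> k"
    then have "idx j \<le> idx k" using less[of j k] by (cases "j = k") (auto intro: less_imp_le)
    then show "f (xs ! idx j) \<le> f (xs ! idx k)"
      using sorted_nth_mono[OF xs(3), of "idx j" "idx k"] bound by simp
  qed
  ultimately show ?thesis by blast
qed

text \<open>If \<open>g k < f k\<close>, then monotonicity puts at least all indices up to
  \<open>k\<close> into the set where \<open>g\<close> is at most \<open>g k\<close>, but only
  indices below \<open>k\<close> into the one for \<open>f\<close>, while equal fibres give both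
  sets the same size.\<close>

lemma mono_determined_by_fibres:
  fixes f g :: "'n::{finite,linorder} \<Rightarrow> 'a::linorder"
  assumes "mono f" "mono g" "\<And>a. card {k. f k = a} = card {k. g k = a}"
  shows "f = g"
proof -
  have le: "f k \<le> g k" if f: "mono f" and g: "mono g" and fg: "\<And>a. card {k. f k = a} = card {k. g k = a}"
    for f g :: "'n \<Rightarrow> 'a" and k
  proof (rule ccontr)
    assume "\<not> f k \<le> g k"
    then have k: "g k < f k" by simp
    have count: "card {j. h j \<le> g k} = (\<Sum>a\<in>{a \<in> range f \<union> range g. a \<le> g k}. card {j. h j = a})"
      if "range h \<subseteq> range f \<union> range g" for h :: "'n \<Rightarrow> 'a"
    proof -
      have "{j. h j \<le> g k} = (\<Union>a\<in>{a \<in> range f \<union> range g. a \<le> g k}. {j. h j = a})" using that by fast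
      moreover have "finite {a \<in> range f \<union> range g. a \<le> g k}" by simp
      ultimately show ?thesis using card_UN_disjoint[of "{a \<in> range f \<union> range g. a \<le> g k}" "\<lambda>a. {j. h j = a}"] by fastforce
    qed
    have "card {j. f j \<le> g k} = card {j. g j \<le> g k}" using count[of f] count[of g] fg by simp
    moreover have "{j. f j \<le> g k} \<subseteq> {..<k}"
      using f k by (auto simp: not_less[symmetric] dest: monoD)
    moreover have "{..k} \<subseteq> {j. g j \<le> g k}" using g by (auto dest: monoD)
    ultimately have "card {..k} \<le> card {..<k}" by (metis card_mono finite order_trans)
    moreover have "card {..<k} < card {..k}" by (intro psubset_card_mono) auto
    ultimately show False by simp
  qed
  show ?thesis
    using le[OF assms(1,2,3)] le[OF assms(2,1) assms(3)[symmetric]] by (auto intro: antisym)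
qed

text \<open>Makes the definite description usable. Sorting a diagonalization gives existence; for
  uniqueness, the multiplicities are dimensions of the spaces
  \<open>real_part_space A \<alpha>\<close>, which do not depend on the diagonalization.\<close>

lemma real_part_jordan_form:
  fixes A :: "real^('n::{finite,linorder})^('n::{finite,linorder})"
  assumes A: "complex_diagonalizable A"
  obtains P D where "diagonalized A P D" "diagonal_mat (real_part_jordan_form A)"
    "\<And>k. real_part_jordan_form A $ k $ k = Re (D $ k $ k)"
proof -
  obtain D0 where "diagonalization (complex_mat A) D0" using A by (auto simp: complex_diagonalizable_def)
  then obtain P0 where "diagonalized A P0 D0" by (rule diagonalization_diagonalized)
  then interpret D0: diagonalized A P0 D0 .
  obtain s :: "'n \<Rightarrow> 'n" where s: "bij s" "mono (\<lambda>k. D0.re (s k))" using exists_sorting[of D0.re] by blast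
  define D where "D = (\<chi> i j. if i = j then D0 $ s i $ s i else 0)"
  interpret D: diagonalized A "\<chi> i k. P0 $ i $ s k" D unfolding D_def by (rule D0.permute[OF s(1)])
  define J where "J = (\<chi> i j. if i = j then D.re i else 0)"
  have J: "diagonal_mat J" "mono (\<lambda>i. J $ i $ i)" "\<And>i. J $ i $ i = D.re i"
    using s(2) by (simp_all add: J_def diagonal_mat_def D_def)
  have "real_part_jordan_form A = J" unfolding real_part_jordan_form_def
  proof (rule the_equality)
    show "diagonal_mat J \<and> mono (\<lambda>i. J $ i $ i) \<and> (\<exists>D. diagonalization (complex_mat A) D \<and> (\<forall>i. J $ i $ i = Re (D $ i $ i)))"
      using J D.diagonalization by blast
    fix B assume B: "diagonal_mat B \<and> mono (\<lambda>i. B $ i $ i) \<and> (\<exists>D. diagonalization (complex_mat A) D \<and> (\<forall>i. B $ i $ i = Re (D $ i $ i)))"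
    then obtain D' where D': "diagonalization (complex_mat A) D'" "\<And>i. B $ i $ i = Re (D' $ i $ i)" by blast
    from D'(1) obtain P' where "diagonalized A P' D'" by (rule diagonalization_diagonalized)
    then interpret D': diagonalized A P' D' .
    have "(\<lambda>i. B $ i $ i) = (\<lambda>i. J $ i $ i)"
    proof (rule mono_determined_by_fibres)
      show "card {k. B $ k $ k = a} = card {k. J $ k $ k = a}" for a
        unfolding D'(2) J(3) D'.dim_real_part_space[symmetric] D.dim_real_part_space[symmetric] ..
    qed (use B J in auto)
    then have "B $ i $ i = J $ i $ i" for i by metis
    then have "B $ i $ j = J $ i $ j" for i j using B J(1) unfolding diagonal_mat_def by (cases "i = j") auto
    then show "B = J" by (simp add: vec_eq_iff)
  qed
  then show ?thesis using that[OF D.diagonalized_axioms] J by simp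
qed

lemma dist_mat_diagonal:
  assumes J: "diagonal_mat J" and pos: "\<And>k. 0 < J $ k $ k"
  shows "dist_mat J x y = wdist (\<lambda>k. J $ k $ k / Min (range (\<lambda>k. J $ k $ k))) x y"
proof -
  interpret J: diagonalized J "mat 1" "complex_mat J"
  proof
    show "invertible (mat 1 :: complex^'a^'a)" unfolding invertible_def by (intro exI[of _ "mat 1"]) (simp add: matrix_mul_lid)
    show "diagonal_mat (complex_mat J)" using J by (simp add: diagonal_mat_def)
  qed (simp add: matrix_mul_lid matrix_mul_rid)
  have U: "J.U v = v" for v using J.P_U[of v] by (simp add: matrix_vector_mul_lid)
  have comp: "components J x \<alpha> = block J.re \<alpha> x" if \<alpha>: "\<alpha> \<in> range J.re" for x \<alpha>
  proof -
    have "components J x = (\<lambda>\<alpha>. if \<alpha> \<in> range J.re then block J.re \<alpha> x else 0)"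
      by (rule J.components_unique) (auto simp: J.real_part_space_iff J.E_def U sum_block)
    then show ?thesis using \<alpha> by simp
  qed
  have "dist_mat J x y = wdist (\<lambda>k. J.re k / Min (range J.re)) (id x) (id y)"
    by (rule J.dist_mat_wdist) (simp_all add: comp block_diff pos)
  then show ?thesis by simp
qed

theorem exists_model_metric:
  fixes A :: "real^('n::{finite,linorder})^('n::{finite,linorder})"
  assumes A: "complex_diagonalizable A" and pos: "\<forall>z\<in>eigenvalues (complex_mat A). 0 < Re z"
  obtains w f where "\<And>k. 1 \<le> w k" "bij f"
    "\<And>x y. dist_mat A x y = wdist w (f x) (f y)"
    "\<And>x y. dist_mat (real_part_jordan_form A) x y = wdist w x y"
proof -
  let ?J = "real_part_jordan_form A"
  obtain P D where D: "diagonalized A P D" and J: "diagonal_mat ?J" "\<And>k. ?J $ k $ k = Re (D $ k $ k)"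
    using real_part_jordan_form[OF A] by metis
  interpret diagonalized A P D by (rule D)
  have re: "0 < re k" for k using pos eigenvalues_eq by auto
  obtain f where f: "bij f" "\<And>x y \<alpha>. \<alpha> \<in> range re \<Longrightarrow> norm (components A x \<alpha> - components A y \<alpha>) = norm (block re \<alpha> (f x - f y))"
    using exists_linear_model by blast
  have "dist_mat ?J x y = wdist (\<lambda>k. re k / Min (range re)) x y" for x y
    using dist_mat_diagonal[OF J(1), of x y] re unfolding J(2) by simp
  then show ?thesis using that[OF weight_ge_1[OF re] f(1) dist_mat_wdist[OF f(2) re]] by blast
qed

section \<open>The main theorem\<close>

context Metric_space
begin

lemma continuous_map_dist: "continuous_map (prod_topology mtopology mtopology) euclideanreal (\<lambda>p. d (fst p) (snd p))"
proof -
  have "continuous_map (prod_topology mtopology mtopology) Met_TC.mtopology (\<lambda>p. d (fst p) (snd p))"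
    unfolding Met_TC.continuous_map_to_metric
  proof (intro ballI allI impI)
    fix p and e :: real
    assume "p \<in> topspace (prod_topology mtopology mtopology)" and e: "0 < e"
    then have p: "fst p \<in> M" "snd p \<in> M" by (auto simp: mem_Times_iff)
    let ?U = "mball (fst p) (e/2) \<times> mball (snd p) (e/2)"
    have "openin (prod_topology mtopology mtopology) ?U" by (simp add: openin_prod_Times_iff)
    moreover have "p \<in> ?U" using p e by (simp add: mem_Times_iff)
    moreover have "d (fst q) (snd q) \<in> Met_TC.mball (d (fst p) (snd p)) e" if "q \<in> ?U" for q
    proof -
      have q: "fst q \<in> M" "snd q \<in> M" "d (fst p) (fst q) < e/2" "d (snd p) (snd q) < e/2"
        using that by (auto simp: mem_Times_iff)
      have "d (fst q) (snd q) \<le> d (fst p) (fst q) + d (fst p) (snd p) + d (snd p) (snd q)"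
        using triangle[of "fst q" "fst p" "snd q"] triangle[of "fst p" "snd p" "snd q"] p q commute[of "fst p" "fst q"] by simp
      moreover have "d (fst p) (snd p) \<le> d (fst p) (fst q) + d (fst q) (snd q) + d (snd p) (snd q)"
        using triangle[of "fst p" "fst q" "snd p"] triangle[of "fst q" "snd q" "snd p"] p q commute[of "snd p" "snd q"] by simp
      ultimately show ?thesis using q by (simp add: dist_real_def abs_less_iff)
    qed
    ultimately show "\<exists>U. openin (prod_topology mtopology mtopology) U \<and> p \<in> U \<and>
        (\<forall>q\<in>U. d (fst q) (snd q) \<in> Met_TC.mball (d (fst p) (snd p)) e)" by blast
  qed
  then show ?thesis by simp
qed

text \<open>The distance is continuous and positive on a compact set of distinct pairs, so it is
  bounded away from 0 and from infinity; one constant then serves all three bounds.\<close>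

lemma compact_distinct_pairs_bounds:
  assumes K: "compactin (prod_topology mtopology mtopology) K" "K \<subseteq> distinct_pairs M" and b: "b \<in> M"
  shows "\<exists>R>0. \<forall>x y. (x, y) \<in> K \<longrightarrow> d x b \<le> R \<and> 1 / R \<le> d x y \<and> d x y \<le> R"
proof -
  let ?D = "\<lambda>p. d (fst p) (snd p)"
  let ?S = "?D ` K"
  have S: "compact ?S" using image_compactin[OF K(1) continuous_map_dist] by simp
  have "continuous_map (prod_topology mtopology mtopology) (prod_topology mtopology mtopology) (\<lambda>p. (fst p, b))"
    using b by (intro continuous_map_pairedI continuous_map_fst) auto
  from continuous_map_compose[OF this continuous_map_dist]
  have "compact ((\<lambda>p. d (fst p) b) ` K)"
    using image_compactin[OF K(1), of euclideanreal "\<lambda>p. d (fst p) b"] by (simp add: o_def)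
  then have "bounded ((\<lambda>p. d (fst p) b) ` K)" by (rule compact_imp_bounded)
  then obtain R1 where R1: "\<And>p. p \<in> K \<Longrightarrow> \<bar>d (fst p) b\<bar> \<le> R1"
    unfolding bounded_iff real_norm_def by blast
  obtain R2 where R2: "\<And>p. p \<in> K \<Longrightarrow> \<bar>?D p\<bar> \<le> R2"
    using compact_imp_bounded[OF S] unfolding bounded_iff real_norm_def by blast
  have pos: "0 < ?D p" if "p \<in> K" for p
    using that K(2) by (auto simp: distinct_pairs_def)
  obtain e where e: "0 < e" "\<And>p. p \<in> K \<Longrightarrow> e \<le> ?D p"
  proof (cases "K = {}")
    case False
    then obtain s where "s \<in> ?S" "\<forall>t\<in>?S. s \<le> t" using compact_attains_inf[OF S] by blast
    then show thesis using that[of s] pos by auto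
  qed (use that[of 1] in auto)
  define R where "R = max (1 / e) (max R1 R2)"
  have "0 < 1 / e" using e by simp
  then have R: "0 < R" unfolding R_def by (rule less_le_trans) (rule max.cobounded1)
  have "1 / R \<le> e" using e(1) R by (simp add: divide_le_eq R_def le_max_iff_disj pos_divide_le_eq mult.commute max_mult_distrib_left)
  then have "d x b \<le> R \<and> 1 / R \<le> d x y \<and> d x y \<le> R" if "(x, y) \<in> K" for x y
    using R1[OF that] R2[OF that] e(2)[OF that] by (auto simp: R_def le_max_iff_disj abs_le_iff)
  then show ?thesis using R by blast
qed

end

lemma group_of_maps:
  assumes S: "subgroup S (BijGroup X)"
  shows group_of_maps_closed: "\<lbrakk>g \<in> S; x \<in> X\<rbrakk> \<Longrightarrow> g x \<in> X"
    and group_of_maps_one: "x \<in> X \<Longrightarrow> \<one>\<^bsub>group_of_maps X S\<^esub> x = x"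
    and group_of_maps_mult: "\<lbrakk>g \<in> S; h \<in> S; x \<in> X\<rbrakk> \<Longrightarrow> (g \<otimes>\<^bsub>group_of_maps X S\<^esub> h) x = g (h x)"
proof -
  have "S \<subseteq> Bij X" using subgroup.subset[OF S] by (simp add: BijGroup_def)
  then have B: "g \<in> Bij X" if "g \<in> S" for g using that by blast
  show "\<lbrakk>g \<in> S; x \<in> X\<rbrakk> \<Longrightarrow> g x \<in> X" using Bij_imp_funcset[OF B] by blast
  show "x \<in> X \<Longrightarrow> \<one>\<^bsub>group_of_maps X S\<^esub> x = x" by (simp add: BijGroup_def)
  show "\<lbrakk>g \<in> S; h \<in> S; x \<in> X\<rbrakk> \<Longrightarrow> (g \<otimes>\<^bsub>group_of_maps X S\<^esub> h) x = g (h x)"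
    using B by (simp add: BijGroup_def compose_def)
qed

lemma Metric_space_pdist: "(\<And>k. 1 \<le> w k) \<Longrightarrow> Metric_space (product_space m) (pdist w m)"
  by unfold_locales (auto simp: pdist_eq_0 pdist_triangle pdist_commute)

lemma continuous_map_fst_pdist:
  assumes w: "\<And>k. 1 \<le> w k"
  shows "continuous_map (Metric_space.mtopology (product_space m) (pdist w m)) euclidean fst"
proof -
  interpret Metric_space "product_space m" "pdist w m" by (rule Metric_space_pdist[OF w])
  have "continuous_map mtopology Met_TC.mtopology fst"
    unfolding metric_continuous_map[OF Met_TC.Metric_space_axioms]
  proof (intro conjI ballI allI impI subset_UNIV)
    fix p :: "'a point" and e :: real assume e: "0 < e"
    let ?n = "real (card (range w))"
    define r where "r = min 1 (e / (?n + 1))"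
    have r: "0 < r" "r \<le> 1" "(?n + 1) * r \<le> e"
      using e by (auto simp: r_def min_def field_simps add_pos_nonneg)
    show "\<exists>r>0. \<forall>q. q \<in> product_space m \<and> pdist w m p q < r \<longrightarrow> dist (fst p) (fst q) < e"
    proof (intro exI[of _ r] conjI allI impI r)
      fix q assume "q \<in> product_space m \<and> pdist w m p q < r"
      then have wd: "wdist w (fst p) (fst q) < r" by (simp add: pdist_def)
      have "norm (fst p - fst q) \<le> (\<Sum>a\<in>range w. wdist w (fst p) (fst q) powr a)" by (rule norm_le_sum_blocks[OF w])
      also have "\<dots> \<le> (\<Sum>a\<in>range w. r)"
      proof (rule sum_mono)
        fix a assume "a \<in> range w"
        then have a: "1 \<le> a" using w by auto
        have "wdist w (fst p) (fst q) powr a \<le> r powr a" using a wd by (intro powr_mono2) auto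
        also have "\<dots> \<le> r powr 1" using a r by (intro powr_mono') auto
        finally show "wdist w (fst p) (fst q) powr a \<le> r" using r by simp
      qed
      also have "\<dots> = ?n * r" by simp
      also have "\<dots> < (?n + 1) * r" using r by simp
      finally show "dist (fst p) (fst q) < e" using r(3) by (simp add: dist_norm)
    qed
  qed
  then show ?thesis by simp
qed

theorem theorem5p4:
  fixes A :: "real^('n::{finite,linorder})^('n::{finite,linorder})"
    and m :: nat
    and \<Gamma> :: "('n point \<Rightarrow> 'n point) set"
    and T :: "('n point \<Rightarrow> 'n point) topology"
  assumes "m \<ge> 1"
    and "complex_diagonalizable A"
    and "\<forall>z\<in>eigenvalues (complex_mat A). Re z > 0"
    and "uniform_quasisimilarity_group (product_space m) (dist_prod A m) \<Gamma>"
    and "separable_locally_compact_action (product_space m) (dist_prod A m) \<Gamma> T"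
    and "amenable (group_of_maps (product_space m) \<Gamma>) T"
    and "cocompact_on_distinct_pairs (product_space m) (dist_prod A m) \<Gamma>"
  shows "\<exists>(l::real) (s::nat) (F :: 'n point \<Rightarrow> 'n point).
    l > 0 \<and> s \<ge> 1 \<and>
    bilipschitz_bij (product_space m) (dist_prod A m)
      (product_space s) (dist_prod (l *\<^sub>R real_part_jordan_form A) s) F \<and>
    (\<exists>(c::nat) i j. i \<ge> 1 \<and> j \<ge> 1 \<and> m = c ^ i \<and> s = c ^ j) \<and>
    (\<forall>\<gamma>'\<in>conjugate_group (product_space m) (product_space s) F \<Gamma>.
      similarity (product_space s) (dist_prod (l *\<^sub>R real_part_jordan_form A) s) \<gamma>')"
proof -
  let ?X = "product_space m :: 'n point set" and ?d = "dist_prod A m" and ?J = "real_part_jordan_form A"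
  let ?G = "group_of_maps ?X \<Gamma>"
  obtain w :: "'n \<Rightarrow> real" and f where w: "\<And>k. 1 \<le> w k" and f: "bij f"
    and dA: "\<And>x y. dist_mat A x y = wdist w (f x) (f y)" and dJ: "\<And>x y. dist_mat ?J x y = wdist w x y"
    using exists_model_metric[OF assms(2,3)] by blast
  \<comment> \<open>\<open>L\<close> turns the metric of \<open>A\<close> into the model metric
    exactly; the action is conjugated by it.\<close>
  define L where "L p = (f (fst p), snd p)" for p :: "'n point"
  define L' where "L' p = (inv_into UNIV f (fst p), snd p)" for p :: "'n point"
  have L: "L (L' p) = p" "L' (L p) = p" "L p \<in> ?X \<longleftrightarrow> p \<in> ?X" "L' p \<in> ?X \<longleftrightarrow> p \<in> ?X" for p
    using f by (simp_all add: L_def L'_def in_product_space bij_is_inj bij_is_surj surj_f_inv_f)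
  have dist_L: "pdist w m (L p) (L q) = ?d p q" for p q
    by (simp add: L_def pdist_def dist_prod_def dA)
  \<comment> \<open>The scaling factor is taken to be 1: the weights of the model are already those
    of the matrix of real parts.\<close>
  have dist_J: "dist_prod (1 *\<^sub>R ?J) s p q = pdist w s p q" for s and p q :: "'n point"
    by (simp add: dist_prod_def pdist_def dJ)
  interpret W: Metric_space ?X "pdist w m" by (rule Metric_space_pdist[OF w])
  interpret D: Metric_space ?X ?d
  proof
    fix p q r :: "'n point" assume pqr: "p \<in> ?X" "q \<in> ?X"
    show "?d p q = 0 \<longleftrightarrow> p = q" using pqr L(2) unfolding dist_L[symmetric] by (subst W.zero) (auto simp: L dest: arg_cong[of _ _ L'])
    assume r: "r \<in> ?X"
    show "?d p r \<le> ?d p q + ?d q r" unfolding dist_L[symmetric] by (rule W.triangle) (use pqr r L in auto)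
  qed (simp_all add: pdist_commute flip: dist_L)
  define act where "act g p = L (g (L' p))" for g p
  have sub: "subgroup \<Gamma> (BijGroup ?X)" using assms(4) by (simp add: uniform_quasisimilarity_group_def)
  obtain M where M: "1 \<le> M" "\<And>\<gamma>. \<gamma> \<in> \<Gamma> \<Longrightarrow> \<exists>C>0. quasisimilarity ?X ?d M C \<gamma>"
    using assms(4) unfolding uniform_quasisimilarity_group_def by blast
  have tg: "topological_group ?G T"
    and cont: "continuous_map (prod_topology T D.mtopology) D.mtopology (\<lambda>(\<gamma>, x). \<gamma> x)"
    using assms(5) by (auto simp: separable_locally_compact_action_def)
  interpret G: group ?G using tg by (simp add: topological_group_def)
  obtain K where K: "compactin (prod_topology D.mtopology D.mtopology) K" "K \<subseteq> distinct_pairs ?X"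
    "distinct_pairs ?X \<subseteq> (\<Union>\<gamma>\<in>\<Gamma>. map_prod \<gamma> \<gamma> ` K)"
    using assms(7) by (auto simp: cocompact_on_distinct_pairs_def)
  let ?o = "(0, \<lambda>_. 0) :: 'n point"
  have oX: "L' ?o \<in> ?X" using zero_madics assms(1) by (simp add: L) (simp add: in_product_space)
  obtain R where R: "0 < R" "\<And>x y. (x, y) \<in> K \<Longrightarrow> ?d x (L' ?o) \<le> R \<and> 1 / R \<le> ?d x y \<and> ?d x y \<le> R"
    using D.compact_distinct_pairs_bounds[OF K(1,2) oX] by blast
  have dist_act: "pdist w m (act g p) (act h q) = ?d (g (L' p)) (h (L' q))" for g h p q
    by (simp add: act_def dist_L)
  have mapX: "g p \<in> ?X" if "g \<in> \<Gamma>" "p \<in> ?X" for g p using group_of_maps_closed[OF sub] that .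
  have homeo: "continuous_map D.mtopology W.mtopology L"
    unfolding D.metric_continuous_map[OF W.Metric_space_axioms] using L by (auto simp: dist_L)
  interpret block_action ?G T w m act M R
  proof
    fix p assume p: "p \<in> ?X"
    have "continuous_map T (prod_topology T D.mtopology) (\<lambda>g. (g, L' p))"
      using p by (intro continuous_map_pairedI) (auto simp: L)
    from continuous_map_compose[OF this cont] have "continuous_map T D.mtopology (\<lambda>g. g (L' p))" by (simp add: o_def)
    from continuous_map_compose[OF continuous_map_compose[OF this homeo] continuous_map_fst_pdist[OF w]]
    show "continuous_map T euclidean (\<lambda>g. fst (act g p))" by (simp add: o_def act_def)
    show "act \<one>\<^bsub>?G\<^esub> p = p" unfolding act_def using p group_of_maps_one[OF sub, of "L' p"] by (simp add: L)
    fix g assume g: "g \<in> carrier ?G"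
    then show "act g p \<in> ?X" unfolding act_def using p mapX by (simp add: L)
    fix h assume h: "h \<in> carrier ?G"
    show "act (g \<otimes>\<^bsub>?G\<^esub> h) p = act g (act h p)"
      unfolding act_def L using p g h group_of_maps_mult[OF sub, of g h "L' p"] by (simp add: L)
  next
    fix g assume "g \<in> carrier ?G"
    then obtain C where C: "0 < C" "quasisimilarity ?X ?d M C g" using M(2)[of g] by auto
    have "C / M * pdist w m p q \<le> pdist w m (act g p) (act g q) \<and> pdist w m (act g p) (act g q) \<le> M * C * pdist w m p q"
      if "p \<in> ?X" "q \<in> ?X" for p q
    proof -
      have "pdist w m p q = ?d (L' p) (L' q)" using dist_L[of "L' p" "L' q"] by (simp add: L)
      then show ?thesis using C(2) that unfolding dist_act quasisimilarity_def by (simp add: L)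
    qed
    then show "\<exists>C>0. \<forall>p\<in>?X. \<forall>q\<in>?X. C / M * pdist w m p q \<le> pdist w m (act g p) (act g q) \<and>
       pdist w m (act g p) (act g q) \<le> M * C * pdist w m p q" using C(1) by blast
  next
    fix p q :: "'n point" assume pq: "p \<in> ?X" "q \<in> ?X" "p \<noteq> q"
    have "L' p \<noteq> L' q" using pq(3) L(1) by metis
    then have "(L' p, L' q) \<in> distinct_pairs ?X" using pq by (simp add: distinct_pairs_def L)
    then have "(L' p, L' q) \<in> (\<Union>\<gamma>\<in>\<Gamma>. map_prod \<gamma> \<gamma> ` K)" using K(3) by (rule subsetD[rotated])
    then obtain g x y where g: "g \<in> \<Gamma>" "(x, y) \<in> K" "L' p = g x" "L' q = g y" by auto
    have xy: "x \<in> ?X" "y \<in> ?X" using g(2) K(2) by (auto simp: distinct_pairs_def)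
    \<comment> \<open>The pair is a translate of a pair in \<open>K\<close> by \<open>g\<close>; the
      inverse brings it back to \<open>K\<close>.\<close>
    let ?h = "inv\<^bsub>?G\<^esub> g"
    have gG: "g \<in> carrier ?G" using g(1) by simp
    have h: "?h \<in> carrier ?G" using gG by (rule G.inv_closed)
    have inv: "?h (g z) = z" if "z \<in> ?X" for z
      using group_of_maps_mult[OF sub, of ?h g z] G.l_inv[OF gG] group_of_maps_one[OF sub that] h g(1) that by simp
    have "pdist w m (act ?h p) ?o = ?d x (L' ?o)"
      using dist_L[of x "L' ?o"] by (simp add: act_def g(3) inv xy L)
    moreover have "pdist w m (act ?h p) (act ?h q) = ?d x y" unfolding dist_act g(3,4) inv[OF xy(1)] inv[OF xy(2)] ..
    ultimately show "\<exists>g\<in>carrier ?G. pdist w m (act g p) (0, \<lambda>_. 0) \<le> R \<and>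
       1 / R \<le> pdist w m (act g p) (act g q) \<and> pdist w m (act g p) (act g q) \<le> R"
      using R(2)[OF g(2)] h by (intro bexI[of _ ?h]) auto
  qed (use tg assms w M R in auto)
  obtain s F B where s: "1 \<le> s" "\<exists>(c::nat) i j. 1 \<le> i \<and> 1 \<le> j \<and> m = c ^ i \<and> s = c ^ j" and B: "1 \<le> B"
    and F: "bij_betw F ?X (product_space s)"
    and bil: "\<And>p q. \<lbrakk>p \<in> ?X; q \<in> ?X\<rbrakk> \<Longrightarrow> pdist w m p q \<le> B * pdist w s (F p) (F q) \<and> pdist w s (F p) (F q) \<le> B * pdist w m p q"
    and sim: "\<And>g p q. \<lbrakk>g \<in> carrier ?G; p \<in> ?X; q \<in> ?X\<rbrakk> \<Longrightarrow> pdist w s (F (act g p)) (F (act g q)) = ratio g * pdist w s (F p) (F q)"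
    using exists_similarity_conjugacy by blast
  let ?Y = "product_space s :: 'n point set" and ?F = "F \<circ> L"
  have bijF: "bij_betw ?F ?X ?Y"
  proof (rule bij_betw_trans[OF _ F])
    show "bij_betw L ?X ?X" by (rule bij_betw_byWitness[where f' = L']) (auto simp: L)
  qed
  have "bilipschitz_bij ?X ?d ?Y (dist_prod (1 *\<^sub>R ?J) s) ?F"
    unfolding bilipschitz_bij_def dist_J
  proof (intro conjI bijF exI[of _ B] B ballI)
    fix p q assume pq: "p \<in> ?X" "q \<in> ?X"
    then have "?d p q \<le> B * pdist w s (?F p) (?F q) \<and> pdist w s (?F p) (?F q) \<le> B * ?d p q"
      using bil[of "L p" "L q"] by (simp add: L dist_L)
    then show "?d p q / B \<le> pdist w s (?F p) (?F q)" "pdist w s (?F p) (?F q) \<le> B * ?d p q"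
      using B by (simp_all add: divide_le_eq mult.commute)
  qed
  moreover have "similarity ?Y (dist_prod (1 *\<^sub>R ?J) s) \<gamma>'" if conj: "\<gamma>' \<in> conjugate_group ?X ?Y ?F \<Gamma>" for \<gamma>'
  proof -
    obtain g where g: "\<gamma>' = (\<lambda>y\<in>?Y. ?F (g (inv_into ?X ?F y)))" "g \<in> \<Gamma>"
      using conj unfolding conjugate_group_def by (rule imageE)
    have gb: "bij_betw g ?X ?X" using M(2)[OF g(2)] by (auto simp: quasisimilarity_def)
    have "bij_betw (?F \<circ> (g \<circ> inv_into ?X ?F)) ?Y ?Y"
      by (rule bij_betw_trans[OF bij_betw_trans[OF bij_betw_inv_into[OF bijF] gb] bijF])
    then have "bij_betw \<gamma>' ?Y ?Y" by (rule bij_betw_cong[THEN iffD1, rotated]) (simp add: g(1))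
    moreover have "pdist w s (\<gamma>' y) (\<gamma>' z) = ratio g * pdist w s y z" if yz: "y \<in> ?Y" "z \<in> ?Y" for y z
    proof -
      obtain p q where pq: "p \<in> ?X" "q \<in> ?X" "y = ?F p" "z = ?F q"
        using yz unfolding bij_betw_imp_surj_on[OF bijF, symmetric] by blast
      have "\<gamma>' y = F (act g (L p))" "\<gamma>' z = F (act g (L q))"
        using yz pq bij_betw_inv_into_left[OF bijF] by (simp_all add: g(1) act_def L)
      then show ?thesis using sim[of g "L p" "L q"] g(2) pq by (simp add: L)
    qed
    ultimately have "quasisimilarity ?Y (pdist w s) 1 (ratio g) \<gamma>'"
      by (simp add: quasisimilarity_def)
    then show ?thesis unfolding similarity_def dist_J[abs_def] by blast
  qed
  ultimately show ?thesis using s by (intro exI[of _ 1] exI[of _ s] exI[of _ ?F]) auto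
qed

end
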